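(* Let $0<n_1\le\dots\le n_m$, $\bar n=(n_1,\dots,n_m)$, $n=n_m$, and let $\lambda$ be a partition with $l(\lambda)\le\#\mathrm{St}_{\bar n}$. Each of the following sets of subspaces generates a distributive lattice of subspaces (under $\cap$ and $+$), and consists exactly of all $\vee$-irreducible elements of the lattice it generates: (1) $\{D_{\mathrm{hor}(A)}: A\in \mathrm{DL}_{\bar n}(\lambda)\}$, generating a sublattice of the lattice $\mathcal L_D(V_\lambda)$ generated by all $D_\nu$, $\nu\in\mathbb S_n\lambda$; (2) $\{D^{op}_{\mathrm{vrt}(A)}: A\in \mathrm{DL}_{\bar n}(\lambda)\}$, generating a sublattice of the lattice $\mathcal L_{D^{op}}(V_\lambda^{op})$ generated by all $D^{op}_\nu$, $\nu\in\mathbb S_m\lambda$; (3) $\{D_{\mathrm{hor}(A)}\otimes D^{op}_{\mathrm{vrt}(B)}: A,B\in \mathrm{DL}_{\bar n}(\lambda)\}$, generating a sublattice of the lattice $\mathcal L_{D\times D^{op}}(V_\lambda\otimes V_\lambda^{op})$ generated by all $D_\nu\otimes D_{\nu'}^{op}$, $\nu\in\mathbb S_n\lambda$, $\nu'\in\mathbb S_m\lambda$.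
   Context: Staircase corners. $Y_{\bar n}=\{(i,j):1\le j\le m,\ 1\le i\le n_j\}$. $\mathrm{St}_{\bar n}\subset Y_{\bar n}$ is the set with at most one cell in each row and column, containing every cell $(n_j,j)$ with $n_j>n_{j-1}$ ($n_0=0$), and such that for each $(i,j)\in \mathrm{St}_{\bar n}$ the remaining elements are exactly the staircase corners of the diagram obtained by deleting row $i$ and column $j$. Concretely: process the columns $j=1,\dots,m$ in order; in column $j$ choose the largest $i\le n_j$ such that row $i$ contains no previously chosen cell (choose nothing if there is none). Partial order: $(i,j)\succeq(i',j')$ iff $i\ge i'$ and $j\le j'$. $DL$-dense arrays. $\mathrm{DL}_{\bar n}(\lambda)$ is the set of functions $A:Y_{\bar n}\to\mathbb Z_{\ge0}$ vanishing outside $\mathrm{St}_{\bar n}$, with $A_s\le A_t$ whenever $s\prec t$ in $\mathrm{St}_{\bar n}$, whose multiset of nonzero values is the multiset of parts of $\lambda$. $\mathrm{hor}(A)\in\mathbb Z^n$ and $\mathrm{vrt}(A)\in\mathbb Z^m$ are the vectors of row sums and of column sums. Demazure modules. Ground field algebraically closed of characteristic $0$; partitions are padded by zeros; $\mathfrak b_n\subset\mathfrak{gl}_n$ denotes the upper triangular matrices. $V_\lambda$ is the irreducible $\mathfrak{gl}_n$-module of highest weight $\lambda$ and, for $\nu\in\mathbb S_n\lambda$, $D_\nu=U(\mathfrak b_n)v_\nu$ with $v_\nu$ an extremal vector of weight $\nu$. $V_\lambda^{op}$ is the right $\mathfrak{gl}_m$-module on the irreducible $\mathfrak{gl}_m$-module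 of highest weight $\lambda$ with $v\cdot X=X^Tv$; for $\nu\in\mathbb S_m\lambda$, $D^{op}_\nu=v_\nu U(\mathfrak b_m)$. Lattices. The lattice generated by a set of subspaces is the smallest set of subspaces containing it and closed under $\cap$ (meet) and $+$ (join $\vee$). An element $V$ is $\vee$-irreducible (indecomposable) if $V=V_1+V_2$ with $V_1,V_2$ in the lattice implies $V=V_1$ or $V=V_2$. *)

theory Defs
  imports
    "Jordan_Normal_Form.Matrix"
    "HOL-Computational_Algebra.Polynomial"
    "HOL-Combinatorics.Permutations"
    "HOL-Library.Multiset"
    "HOL-Library.Set_Algebras"
begin

section \<open>Staircase corners and DL-dense arrays\<close>

text \<open>A diagram is given by its number of columns \<open>m\<close> and column heights
  \<open>h 1, \<dots>, h m\<close>; other values of \<open>h\<close> are irrelevant. Cells \<open>(i, j)\<close> are (row, column),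
  both counted from 1.\<close>

definition diagram :: "(nat \<Rightarrow> nat) \<Rightarrow> nat \<Rightarrow> (nat \<times> nat) set" where
  "diagram h m = {(i, j). 1 \<le> j \<and> j \<le> m \<and> 1 \<le> i \<and> i \<le> h j}"

fun staircase :: "(nat \<Rightarrow> nat) \<Rightarrow> nat \<Rightarrow> (nat \<times> nat) set" where
  "staircase h 0 = {}"
| "staircase h (Suc j) =
     (let S = staircase h j; F = {i \<in> {1..h (Suc j)}. i \<notin> fst ` S}
      in if F = {} then S else insert (Max F, Suc j) S)"

definition cell_less :: "nat \<times> nat \<Rightarrow> nat \<times> nat \<Rightarrow> bool" where
  "cell_less s t \<longleftrightarrow> s \<noteq> t \<and> fst s \<le> fst t \<and> snd t \<le> snd s"

definition is_partition :: "nat list \<Rightarrow> bool" where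
  "is_partition lam \<longleftrightarrow> sorted_wrt (\<ge>) lam \<and> 0 \<notin> set lam"

definition pad :: "nat \<Rightarrow> nat list \<Rightarrow> nat list" where
  "pad n lam = lam @ replicate (n - length lam) 0"

text \<open>The orbit of the partition, padded by zeros, under the symmetric group on \<open>n\<close> letters.\<close>

definition sym_orbit :: "nat \<Rightarrow> nat list \<Rightarrow> nat list set" where
  "sym_orbit n lam = {permute_list \<sigma> (pad n lam) | \<sigma>. \<sigma> permutes {..<n}}"

text \<open>Arrays are total functions; those in \<open>DL\<close> vanish outside the diagram because the staircase
  corners are cells of the diagram.\<close>

definition DL :: "(nat \<Rightarrow> nat) \<Rightarrow> nat \<Rightarrow> nat list \<Rightarrow> (nat \<times> nat \<Rightarrow> nat) set" where
  "DL h m lam = {A.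
     (\<forall>s. s \<notin> staircase h m \<longrightarrow> A s = 0) \<and>
     (\<forall>s\<in>staircase h m. \<forall>t\<in>staircase h m. cell_less s t \<longrightarrow> A s \<le> A t) \<and>
     image_mset A (mset_set {s \<in> diagram h m. A s \<noteq> 0}) = mset lam}"

definition hor :: "nat \<Rightarrow> nat \<Rightarrow> (nat \<times> nat \<Rightarrow> nat) \<Rightarrow> nat list" where
  "hor n m A = map (\<lambda>i. \<Sum>j\<in>{1..m}. A (i, j)) [1..<Suc n]"

definition vrt :: "nat \<Rightarrow> nat \<Rightarrow> (nat \<times> nat \<Rightarrow> nat) \<Rightarrow> nat list" where
  "vrt n m A = map (\<lambda>j. \<Sum>i\<in>{1..n}. A (i, j)) [1..<Suc m]"


section \<open>Modules over the general linear Lie algebra\<close>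

text \<open>The module is the whole type; \<open>act X v\<close> is only meaningful for \<open>X \<in> carrier_mat n n\<close>.
  Weights are lists indexed from 0, like the entries of the matrices.\<close>

locale gl_module = vector_space scale
  for scale :: "'k::field \<Rightarrow> 'v::ab_group_add \<Rightarrow> 'v" +
  fixes n :: nat and act :: "'k mat \<Rightarrow> 'v \<Rightarrow> 'v"
  assumes act_add_right: "X \<in> carrier_mat n n \<Longrightarrow> act X (v + w) = act X v + act X w"
    and act_scale_right: "X \<in> carrier_mat n n \<Longrightarrow> act X (scale c v) = scale c (act X v)"
    and act_add_left: "X \<in> carrier_mat n n \<Longrightarrow> Y \<in> carrier_mat n n \<Longrightarrow>
           act (X + Y) v = act X v + act Y v"
    and act_scale_left: "X \<in> carrier_mat n n \<Longrightarrow> act (c \<cdot>\<^sub>m X) v = scale c (act X v)"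
    and act_bracket: "X \<in> carrier_mat n n \<Longrightarrow> Y \<in> carrier_mat n n \<Longrightarrow>
           act (X * Y - Y * X) v = act X (act Y v) - act Y (act X v)"

definition borel :: "nat \<Rightarrow> 'k::zero mat set" where
  "borel n = {X \<in> carrier_mat n n. upper_triangular X}"

definition strictly_upper :: "nat \<Rightarrow> 'k::zero mat set" where
  "strictly_upper n = {X \<in> carrier_mat n n. \<forall>i<n. \<forall>j\<le>i. X $$ (i, j) = 0}"

definition weight_vector ::
    "('k::field \<Rightarrow> 'v::ab_group_add \<Rightarrow> 'v) \<Rightarrow> nat \<Rightarrow> ('k mat \<Rightarrow> 'v \<Rightarrow> 'v) \<Rightarrow> nat list \<Rightarrow> 'v \<Rightarrow> bool" where
  "weight_vector scale n act \<nu> v \<longleftrightarrow> v \<noteq> 0 \<and>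
     (\<forall>H\<in>carrier_mat n n. diagonal_mat H \<longrightarrow>
        act H v = scale (\<Sum>i<n. of_nat (\<nu> ! i) * H $$ (i, i)) v)"

locale irreducible_gl_module = gl_module scale n act
  for scale :: "'k::field \<Rightarrow> 'v::ab_group_add \<Rightarrow> 'v" and n act +
  fixes lam :: "nat list"
  assumes irreducible: "\<lbrakk>subspace U; \<And>X u. X \<in> carrier_mat n n \<Longrightarrow> u \<in> U \<Longrightarrow> act X u \<in> U\<rbrakk>
           \<Longrightarrow> U = {0} \<or> U = UNIV"
    and highest_weight: "\<exists>v. weight_vector scale n act (pad n lam) v \<and>
           (\<forall>X\<in>strictly_upper n. act X v = 0)"

text \<open>A choice of an extremal vector for every weight in the orbit of the highest weight. The
  weight spaces of these weights are lines, so every weight vector for such a weight is extremal.\<close>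

definition extremal_vectors ::
    "('k::field \<Rightarrow> 'v::ab_group_add \<Rightarrow> 'v) \<Rightarrow> nat \<Rightarrow> ('k mat \<Rightarrow> 'v \<Rightarrow> 'v) \<Rightarrow> nat list \<Rightarrow>
     (nat list \<Rightarrow> 'v) \<Rightarrow> bool" where
  "extremal_vectors scale n act lam e \<longleftrightarrow>
     (\<forall>\<nu>\<in>sym_orbit n lam. weight_vector scale n act \<nu> (e \<nu>))"

text \<open>The universal enveloping algebra of the upper triangular matrices is spanned by products of
  upper triangular matrices; hence so is the cyclic module it generates.\<close>

definition demazure ::
    "('k::field \<Rightarrow> 'v::ab_group_add \<Rightarrow> 'v) \<Rightarrow> nat \<Rightarrow> ('k mat \<Rightarrow> 'v \<Rightarrow> 'v) \<Rightarrow> 'v \<Rightarrow> 'v set" where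
  "demazure scale n act v = module.span scale {foldr act Xs v | Xs. set Xs \<subseteq> borel n}"

definition op_act :: "('k mat \<Rightarrow> 'v \<Rightarrow> 'v) \<Rightarrow> 'v \<Rightarrow> 'k mat \<Rightarrow> 'v" where
  "op_act act v X = act (transpose_mat X) v"

text \<open>Diagonal matrices are symmetric, so weights and extremal vectors of the right module are
  those of the original left module.\<close>

definition op_demazure ::
    "('k::field \<Rightarrow> 'v::ab_group_add \<Rightarrow> 'v) \<Rightarrow> nat \<Rightarrow> ('k mat \<Rightarrow> 'v \<Rightarrow> 'v) \<Rightarrow> 'v \<Rightarrow> 'v set" where
  "op_demazure scale n act v =
     module.span scale {foldl (op_act act) v Xs | Xs. set Xs \<subseteq> borel n}"


section \<open>Tensor products\<close>

definition bilinear_map ::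
    "('k::field \<Rightarrow> 'v::ab_group_add \<Rightarrow> 'v) \<Rightarrow> ('k \<Rightarrow> 'w::ab_group_add \<Rightarrow> 'w) \<Rightarrow>
     ('k \<Rightarrow> 't::ab_group_add \<Rightarrow> 't) \<Rightarrow> ('v \<Rightarrow> 'w \<Rightarrow> 't) \<Rightarrow> bool" where
  "bilinear_map sV sW sT b \<longleftrightarrow>
     (\<forall>w. Vector_Spaces.linear sV sT (\<lambda>v. b v w)) \<and> (\<forall>v. Vector_Spaces.linear sW sT (b v))"

text \<open>The universal property is stated for scalar-valued bilinear maps, as HOL does not allow
  quantification over the target type. Over a field this is no restriction: uniqueness forces the
  pure tensors to span, and existence forces tensors of linearly independent families to be
  linearly independent.\<close>

locale tensor_product =
  V: vector_space sV + W: vector_space sW + T: vector_space sT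
  for sV :: "'k::field \<Rightarrow> 'v::ab_group_add \<Rightarrow> 'v"
    and sW :: "'k \<Rightarrow> 'w::ab_group_add \<Rightarrow> 'w"
    and sT :: "'k \<Rightarrow> 't::ab_group_add \<Rightarrow> 't" +
  fixes tensor :: "'v \<Rightarrow> 'w \<Rightarrow> 't"
  assumes bilinear_tensor: "bilinear_map sV sW sT tensor"
    and universal: "bilinear_map sV sW (*) b \<Longrightarrow>
          \<exists>!f. Vector_Spaces.linear sT (*) f \<and> (\<forall>v w. f (tensor v w) = b v w)"

definition tensor_subspace ::
    "('k::field \<Rightarrow> 't::ab_group_add \<Rightarrow> 't) \<Rightarrow> ('v \<Rightarrow> 'w \<Rightarrow> 't) \<Rightarrow> 'v set \<Rightarrow> 'w set \<Rightarrow> 't set" where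
  "tensor_subspace sT tensor U U' = module.span sT {tensor u u' | u u'. u \<in> U \<and> u' \<in> U'}"


section \<open>Lattices of subspaces\<close>

text \<open>\<open>U + W\<close> on sets is the elementwise sum, so for subspaces it is their join.\<close>

inductive_set lattice_gen :: "'v::ab_group_add set set \<Rightarrow> 'v set set"
  for G :: "'v set set" where
  generator: "U \<in> G \<Longrightarrow> U \<in> lattice_gen G"
| meet: "U \<in> lattice_gen G \<Longrightarrow> W \<in> lattice_gen G \<Longrightarrow> U \<inter> W \<in> lattice_gen G"
| join: "U \<in> lattice_gen G \<Longrightarrow> W \<in> lattice_gen G \<Longrightarrow> U + W \<in> lattice_gen G"

definition distributive :: "'v::ab_group_add set set \<Rightarrow> bool" where
  "distributive L \<longleftrightarrow> (\<forall>U\<in>L. \<forall>V\<in>L. \<forall>W\<in>L. U \<inter> (V + W) = (U \<inter> V) + (U \<inter> W))"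

definition join_irreducible :: "'v::ab_group_add set set \<Rightarrow> 'v set \<Rightarrow> bool" where
  "join_irreducible L V \<longleftrightarrow>
     V \<in> L \<and> (\<forall>V1\<in>L. \<forall>V2\<in>L. V = V1 + V2 \<longrightarrow> V = V1 \<or> V = V2)"

end

theory Submission
  imports Defs "HOL-Library.Function_Algebras"
begin

text \<open>All Demazure modules of a highest weight embed into one tensor product of exterior powers, one
  factor for each column of the partition. For a set \<open>I\<close> of weights that is closed downwards in the
  Bruhat order, let \<open>D I\<close> be the sum of the corresponding Demazure modules. Its character is bounded
  below by recursion over the columns, through the leading terms in the first tensor factor, and above
  by Demazure operators; the two bounds agree. Hence the character is modular in \<open>I\<close>, so
  \<open>D I \<inter> D I' = D (I \<inter> I')\<close>, and there is one basis, labelled by weights, such that each Demazure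
  module is spanned by the basis vectors whose labels are below its weight. A highest weight module is
  identified with the submodule generated by the highest weight vector: irreducibility makes a submodule
  of the direct sum the graph of an isomorphism.

  The lattices thus become lattices of subsets of a basis. The weights of DL-dense arrays are exactly
  the weights supported on the staircase rows that satisfy the order conditions, and above each weight
  of the orbit that lies below one of them there is a least one. So an intersection of two generators
  is a sum of generators, and each generator contains a basis vector that no smaller one contains.\<close>

section \<open>The Bruhat order on an orbit of compositions\<close>

text \<open>Of the equality of \<open>D I \<inter> D I'\<close> and \<open>D (I \<inter> I')\<close>
  only one inclusion is immediate; the other is forced by dimensions, and the character computation
  exists for this purpose. Demazure operators bound only the character of a single Demazure module
  from above. For an arbitrary lower set the bound comes from inclusion and exclusion, which needs a
  modular combinatorial character. That rests on one fact about the Bruhat order,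
  \<open>compatible_closure\<close>, which is used twice and is therefore stated for arbitrary rows
  and labels: with void order conditions it makes the column recursion respect intersections, and
  with those of DL-dense arrays it makes intersections of generators sums of generators.

  The given module is assumed neither finite-dimensional nor a sum of weight spaces. The comparison
  with the tensor model therefore separates the highest weight vector from lower weights by
  polynomials in one diagonal operator, and it shows that the radical of the model is zero by a form
  that is positive definite over the rationals.\<close>

definition rk :: "(nat \<Rightarrow> nat) \<Rightarrow> nat \<Rightarrow> nat \<Rightarrow> nat" where
  "rk u k t = card {j. j < k \<and> t < u j}"

text \<open>This is the tableau criterion. The dominant weight is least, so that
  \<open>bruhat_le u v\<close> goes with inclusion of the Demazure module of \<open>u\<close> in
  that of \<open>v\<close>.\<close>

definition bruhat_le :: "(nat \<Rightarrow> nat) \<Rightarrow> (nat \<Rightarrow> nat) \<Rightarrow> bool" where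
  "bruhat_le u v \<longleftrightarrow> (\<forall>k t. rk v k t \<le> rk u k t)"

definition orbit :: "nat \<Rightarrow> (nat \<Rightarrow> nat) \<Rightarrow> (nat \<Rightarrow> nat) set" where
  "orbit n lam = {lam \<circ> \<sigma> | \<sigma>. \<sigma> permutes {..<n}}"

text \<open>Polymorphic in the values because the same simple reflection acts on compositions, on
  integral weights and, through membership predicates, on subsets.\<close>

definition swp :: "nat \<Rightarrow> (nat \<Rightarrow> 'a) \<Rightarrow> nat \<Rightarrow> 'a" where
  "swp i u = u \<circ> Transposition.transpose i (Suc i)"

lemma rk_0 [simp]: "rk u 0 t = 0"
  by (simp add: rk_def)

lemma rk_Suc: "rk u (Suc k) t = rk u k t + of_bool (t < u k)"
proof -
  have *: "{j. j < Suc k \<and> t < u j} = {j. j < k \<and> t < u j} \<union> (if t < u k then {k} else {})"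
    by (auto simp: less_Suc_eq)
  show ?thesis
    unfolding rk_def * by auto
qed

lemma bruhat_refl [simp]: "bruhat_le u u"
  by (simp add: bruhat_le_def)

lemma bruhat_trans: "bruhat_le u v \<Longrightarrow> bruhat_le v w \<Longrightarrow> bruhat_le u w"
  unfolding bruhat_le_def using order_trans by blast

lemma bruhat_antisym:
  assumes "bruhat_le u v" "bruhat_le v u"
  shows "u = v"
proof
  fix j
  have eq: "rk u k t = rk v k t" for k t
    using assms by (simp add: bruhat_le_def le_antisym)
  have "t < u j \<longleftrightarrow> t < v j" for t
    using eq[of "Suc j" t] eq[of j t] by (simp add: rk_Suc of_bool_def split: if_splits)
  then show "u j = v j"
    by (meson linorder_neqE_nat less_irrefl)
qed

lemma swp_apply: "swp i u j = (if j = i then u (Suc i) else if j = Suc i then u i else u j)"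
  by (simp add: swp_def Transposition.transpose_def)

lemma swp_swp [simp]: "swp i (swp i u) = u"
  by (auto simp: swp_apply fun_eq_iff)

text \<open>A swap of neighbours alters only the prefix that ends between them, so the comparisons
  below reduce to the prefixes of lengths \<open>i\<close>, \<open>Suc i\<close> and
  \<open>Suc (Suc i)\<close>.\<close>

lemma rk_swp:
  "rk (swp i u) k t = (if k = Suc i then rk u i t + of_bool (t < u (Suc i)) else rk u k t)"
proof (induction k)
  case (Suc k)
  then show ?case
    by (auto simp: rk_Suc swp_apply)
qed simp

lemma bruhat_le_swp: "u (Suc i) \<le> u i \<Longrightarrow> bruhat_le u (swp i u)"
  by (auto simp: bruhat_le_def rk_swp rk_Suc)

lemma swp_bruhat_le: "u i \<le> u (Suc i) \<Longrightarrow> bruhat_le (swp i u) u"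
  using bruhat_le_swp[of "swp i u" i] by (simp add: swp_apply)

text \<open>Half of the lifting property of the Bruhat order: at the one altered prefix the
  inequality follows from those at its two neighbours, because \<open>v\<close> does not decrease
  from \<open>i\<close> to \<open>Suc i\<close>.\<close>

lemma bruhat_swp_left:
  assumes "bruhat_le u v" "v i \<le> v (Suc i)"
  shows "bruhat_le (swp i u) v"
  unfolding bruhat_le_def
proof (intro allI)
  fix k t
  have le: "rk v k t \<le> rk u k t" for k
    using assms(1) by (simp add: bruhat_le_def)
  show "rk v k t \<le> rk (swp i u) k t"
    using le[of k] le[of i] le[of "Suc i"] le[of "Suc (Suc i)"] assms(2)
    by (auto simp: rk_swp rk_Suc of_bool_def split: if_splits)
qed

lemma bruhat_swp_right:
  assumes "bruhat_le u v" "u (Suc i) \<le> u i"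
  shows "bruhat_le u (swp i v)"
  unfolding bruhat_le_def
proof (intro allI)
  fix k t
  have le: "rk v k t \<le> rk u k t" for k
    using assms(1) by (simp add: bruhat_le_def)
  show "rk (swp i v) k t \<le> rk u k t"
    using le[of k] le[of i] le[of "Suc i"] le[of "Suc (Suc i)"] assms(2)
    by (auto simp: rk_swp rk_Suc of_bool_def split: if_splits)
qed

lemma orbitE:
  assumes "u \<in> orbit n lam"
  obtains \<sigma> where "\<sigma> permutes {..<n}" "u = lam \<circ> \<sigma>"
  using assms by (auto simp: orbit_def)

lemma orbit_self: "lam \<in> orbit n lam"
  unfolding orbit_def using permutes_id by (metis (mono_tags, lifting) comp_id mem_Collect_eq)

lemma orbit_transpose:
  assumes "u \<in> orbit n lam" "a < n" "b < n"
  shows "u \<circ> Transposition.transpose a b \<in> orbit n lam"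
proof -
  obtain \<sigma> where \<sigma>: "\<sigma> permutes {..<n}" "u = lam \<circ> \<sigma>"
    using assms(1) by (rule orbitE)
  have "\<sigma> \<circ> Transposition.transpose a b permutes {..<n}"
    using \<sigma>(1) assms(2,3) by (intro permutes_compose permutes_swap_id) auto
  then show ?thesis
    unfolding orbit_def \<sigma>(2) by (auto simp: comp_assoc)
qed

lemma orbit_swp: "u \<in> orbit n lam \<Longrightarrow> Suc i < n \<Longrightarrow> swp i u \<in> orbit n lam"
  unfolding swp_def by (rule orbit_transpose) auto

lemma finite_orbit: "finite (orbit n lam)"
proof -
  have "orbit n lam = (\<lambda>\<sigma>. lam \<circ> \<sigma>) ` {\<sigma>. \<sigma> permutes {..<n}}"
    by (auto simp: orbit_def)
  then show ?thesis
    by (simp add: finite_permutations)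
qed

lemma rk_orbit:
  assumes "u \<in> orbit n lam"
  shows "rk u n t = rk lam n t"
proof -
  obtain \<sigma> where \<sigma>: "\<sigma> permutes {..<n}" "u = lam \<circ> \<sigma>"
    using assms by (rule orbitE)
  have "bij_betw \<sigma> {j. j < n \<and> t < u j} {j. j < n \<and> t < lam j}"
    unfolding bij_betw_def
  proof (intro conjI)
    show "inj_on \<sigma> {j. j < n \<and> t < u j}"
      using permutes_inj[OF \<sigma>(1)] by (simp add: inj_on_def)
    show "\<sigma> ` {j. j < n \<and> t < u j} = {j. j < n \<and> t < lam j}"
    proof (intro equalityI subsetI)
      fix j assume "j \<in> {j. j < n \<and> t < lam j}"
      moreover from this have "j \<in> \<sigma> ` {..<n}"
        using permutes_image[OF \<sigma>(1)] by auto
      ultimately show "j \<in> \<sigma> ` {j. j < n \<and> t < u j}"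
        using \<sigma>(2) by auto
    next
      fix j assume "j \<in> \<sigma> ` {j. j < n \<and> t < u j}"
      then show "j \<in> {j. j < n \<and> t < lam j}"
        using \<sigma> permutes_in_image[OF \<sigma>(1)] by auto
    qed
  qed
  then show ?thesis
    unfolding rk_def by (rule bij_betw_same_card)
qed

lemma orbit_beyond:
  assumes "u \<in> orbit n lam" "n \<le> j"
  shows "u j = lam j"
  using assms by (auto simp: orbit_def permutes_def)

lemma orbit_le:
  assumes "u \<in> orbit n lam" "\<And>j. lam j \<le> r"
  shows "u j \<le> r"
  using assms by (auto simp: orbit_def)

section \<open>Least compatible weights\<close>

text \<open>Exchanging a large entry with a smaller later one lowers the ranks by one exactly on a
  rectangle of prefixes and thresholds. Such a move stays below \<open>x\<close> as soon as the rank
  inequality with \<open>x\<close> is strict on that rectangle.\<close>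

lemma rk_transpose_aux:
  assumes "l < l'" "u l' < u l"
    and v: "v l = u l'" "v l' = u l" "\<And>j. j \<noteq> l \<Longrightarrow> j \<noteq> l' \<Longrightarrow> v j = u j"
  shows "rk v k t + of_bool (l < k \<and> k \<le> l' \<and> u l' \<le> t \<and> t < u l) = rk u k t"
proof -
  define C where "C \<longleftrightarrow> u l' \<le> t \<and> t < u l"
  have C: "of_bool (t < u l) = (of_bool (t < u l') + of_bool C :: nat)"
    using assms(2) by (auto simp: C_def)
  have "rk v k t + of_bool (l < k \<and> k \<le> l' \<and> C) = rk u k t"
  proof (induction k)
    case (Suc k)
    consider "k = l" | "k = l'" | "k \<noteq> l" "k \<noteq> l'" by blast
    then show ?case
    proof cases
      case 1
      then show ?thesis
        using Suc assms(1) v(1) C by (simp add: rk_Suc)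
    next
      case 2
      then show ?thesis
        using Suc assms(1) v(2) C by (simp add: rk_Suc)
    next
      case 3
      then have "v k = u k" "l < Suc k \<longleftrightarrow> l < k" "Suc k \<le> l' \<longleftrightarrow> k \<le> l'"
        using v(3)[of k] by auto
      then show ?thesis
        using Suc unfolding rk_Suc by simp
    qed
  qed simp
  then show ?thesis by (simp only: C_def)
qed

lemma rk_transpose:
  assumes "l < l'" "u l' < u l"
  shows "rk (u \<circ> Transposition.transpose l l') k t
           + of_bool (l < k \<and> k \<le> l' \<and> u l' \<le> t \<and> t < u l) = rk u k t"
  by (rule rk_transpose_aux) (use assms in auto)

lemma rk_interval:
  assumes "l \<le> k"
  shows "rk u k t = rk u l t + card {j. l \<le> j \<and> j < k \<and> t < u j}"
proof -
  have "{j. j < k \<and> t < u j} = {j. j < l \<and> t < u j} \<union> {j. l \<le> j \<and> j < k \<and> t < u j}"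
    using assms by auto
  moreover have "card ({j. j < l \<and> t < u j} \<union> {j. l \<le> j \<and> j < k \<and> t < u j})
      = card {j. j < l \<and> t < u j} + card {j. l \<le> j \<and> j < k \<and> t < u j}"
    by (rule card_Un_disjoint) auto
  ultimately show ?thesis
    unfolding rk_def by (simp only:)
qed

text \<open>\<open>R\<close> contains the positions that may carry a nonzero entry; the labels
  \<open>c\<close> encode the order on cells. With \<open>c = id\<close> the order condition is
  void.\<close>

definition compatible ::
    "nat \<Rightarrow> (nat \<Rightarrow> nat) \<Rightarrow> nat set \<Rightarrow> (nat \<Rightarrow> nat) \<Rightarrow> (nat \<Rightarrow> nat) set" where
  "compatible n lam R c = {z \<in> orbit n lam. (\<forall>j. 0 < z j \<longrightarrow> j \<in> R) \<and>
     (\<forall>i\<in>R. \<forall>i'\<in>R. i < i' \<longrightarrow> c i' < c i \<longrightarrow> z i \<le> z i')}"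

lemma in_neq_sets: "a \<in> B \<Longrightarrow> a \<notin> A \<Longrightarrow> A \<noteq> B"
  by blast

text \<open>Equality at \<open>k\<close> and the inequality at \<open>l\<close> give
  \<open>x\<close> at least as many entries above \<open>t\<close> in between as \<open>u\<close>
  has. One of those of \<open>u\<close> sits at \<open>l\<close>, where \<open>x\<close> vanishes,
  so \<open>x\<close> is large at some position where \<open>u\<close> is not, and that position
  lies in \<open>R\<close>.\<close>

lemma row_outside_move:
  assumes x: "\<And>j. 0 < x j \<Longrightarrow> j \<in> R" and ux: "bruhat_le u x"
    and l: "l \<notin> R" "l < k" "t < u l" and eq: "rk x k t = rk u k t"
  obtains l0 where "l0 \<in> R" "l < l0" "l0 < k" "u l0 \<le> t"
proof -
  let ?X = "{j. l \<le> j \<and> j < k \<and> t < x j}" and ?U = "{j. l \<le> j \<and> j < k \<and> t < u j}"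
  have "rk x l t \<le> rk u l t"
    using ux by (simp add: bruhat_le_def)
  then have card: "card ?U \<le> card ?X"
    using eq rk_interval[of l k u t] rk_interval[of l k x t] l(2) by simp
  have "\<not> ?X \<subseteq> ?U"
  proof
    assume sub: "?X \<subseteq> ?U"
    have "l \<in> ?U" "l \<notin> ?X"
      using l x[of l] by auto
    with sub have "?X \<subset> ?U" by blast
    then have "card ?X < card ?U"
      by (rule psubset_card_mono[rotated]) auto
    with card show False by simp
  qed
  then obtain l0 where "l \<le> l0" "l0 < k" "t < x l0" "\<not> t < u l0"
    by blast
  moreover have "l0 \<noteq> l" using \<open>\<not> t < u l0\<close> l(3) by auto
  moreover have "l0 \<in> R" using x[of l0] \<open>t < x l0\<close> by simp
  ultimately show ?thesis
    using that[of l0] by simp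
qed

text \<open>A count on both sides of \<open>k\<close> for a violating pair at minimal distance. Rank
  equality would give \<open>x\<close> enough large entries on the left and not too many on the
  right, which the order conditions on \<open>x\<close> exclude. So exchanging the two entries of
  \<open>u\<close> stays below \<open>x\<close>.\<close>

lemma violation_move:
  fixes c :: "nat \<Rightarrow> nat"
  assumes x: "\<And>j. 0 < x j \<Longrightarrow> j \<in> R"
      "\<And>i i'. i \<in> R \<Longrightarrow> i' \<in> R \<Longrightarrow> i < i' \<Longrightarrow> c i' < c i \<Longrightarrow> x i \<le> x i'"
    and ux: "bruhat_le u x" and u: "\<And>j. 0 < u j \<Longrightarrow> j \<in> R" and inj: "inj_on c R"
    and viol: "i \<in> R" "i' \<in> R" "i < i'" "c i' < c i"
    and minimal: "\<And>a b. a \<in> R \<Longrightarrow> b \<in> R \<Longrightarrow> a < b \<Longrightarrow> c b < c a \<Longrightarrow> b - a < i' - i \<Longrightarrow> u a \<le> u b"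
    and k: "i < k" "k \<le> i'" and t: "u i' \<le> t" "t < u i"
  shows "rk x k t \<noteq> rk u k t"
proof
  assume eq: "rk x k t = rk u k t"
  let ?X = "\<lambda>a b. {j. a \<le> j \<and> j < b \<and> t < x j}" and ?U = "\<lambda>a b. {j. a \<le> j \<and> j < b \<and> t < u j}"
  have le: "rk x k' t \<le> rk u k' t" for k'
    using ux by (simp add: bruhat_le_def)
  have card1: "card (?U i k) \<le> card (?X i k)"
    using eq le[of i] rk_interval[OF less_imp_le[OF k(1)], of u t] rk_interval[OF less_imp_le[OF k(1)], of x t]
    by linarith
  have card2: "card (?X k (Suc i')) \<le> card (?U k (Suc i'))"
    using eq le[of "Suc i'"] rk_interval[OF le_SucI[OF k(2)], of u t] rk_interval[OF le_SucI[OF k(2)], of x t]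
    by linarith
  \<comment> \<open>Otherwise all entries of \<open>x\<close> above \<open>t\<close> left of
    \<open>k\<close> sit at labels below \<open>c i\<close>; minimality makes \<open>u\<close> large
    there too, and \<open>u\<close> is large at \<open>i\<close> besides, so \<open>u\<close> has
    more of them than \<open>x\<close>.\<close>
  have "\<exists>l0. i \<le> l0 \<and> l0 < k \<and> t < x l0 \<and> c i \<le> c l0"
  proof (rule ccontr)
    assume "\<not> ?thesis"
    then have neg: "c l < c i" if "i \<le> l" "l < k" "t < x l" for l
      using that not_le by blast
    have "?X i k \<subset> ?U i k"
    proof
      show "?X i k \<subseteq> ?U i k"
      proof
        fix l assume "l \<in> ?X i k"
        then have l: "i \<le> l" "l < k" "t < x l" by simp_all
        have c: "c l < c i" using neg[OF l] .
        have lR: "l \<in> R" using x(1)[of l] l(3) by simp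
        have "l \<noteq> i" using c by auto
        then have "u i \<le> u l" using l k by (intro minimal viol lR c) simp_all
        with t(2) l show "l \<in> ?U i k" by simp
      qed
      have "i \<in> ?U i k" using t k by simp
      moreover have "i \<notin> ?X i k" using neg[of i] k(1) by auto
      ultimately show "?X i k \<noteq> ?U i k" by (rule in_neq_sets)
    qed
    then have "card (?X i k) < card (?U i k)"
      by (rule psubset_card_mono[rotated]) simp
    with card1 show False by simp
  qed
  then obtain l0 where l0: "i \<le> l0" "l0 < k" "t < x l0" "c i \<le> c l0" by blast
  have l0R: "l0 \<in> R" using x(1)[of l0] l0(3) by simp
  have "x l0 \<le> x i'"
    using l0 k viol by (intro x(2) l0R viol) simp_all
  then have i'X: "t < x i'" using l0 by simp
  \<comment> \<open>The entry at \<open>l0\<close> forces \<open>x\<close> to be large at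
    \<open>i'\<close>, and also wherever \<open>u\<close> is large: by minimality such a position
    has a label below \<open>c i'\<close>, hence below \<open>c l0\<close>.\<close>
  have "?U k (Suc i') \<subset> ?X k (Suc i')"
  proof
    show "?U k (Suc i') \<subseteq> ?X k (Suc i')"
    proof
      fix l assume l: "l \<in> ?U k (Suc i')"
      then have lR: "l \<in> R" using u[of l] by simp
      have ne: "l \<noteq> i'" using l t by auto
      have "\<not> c i' < c l"
      proof
        assume "c i' < c l"
        then have "u l \<le> u i'" using l lR viol ne k by (intro minimal) auto
        then show False using l t by simp
      qed
      moreover have "c l \<noteq> c i'" using inj_onD[OF inj _ lR viol(2)] ne by blast
      ultimately have "c l < c l0" using viol l0 by simp
      then have "x l0 \<le> x l" using l l0 l0R lR by (intro x(2)) auto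
      then show "l \<in> ?X k (Suc i')" using l l0 by simp
    qed
    have "i' \<in> ?X k (Suc i')" using i'X k by simp
    moreover have "i' \<notin> ?U k (Suc i')" using t by simp
    ultimately show "?U k (Suc i') \<noteq> ?X k (Suc i')" by (rule in_neq_sets)
  qed
  then have "card (?U k (Suc i')) < card (?X k (Suc i'))"
    by (rule psubset_card_mono[rotated]) auto
  with card2 show False by simp
qed

text \<open>A rearrangement inequality that supplies termination measures: decreasing coefficients
  for moves up in the Bruhat order, increasing ones for reflections down.\<close>

lemma sum_transpose_less:
  fixes w u :: "nat \<Rightarrow> nat"
  assumes "l < n" "l' < n" "w l' < w l" "u l' < u l"
  shows "(\<Sum>j<n. w j * (u \<circ> Transposition.transpose l l') j) < (\<Sum>j<n. w j * u j)"
proof -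
  have ne: "l \<noteq> l'" using assms by auto
  let ?S = "{..<n} - {l, l'}"
  have split: "(\<Sum>j<n. w j * x j) = w l * x l + (w l' * x l' + (\<Sum>j\<in>?S. w j * x j))"
    for x :: "nat \<Rightarrow> nat"
  proof -
    have "(\<Sum>j<n. w j * x j) = w l * x l + (\<Sum>j\<in>{..<n} - {l}. w j * x j)"
      using assms by (intro sum.remove) auto
    also have "(\<Sum>j\<in>{..<n} - {l}. w j * x j)
        = w l' * x l' + (\<Sum>j\<in>{..<n} - {l} - {l'}. w j * x j)"
      using assms ne by (intro sum.remove) auto
    also have "{..<n} - {l} - {l'} = ?S" by auto
    finally show ?thesis .
  qed
  have same: "(\<Sum>j\<in>?S. w j * (u \<circ> Transposition.transpose l l') j) = (\<Sum>j\<in>?S. w j * u j)"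
    by (intro sum.cong) (auto simp: Transposition.transpose_def)
  obtain d where d: "u l = u l' + Suc d" using assms(4) by (metis add_Suc_right less_iff_Suc_add)
  have "w l' * Suc d < w l * Suc d" using assms by (intro mult_strict_right_mono) auto
  then have "w l * u l' + w l' * (u l' + Suc d) < w l * (u l' + Suc d) + w l' * u l'"
    by (simp only: distrib_left)
  then show ?thesis
    unfolding split same using d by (simp del: mult_Suc_right)
qed

text \<open>Moves that increase \<open>u\<close> without leaving the lower set of any compatible element above it
  lead to the least compatible element above \<open>u\<close>.\<close>

lemma compatible_closure:
  assumes R: "R \<subseteq> {..<n}" and inj: "inj_on c R"
    and u: "u \<in> orbit n lam" and ex: "\<exists>x\<in>compatible n lam R c. bruhat_le u x"
  shows "\<exists>z\<in>compatible n lam R c. bruhat_le u z \<and>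
           (\<forall>x\<in>compatible n lam R c. bruhat_le u x \<longrightarrow> bruhat_le z x)"
  using u ex
proof (induction "\<Sum>j<n. (n - j) * u j" arbitrary: u rule: less_induct)
  case less
  let ?P = "compatible n lam R c"
  obtain x0 where x0: "x0 \<in> ?P" "bruhat_le u x0" using less.prems by blast
  show ?case
  proof (cases "u \<in> ?P")
    case True
    then show ?thesis by (intro bexI[of _ u]) auto
  next
    case False
    have outside: "u j = 0" if "n \<le> j" for j
    proof -
      have "u j = x0 j"
        using orbit_beyond[OF less.prems(1) that] orbit_beyond[of x0 n lam j] that x0(1)
        by (simp add: compatible_def)
      moreover have "j \<notin> R" using that R by auto
      ultimately show ?thesis using x0(1) by (auto simp: compatible_def)
    qed
    \<comment> \<open>Positive entries outside \<open>R\<close> are repaired first; the count for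
      order violations needs the support of \<open>u\<close> inside \<open>R\<close>.\<close>
    have "\<exists>l l'. l < l' \<and> l' < n \<and> u l' < u l \<and>
        (\<forall>x\<in>?P. bruhat_le u x \<longrightarrow>
          (\<forall>k t. l < k \<longrightarrow> k \<le> l' \<longrightarrow> u l' \<le> t \<longrightarrow> t < u l \<longrightarrow> rk x k t \<noteq> rk u k t))"
    proof (cases "\<exists>l. l \<notin> R \<and> 0 < u l")
      case True
      then obtain l where l: "l \<notin> R" "0 < u l" by blast
      then have ln: "l < n" using outside by (metis not_less less_irrefl)
      let ?Q = "\<lambda>l'. l' \<in> R \<and> l < l' \<and> u l' < u l"
      \<comment> \<open>Weights of one orbit have equal ranks at the full length \<open>n\<close>;
        the threshold \<open>u l - 1\<close> then yields a position of \<open>R\<close> with an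
        entry below \<open>u l\<close>.\<close>
      have "rk x0 n (u l - 1) = rk u n (u l - 1)"
        using rk_orbit less.prems(1) x0(1) by (simp add: compatible_def)
      then obtain l0 where "l0 \<in> R" "l < l0" "l0 < n" "u l0 \<le> u l - 1"
        using row_outside_move[of x0 R u l n "u l - 1"] x0 l ln by (auto simp: compatible_def)
      then have "?Q l0" using l by auto
      \<comment> \<open>The first admissible position is essential: rank equality inside the
        rectangle would produce an earlier one.\<close>
      define l' where "l' = (LEAST l'. ?Q l')"
      have l': "?Q l'" unfolding l'_def by (rule LeastI) fact
      have least: "\<not> ?Q j" if "j < l'" for j
        using that unfolding l'_def by (rule not_less_Least)
      have "rk x k t \<noteq> rk u k t"
        if x: "x \<in> ?P" "bruhat_le u x" and k: "l < k" "k \<le> l'" "u l' \<le> t" "t < u l" for x k t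
      proof
        assume eq: "rk x k t = rk u k t"
        obtain l1 where "l1 \<in> R" "l < l1" "l1 < k" "u l1 \<le> t"
          using row_outside_move[OF _ x(2) l(1) k(1) k(4) eq] x(1) by (auto simp: compatible_def)
        then show False using least[of l1] k by auto
      qed
      then show ?thesis using l' R by (intro exI[of _ l] exI[of _ l']) auto
    next
      case False
      then have uR: "\<And>j. 0 < u j \<Longrightarrow> j \<in> R" by blast
      let ?V = "\<lambda>p. fst p \<in> R \<and> snd p \<in> R \<and> fst p < snd p \<and> c (snd p) < c (fst p) \<and> u (snd p) < u (fst p)"
      have "\<exists>p. ?V p"
        using \<open>u \<notin> ?P\<close> less.prems(1) uR by (auto simp: compatible_def not_le)
      then obtain p where p: "?V p" "\<And>q. ?V q \<Longrightarrow> snd p - fst p \<le> snd q - fst q"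
        using ex_has_least_nat[of ?V _ "\<lambda>p. snd p - fst p"] by blast
      define l l' where "l = fst p" and "l' = snd p"
      have V: "l \<in> R" "l' \<in> R" "l < l'" "c l' < c l" "u l' < u l"
        using p(1) by (auto simp: l_def l'_def)
      have minimal: "u a \<le> u b"
        if "a \<in> R" "b \<in> R" "a < b" "c b < c a" "b - a < l' - l" for a b
        using p(2)[of "(a, b)"] that unfolding l_def l'_def by (metis fst_conv snd_conv not_le)
      have "rk x k t \<noteq> rk u k t"
        if x: "x \<in> ?P" "bruhat_le u x" and k: "l < k" "k \<le> l'" "u l' \<le> t" "t < u l" for x k t
        using x(1) by (intro violation_move[OF _ _ x(2) uR inj V(1-4) minimal k])
          (auto simp: compatible_def)
      then show ?thesis using V R by (intro exI[of _ l] exI[of _ l']) auto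
    qed
    then obtain l l' where l: "l < l'" "l' < n" "u l' < u l"
      and strict: "\<And>x k t. x \<in> ?P \<Longrightarrow> bruhat_le u x \<Longrightarrow> l < k \<Longrightarrow> k \<le> l' \<Longrightarrow> u l' \<le> t \<Longrightarrow> t < u l
             \<Longrightarrow> rk x k t \<noteq> rk u k t"
      by blast
    let ?v = "u \<circ> Transposition.transpose l l'"
    have uv: "bruhat_le u ?v"
      unfolding bruhat_le_def using rk_transpose[OF l(1,3)] by (metis le_add1)
    have vx: "bruhat_le ?v x" if x: "x \<in> ?P" "bruhat_le u x" for x
      unfolding bruhat_le_def
    proof (intro allI)
      fix k t
      have "rk x k t \<le> rk u k t" using x(2) by (simp add: bruhat_le_def)
      then show "rk x k t \<le> rk ?v k t"
        using rk_transpose[OF l(1,3), of k t] strict[OF x, of k t] by (auto simp: of_bool_def split: if_splits)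
    qed
    have "\<exists>z\<in>?P. bruhat_le ?v z \<and> (\<forall>x\<in>?P. bruhat_le ?v x \<longrightarrow> bruhat_le z x)"
    proof (rule less.hyps)
      show "(\<Sum>j<n. (n - j) * ?v j) < (\<Sum>j<n. (n - j) * u j)"
        by (rule sum_transpose_less) (use l in auto)
      show "?v \<in> orbit n lam" using less.prems(1) l by (intro orbit_transpose) auto
      show "\<exists>x\<in>?P. bruhat_le ?v x" using x0 vx by blast
    qed
    then show ?thesis using uv vx bruhat_trans by blast
  qed
qed

section \<open>Dimensions of finite-dimensional subspaces\<close>

context vector_space
begin

text \<open>The representation in a larger independent set is unique, so its support lies in both
  subsets. This turns intersections of subspaces into intersections of index sets.\<close>

lemma span_Int_independent:
  assumes B: "independent B" and X: "X \<subseteq> B" and Y: "Y \<subseteq> B"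
  shows "span X \<inter> span Y = span (X \<inter> Y)"
proof
  show "span (X \<inter> Y) \<subseteq> span X \<inter> span Y"
    by (simp add: span_mono)
  show "span X \<inter> span Y \<subseteq> span (X \<inter> Y)"
  proof
    fix x assume x: "x \<in> span X \<inter> span Y"
    have iX: "independent X" using B X by (rule independent_mono)
    have rep: "representation X x = representation Y x"
      using representation_extend[OF B _ X, of x] representation_extend[OF B _ Y, of x] x by simp
    have "x = (\<Sum>b | representation X x b \<noteq> 0. representation X x b *s b)"
      using sum_nonzero_representation_eq[OF iX, of x] x by simp
    also have "\<dots> \<in> span (X \<inter> Y)"
    proof (intro span_sum span_scale span_base)
      fix b assume "b \<in> {b. representation X x b \<noteq> 0}"
      then show "b \<in> X \<inter> Y"
        using representation_ne_zero[of X x b] representation_ne_zero[of Y x b] rep by simp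
    qed
    finally show "x \<in> span (X \<inter> Y)" .
  qed
qed

text \<open>The function space of the model is infinite-dimensional; the finite set \<open>F\<close>
  marks out a part in which dimensions behave as usual.\<close>

lemma dim_mono_fd:
  assumes "A \<subseteq> B" "finite F" "B \<subseteq> span F"
  shows "dim A \<le> dim B"
proof -
  obtain BA where BA: "BA \<subseteq> A" "independent BA" "A \<subseteq> span BA" "card BA = dim A"
    by (rule basis_exists)
  obtain BB where BB: "BB \<subseteq> B" "independent BB" "B \<subseteq> span BB" "card BB = dim B"
    by (rule basis_exists)
  have "finite BB"
    using independent_span_bound[OF assms(2) BB(2)] BB(1) assms(3) by blast
  then have "card BA \<le> card BB"
    using independent_span_bound[OF _ BA(2), of BB] BA(1) BB(3) assms(1) by blast
  then show ?thesis
    using BA(4) BB(4) by simp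
qed

lemma dim_eq_fd:
  assumes "A \<subseteq> B" "finite F" "B \<subseteq> span F" "subspace A" "dim B \<le> dim A"
  shows "A = B"
proof -
  obtain BA where BA: "BA \<subseteq> A" "independent BA" "A \<subseteq> span BA" "card BA = dim A"
    by (rule basis_exists)
  obtain BB where BB: "BA \<subseteq> BB" "BB \<subseteq> B" "independent BB" "B \<subseteq> span BB"
    using maximal_independent_subset_extend[of BA B] BA(1,2) assms(1) by blast
  have "finite BB"
    using independent_span_bound[OF assms(2) BB(3)] BB(2) assms(3) by blast
  moreover have "card BB \<le> card BA"
    using basis_card_eq_dim[OF BB(2,4,3)] BA(4) assms(5) by simp
  ultimately have "BA = BB"
    using BB(1) by (simp add: card_seteq)
  then have "B \<subseteq> span A"
    using BB(4) BA(1) span_mono by blast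
  then show ?thesis
    using assms(1,4) by (metis span_eq_iff subset_antisym)
qed

lemma rank_nullity_fd:
  assumes f: "Vector_Spaces.linear scale scale f" and U: "subspace U" "U \<subseteq> span F" "finite F"
  shows "dim U = dim {x \<in> U. f x = 0} + dim (f ` U)"
proof -
  interpret f: Vector_Spaces.linear scale scale f by (rule f)
  let ?K = "{x \<in> U. f x = 0}"
  obtain K where K: "K \<subseteq> ?K" "independent K" "?K \<subseteq> span K" "card K = dim ?K"
    by (rule basis_exists)
  obtain B where B: "K \<subseteq> B" "B \<subseteq> U" "independent B" "U \<subseteq> span B"
    using maximal_independent_subset_extend[of K U] K(1,2) by blast
  have finB: "finite B"
    using independent_span_bound[OF U(3) B(3)] B(2) U(2) by blast
  let ?C = "B - K"
  have spanC: "span ?C \<subseteq> U"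
    using B(2) U(1) by (metis Diff_subset order_trans span_minimal)
  have inj: "inj_on f (span ?C)"
    unfolding f.inj_on_iff_eq_0[OF subspace_span]
  proof (intro ballI impI)
    fix x assume x: "x \<in> span ?C" "f x = 0"
    then have "x \<in> span K" using spanC K(3) by blast
    moreover have "span K \<inter> span ?C = span (K \<inter> ?C)"
      by (rule span_Int_independent[OF B(3)]) (use B(1) in auto)
    ultimately show "x = 0" using x(1) by (auto simp: Int_Diff)
  qed
  have indC: "independent (f ` ?C)"
    by (rule f.independent_injective_image[OF independent_mono[OF B(3)] inj]) auto
  have "f ` U \<subseteq> span (f ` ?C)"
  proof
    fix y assume "y \<in> f ` U"
    then obtain x where x: "x \<in> U" "y = f x" by blast
    then have "y \<in> f ` span B" using B(4) by blast
    also have "f ` span B = span (f ` B)" by (rule f.span_image[symmetric])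
    also have "\<dots> \<subseteq> span (f ` ?C \<union> {0})"
    proof (rule span_mono)
      show "f ` B \<subseteq> f ` ?C \<union> {0}" using K(1) by auto
    qed
    also have "\<dots> = span (f ` ?C)" by simp
    finally show "y \<in> span (f ` ?C)" .
  qed
  moreover have "?C \<subseteq> U" using B(2) by blast
  ultimately have "dim (f ` U) = card (f ` ?C)"
    by (intro basis_card_eq_dim[symmetric] image_mono indC)
  also have "\<dots> = card ?C"
    using inj_on_subset[OF inj span_superset] by (rule card_image)
  also have "\<dots> = card B - card K"
    using B(1) finB by (intro card_Diff_subset) (auto intro: finite_subset)
  finally have "dim (f ` U) = card B - card K" .
  moreover have "card K \<le> card B" using B(1) finB by (rule card_mono[rotated])
  ultimately show ?thesis
    using basis_card_eq_dim[OF B(2,4,3)] K(4) by simp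
qed

lemma dim_inj_image_fd:
  assumes f: "Vector_Spaces.linear scale scale f" and U: "subspace U" "U \<subseteq> span F" "finite F"
    and inj: "\<And>x. x \<in> U \<Longrightarrow> f x = 0 \<Longrightarrow> x = 0"
  shows "dim (f ` U) = dim U"
proof -
  interpret f: Vector_Spaces.linear scale scale f by (rule f)
  have "{x \<in> U. f x = 0} = {0}"
    using inj subspace_0[OF U(1)] f.zero by auto
  moreover have "dim {0} = 0"
    using dim_unique[of "{}" "{0}" 0, OF _ _ independent_empty] by simp
  ultimately show ?thesis
    using rank_nullity_fd[OF f U] by simp
qed

text \<open>A linear map that kills \<open>A\<close> and fixes a complement of \<open>A\<close> in
  the sum has kernel \<open>A\<close> on the sum and kernel \<open>A \<inter> B\<close> on
  \<open>B\<close>, with the same image; rank and nullity are compared.\<close>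

lemma dim_modular_fd:
  assumes A: "subspace A" "A \<subseteq> span F" and B: "subspace B" "B \<subseteq> span F" and F: "finite F"
  shows "dim (span (A \<union> B)) + dim (A \<inter> B) = dim A + dim B"
proof -
  let ?S = "span (A \<union> B)"
  have S: "?S = {x + y | x y. x \<in> A \<and> y \<in> B}"
    using A(1) B(1) by (simp add: span_Un span_eq_iff[THEN iffD2])
  have SF: "?S \<subseteq> span F"
    using A(2) B(2) by (intro span_minimal) auto
  obtain BA where BA: "BA \<subseteq> A" "independent BA" "A \<subseteq> span BA" "card BA = dim A"
    by (rule basis_exists)
  have AS: "A \<subseteq> ?S" and BS: "B \<subseteq> ?S" using span_superset by blast+
  obtain BB where BB: "BA \<subseteq> BB" "BB \<subseteq> ?S" "independent BB" "?S \<subseteq> span BB"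
    using maximal_independent_subset_extend[of BA ?S] BA(1,2) AS by blast
  interpret vector_space_pair scale scale ..
  obtain f where f: "Vector_Spaces.linear scale scale f"
      and fb: "\<And>b. b \<in> BB \<Longrightarrow> f b = (if b \<in> BA then 0 else b)"
    using linear_independent_extend[OF BB(3), of "\<lambda>b. if b \<in> BA then 0 else b"] by blast
  interpret f: Vector_Spaces.linear scale scale f by (rule f)
  have spanBA: "span BA = A"
    using BA A(1) by (metis span_minimal subset_antisym)
  have fA: "f a = 0" if "a \<in> A" for a
  proof (rule f.eq_0_on_span)
    show "a \<in> span BA" using that BA(3) by blast
    show "f b = 0" if "b \<in> BA" for b
      using fb[of b] that BB(1) by auto
  qed
  have fC: "f c = c" if "c \<in> span (BB - BA)" for c
    using linear_eq_on[OF f module_hom_ident[unfolded module_hom_eq_linear] that] fb by auto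
  have ker: "x \<in> A" if x: "x \<in> ?S" "f x = 0" for x
  proof -
    have "x \<in> span (BA \<union> (BB - BA))"
      using x(1) BB(1,4) by (metis Un_Diff_cancel sup.absorb2 subsetD)
    then obtain a c where ac: "x = a + c" "a \<in> span BA" "c \<in> span (BB - BA)"
      unfolding span_Un by blast
    have "f x = c"
      using ac f.add[of a c] fA fC spanBA by simp
    with x ac spanBA show ?thesis by simp
  qed
  have "{x \<in> ?S. f x = 0} = A" using ker fA AS by auto
  moreover have "{x \<in> B. f x = 0} = A \<inter> B" using ker fA BS by auto
  moreover have "f ` ?S = f ` B"
  proof
    show "f ` B \<subseteq> f ` ?S" using BS by blast
    show "f ` ?S \<subseteq> f ` B"
    proof
      fix y assume "y \<in> f ` ?S"
      then obtain a b where "y = f (a + b)" "a \<in> A" "b \<in> B" unfolding S by blast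
      then show "y \<in> f ` B" by (auto simp: f.add fA)
    qed
  qed
  ultimately show ?thesis
    using rank_nullity_fd[OF f subspace_span SF F] rank_nullity_fd[OF f B F] by simp
qed

end

section \<open>Weight spaces of representations of \<open>\<ss>\<ll>\<^sub>2\<close>\<close>

text \<open>The relation and local nilpotency are asked for weight vectors only, since the operators
  live on a function space that is not the sum of its weight spaces.\<close>

locale sl2_rep = vector_space scale
  for scale :: "'k::field_char_0 \<Rightarrow> 'v::ab_group_add \<Rightarrow> 'v" +
  fixes e f :: "'v \<Rightarrow> 'v" and W :: "int \<Rightarrow> 'v set"
  assumes subspace_W: "subspace (W p)"
    and linear_e: "Vector_Spaces.linear scale scale e"
    and linear_f: "Vector_Spaces.linear scale scale f"
    and e_W: "x \<in> W p \<Longrightarrow> e x \<in> W (p + 2)"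
    and f_W: "x \<in> W p \<Longrightarrow> f x \<in> W (p - 2)"
    and ef: "x \<in> W p \<Longrightarrow> e (f x) = f (e x) + scale (of_int p) x"
    and e_nil: "x \<in> W p \<Longrightarrow> \<exists>k. (e ^^ k) x = 0"
    and f_nil: "x \<in> W p \<Longrightarrow> \<exists>k. (f ^^ k) x = 0"
begin

interpretation e: Vector_Spaces.linear scale scale e by (rule linear_e)
interpretation f: Vector_Spaces.linear scale scale f by (rule linear_f)

lemma e_pow_W: "x \<in> W p \<Longrightarrow> (e ^^ k) x \<in> W (p + 2 * int k)"
proof (induction k)
  case (Suc k)
  then show ?case using e_W[of "(e ^^ k) x" "p + 2 * int k"] by (simp add: algebra_simps)
qed simp

lemma f_pow_W: "x \<in> W p \<Longrightarrow> (f ^^ k) x \<in> W (p - 2 * int k)"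
proof (induction k)
  case (Suc k)
  then show ?case using f_W[of "(f ^^ k) x" "p - 2 * int k"] by (simp add: algebra_simps)
qed simp

lemma pow_e_0: "(e ^^ k) 0 = 0"
  by (induction k) (auto simp: e.zero)

lemma pow_e_zero_mono: "(e ^^ k) x = 0 \<Longrightarrow> k \<le> l \<Longrightarrow> (e ^^ l) x = 0"
  using pow_e_0 by (metis comp_apply funpow_add le_add_diff_inverse2)

text \<open>The coefficient is the sum of the weights \<open>p\<close>, \<open>p + 2\<close>, ...,
  \<open>p + 2 * a\<close> met when \<open>e\<close> passes \<open>f\<close> one factor at a
  time.\<close>

lemma e_pow_f:
  assumes x: "x \<in> W p"
  shows "(e ^^ Suc a) (f x) = f ((e ^^ Suc a) x) + scale (of_int (int (Suc a) * (p + int a))) ((e ^^ a) x)"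
proof (induction a)
  case 0
  then show ?case using ef[OF x] by simp
next
  case (Suc a)
  have W: "(e ^^ Suc a) x \<in> W (p + 2 * int (Suc a))"
    by (rule e_pow_W[OF x])
  have "(e ^^ Suc (Suc a)) (f x) = e ((e ^^ Suc a) (f x))" by simp
  also have "\<dots> = e (f ((e ^^ Suc a) x)) + scale (of_int (int (Suc a) * (p + int a))) ((e ^^ Suc a) x)"
    unfolding Suc by (simp add: e.add e.scale)
  also have "e (f ((e ^^ Suc a) x)) = f ((e ^^ Suc (Suc a)) x) + scale (of_int (p + 2 * int (Suc a))) ((e ^^ Suc a) x)"
    using ef[OF W] by simp
  finally have "(e ^^ Suc (Suc a)) (f x) = f ((e ^^ Suc (Suc a)) x)
      + scale (of_int (p + 2 * int (Suc a)) + of_int (int (Suc a) * (p + int a))) ((e ^^ Suc a) x)"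
    by (simp add: scale_left_distrib add.assoc)
  moreover have "of_int (p + 2 * int (Suc a)) + of_int (int (Suc a) * (p + int a))
      = (of_int (int (Suc (Suc a)) * (p + int (Suc a))) :: 'k)"
    by (simp add: algebra_simps flip: of_int_add)
  ultimately show ?case by metis
qed

text \<open>\<open>y\<close> need not be primitive: beyond \<open>j\<close> all powers of
  \<open>e\<close> kill it. Going down by \<open>b\<close> and up by \<open>j + b\<close> then
  returns a multiple of \<open>(e ^^ j) y\<close>.\<close>

lemma e_pow_f_pow:
  assumes y: "y \<in> W m" "(e ^^ Suc j) y = 0"
  shows "(e ^^ (j + b)) ((f ^^ b) y)
           = scale (\<Prod>t = 1..b. of_int ((int j + int t) * (m + int j - int t + 1))) ((e ^^ j) y)
         \<and> (e ^^ Suc (j + b)) ((f ^^ b) y) = 0"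
proof (induction b)
  case 0
  then show ?case using y by simp
next
  case (Suc b)
  let ?x = "(f ^^ b) y"
  have x: "?x \<in> W (m - 2 * int b)" by (rule f_pow_W[OF y(1)])
  have IH: "(e ^^ (j + b)) ?x = scale (\<Prod>t = 1..b. of_int ((int j + int t) * (m + int j - int t + 1))) ((e ^^ j) y)"
    "(e ^^ Suc (j + b)) ?x = 0" using Suc by auto
  have IH': "(e ^^ Suc (Suc (j + b))) ?x = 0"
    using pow_e_zero_mono[OF IH(2), of "Suc (Suc (j + b))"] by simp
  have one: "(e ^^ (j + Suc b)) ((f ^^ Suc b) y)
      = scale (of_int (int (Suc (j + b)) * (m - 2 * int b + int (j + b)))) ((e ^^ (j + b)) ?x)"
    using e_pow_f[OF x, of "j + b"] IH(2) by (simp add: f.zero del: of_int_mult)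
  have two: "(e ^^ Suc (j + Suc b)) ((f ^^ Suc b) y) = 0"
    using e_pow_f[OF x, of "Suc (j + b)"] IH(2) IH' by (simp add: f.zero del: of_int_mult)
  have coeff: "int (Suc (j + b)) * (m - 2 * int b + int (j + b))
      = (int j + int (Suc b)) * (m + int j - int (Suc b) + 1)"
    by (simp add: algebra_simps)
  show ?case
    using two one unfolding coeff IH(1)
    by (simp add: mult.commute del: of_int_mult)
qed

text \<open>Take \<open>j\<close> to be the last power of \<open>e\<close> that does not kill
  \<open>y\<close>. For \<open>b \<le> m\<close> all factors of the coefficient are positive
  integers, hence nonzero in characteristic 0.\<close>

lemma f_pow_inj:
  assumes y: "y \<in> W m" "int b \<le> m" "(f ^^ b) y = 0"
  shows "y = 0"
proof (rule ccontr)
  assume "y \<noteq> 0"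
  obtain k where "(e ^^ k) y = 0" using e_nil[OF y(1)] by blast
  then obtain j where j: "(e ^^ j) y \<noteq> 0" "(e ^^ Suc j) y = 0"
    using \<open>y \<noteq> 0\<close>
  proof (induction k)
    case (Suc k)
    then show ?case by (cases "(e ^^ k) y = 0") auto
  qed simp
  have "scale (\<Prod>t = 1..b. of_int ((int j + int t) * (m + int j - int t + 1))) ((e ^^ j) y) = 0"
    using e_pow_f_pow[OF y(1) j(2), of b] y(3) pow_e_0 by simp
  then have "(\<Prod>t = 1..b. of_int ((int j + int t) * (m + int j - int t + 1))) = (0 :: 'k)"
    using j(1) by (simp del: of_int_mult)
  then obtain t where t: "t \<in> {1..b}" "of_int ((int j + int t) * (m + int j - int t + 1)) = (0 :: 'k)"
    unfolding prod_zero_iff[OF finite_atLeastAtMost] by blast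
  then have "(int j + int t) * (m + int j - int t + 1) = 0"
    by (simp only: of_int_eq_0_iff)
  then show False using t(1) y(2) by auto
qed

end

text \<open>Exchanging \<open>e\<close> and \<open>f\<close> and negating the weights supplies the
  mirror image of each formula.\<close>

lemma (in sl2_rep) opposite: "sl2_rep scale f e (\<lambda>p. W (- p))"
proof unfold_locales
  show "x \<in> W (- p) \<Longrightarrow> f x \<in> W (- (p + 2))" for x p
    using f_W[of x "- p"] by simp
  show "x \<in> W (- p) \<Longrightarrow> e x \<in> W (- (p - 2))" for x p
    using e_W[of x "- p"] by (simp add: algebra_simps)
  show "x \<in> W (- p) \<Longrightarrow> f (e x) = e (f x) + scale (of_int p) x" for x p
    using ef[of x "- p"] by simp
qed (use subspace_W linear_e linear_f e_nil f_nil in \<open>auto simp: Vector_Spaces.linear_def module_hom_def module_hom_axioms_def\<close>)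

context sl2_rep
begin

interpretation e: Vector_Spaces.linear scale scale e by (rule linear_e)
interpretation f: Vector_Spaces.linear scale scale f by (rule linear_f)

lemma e_pow_inj:
  assumes "y \<in> W (- m)" "int b \<le> m" "(e ^^ b) y = 0"
  shows "y = 0"
  using sl2_rep.f_pow_inj[OF opposite, of y m b] assms by simp

lemma f_pow_e:
  assumes "x \<in> W p"
  shows "(f ^^ Suc a) (e x) = e ((f ^^ Suc a) x) + scale (of_int (int (Suc a) * (- p + int a))) ((f ^^ a) x)"
  using sl2_rep.e_pow_f[OF opposite, of x "- p" a] assms by simp

text \<open>Moving one \<open>e\<close> across a positive power of \<open>f\<close> costs one
  \<open>f\<close> and only changes the inner vector inside \<open>P\<close> and its weight space;
  the surplus \<open>f\<close> stay outside. The stable subspace is carried along because the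
  preimage is later required to lie in it.\<close>

lemma e_pow_f_pow_range:
  assumes P: "subspace P" "\<And>x. x \<in> P \<Longrightarrow> e x \<in> P" "\<And>x. x \<in> P \<Longrightarrow> f x \<in> P"
    and y: "y \<in> P" "y \<in> W p" and ab: "a < b"
  shows "\<exists>z \<in> P. \<exists>q. z \<in> W q \<and> (e ^^ a) ((f ^^ b) y) = (f ^^ (b - a)) z"
  using ab
proof (induction a)
  case 0
  then show ?case using y by auto
next
  case (Suc a)
  then obtain z q where z: "z \<in> P" "z \<in> W q" "(e ^^ a) ((f ^^ b) y) = (f ^^ (b - a)) z" by auto
  obtain c where c: "b - a = Suc c" "b - Suc a = c" using Suc.prems by (metis Suc_diff_Suc Suc_lessD)
  obtain c' where c': "c = Suc c'" using c Suc.prems by (cases c) auto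
  let ?z = "f (e z) - scale (of_int (int (Suc c) * (- q + int c))) z"
  have W0: "?z \<in> P" using P z(1) by (intro subspace_diff subspace_scale) auto
  have pow_f: "(f ^^ k) (x - scale r y) = (f ^^ k) x - scale r ((f ^^ k) y)" for k x y r
    by (induction k) (auto simp: f.diff f.scale)
  have "(e ^^ Suc a) ((f ^^ b) y) = e ((f ^^ Suc c) z)"
    using z(3) c(1) by simp
  also have "\<dots> = (f ^^ Suc c) (e z) - scale (of_int (int (Suc c) * (- q + int c))) ((f ^^ c) z)"
    using f_pow_e[OF z(2), of c] by simp
  also have "\<dots> = (f ^^ c) ?z"
    unfolding pow_f by (simp add: funpow_swap1)
  finally have eq: "(e ^^ Suc a) ((f ^^ b) y) = (f ^^ c) ?z" .
  have "f (e z) \<in> W q"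
    using f_W[OF e_W[OF z(2)]] by simp
  then have "?z \<in> W q"
    using z(2) by (intro subspace_diff subspace_scale subspace_W)
  then show ?case using eq W0 c(2) by blast
qed

end

section \<open>Tensor products of exterior powers\<close>

definition scl :: "'k::field \<Rightarrow> (nat set list \<Rightarrow> 'k) \<Rightarrow> nat set list \<Rightarrow> 'k" where
  "scl c x = (\<lambda>t. c * x t)"

lemma scl_apply [simp]: "scl c x t = c * x t"
  by (simp add: scl_def)

interpretation T: vector_space "scl :: 'k::field \<Rightarrow> _"
  by unfold_locales (auto simp: fun_eq_iff algebra_simps)

definition sw :: "nat \<Rightarrow> nat set \<Rightarrow> nat set" where
  "sw i S = {j. swp i (\<lambda>j. j \<in> S) j}"

text \<open>Written on coefficients, hence backwards: the coefficient at \<open>t\<close> collects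
  those of the monomials that become \<open>t\<close> when \<open>b\<close> is replaced by
  \<open>a\<close> in one factor. The recursion is the Leibniz rule for tensor products.\<close>

primrec mv :: "nat \<Rightarrow> nat \<Rightarrow> nat \<Rightarrow> (nat set list \<Rightarrow> 'k::field) \<Rightarrow> nat set list \<Rightarrow> 'k" where
  "mv i a b x [] = 0"
| "mv i a b x (S # t) = (if a \<in> S \<and> b \<notin> S then x (sw i S # t) else 0) + mv i a b (\<lambda>t. x (S # t)) t"

text \<open>A subset \<open>S\<close> stands for the wedge of the basis vectors \<open>\<epsilon>\<^sub>j\<close>, \<open>j \<in> S\<close>, in increasing order; a list for a
  tensor product of such wedges. No signs occur for simple root vectors.\<close>

definition ee :: "nat \<Rightarrow> (nat set list \<Rightarrow> 'k::field) \<Rightarrow> nat set list \<Rightarrow> 'k" where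
  "ee i = mv i i (Suc i)"

definition ff :: "nat \<Rightarrow> (nat set list \<Rightarrow> 'k::field) \<Rightarrow> nat set list \<Rightarrow> 'k" where
  "ff i = mv i (Suc i) i"

lemma in_sw: "j \<in> sw i S \<longleftrightarrow> (if j = i then Suc i \<in> S else if j = Suc i then i \<in> S else j \<in> S)"
  by (simp add: sw_def swp_apply)

lemma sw_sw [simp]: "sw i (sw i S) = S"
  by (rule Set.set_eqI) (simp add: in_sw)

lemma mv_add: "mv i a b (x + y) t = mv i a b x t + mv i a b y t"
proof (induction t arbitrary: x y)
  case (Cons S t)
  have *: "(\<lambda>t. (x + y) (S # t)) = (\<lambda>t. x (S # t)) + (\<lambda>t. y (S # t))" by (auto simp: fun_eq_iff)
  show ?case unfolding mv.simps * Cons by simp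
qed simp

lemma mv_scl: "mv i a b (scl c x) t = c * mv i a b x t"
proof (induction t arbitrary: x)
  case (Cons S t)
  have *: "(\<lambda>t. scl c x (S # t)) = scl c (\<lambda>t. x (S # t))" by (auto simp: fun_eq_iff)
  show ?case unfolding mv.simps * Cons by (simp add: algebra_simps)
qed simp

lemma linear_mv: "Vector_Spaces.linear scl scl (mv i a b)"
  by (intro Vector_Spaces.linear.intro module_hom.intro T.vector_space_axioms T.module_axioms
      module_hom_axioms.intro) (auto simp: fun_eq_iff mv_add mv_scl)

lemma linear_ee: "Vector_Spaces.linear scl scl (ee i)"
  and linear_ff: "Vector_Spaces.linear scl scl (ff i)"
  unfolding ee_def ff_def by (rule linear_mv)+

interpretation ee: Vector_Spaces.linear scl scl "ee i" for i by (rule linear_ee)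
interpretation ff: Vector_Spaces.linear scl scl "ff i" for i by (rule linear_ff)

lemma mv_nonzero:
  "mv i a b x t \<noteq> 0 \<Longrightarrow> \<exists>p < length t. a \<in> t ! p \<and> b \<notin> t ! p \<and> x (t[p := sw i (t ! p)]) \<noteq> 0"
proof (induction t arbitrary: x)
  case (Cons S t)
  show ?case
  proof (cases "a \<in> S \<and> b \<notin> S \<and> x (sw i S # t) \<noteq> 0")
    case True
    then show ?thesis by (intro exI[of _ 0]) auto
  next
    case False
    then have "mv i a b (\<lambda>t. x (S # t)) t \<noteq> 0" using Cons.prems by (auto split: if_splits)
    then obtain p where "p < length t" "a \<in> t ! p" "b \<notin> t ! p" "x (S # t[p := sw i (t ! p)]) \<noteq> 0"
      using Cons.IH by blast
    then show ?thesis by (intro exI[of _ "Suc p"]) auto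
  qed
qed simp

lemma mv_cong:
  assumes "\<And>p. p < length t \<Longrightarrow> a \<in> t ! p \<Longrightarrow> b \<notin> t ! p \<Longrightarrow> x (t[p := sw i (t ! p)]) = y (t[p := sw i (t ! p)])"
  shows "mv i a b x t = mv i a b y t"
proof -
  have "mv i a b (x + scl (- 1) y) t = 0"
    using mv_nonzero[of i a b "x + scl (- 1) y" t] assms by force
  then show ?thesis unfolding mv_add mv_scl by simp
qed

definition slice :: "nat set \<Rightarrow> (nat set list \<Rightarrow> 'k) \<Rightarrow> nat set list \<Rightarrow> 'k" where
  "slice S x = (\<lambda>t. x (S # t))"

lemma slice_mv: "slice S (mv i a b x) = (if a \<in> S \<and> b \<notin> S then slice (sw i S) x else 0) + mv i a b (slice S x)"
  by (auto simp: slice_def fun_eq_iff)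

lemma mv_Cons: "mv i a b x (S # t) = (if a \<in> S \<and> b \<notin> S then slice (sw i S) x t else 0) + mv i a b (slice S x) t"
  by (simp add: slice_def)

text \<open>Two applications, sorted by which of them act on the first factor; both commutation
  relations then follow by induction over the factors.\<close>

lemma mv_mv_Cons:
  "mv i a b (mv j c d x) (S # t) =
     (if a \<in> S \<and> b \<notin> S then (if c \<in> sw i S \<and> d \<notin> sw i S then slice (sw j (sw i S)) x t else 0)
        + mv j c d (slice (sw i S) x) t else 0)
     + (if c \<in> S \<and> d \<notin> S then mv i a b (slice (sw j S) x) t else 0) + mv i a b (mv j c d (slice S x)) t"
proof -
  have zero: "mv i a b 0 t = 0"
    using mv_scl[of i a b 0 0 t] by (simp add: scl_def zero_fun_def)
  show ?thesis
    unfolding mv_Cons slice_mv mv_add by (auto simp: zero)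
qed

definition wt :: "nat set list \<Rightarrow> nat \<Rightarrow> int" where
  "wt t j = (\<Sum>S\<leftarrow>t. of_bool (j \<in> S))"

lemma wt_Nil [simp]: "wt [] j = 0" and wt_Cons [simp]: "wt (S # t) j = of_bool (j \<in> S) + wt t j"
  by (simp_all add: wt_def)

lemma wt_nonneg: "0 \<le> wt t j" and wt_le: "wt t j \<le> int (length t)"
  by (induction t) auto

lemma ee_ff_commute: "i \<noteq> j \<Longrightarrow> ee i (ff j x) = ff j (ee i x)"
proof
  fix t assume "i \<noteq> j"
  then show "ee i (ff j x) t = ff j (ee i x) t"
    unfolding ee_def ff_def
  proof (induction t arbitrary: x)
    case (Cons S t)
    have "sw i (sw j S) = sw j (sw i S)"
      if "i \<in> S" "Suc i \<notin> S" "Suc j \<in> sw i S" "j \<notin> sw i S"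
      using that Cons.prems by (auto simp: in_sw split: if_splits)
    with Cons show ?case
      unfolding mv_mv_Cons by (auto simp: in_sw)
  qed simp
qed

lemma ee_ff_same: "ee i (ff i x) t = ff i (ee i x) t + of_int (wt t i - wt t (Suc i)) * x t"
  unfolding ee_def ff_def
proof (induction t arbitrary: x)
  case (Cons S t)
  show ?case
    unfolding mv_mv_Cons Cons by (auto simp: in_sw slice_def algebra_simps)
qed simp

text \<open>Translation by \<open>k\<close> times the simple root number \<open>i\<close>.\<close>

definition al :: "nat \<Rightarrow> int \<Rightarrow> (nat \<Rightarrow> int) \<Rightarrow> nat \<Rightarrow> int" where
  "al i k \<mu> = (\<lambda>j. \<mu> j + k * (of_bool (j = i) - of_bool (j = Suc i)))"

lemma al_al [simp]: "al i k (al i l \<mu>) = al i (k + l) \<mu>"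
  by (auto simp: al_def fun_eq_iff algebra_simps)

lemma al_0 [simp]: "al i 0 \<mu> = \<mu>"
  by (simp add: al_def)

lemma al_same: "al i k \<mu> i = \<mu> i + k" "al i k \<mu> (Suc i) = \<mu> (Suc i) - k"
  by (simp_all add: al_def)

lemma swp_al: "swp i \<mu> = al i (\<mu> (Suc i) - \<mu> i) \<mu>"
  by (auto simp: fun_eq_iff al_def swp_apply)

lemma wt_update:
  assumes "p < length t"
  shows "wt (t[p := S]) j = wt t j - of_bool (j \<in> t ! p) + of_bool (j \<in> S)"
  using assms
proof (induction t arbitrary: p)
  case (Cons U t)
  then show ?case by (cases p) auto
qed simp

lemma wt_sw_e:
  assumes "p < length t" "i \<in> t ! p" "Suc i \<notin> t ! p"
  shows "wt t = al i 1 (wt (t[p := sw i (t ! p)]))"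
  using assms by (auto simp: fun_eq_iff wt_update al_def in_sw)

lemma wt_sw_f:
  assumes "p < length t" "Suc i \<in> t ! p" "i \<notin> t ! p"
  shows "wt t = al i (- 1) (wt (t[p := sw i (t ! p)]))"
  using assms by (auto simp: fun_eq_iff wt_update al_def in_sw)

definition Wt :: "(nat \<Rightarrow> int) \<Rightarrow> (nat set list \<Rightarrow> 'k::field) set" where
  "Wt \<mu> = {x. \<forall>t. x t \<noteq> 0 \<longrightarrow> wt t = \<mu>}"

lemma subspace_Wt: "T.subspace (Wt \<mu>)"
  by (rule T.subspaceI) (auto simp: Wt_def, metis add.right_neutral)

lemma ee_Wt: "x \<in> Wt \<mu> \<Longrightarrow> ee i x \<in> Wt (al i 1 \<mu>)"
  unfolding Wt_def ee_def using mv_nonzero[of i i "Suc i" x] wt_sw_e by fastforce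

lemma ff_Wt: "x \<in> Wt \<mu> \<Longrightarrow> ff i x \<in> Wt (al i (- 1) \<mu>)"
  unfolding Wt_def ff_def using mv_nonzero[of i "Suc i" i x] wt_sw_f by fastforce

text \<open>The projection to a weight space. Being total, it allows gradedness to be stated without
  decomposing a vector.\<close>

definition rs :: "(nat \<Rightarrow> int) \<Rightarrow> (nat set list \<Rightarrow> 'k::field) \<Rightarrow> nat set list \<Rightarrow> 'k" where
  "rs \<mu> x = (\<lambda>t. if wt t = \<mu> then x t else 0)"

lemma rs_Wt [simp]: "rs \<mu> x \<in> Wt \<mu>"
  by (auto simp: rs_def Wt_def)

lemma rs_id: "x \<in> Wt \<mu> \<Longrightarrow> rs \<mu> x = x"
  by (auto simp: rs_def Wt_def fun_eq_iff)

lemma rs_other: "x \<in> Wt \<nu> \<Longrightarrow> \<mu> \<noteq> \<nu> \<Longrightarrow> rs \<mu> x = 0"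
  by (auto simp: rs_def Wt_def fun_eq_iff)

lemma linear_rs: "Vector_Spaces.linear scl scl (rs \<mu>)"
  by (intro Vector_Spaces.linear.intro module_hom.intro T.vector_space_axioms T.module_axioms
      module_hom_axioms.intro) (auto simp: fun_eq_iff rs_def)

interpretation rs: Vector_Spaces.linear scl scl "rs \<mu>" for \<mu> by (rule linear_rs)

lemma ff_rs: "ff i (rs \<mu> x) = rs (al i (- 1) \<mu>) (ff i x)"
proof
  fix t
  show "ff i (rs \<mu> x) t = rs (al i (- 1) \<mu>) (ff i x) t"
  proof (cases "wt t = al i (- 1) \<mu>")
    case True
    have "mv i (Suc i) i (rs \<mu> x) t = mv i (Suc i) i x t"
    proof (rule mv_cong)
      fix p assume "p < length t" "Suc i \<in> t ! p" "i \<notin> t ! p"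
      then have "al i 1 (al i (- 1) \<mu>) = al i 1 (al i (- 1) (wt (t[p := sw i (t ! p)])))"
        using wt_sw_f[of p t i] True by simp
      then show "rs \<mu> x (t[p := sw i (t ! p)]) = x (t[p := sw i (t ! p)])"
        by (simp add: rs_def)
    qed
    then show ?thesis using True by (simp add: ff_def rs_def)
  next
    case False
    then show ?thesis
      using ff_Wt[OF rs_Wt, of i \<mu> x] by (auto simp: Wt_def rs_def)
  qed
qed

definition idx :: "nat \<Rightarrow> nat \<Rightarrow> nat set list set" where
  "idx n r = {t. set t \<subseteq> Pow {..<n} \<and> length t = r}"

text \<open>The \<open>r\<close>-th tensor power of the whole exterior algebra of an
  \<open>n\<close>-dimensional space. It contains tensor products of exterior powers of all degrees,
  so degrees need not be tracked.\<close>

definition Supp :: "nat \<Rightarrow> nat \<Rightarrow> (nat set list \<Rightarrow> 'k::field) set" where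
  "Supp n r = {x. \<forall>t. x t \<noteq> 0 \<longrightarrow> t \<in> idx n r}"

definition delta :: "nat set list \<Rightarrow> nat set list \<Rightarrow> 'k::field" where
  "delta t = (\<lambda>t'. if t' = t then 1 else 0)"

lemma sum_fun_apply: "(\<Sum>s\<in>A. f s) t = (\<Sum>s\<in>A. f s t)"
  by (induction A rule: infinite_finite_induct) auto

lemma finite_idx: "finite (idx n r)"
  unfolding idx_def by (rule finite_lists_length_eq) simp

lemma subspace_Supp: "T.subspace (Supp n r)"
  by (rule T.subspaceI) (auto simp: Supp_def, metis add.right_neutral)

lemma Supp_span: "Supp n r \<subseteq> T.span (delta ` idx n r)"
proof
  fix x :: "nat set list \<Rightarrow> 'k::field" assume x: "x \<in> Supp n r"
  have "x = (\<Sum>t\<in>idx n r. scl (x t) (delta t))"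
  proof
    fix t
    have "(\<Sum>s\<in>idx n r. scl (x s) (delta s)) t = (\<Sum>s\<in>idx n r. if s = t then x s else 0)"
      by (simp add: sum_fun_apply delta_def if_distrib cong: if_cong) (auto intro: sum.cong)
    also have "\<dots> = x t"
      using x finite_idx by (auto simp: Supp_def)
    finally show "x t = (\<Sum>s\<in>idx n r. scl (x s) (delta s)) t" by simp
  qed
  also have "\<dots> \<in> T.span (delta ` idx n r)"
    by (intro T.span_sum T.span_scale T.span_base) auto
  finally show "x \<in> T.span (delta ` idx n r)" .
qed

lemma finite_Supp_basis: "finite (delta ` idx n r)"
  by (simp add: finite_idx)

lemma idx_sw:
  assumes "Suc i < n" "p < length t"
  shows "t[p := sw i (t ! p)] \<in> idx n r \<longleftrightarrow> t \<in> idx n r"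
proof -
  have *: "sw i S \<subseteq> {..<n}" if "S \<subseteq> {..<n}" for S
    using that assms(1) by (force simp: in_sw split: if_splits)
  have one: "t[p := sw i (t ! p)] \<in> idx n r" if "t \<in> idx n r" "p < length t" for t
  proof -
    have "t ! p \<in> set t" using that(2) by simp
    then have "t ! p \<in> Pow {..<n}" using that(1) unfolding idx_def by blast
    then have "sw i (t ! p) \<in> Pow {..<n}" using * by blast
    then show ?thesis
      using that set_update_subset_insert[of t p "sw i (t ! p)"] by (auto simp: idx_def)
  qed
  have "t = (t[p := sw i (t ! p)])[p := sw i ((t[p := sw i (t ! p)]) ! p)]"
    using assms(2) by simp
  then show ?thesis
    using one[of t] one[of "t[p := sw i (t ! p)]"] assms(2) by (metis length_list_update)
qed

lemma ee_Supp: "Suc i < n \<Longrightarrow> x \<in> Supp n r \<Longrightarrow> ee i x \<in> Supp n r"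
  unfolding Supp_def ee_def using mv_nonzero[of i i "Suc i" x] idx_sw[of i n] by blast

lemma ff_Supp: "Suc i < n \<Longrightarrow> x \<in> Supp n r \<Longrightarrow> ff i x \<in> Supp n r"
  unfolding Supp_def ff_def using mv_nonzero[of i "Suc i" i x] idx_sw[of i n] by blast

section \<open>Characters and Demazure operators\<close>

text \<open>Each application of \<open>ee i\<close> puts one more \<open>i\<close> into a monomial,
  and \<open>r\<close> factors hold at most \<open>r\<close> of them; this is the source of
  nilpotency.\<close>

lemma ee_pow_nonzero:
  assumes "\<And>t. x t \<noteq> 0 \<Longrightarrow> length t = r"
  shows "(ee i ^^ k) x t \<noteq> 0 \<Longrightarrow> length t = r \<and> int k \<le> wt t i"
proof (induction k arbitrary: t)
  case 0
  then show ?case using assms wt_nonneg by simp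
next
  case (Suc k)
  then have "mv i i (Suc i) ((ee i ^^ k) x) t \<noteq> 0" by (simp add: ee_def)
  then obtain p where p: "p < length t" "i \<in> t ! p" "Suc i \<notin> t ! p"
      "(ee i ^^ k) x (t[p := sw i (t ! p)]) \<noteq> 0"
    using mv_nonzero by blast
  then show ?case
    using Suc.IH[OF p(4)] wt_sw_e[OF p(1-3)] by (simp add: al_same)
qed

lemma ff_pow_nonzero:
  assumes "\<And>t. x t \<noteq> 0 \<Longrightarrow> length t = r"
  shows "(ff i ^^ k) x t \<noteq> 0 \<Longrightarrow> length t = r \<and> int k \<le> wt t (Suc i)"
proof (induction k arbitrary: t)
  case 0
  then show ?case using assms wt_nonneg by simp
next
  case (Suc k)
  then have "mv i (Suc i) i ((ff i ^^ k) x) t \<noteq> 0" by (simp add: ff_def)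
  then obtain p where p: "p < length t" "Suc i \<in> t ! p" "i \<notin> t ! p"
      "(ff i ^^ k) x (t[p := sw i (t ! p)]) \<noteq> 0"
    using mv_nonzero by blast
  then show ?case
    using Suc.IH[OF p(4)] wt_sw_f[OF p(1-3)] by (simp add: al_same)
qed

text \<open>Only the value on the coroot is fixed, together with the number of factors, which bounds
  the lengths of strings.\<close>

definition Wstring :: "nat \<Rightarrow> nat \<Rightarrow> int \<Rightarrow> (nat set list \<Rightarrow> 'k::field) set" where
  "Wstring i r p = {x. \<forall>t. x t \<noteq> 0 \<longrightarrow> wt t i - wt t (Suc i) = p \<and> length t = r}"

lemma sl2_tensor: "sl2_rep (scl :: 'k::field_char_0 \<Rightarrow> _) (ee i) (ff i) (Wstring i r)"
proof unfold_locales
  fix p and x :: "nat set list \<Rightarrow> 'k"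
  show "T.subspace (Wstring i r p :: (nat set list \<Rightarrow> 'k) set)"
    by (rule T.subspaceI) (auto simp: Wstring_def, (metis add.right_neutral)+)
  assume x: "x \<in> Wstring i r p"
  show "ee i x \<in> Wstring i r (p + 2)"
    unfolding Wstring_def
  proof (intro CollectI allI impI)
    fix t assume "ee i x t \<noteq> 0"
    then obtain q where q: "q < length t" "i \<in> t ! q" "Suc i \<notin> t ! q" "x (t[q := sw i (t ! q)]) \<noteq> 0"
      unfolding ee_def using mv_nonzero by blast
    then show "wt t i - wt t (Suc i) = p + 2 \<and> length t = r"
      using wt_sw_e[OF q(1-3)] x by (auto simp: Wstring_def al_same)
  qed
  show "ff i x \<in> Wstring i r (p - 2)"
    unfolding Wstring_def
  proof (intro CollectI allI impI)
    fix t assume "ff i x t \<noteq> 0"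
    then obtain q where q: "q < length t" "Suc i \<in> t ! q" "i \<notin> t ! q" "x (t[q := sw i (t ! q)]) \<noteq> 0"
      unfolding ff_def using mv_nonzero by blast
    then show "wt t i - wt t (Suc i) = p - 2 \<and> length t = r"
      using wt_sw_f[OF q(1-3)] x by (auto simp: Wstring_def al_same)
  qed
  show "ee i (ff i x) = ff i (ee i x) + scl (of_int p) x"
  proof
    fix t
    have "of_int (wt t i - wt t (Suc i)) * x t = of_int p * x t"
      using x by (cases "x t = 0") (auto simp: Wstring_def)
    then show "ee i (ff i x) t = (ff i (ee i x) + scl (of_int p) x) t"
      by (simp add: ee_ff_same)
  qed
  have len: "\<And>t. x t \<noteq> 0 \<Longrightarrow> length t = r" using x by (auto simp: Wstring_def)
  have "(ee i ^^ Suc r) x t = 0" for t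
    using ee_pow_nonzero[OF len, where t=t and k="Suc r"] wt_le[of t i] by fastforce
  then show "\<exists>k. (ee i ^^ k) x = 0" by (intro exI[of _ "Suc r"]) (simp add: fun_eq_iff)
  have "(ff i ^^ Suc r) x t = 0" for t
    using ff_pow_nonzero[OF len, where t=t and k="Suc r"] wt_le[of t "Suc i"] by fastforce
  then show "\<exists>k. (ff i ^^ k) x = 0" by (intro exI[of _ "Suc r"]) (simp add: fun_eq_iff)
qed

lemma Wt_Wstring:
  "x \<in> Wt \<mu> \<Longrightarrow> x \<in> Supp n r \<Longrightarrow> x \<in> Wstring i r (\<mu> i - \<mu> (Suc i))"
  by (auto simp: Wt_def Supp_def Wstring_def idx_def)

lemma ee_pow_Wt: "x \<in> Wt \<mu> \<Longrightarrow> (ee i ^^ k) x \<in> Wt (al i (int k) \<mu>)"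
proof (induction k)
  case (Suc k)
  then show ?case using ee_Wt[of "(ee i ^^ k) x" _ i] by (force simp: add.commute)
qed simp

lemma ff_pow_Wt: "x \<in> Wt \<mu> \<Longrightarrow> (ff i ^^ k) x \<in> Wt (al i (- int k) \<mu>)"
proof (induction k)
  case (Suc k)
  then show ?case using ff_Wt[of "(ff i ^^ k) x" _ i] by force
qed simp

lemma linear_pow:
  assumes "Vector_Spaces.linear scl scl g"
  shows "Vector_Spaces.linear scl scl (g ^^ k)"
proof (induction k)
  case 0
  show ?case unfolding funpow.simps(1) by (rule T.linear_id)
next
  case (Suc k)
  show ?case
    unfolding funpow.simps(2) by (rule Vector_Spaces.linear_compose[OF Suc assms])
qed

lemma pow_stable: "(\<And>x. x \<in> P \<Longrightarrow> g x \<in> P) \<Longrightarrow> x \<in> P \<Longrightarrow> (g ^^ k) x \<in> P"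
  by (induction k) auto

definition ch :: "(nat set list \<Rightarrow> 'k::field) set \<Rightarrow> (nat \<Rightarrow> int) \<Rightarrow> int" where
  "ch U \<mu> = int (T.dim (U \<inter> Wt \<mu>))"

definition graded :: "(nat set list \<Rightarrow> 'k::field) set \<Rightarrow> bool" where
  "graded U \<longleftrightarrow> (\<forall>x\<in>U. \<forall>\<mu>. rs \<mu> x \<in> U)"

lemma dim_pow_le:
  assumes g: "Vector_Spaces.linear scl scl g" and A: "T.subspace A" "A \<subseteq> Supp n r"
    and B: "B \<subseteq> Supp n r" and sub: "(g ^^ k) ` A \<subseteq> B"
    and inj: "\<And>x. x \<in> A \<Longrightarrow> (g ^^ k) x = 0 \<Longrightarrow> x = 0"
  shows "T.dim A \<le> T.dim B" "T.dim ((g ^^ k) ` A) = T.dim A"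
proof -
  note F = finite_Supp_basis[of n r] Supp_span[of n r]
  show eq: "T.dim ((g ^^ k) ` A) = T.dim A"
    by (rule T.dim_inj_image_fd[OF linear_pow[OF g] A(1) order_trans[OF A(2) F(2)] F(1) inj])
  show "T.dim A \<le> T.dim B"
    using T.dim_mono_fd[OF sub F(1) order_trans[OF B F(2)]] eq by simp
qed

text \<open>Both \<open>ff i ^^ m\<close> and \<open>ee i ^^ m\<close> are injective between the two
  weight spaces, so each dimension bounds the other.\<close>

lemma ch_swp_nonneg:
  fixes P :: "(nat set list \<Rightarrow> 'k::field_char_0) set"
  assumes P: "T.subspace P" "P \<subseteq> Supp n r" "\<And>x. x \<in> P \<Longrightarrow> ee i x \<in> P" "\<And>x. x \<in> P \<Longrightarrow> ff i x \<in> P"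
    and m: "\<mu> i - \<mu> (Suc i) = int m"
  shows "T.dim (P \<inter> Wt (swp i \<mu>)) = T.dim (P \<inter> Wt \<mu>)"
    and "(ff i ^^ m) ` (P \<inter> Wt \<mu>) = P \<inter> Wt (swp i \<mu>)"
proof -
  interpret sl2: sl2_rep scl "ee i" "ff i" "Wstring i r" by (rule sl2_tensor)
  have swp: "swp i \<mu> = al i (- int m) \<mu>" using m by (simp add: swp_al flip: m)
  have swp': "\<mu> = al i (int m) (swp i \<mu>)" by (simp add: swp)
  have sub: "T.subspace (P \<inter> Wt \<nu>)" "P \<inter> Wt \<nu> \<subseteq> Supp n r" for \<nu>
    using P(1,2) subspace_Wt by (auto intro: T.subspace_inter)
  have f_sub: "(ff i ^^ m) ` (P \<inter> Wt \<mu>) \<subseteq> P \<inter> Wt (swp i \<mu>)"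
    using pow_stable[of P "ff i"] P(4) ff_pow_Wt[where \<mu>=\<mu> and i=i and k=m] by (auto simp: swp)
  have e_sub: "(ee i ^^ m) ` (P \<inter> Wt (swp i \<mu>)) \<subseteq> P \<inter> Wt \<mu>"
    using pow_stable[of P "ee i"] P(3) ee_pow_Wt[where \<mu>="swp i \<mu>" and i=i and k=m] by (auto simp flip: swp')
  have f_inj: "x = 0" if "x \<in> P \<inter> Wt \<mu>" "(ff i ^^ m) x = 0" for x
    using sl2.f_pow_inj[of x "int m" m] Wt_Wstring[of x \<mu> n r i] that P(2) m by auto
  have e_inj: "x = 0" if "x \<in> P \<inter> Wt (swp i \<mu>)" "(ee i ^^ m) x = 0" for x
  proof -
    have "swp i \<mu> i - swp i \<mu> (Suc i) = - int m" using m by (simp add: swp_apply)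
    then have "x \<in> Wstring i r (- int m)"
      using Wt_Wstring[of x "swp i \<mu>" n r i] that(1) P(2) by auto
    then show ?thesis using sl2.e_pow_inj[of x "int m" m] that(2) by simp
  qed
  have le1: "T.dim (P \<inter> Wt \<mu>) \<le> T.dim (P \<inter> Wt (swp i \<mu>))"
    by (rule dim_pow_le(1)[OF linear_ff sub sub(2) f_sub f_inj])
  have le2: "T.dim (P \<inter> Wt (swp i \<mu>)) \<le> T.dim (P \<inter> Wt \<mu>)"
    by (rule dim_pow_le(1)[OF linear_ee sub sub(2) e_sub e_inj])
  show eq: "T.dim (P \<inter> Wt (swp i \<mu>)) = T.dim (P \<inter> Wt \<mu>)"
    using le1 le2 by simp
  interpret fm: Vector_Spaces.linear scl scl "ff i ^^ m"
    by (rule linear_pow[OF linear_ff])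
  show "(ff i ^^ m) ` (P \<inter> Wt \<mu>) = P \<inter> Wt (swp i \<mu>)"
  proof (rule T.dim_eq_fd[OF f_sub finite_Supp_basis])
    show "P \<inter> Wt (swp i \<mu>) \<subseteq> T.span (delta ` idx n r)"
      using sub(2) Supp_span by (rule order_trans)
    show "T.subspace ((ff i ^^ m) ` (P \<inter> Wt \<mu>))"
      by (rule fm.subspace_image[OF sub(1)])
    show "T.dim (P \<inter> Wt (swp i \<mu>)) \<le> T.dim ((ff i ^^ m) ` (P \<inter> Wt \<mu>))"
      using dim_pow_le(2)[OF linear_ff sub sub(2) f_sub f_inj] eq by simp
  qed
qed

lemma ch_swp:
  fixes P :: "(nat set list \<Rightarrow> 'k::field_char_0) set"
  assumes P: "T.subspace P" "P \<subseteq> Supp n r" "\<And>x. x \<in> P \<Longrightarrow> ee i x \<in> P" "\<And>x. x \<in> P \<Longrightarrow> ff i x \<in> P"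
  shows "ch P (swp i \<mu>) = ch P \<mu>"
proof (cases "\<mu> (Suc i) \<le> \<mu> i")
  case True
  then obtain m where "\<mu> i - \<mu> (Suc i) = int m" by (metis nonneg_int_cases diff_ge_0_iff_ge)
  from ch_swp_nonneg(1)[OF P this] show ?thesis by (simp add: ch_def)
next
  case False
  then obtain m where "swp i \<mu> i - swp i \<mu> (Suc i) = int m"
    unfolding swp_apply by (metis diff_ge_0_iff_ge le_cases nonneg_int_cases n_not_Suc_n)
  from ch_swp_nonneg(1)[OF P this] show ?thesis by (simp add: ch_def)
qed

text \<open>The upper estimate of the Demazure character formula, one coefficient at a time. At
  \<open>\<mu>\<close> the space \<open>P\<close> is \<open>U\<close> plus the image of
  \<open>ff i\<close>, which is injective from one root above. The overlap contains an injective
  image of the part of \<open>U\<close> at the reflection of \<open>\<mu>\<close> minus the root,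
  moved up by a power of \<open>ee i\<close>. Modularity of dimension concludes.\<close>

lemma ch_difference_le:
  fixes P :: "(nat set list \<Rightarrow> 'k::field_char_0) set"
  assumes P: "T.subspace P" "P \<subseteq> Supp n r" "\<And>x. x \<in> P \<Longrightarrow> ee i x \<in> P" "\<And>x. x \<in> P \<Longrightarrow> ff i x \<in> P"
      "graded P"
    and U: "T.subspace U" "U \<subseteq> P" "\<And>x. x \<in> U \<Longrightarrow> ee i x \<in> U" "graded U"
    and gen: "P \<subseteq> T.span {(ff i ^^ k) u | k u. u \<in> U}"
    and \<mu>: "\<mu> (Suc i) \<le> \<mu> i"
  shows "ch P \<mu> - ch P (al i 1 \<mu>) \<le> ch U \<mu> - ch U (al i (- 1) (swp i \<mu>))"
proof -
  interpret sl2: sl2_rep scl "ee i" "ff i" "Wstring i r" by (rule sl2_tensor)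
  obtain m where m: "\<mu> i - \<mu> (Suc i) = int m" using \<mu> by (metis nonneg_int_cases diff_ge_0_iff_ge)
  \<comment> \<open>The two weights are exchanged by the reflection; \<open>\<mu>\<close> lies one
    root below \<open>?\<alpha>\<close> and \<open>m + 1\<close> roots above
    \<open>?\<beta>\<close>.\<close>
  let ?\<alpha> = "al i 1 \<mu>" and ?\<beta> = "al i (- 1) (swp i \<mu>)"
  let ?A = "U \<inter> Wt \<mu>" and ?B = "ff i ` (P \<inter> Wt ?\<alpha>)" and ?C = "U \<inter> Wt ?\<beta>"
  have \<beta>: "?\<beta> = swp i ?\<alpha>" by (auto simp: fun_eq_iff swp_apply al_def)
  have \<beta>': "\<mu> = al i (int (Suc m)) ?\<beta>" using m[symmetric] by (simp add: swp_al)
  have sub: "T.subspace (P \<inter> Wt \<nu>)" "P \<inter> Wt \<nu> \<subseteq> Supp n r"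
       "T.subspace (U \<inter> Wt \<nu>)" "U \<inter> Wt \<nu> \<subseteq> Supp n r" for \<nu>
    using P(1,2) U(1,2) subspace_Wt by (auto intro: T.subspace_inter)
  have m2: "?\<alpha> i - ?\<alpha> (Suc i) = int (m + 2)" using m by (simp add: al_same)
  have B: "T.subspace ?B" "?B \<subseteq> P \<inter> Wt \<mu>"
    using ee.subspace_image ff.subspace_image[OF sub(1)] P(4) ff_Wt[of _ ?\<alpha> i] by auto
  have f_inj: "x = 0" if "x \<in> P \<inter> Wt ?\<alpha>" "ff i x = 0" for x
    using sl2.f_pow_inj[of x "int (m + 2)" 1] Wt_Wstring[of x ?\<alpha> n r i] that P(2) m2 by auto
  have dimB: "T.dim ?B = T.dim (P \<inter> Wt ?\<alpha>)"
    by (rule T.dim_inj_image_fd[OF linear_ff sub(1) order_trans[OF sub(2) Supp_span] finite_Supp_basis f_inj])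
  have PUf: "P \<subseteq> T.span (U \<union> ff i ` P)"
  proof (rule order_trans[OF gen T.span_minimal])
    show "{(ff i ^^ k) u | k u. u \<in> U} \<subseteq> T.span (U \<union> ff i ` P)"
    proof
      fix x assume "x \<in> {(ff i ^^ k) u | k u. u \<in> U}"
      then obtain k u where x: "x = (ff i ^^ k) u" "u \<in> U" by blast
      then have "x \<in> U \<union> ff i ` P"
        using pow_stable[of P "ff i" u] P(4) U(2) by (cases k) auto
      then show "x \<in> T.span (U \<union> ff i ` P)" by (rule T.span_base)
    qed
  qed simp
  have PAB: "P \<inter> Wt \<mu> = T.span (?A \<union> ?B)"
  proof
    show "T.span (?A \<union> ?B) \<subseteq> P \<inter> Wt \<mu>"
      using B(2) U(2) sub(1) by (intro T.span_minimal) auto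
    show "P \<inter> Wt \<mu> \<subseteq> T.span (?A \<union> ?B)"
    proof
      fix x assume x: "x \<in> P \<inter> Wt \<mu>"
      have "x \<in> T.span (U \<union> ff i ` P)" using x PUf by blast
      then obtain u q where "x = u + q" "u \<in> T.span U" "q \<in> T.span (ff i ` P)"
        unfolding T.span_Un by blast
      moreover have "T.span U = U" "T.span (ff i ` P) = ff i ` P"
        using U(1) ff.subspace_image[OF P(1)] by (simp_all only: T.span_eq_iff)
      ultimately obtain p where up: "x = u + ff i p" "u \<in> U" "p \<in> P"
        by auto
      have "x = rs \<mu> u + ff i (rs ?\<alpha> p)"
        using rs_id[of x \<mu>] x up(1) by (simp add: rs.add ff_rs)
      moreover have "rs \<mu> u \<in> ?A" "ff i (rs ?\<alpha> p) \<in> ?B"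
        using U(4) P(5) up(2,3) by (auto simp: graded_def)
      ultimately show "x \<in> T.span (?A \<union> ?B)"
        by (simp only:) (intro T.span_add T.span_base UnI1 UnI2)
    qed
  qed
  have "T.dim ?C \<le> T.dim (?A \<inter> ?B)"
  proof (rule dim_pow_le(1)[OF linear_ee sub(3,4)])
    show "?A \<inter> ?B \<subseteq> Supp n r" using sub(4) by blast
    show "(ee i ^^ Suc m) ` ?C \<subseteq> ?A \<inter> ?B"
    proof
      fix y assume "y \<in> (ee i ^^ Suc m) ` ?C"
      then obtain x where x: "x \<in> U" "x \<in> Wt ?\<beta>" "y = (ee i ^^ Suc m) x" by blast
      have yA: "y \<in> ?A"
        using pow_stable[of U "ee i" x "Suc m"] U(3) x ee_pow_Wt[OF x(2), where i=i and k="Suc m"] \<beta>' by auto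
      \<comment> \<open>\<open>?\<beta>\<close> lies \<open>m + 2\<close> roots below
        \<open>?\<alpha>\<close>, so \<open>x\<close> comes from there; raising it by only
        \<open>m + 1\<close> leaves one factor \<open>ff i\<close> outside.\<close>
      have "x \<in> (ff i ^^ (m + 2)) ` (P \<inter> Wt ?\<alpha>)"
        using ch_swp_nonneg(2)[OF P(1-4) m2] x U(2) \<beta> by auto
      then obtain w where w: "w \<in> P" "w \<in> Wt ?\<alpha>" "x = (ff i ^^ (m + 2)) w" by blast
      obtain z where z: "z \<in> P" "(ee i ^^ Suc m) ((ff i ^^ (m + 2)) w) = (ff i ^^ (m + 2 - Suc m)) z"
        using sl2.e_pow_f_pow_range[OF P(1,3,4) w(1) Wt_Wstring[OF w(2)], of n "Suc m" "m + 2"]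
          w(1) P(2) by auto
      have "y = ff i z" using x(3) w(3) z(2) by simp
      then have "y = ff i (rs ?\<alpha> z)"
        using rs_id[of y \<mu>] yA by (simp add: ff_rs)
      then have "y \<in> ?B" using z(1) P(5) by (auto simp: graded_def)
      with yA show "y \<in> ?A \<inter> ?B" by blast
    qed
    show "x = 0" if "x \<in> ?C" "(ee i ^^ Suc m) x = 0" for x
    proof -
      have "?\<beta> i - ?\<beta> (Suc i) = - int (m + 2)" using m by (simp add: al_same swp_apply)
      then have "x \<in> Wstring i r (- int (m + 2))"
        using Wt_Wstring[of x ?\<beta> n r i] that(1) sub(4)[of ?\<beta>] by auto
      then show ?thesis using sl2.e_pow_inj[of x "int (m + 2)" "Suc m"] that(2) by simp
    qed
  qed
  moreover have "T.dim (P \<inter> Wt \<mu>) + T.dim (?A \<inter> ?B) = T.dim ?A + T.dim ?B"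
    unfolding PAB
    by (rule T.dim_modular_fd[OF sub(3) order_trans[OF sub(4) Supp_span] B(1) _ finite_Supp_basis])
      (rule order_trans[OF order_trans[OF B(2) sub(2)] Supp_span])
  ultimately show ?thesis
    using dimB by (simp add: ch_def)
qed

section \<open>Demazure modules in the tensor product\<close>

declare scl_apply [simp del]

lemma fun_nonzero: "(x :: 'a \<Rightarrow> 'b::zero) \<noteq> 0 \<Longrightarrow> \<exists>t. x t \<noteq> 0"
  by (auto simp: fun_eq_iff)

text \<open>The columns of the key tableau: factor number \<open>p\<close> is the set of positions
  with entry above \<open>p\<close>. Columns beyond the largest entry are empty, so one
  \<open>r\<close> serves every weight with entries at most \<open>r\<close>.\<close>

primrec cols :: "nat \<Rightarrow> (nat \<Rightarrow> nat) \<Rightarrow> nat set list" where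
  "cols 0 u = []"
| "cols (Suc r) u = {j. 0 < u j} # cols r (\<lambda>j. u j - 1)"

lemma length_cols [simp]: "length (cols r u) = r"
  by (induction r arbitrary: u) auto

lemma nth_cols: "p < r \<Longrightarrow> cols r u ! p = {j. p < u j}"
proof (induction r arbitrary: u p)
  case (Suc r)
  then show ?case by (cases p) auto
qed simp

lemma wt_cols: "u j \<le> r \<Longrightarrow> wt (cols r u) j = int (u j)"
  by (induction r arbitrary: u) auto

lemma cols_swp: "cols r (swp i u) = map (sw i) (cols r u)"
  by (rule nth_equalityI) (auto simp: nth_cols in_sw swp_apply)

lemma cols_idx: "(\<And>j. n \<le> j \<Longrightarrow> u j = 0) \<Longrightarrow> cols r u \<in> idx n r"
proof -
  assume u: "\<And>j. n \<le> j \<Longrightarrow> u j = 0"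
  have "S \<subseteq> {..<n}" if "S \<in> set (cols r u)" for S
  proof
    fix j assume "j \<in> S"
    moreover obtain p where "p < r" "S = {j. p < u j}"
      using \<open>S \<in> set (cols r u)\<close> by (auto simp: in_set_conv_nth nth_cols)
    ultimately show "j \<in> {..<n}" using u[of j] by (cases "n \<le> j") auto
  qed
  then show ?thesis by (auto simp: idx_def)
qed

definition evec :: "nat \<Rightarrow> (nat \<Rightarrow> nat) \<Rightarrow> nat set list \<Rightarrow> 'k::field" where
  "evec r u = delta (cols r u)"

lemma evec_Wt: "(\<And>j. u j \<le> r) \<Longrightarrow> evec r u \<in> Wt (\<lambda>j. int (u j))"
  by (auto simp: evec_def delta_def Wt_def wt_cols)

lemma evec_Supp: "(\<And>j. n \<le> j \<Longrightarrow> u j = 0) \<Longrightarrow> evec r u \<in> Supp n r"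
  using cols_idx[of n u r] by (auto simp: evec_def delta_def Supp_def)

lemma delta_nonzero: "delta t \<noteq> 0"
  by (auto simp: delta_def fun_eq_iff)

lemma eq_scl_delta: "(\<And>t. x t \<noteq> 0 \<Longrightarrow> t = t0) \<Longrightarrow> x = scl (x t0) (delta t0)"
  by (auto simp: fun_eq_iff delta_def scl_apply)

lemma evec_nonzero: "(evec r u t :: 'k::field) \<noteq> 0 \<longleftrightarrow> t = cols r u"
  by (simp add: evec_def delta_def)

lemma ee_evec:
  fixes r :: nat
  assumes "u (Suc i) \<le> u i"
  shows "ee i (evec r u :: nat set list \<Rightarrow> 'k::field) = 0"
proof (rule ccontr)
  assume "ee i (evec r u :: nat set list \<Rightarrow> 'k) \<noteq> 0"
  from fun_nonzero[OF this] obtain t where "ee i (evec r u :: nat set list \<Rightarrow> 'k) t \<noteq> 0" ..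
  then obtain p where p: "p < length t" "i \<in> t ! p" "Suc i \<notin> t ! p" "t[p := sw i (t ! p)] = cols r u"
    unfolding ee_def using mv_nonzero[of i i "Suc i" "evec r u :: nat set list \<Rightarrow> 'k" t]
    unfolding evec_nonzero by blast
  have pr: "p < r" using p(1) arg_cong[OF p(4), of length] by simp
  have "{j. p < u j} = sw i (t ! p)"
    using arg_cong[OF p(4), of "\<lambda>l. l ! p"] p(1) pr by (simp add: nth_cols)
  then have "p < u j \<longleftrightarrow> j \<in> sw i (t ! p)" for j by blast
  from this[of i] this[of "Suc i"] show False using p(2,3) assms by (simp add: in_sw)
qed

lemma ff_evec:
  assumes "u i \<le> u (Suc i)"
  shows "ff i (evec r u :: nat set list \<Rightarrow> 'k::field) = 0"
proof (rule ccontr)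
  assume "ff i (evec r u :: nat set list \<Rightarrow> 'k) \<noteq> 0"
  from fun_nonzero[OF this] obtain t where "ff i (evec r u :: nat set list \<Rightarrow> 'k) t \<noteq> 0" ..
  then obtain p where p: "p < length t" "Suc i \<in> t ! p" "i \<notin> t ! p" "t[p := sw i (t ! p)] = cols r u"
    unfolding ff_def using mv_nonzero[of i "Suc i" i "evec r u :: nat set list \<Rightarrow> 'k" t]
    unfolding evec_nonzero by blast
  have pr: "p < r" using p(1) arg_cong[OF p(4), of length] by simp
  have "{j. p < u j} = sw i (t ! p)"
    using arg_cong[OF p(4), of "\<lambda>l. l ! p"] p(1) pr by (simp add: nth_cols)
  then have "p < u j \<longleftrightarrow> j \<in> sw i (t ! p)" for j by blast
  from this[of i] this[of "Suc i"] show False using p(2,3) assms by (simp add: in_sw)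
qed

text \<open>Raising and lowering operators for \<open>i\<close> can only reflect factors, so their
  powers on an extremal vector stay among these monomials.\<close>

definition stringset :: "nat \<Rightarrow> nat set list \<Rightarrow> (nat set list \<Rightarrow> 'k::field) set" where
  "stringset i c = {x. \<forall>t. x t \<noteq> 0 \<longrightarrow> length t = length c \<and> (\<forall>p<length c. t ! p = c ! p \<or> t ! p = sw i (c ! p))}"

lemma stringset_mv: "x \<in> stringset i c \<Longrightarrow> mv i a b x \<in> stringset i c"
  unfolding stringset_def
proof (intro CollectI allI impI)
  fix t
  assume x: "x \<in> {x. \<forall>t. x t \<noteq> 0 \<longrightarrow> length t = length c \<and> (\<forall>p<length c. t ! p = c ! p \<or> t ! p = sw i (c ! p))}"
    and "mv i a b x t \<noteq> 0"
  then obtain p where p: "p < length t" "x (t[p := sw i (t ! p)]) \<noteq> 0" using mv_nonzero by blast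
  let ?t = "t[p := sw i (t ! p)]"
  have len: "length ?t = length c" and *: "\<And>q. q < length c \<Longrightarrow> ?t ! q = c ! q \<or> ?t ! q = sw i (c ! q)"
    using x p(2) by blast+
  have "t ! q = c ! q \<or> t ! q = sw i (c ! q)" if "q < length c" for q
  proof (cases "q = p")
    case True
    then have "sw i (t ! q) = c ! q \<or> sw i (t ! q) = sw i (c ! q)" using *[OF that] p(1) by simp
    then show ?thesis by (metis sw_sw)
  next
    case False
    then show ?thesis using *[OF that] by simp
  qed
  then show "length t = length c \<and> (\<forall>p<length c. t ! p = c ! p \<or> t ! p = sw i (c ! p))"
    using len by simp
qed

lemma wt_nth: "wt t j = (\<Sum>p<length t. of_bool (j \<in> t ! p))"
  by (simp add: wt_def sum_list_sum_nth atLeast0LessThan)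

text \<open>The only tensor monomial in the string through an extremal one with the reflected weight is the
  reflected one.\<close>

lemma stringset_extremal:
  assumes x: "x \<in> stringset i (cols r u)" "x t \<noteq> 0" and u: "u (Suc i) \<le> u i" "\<And>j. u j \<le> r"
  shows "wt t = (\<lambda>j. int (swp i u j)) \<Longrightarrow> t = cols r (swp i u)"
    and "wt t = (\<lambda>j. int (u j)) \<Longrightarrow> t = cols r u"
proof -
  have len: "length t = r" and nth: "\<And>p. p < r \<Longrightarrow> t ! p = {j. p < u j} \<or> t ! p = sw i {j. p < u j}"
    using x by (auto simp: stringset_def nth_cols)
  \<comment> \<open>These factors contain both or none of \<open>i\<close> and \<open>Suc i\<close>.
    For each of the others the weight decides whether it is reflected, because it makes the count of
    \<open>i\<close> or of \<open>Suc i\<close> as large as possible.\<close>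
  have fix': "sw i {j. p < u j} = {j. p < u j}" if "p < u (Suc i) \<or> u i \<le> p" for p
  proof -
    have "p < u i \<longleftrightarrow> p < u (Suc i)" using that u(1) by linarith
    then show ?thesis by (intro Set.set_eqI) (simp add: in_sw)
  qed
  have ui: "(\<Sum>p<r. of_bool (p < u i)) = int (u i)"
    using wt_nth[of "cols r u" i] wt_cols[of u i r, OF u(2)] by (simp add: nth_cols)
  show "t = cols r (swp i u)" if w: "wt t = (\<lambda>j. int (swp i u j))"
  proof (rule nth_equalityI)
    have "(\<Sum>p<r. of_bool (Suc i \<in> t ! p)) = (\<Sum>p<r. of_bool (p < u i) :: int)"
      using w wt_nth[of t "Suc i"] len ui by (simp add: swp_apply)
    moreover have "of_bool (Suc i \<in> t ! p) \<le> (of_bool (p < u i) :: int)" if "p \<in> {..<r}" for p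
      using nth[OF that[unfolded lessThan_iff]] u(1) by (elim disjE) (simp_all add: in_sw)
    ultimately have eq: "of_bool (Suc i \<in> t ! p) = (of_bool (p < u i) :: int)" if "p < r" for p
      using sum_mono_inv[of "\<lambda>p. of_bool (Suc i \<in> t ! p) :: int" "{..<r}" "\<lambda>p. of_bool (p < u i)" p] that
      by blast
    fix p assume p: "p < length t"
    then have "Suc i \<in> t ! p \<longleftrightarrow> p < u i"
      using eq[of p] len by (cases "p < u i"; cases "Suc i \<in> t ! p") simp_all
    moreover have "p < u i" "\<not> p < u (Suc i)" if "\<not> (p < u (Suc i) \<or> u i \<le> p)"
      using that by simp_all
    moreover have "t ! p = {j. p < u j} \<Longrightarrow> Suc i \<in> t ! p \<longleftrightarrow> p < u (Suc i)"
      by simp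
    ultimately have "t ! p = sw i {j. p < u j}"
      using nth[of p] p len fix'[of p] by metis
    then show "t ! p = cols r (swp i u) ! p"
      using p len by (simp add: cols_swp nth_cols)
  qed (simp add: len)
  show "t = cols r u" if w: "wt t = (\<lambda>j. int (u j))"
  proof (rule nth_equalityI)
    have "(\<Sum>p<r. of_bool (i \<in> t ! p)) = (\<Sum>p<r. of_bool (p < u i) :: int)"
      using w wt_nth[of t i] len ui by simp
    moreover have "of_bool (i \<in> t ! p) \<le> (of_bool (p < u i) :: int)" if "p \<in> {..<r}" for p
      using nth[OF that[unfolded lessThan_iff]] u(1) by (elim disjE) (simp_all add: in_sw)
    ultimately have eq: "of_bool (i \<in> t ! p) = (of_bool (p < u i) :: int)" if "p < r" for p
      using sum_mono_inv[of "\<lambda>p. of_bool (i \<in> t ! p) :: int" "{..<r}" "\<lambda>p. of_bool (p < u i)" p] that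
      by blast
    fix p assume p: "p < length t"
    then have "i \<in> t ! p \<longleftrightarrow> p < u i"
      using eq[of p] len by (cases "p < u i"; cases "i \<in> t ! p") simp_all
    moreover have "p < u i" "\<not> p < u (Suc i)" if "\<not> (p < u (Suc i) \<or> u i \<le> p)"
      using that by simp_all
    moreover have "t ! p = sw i {j. p < u j} \<Longrightarrow> i \<in> t ! p \<longleftrightarrow> p < u (Suc i)"
      by (simp add: in_sw)
    ultimately have "t ! p = {j. p < u j}"
      using nth[of p] p len fix'[of p] by metis
    then show "t ! p = cols r u ! p"
      using p len by (simp add: nth_cols)
  qed (simp add: len)
qed

text \<open>The result has the reflected weight and stays among the partly reflected monomials, only
  one of which has that weight; it is nonzero by injectivity of the power.\<close>

lemma extremal_reflection:
  fixes u :: "nat \<Rightarrow> nat"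
  assumes u: "u (Suc i) \<le> u i" "\<And>j. u j \<le> r" "\<And>j. n \<le> j \<Longrightarrow> u j = 0" and i: "Suc i < n"
  shows "\<exists>c. c \<noteq> 0 \<and> (ff i ^^ (u i - u (Suc i))) (evec r u) = scl c (evec r (swp i u) :: _ \<Rightarrow> 'k::field_char_0)"
    and "\<exists>c. c \<noteq> 0 \<and> (ee i ^^ (u i - u (Suc i))) (evec r (swp i u)) = scl c (evec r u :: _ \<Rightarrow> 'k)"
proof -
  let ?m = "u i - u (Suc i)" and ?\<mu> = "\<lambda>j. int (u j)" and ?s = "\<lambda>j. int (swp i u j)"
  let ?v = "evec r u :: nat set list \<Rightarrow> 'k" and ?w = "evec r (swp i u) :: nat set list \<Rightarrow> 'k"
  interpret sl2: sl2_rep "scl :: 'k \<Rightarrow> _" "ee i" "ff i" "Wstring i r" by (rule sl2_tensor)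
  have u': "\<And>j. swp i u j \<le> r" "\<And>j. n \<le> j \<Longrightarrow> swp i u j = 0"
    using u(2,3) i by (auto simp: swp_apply)
  have al: "al i (- int ?m) ?\<mu> = ?s" "al i (int ?m) ?s = ?\<mu>"
    using u(1) by (auto simp: al_def swp_apply fun_eq_iff)
  have mem: "?v \<in> Wt ?\<mu>" "?v \<in> Supp n r" "?w \<in> Wt ?s" "?w \<in> Supp n r"
    using evec_Wt[of u r] evec_Wt[of "swp i u" r] evec_Supp[of n u r] evec_Supp[of n "swp i u" r] u u'
    by blast+
  have str: "?v \<in> stringset i (cols r u)" "?w \<in> stringset i (cols r u)"
    by (auto simp: stringset_def evec_def delta_def cols_swp)
  let ?x = "(ff i ^^ ?m) ?v" and ?y = "(ee i ^^ ?m) ?w"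
  have xs: "?x \<in> stringset i (cols r u)" and ys: "?y \<in> stringset i (cols r u)"
    using pow_stable[of "stringset i (cols r u)"] stringset_mv str unfolding ee_def ff_def by blast+
  have xw: "?x \<in> Wt ?s" and yw: "?y \<in> Wt ?\<mu>"
    using ff_pow_Wt[OF mem(1), where i=i and k="?m"] ee_pow_Wt[OF mem(3), where i=i and k="?m"] al
    by simp_all
  have "?x = scl (?x (cols r (swp i u))) (delta (cols r (swp i u)))"
    using stringset_extremal(1)[OF xs _ u(1,2)] xw by (intro eq_scl_delta) (auto simp: Wt_def)
  moreover have "?x \<noteq> 0"
  proof
    assume "?x = 0"
    then have "?v = 0"
      using sl2.f_pow_inj[OF Wt_Wstring[OF mem(1,2)], of ?m] u(1) by simp
    then show False unfolding evec_def using delta_nonzero by blast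
  qed
  ultimately show "\<exists>c. c \<noteq> 0 \<and> ?x = scl c ?w"
    unfolding evec_def by (metis T.scale_zero_left)
  have "?y = scl (?y (cols r u)) (delta (cols r u))"
    using stringset_extremal(2)[OF ys _ u(1,2)] yw by (intro eq_scl_delta) (auto simp: Wt_def)
  moreover have "?y \<noteq> 0"
  proof
    assume "?y = 0"
    moreover have "?w \<in> Wstring i r (- int ?m)"
      using Wt_Wstring[OF mem(3,4), of i] u(1) by (simp add: swp_apply)
    ultimately have "?w = 0"
      using sl2.e_pow_inj[of _ "int ?m" ?m] by simp
    then show False unfolding evec_def using delta_nonzero by blast
  qed
  ultimately show "\<exists>c. c \<noteq> 0 \<and> ?y = scl c ?v"
    unfolding evec_def by (metis T.scale_zero_left)
qed

text \<open>Simple raising operators suffice as generators: on a weight vector the torus acts by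
  scalars, and the other positive root vectors are iterated commutators.
  \<open>span_flag_words\<close> makes this precise for the given module.\<close>

definition Dem :: "nat \<Rightarrow> nat \<Rightarrow> (nat \<Rightarrow> nat) \<Rightarrow> (nat set list \<Rightarrow> 'k::field) set" where
  "Dem n r u = T.span {foldr ee is (evec r u) | is. set is \<subseteq> {i. Suc i < n}}"

lemma subspace_Dem [simp]: "T.subspace (Dem n r u)"
  by (simp add: Dem_def)

lemma evec_Dem: "evec r u \<in> Dem n r u"
  unfolding Dem_def by (rule T.span_base, rule CollectI, rule exI[of _ "[]"]) simp

lemma ee_span_stable:
  assumes "\<And>g. g \<in> G \<Longrightarrow> ee i g \<in> T.span G" "x \<in> T.span G"
  shows "ee i x \<in> T.span G"
  using assms(2)
proof (induction rule: T.span_induct)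
  case base
  then show ?case by (rule T.subspaceI) (auto simp: ee.zero ee.add ee.scale T.span_zero T.span_add T.span_scale)
qed (use assms(1) in blast)

lemma ff_span_stable:
  assumes "\<And>g. g \<in> G \<Longrightarrow> ff i g \<in> T.span G" "x \<in> T.span G"
  shows "ff i x \<in> T.span G"
  using assms(2)
proof (induction rule: T.span_induct)
  case base
  then show ?case by (rule T.subspaceI) (auto simp: ff.zero ff.add ff.scale T.span_zero T.span_add T.span_scale)
qed (use assms(1) in blast)

lemma ee_Dem:
  assumes "Suc i < n" "x \<in> Dem n r u"
  shows "ee i x \<in> Dem n r u"
  using assms(2) unfolding Dem_def
proof (rule ee_span_stable[rotated])
  fix g :: "nat set list \<Rightarrow> 'a" assume "g \<in> {foldr ee is (evec r u) | is. set is \<subseteq> {i. Suc i < n}}"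
  then obtain "is" where "g = foldr ee is (evec r u)" "set is \<subseteq> {i. Suc i < n}" by blast
  then have "ee i g = foldr ee (i # is) (evec r u)" "set (i # is) \<subseteq> {i. Suc i < n}"
    using assms(1) by auto
  then show "ee i g \<in> T.span {foldr ee is (evec r u) | is. set is \<subseteq> {i. Suc i < n}}"
    by (intro T.span_base) blast
qed

lemma Dem_minimal:
  assumes Z: "T.subspace Z" "evec r u \<in> Z" "\<And>i x. Suc i < n \<Longrightarrow> x \<in> Z \<Longrightarrow> ee i x \<in> Z"
  shows "Dem n r u \<subseteq> Z"
  unfolding Dem_def
proof (rule T.span_minimal[OF _ Z(1)])
  have "foldr ee is (evec r u) \<in> Z" if "set is \<subseteq> {i. Suc i < n}" for "is"
    using that by (induction "is") (auto simp: Z)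
  then show "{foldr ee is (evec r u) | is. set is \<subseteq> {i. Suc i < n}} \<subseteq> Z" by blast
qed

lemma Dem_Supp: "(\<And>j. n \<le> j \<Longrightarrow> u j = 0) \<Longrightarrow> Dem n r u \<subseteq> Supp n r"
  by (rule Dem_minimal) (auto simp: subspace_Supp evec_Supp ee_Supp)

lemma foldr_ee_Wt: "v \<in> Wt \<mu> \<Longrightarrow> \<exists>\<nu>. foldr ee is v \<in> Wt \<nu>"
proof (induction "is")
  case (Cons i "is")
  then show ?case using ee_Wt[of _ _ i] by fastforce
qed auto

lemma graded_span:
  assumes "\<And>g. g \<in> G \<Longrightarrow> \<exists>\<nu>. g \<in> Wt \<nu>"
  shows "graded (T.span G)"
  unfolding graded_def
proof (intro ballI allI)
  fix x \<mu> assume "x \<in> T.span G"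
  then show "rs \<mu> x \<in> T.span G"
  proof (induction rule: T.span_induct)
    case base
    then show ?case
      by (rule T.subspaceI) (auto simp: rs.zero rs.add rs.scale T.span_zero T.span_add T.span_scale)
  next
    case (step g)
    then obtain \<nu> where "g \<in> Wt \<nu>" using assms by blast
    then have "rs \<mu> g = g \<or> rs \<mu> g = 0"
      using rs_id[of g \<nu>] rs_other[of g \<nu> \<mu>] by metis
    then show ?case
      using T.span_base[OF step] T.span_zero[of G] by metis
  qed
qed

lemma graded_Dem: "(\<And>j. u j \<le> r) \<Longrightarrow> graded (Dem n r u)"
  unfolding Dem_def by (rule graded_span) (use foldr_ee_Wt evec_Wt in blast)

lemma ee_ff_Wt:
  assumes "x \<in> Wt \<mu>"
  shows "ee i (ff i x) = ff i (ee i x) + scl (of_int (\<mu> i - \<mu> (Suc i))) x"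
proof
  fix t
  have "of_int (wt t i - wt t (Suc i)) * x t = of_int (\<mu> i - \<mu> (Suc i)) * x t"
    using assms by (cases "x t = 0") (auto simp: Wt_def)
  then show "ee i (ff i x) t = (ff i (ee i x) + scl (of_int (\<mu> i - \<mu> (Suc i))) x) t"
    by (simp add: ee_ff_same scl_apply)
qed

text \<open>The generator is killed by \<open>ff i\<close>, and moving \<open>ff i\<close> to the
  right through a word of raising operators leaves only scalar multiples of words. So the module is
  stable under a minimal parabolic subalgebra.\<close>

lemma ff_Dem:
  assumes u: "u i \<le> u (Suc i)" "\<And>j. u j \<le> r" and x: "x \<in> Dem n r u"
  shows "ff i x \<in> Dem n r u"
  using x unfolding Dem_def
proof (rule ff_span_stable[rotated])
  fix g :: "nat set list \<Rightarrow> 'a" assume "g \<in> {foldr ee is (evec r u) | is. set is \<subseteq> {i. Suc i < n}}"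
  then obtain "is" where "g = foldr ee is (evec r u)" "set is \<subseteq> {i. Suc i < n}" by blast
  moreover have "ff i (foldr ee is (evec r u) :: nat set list \<Rightarrow> 'a) \<in> Dem n r u \<and>
      (foldr ee is (evec r u) :: nat set list \<Rightarrow> 'a) \<in> Dem n r u"
    if "set is \<subseteq> {i. Suc i < n}" for "is"
    using that
  proof (induction "is")
    case Nil
    have "ff i (evec r u) = (0 :: nat set list \<Rightarrow> 'a)" by (rule ff_evec) (rule u(1))
    then show ?case using evec_Dem[of r u n] T.subspace_0[OF subspace_Dem[of n r u]]
      by (simp only: foldr.simps id_apply)
  next
    case (Cons j "is")
    let ?y = "foldr ee is (evec r u) :: nat set list \<Rightarrow> 'a"
    have y: "ff i ?y \<in> Dem n r u" "?y \<in> Dem n r u" "Suc j < n" using Cons by auto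
    obtain \<mu> where \<mu>: "?y \<in> Wt \<mu>" using foldr_ee_Wt[OF evec_Wt[of u r, OF u(2)]] by blast
    have "ff i (ee j ?y) \<in> Dem n r u"
    proof (cases "j = i")
      case True
      have "ff i (ee j ?y) = ee i (ff i ?y) - scl (of_int (\<mu> i - \<mu> (Suc i))) ?y"
        using ee_ff_Wt[OF \<mu>, of i] True by simp
      then show ?thesis
        using y ee_Dem[of i n "ff i ?y"] True by (auto intro!: T.subspace_diff T.subspace_scale)
    next
      case False
      then show ?thesis using ee_ff_commute[of j i ?y] ee_Dem[OF y(3,1)] by simp
    qed
    then show ?case using ee_Dem[OF y(3,2)] by simp
  qed
  ultimately show "ff i g \<in> T.span {foldr ee is (evec r u) | is. set is \<subseteq> {i. Suc i < n}}"
    by (simp only: Dem_def)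
qed

context
  fixes u :: "nat \<Rightarrow> nat" and i n r :: nat
  assumes u: "u (Suc i) \<le> u i" "\<And>j. u j \<le> r" "\<And>j. n \<le> j \<Longrightarrow> u j = 0" and i: "Suc i < n"
begin

lemma swp_bounds: "swp i u j \<le> r" "n \<le> j \<Longrightarrow> swp i u j = 0"
  using u(2,3) i by (auto simp: swp_apply)

lemma ff_Dem_swp: "x \<in> Dem n r (swp i u) \<Longrightarrow> ff i x \<in> Dem n r (swp i u)"
  by (rule ff_Dem) (use u swp_bounds in \<open>auto simp: swp_apply\<close>)

lemma Dem_subset_swp: "Dem n r u \<subseteq> (Dem n r (swp i u) :: (_ \<Rightarrow> 'k::field_char_0) set)"
proof (rule Dem_minimal)
  obtain c where c: "c \<noteq> 0" "(ee i ^^ (u i - u (Suc i))) (evec r (swp i u)) = scl c (evec r u :: _ \<Rightarrow> 'k)"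
    using extremal_reflection(2)[OF u i] by blast
  have "scl c (evec r u :: _ \<Rightarrow> 'k) \<in> Dem n r (swp i u)"
    unfolding c(2)[symmetric] by (rule pow_stable[OF ee_Dem[OF i] evec_Dem])
  then have "scl (inverse c) (scl c (evec r u :: _ \<Rightarrow> 'k)) \<in> Dem n r (swp i u)"
    by (rule T.subspace_scale[OF subspace_Dem])
  then show "(evec r u :: _ \<Rightarrow> 'k) \<in> Dem n r (swp i u)"
    using c(1) by simp
qed (auto intro: ee_Dem)

text \<open>The right-hand span contains the reflected extremal vector and is stable under raising:
  \<open>ee j\<close> with \<open>j \<noteq> i\<close> commutes with \<open>ff i\<close>, and for
  \<open>j = i\<close> the commutator is a scalar times a smaller power of
  \<open>ff i\<close>.\<close>

lemma Dem_swp_generated: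
  "(Dem n r (swp i u) :: (_ \<Rightarrow> 'k::field_char_0) set) \<subseteq> T.span {(ff i ^^ k) x | k x. x \<in> Dem n r u}"
proof -
  let ?D = "Dem n r u :: (_ \<Rightarrow> 'k) set"
  \<comment> \<open>Restricted to weight vectors, because the commutator with a power of
    \<open>ff i\<close> depends on the weight.\<close>
  let ?G = "{(ff i ^^ k) x | k x. x \<in> ?D \<and> (\<exists>\<mu>. x \<in> Wt \<mu>)}"
  interpret sl2: sl2_rep "scl :: 'k \<Rightarrow> _" "ee i" "ff i" "Wstring i r" by (rule sl2_tensor)
  have "Dem n r (swp i u) \<subseteq> T.span ?G"
  proof (rule Dem_minimal)
    obtain c where c: "c \<noteq> 0" "(ff i ^^ (u i - u (Suc i))) (evec r u) = scl c (evec r (swp i u) :: _ \<Rightarrow> 'k)"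
      using extremal_reflection(1)[OF u i] by blast
    have "scl c (evec r (swp i u)) \<in> T.span ?G"
      unfolding c(2)[symmetric] using evec_Dem evec_Wt[of u r, OF u(2)] by (intro T.span_base) blast
    then have "scl (inverse c) (scl c (evec r (swp i u))) \<in> T.span ?G"
      by (rule T.span_scale)
    then show "evec r (swp i u) \<in> T.span ?G" using c(1) by simp
  next
    fix j and x :: "nat set list \<Rightarrow> 'k" assume j: "Suc j < n" and "x \<in> T.span ?G"
    from this(2) show "ee j x \<in> T.span ?G"
    proof (rule ee_span_stable[rotated])
      fix g assume "g \<in> ?G"
      then obtain k x \<mu> where g: "g = (ff i ^^ k) x" "x \<in> ?D" "x \<in> Wt \<mu>" by blast
      have eG: "(ff i ^^ k) (ee j x) \<in> T.span ?G" for k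
        using ee_Dem[OF j g(2)] ee_Wt[OF g(3)] by (intro T.span_base) blast
      show "ee j g \<in> T.span ?G"
      proof (cases "j = i")
        case False
        have "ee j ((ff i ^^ k) y) = (ff i ^^ k) (ee j y)" for y :: "nat set list \<Rightarrow> 'k"
        proof (induction k)
          case (Suc k)
          then show ?case
            using ee_ff_commute[OF False, of "(ff i ^^ k) y"] by (simp only: funpow.simps o_apply)
        qed (simp only: funpow.simps id_apply)
        then show ?thesis using eG g(1) by simp
      next
        case True
        show ?thesis
        proof (cases k)
          case 0
          then show ?thesis using eG[of 0] g(1) by simp
        next
          case (Suc a)
          have "x \<in> Wstring i r (\<mu> i - \<mu> (Suc i))"
            using Wt_Wstring[OF g(3)] g(2) Dem_Supp[of n u r] u(3) by blast
          from sl2.f_pow_e[OF this, of a] have "ee i ((ff i ^^ Suc a) x) = (ff i ^^ Suc a) (ee i x)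
              - scl (of_int (int (Suc a) * (- (\<mu> i - \<mu> (Suc i)) + int a))) ((ff i ^^ a) x)"
            by (simp add: algebra_simps)
          also have "\<dots> \<in> T.span ?G"
            using eG[of "Suc a"] g(2,3) True by (intro T.span_diff T.span_scale) (auto intro!: T.span_base)
          finally show ?thesis using g(1) Suc True by simp
        qed
      qed
    qed
  qed simp
  also have "\<dots> \<subseteq> T.span {(ff i ^^ k) x | k x. x \<in> ?D}"
    by (rule T.span_mono) blast
  finally show ?thesis .
qed

end

section \<open>Order ideals and the recursion over columns\<close>

definition dominant :: "nat \<Rightarrow> (nat \<Rightarrow> nat) \<Rightarrow> bool" where
  "dominant n u \<longleftrightarrow> (\<forall>i. Suc i < n \<longrightarrow> u (Suc i) \<le> u i)"

lemma rk_mono: "k \<le> l \<Longrightarrow> rk u k t \<le> rk u l t"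
  by (simp add: rk_interval[of k l])

lemma rk_le: "rk u k t \<le> k"
  by (induction k) (auto simp: rk_Suc)

text \<open>The entries of a nonincreasing weight above a threshold fill an initial segment, the
  most that any prefix can contain.\<close>

lemma dominant_least:
  assumes "u \<in> orbit n lam" "v \<in> orbit n lam" "dominant n u" "\<And>j. n \<le> j \<Longrightarrow> lam j = 0"
  shows "bruhat_le u v"
  unfolding bruhat_le_def
proof (intro allI)
  fix k t
  have anti: "u b \<le> u a" if "a \<le> b" "b < n" for a b
    using that
  proof (induction b rule: dec_induct)
    case (step b)
    then have "u (Suc b) \<le> u b" using assms(3) by (simp add: dominant_def)
    with step show ?case by simp
  qed simp
  have n: "rk u n t = rk v n t"
    using rk_orbit assms(1,2) by simp
  show "rk v k t \<le> rk u k t"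
  proof (cases "\<exists>j<k. u j \<le> t")
    case True
    then obtain j where j: "j < k" "u j \<le> t" by blast
    have "u j' \<le> t" if "k \<le> j'" for j'
      using anti[of j j'] j that orbit_beyond[OF assms(1), of j'] assms(4)[of j'] by (cases "j' < n") auto
    then have "{j'. k \<le> j' \<and> j' < n \<and> t < u j'} = {}"
      by (metis (mono_tags, lifting) Collect_empty_eq leD)
    then have u: "rk u n t = rk u k t" if "k \<le> n"
      using rk_interval[OF that, of u t] by (metis add.right_neutral card.empty)
    show ?thesis
    proof (cases "n \<le> k")
      case True
      have "{j'. n \<le> j' \<and> j' < k \<and> t < v j'} = {}"
      proof -
        have "v j' = 0" if "n \<le> j'" for j'
          using orbit_beyond[OF assms(2) that] assms(4)[OF that] by simp
        then show ?thesis by auto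
      qed
      then have "rk v k t = rk v n t"
        using rk_interval[OF True, of v t] by (metis add.right_neutral card.empty)
      then show ?thesis using n rk_mono[OF True, of u t] by simp
    next
      case False
      then have "k \<le> n" by simp
      then show ?thesis using n u rk_mono[of k n v t] by simp
    qed
  next
    case False
    then have "{j. j < k \<and> t < u j} = {..<k}" by auto
    then have "rk u k t = k" by (simp add: rk_def)
    then show ?thesis using rk_le by simp
  qed
qed

text \<open>Differences of consecutive tail counts are the multiplicities of the values, and equal
  multisets of values differ by a permutation.\<close>

lemma orbitI_rk:
  assumes rk: "\<And>t. rk w n t = rk lam n t" and beyond: "\<And>j. n \<le> j \<Longrightarrow> w j = lam j"
  shows "w \<in> orbit n lam"
proof -
  have count: "rk f n x + card {j. j < n \<and> f j = x} = (if x = 0 then n else rk f n (x - 1))" for f x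
  proof -
    have "rk f n x + card {j. j < n \<and> f j = x} = card ({j. j < n \<and> x < f j} \<union> {j. j < n \<and> f j = x})"
      unfolding rk_def by (rule card_Un_disjoint[symmetric]) auto
    also have "{j. j < n \<and> x < f j} \<union> {j. j < n \<and> f j = x} = {j. j < n \<and> x \<le> f j}" by auto
    also have "card {j. j < n \<and> x \<le> f j} = (if x = 0 then n else rk f n (x - 1))"
      by (cases x) (auto simp: rk_def Suc_le_eq)
    finally show ?thesis .
  qed
  have "image_mset w (mset_set {..<n}) = image_mset lam (mset_set {..<n})"
  proof (rule multiset_eqI)
    fix x
    have "count (image_mset f (mset_set {..<n})) x = card {j. j < n \<and> f j = x}" for f :: "nat \<Rightarrow> nat"
    proof -
      have "count (image_mset f (mset_set {..<n})) x = card (f -` {x} \<inter> {..<n})"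
        by (simp add: count_image_mset)
      also have "f -` {x} \<inter> {..<n} = {j. j < n \<and> f j = x}" by auto
      finally show ?thesis .
    qed
    moreover have "card {j. j < n \<and> w j = x} = card {j. j < n \<and> lam j = x}"
      using count[of w x] count[of lam x] rk by (metis add_left_cancel)
    ultimately show "count (image_mset w (mset_set {..<n})) x = count (image_mset lam (mset_set {..<n})) x"
      by simp
  qed
  then obtain p where p: "p permutes {..<n}" "\<forall>j\<in>{..<n}. w j = lam (p j)"
    by (rule image_mset_eq_implies_permutes[OF finite_lessThan])
  have "w = lam \<circ> p"
  proof
    fix j
    show "w j = (lam \<circ> p) j"
      using p beyond permutes_not_in[OF p(1), of j] by (cases "j < n") auto
  qed
  then show ?thesis using p(1) by (auto simp: orbit_def)
qed

definition ideal :: "nat \<Rightarrow> (nat \<Rightarrow> nat) \<Rightarrow> (nat \<Rightarrow> nat) set \<Rightarrow> bool" where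
  "ideal n lam I \<longleftrightarrow> I \<subseteq> orbit n lam \<and> (\<forall>u\<in>orbit n lam. \<forall>v\<in>I. bruhat_le u v \<longrightarrow> u \<in> I)"

definition down :: "nat \<Rightarrow> (nat \<Rightarrow> nat) \<Rightarrow> (nat \<Rightarrow> nat) set \<Rightarrow> (nat \<Rightarrow> nat) set" where
  "down n lam X = {u \<in> orbit n lam. \<exists>x\<in>X. bruhat_le u x}"

lemma ideal_down: "ideal n lam (down n lam X)"
  unfolding ideal_def down_def using bruhat_trans by blast

lemma down_ideal: "ideal n lam I \<Longrightarrow> down n lam I = I"
  unfolding ideal_def down_def by (auto intro: bruhat_refl)

lemma down_Un: "down n lam (X \<union> Y) = down n lam X \<union> down n lam Y"
  by (auto simp: down_def)

lemma swp_in_orbit: "Suc i < n \<Longrightarrow> swp i u \<in> orbit n lam \<longleftrightarrow> u \<in> orbit n lam"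
  using orbit_swp[of u n lam i] orbit_swp[of "swp i u" n lam i] by auto

lemma in_swp_image: "u \<in> swp i ` X \<longleftrightarrow> swp i u \<in> X"
  by (metis imageE imageI swp_swp)

text \<open>Both inclusions come from the lifting property, used according to which of
  \<open>x\<close> and \<open>swp i x\<close> is larger.\<close>

lemma down_swp:
  assumes i: "Suc i < n"
  shows "down n lam (X \<union> swp i ` X) = down n lam X \<union> swp i ` down n lam X"
proof (intro equalityI subsetI)
  fix y assume "y \<in> down n lam (X \<union> swp i ` X)"
  then obtain x where y: "y \<in> orbit n lam" and x: "x \<in> X" and or: "bruhat_le y x \<or> bruhat_le y (swp i x)"
    by (auto simp: down_def)
  show "y \<in> down n lam X \<union> swp i ` down n lam X"
  proof (cases "bruhat_le y x")
    case True
    then show ?thesis using x y by (auto simp: down_def)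
  next
    case False
    then have yx: "bruhat_le y (swp i x)" using or by simp
    have "bruhat_le (swp i y) x"
    proof (cases "x (Suc i) \<le> x i")
      case True
      have "\<not> y (Suc i) \<le> y i"
        using bruhat_swp_right[OF yx, of i] False by auto
      then have "swp i y (Suc i) \<le> swp i y i" by (simp add: swp_apply)
      moreover have "bruhat_le (swp i y) (swp i x)"
        using True by (intro bruhat_swp_left yx) (simp add: swp_apply)
      ultimately show ?thesis using bruhat_swp_right[of "swp i y" "swp i x" i] by simp
    next
      case False
      then have "bruhat_le y x"
        using bruhat_trans[OF yx swp_bruhat_le[of x i]] by simp
      then show ?thesis using \<open>\<not> bruhat_le y x\<close> by simp
    qed
    then show ?thesis using x y i by (auto simp: in_swp_image down_def swp_in_orbit)
  qed
next
  fix y assume "y \<in> down n lam X \<union> swp i ` down n lam X"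
  then have or: "y \<in> down n lam X \<or> swp i y \<in> down n lam X" by (simp add: in_swp_image)
  show "y \<in> down n lam (X \<union> swp i ` X)"
  proof (cases "y \<in> down n lam X")
    case True
    then show ?thesis by (auto simp: down_def)
  next
    case False
    then obtain x where x: "x \<in> X" "bruhat_le (swp i y) x" and y: "y \<in> orbit n lam"
      using or i by (auto simp: down_def swp_in_orbit)
    have "bruhat_le y x \<or> bruhat_le y (swp i x)"
    proof (cases "x i \<le> x (Suc i)")
      case True
      then show ?thesis using bruhat_swp_left[OF x(2), of i] by simp
    next
      case False
      have "bruhat_le (swp i y) (swp i x)"
        using False by (intro bruhat_trans[OF x(2)] bruhat_le_swp) simp
      then show ?thesis
        using False bruhat_swp_left[of "swp i y" "swp i x" i] by (simp add: swp_apply)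
    qed
    then show ?thesis using x y by (auto simp: down_def)
  qed
qed

lemma ideal_Un: "ideal n lam I \<Longrightarrow> ideal n lam I' \<Longrightarrow> ideal n lam (I \<union> I')"
  and ideal_Int: "ideal n lam I \<Longrightarrow> ideal n lam I' \<Longrightarrow> ideal n lam (I \<inter> I')"
  unfolding ideal_def by blast+

section \<open>Removing the first column of a weight\<close>

definition dec :: "(nat \<Rightarrow> nat) \<Rightarrow> nat \<Rightarrow> nat" where
  "dec u = (\<lambda>j. u j - 1)"

definition supp :: "(nat \<Rightarrow> nat) \<Rightarrow> nat set" where
  "supp u = {j. 0 < u j}"

lemma dec_orbit: "u \<in> orbit n lam \<Longrightarrow> dec u \<in> orbit n (dec lam)"
  unfolding orbit_def dec_def by (auto simp: comp_def)

lemma dec_swp: "dec (swp i u) = swp i (dec u)"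
  by (auto simp: dec_def swp_apply fun_eq_iff)

lemma supp_swp: "supp (swp i u) = sw i (supp u)"
  by (auto simp: supp_def swp_apply in_sw split: if_splits)

lemma rk_dec: "rk (dec u) k t = rk u k (Suc t)"
  by (simp add: rk_def dec_def less_diff_conv)

lemma bruhat_of_dec:
  assumes "bruhat_le (dec u) (dec v)" "supp u = supp v"
  shows "bruhat_le u v"
  unfolding bruhat_le_def
proof (intro allI)
  fix k t
  show "rk v k t \<le> rk u k t"
  proof (cases t)
    case 0
    have "0 < u j \<longleftrightarrow> 0 < v j" for j using assms(2) unfolding supp_def by blast
    then show ?thesis using 0 by (simp add: rk_def)
  next
    case (Suc t')
    then show ?thesis using assms(1) by (simp add: bruhat_le_def rk_dec[symmetric])
  qed
qed

definition fib :: "(nat \<Rightarrow> nat) set \<Rightarrow> nat set \<Rightarrow> (nat \<Rightarrow> nat) set" where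
  "fib I S = {dec u | u. u \<in> I \<and> supp u = S}"

text \<open>The remainders of members of \<open>I\<close> with first column \<open>S\<close> need
  not form a lower set. The closure is taken because the leading slices at \<open>S\<close> contain
  the whole Demazure module of each remainder.\<close>

definition J :: "nat \<Rightarrow> (nat \<Rightarrow> nat) \<Rightarrow> (nat \<Rightarrow> nat) set \<Rightarrow> nat set \<Rightarrow> (nat \<Rightarrow> nat) set" where
  "J n lam I S = down n (dec lam) (fib I S)"

lemma ideal_J: "ideal n (dec lam) (J n lam I S)"
  unfolding J_def by (rule ideal_down)

lemma J_Un: "J n lam (I \<union> I') S = J n lam I S \<union> J n lam I' S"
proof -
  have "fib (I \<union> I') S = fib I S \<union> fib I' S" by (auto simp: fib_def)
  then show ?thesis by (simp add: J_def down_Un)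
qed

text \<open>The nontrivial inclusion needs a common lower bound: if \<open>y\<close> is below the
  remainders of \<open>u\<close> and \<open>v\<close>, the least weight above \<open>y\<close>
  supported in \<open>S\<close> is below both, and restoring the column \<open>S\<close> gives a
  member of both ideals.\<close>

lemma J_Int:
  assumes I: "ideal n lam I" and I': "ideal n lam I'" and lam: "\<And>j. n \<le> j \<Longrightarrow> lam j = 0"
  shows "J n lam (I \<inter> I') S = J n lam I S \<inter> J n lam I' S"
proof
  show "J n lam (I \<inter> I') S \<subseteq> J n lam I S \<inter> J n lam I' S"
    unfolding J_def down_def fib_def by blast
  show "J n lam I S \<inter> J n lam I' S \<subseteq> J n lam (I \<inter> I') S"
  proof
    fix y assume "y \<in> J n lam I S \<inter> J n lam I' S"
    then obtain u v where y: "y \<in> orbit n (dec lam)"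
      and u: "u \<in> I" "supp u = S" "bruhat_le y (dec u)"
      and v: "v \<in> I'" "supp v = S" "bruhat_le y (dec v)"
      unfolding J_def down_def fib_def by blast
    have uo: "u \<in> orbit n lam" and vo: "v \<in> orbit n lam"
      using I I' u(1) v(1) by (auto simp: ideal_def)
    have Sn: "S \<subseteq> {..<n}"
    proof
      fix j assume "j \<in> S"
      then show "j \<in> {..<n}"
        using orbit_beyond[OF uo, of j] lam[of j] u(2) by (cases "n \<le> j") (auto simp: supp_def)
    qed
    \<comment> \<open>With the identity as labels no later position has a smaller label, so only the
      condition on the support remains.\<close>
    let ?P = "compatible n (dec lam) S id"
    have inP: "dec w \<in> ?P" if "w \<in> orbit n lam" "supp w = S" for w
      using dec_orbit[OF that(1)] that(2) by (auto simp: compatible_def supp_def dec_def)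
    obtain z where z: "z \<in> ?P" "bruhat_le y z" "\<And>x. x \<in> ?P \<Longrightarrow> bruhat_le y x \<Longrightarrow> bruhat_le z x"
      using compatible_closure[OF Sn inj_on_id y] inP[OF uo u(2)] u(3) by blast
    define w where "w = (\<lambda>j. if j \<in> S then Suc (z j) else 0)"
    have zS: "z j = 0" if "j \<notin> S" for j using z(1) that by (auto simp: compatible_def)
    have dw: "dec w = z" using zS by (auto simp: w_def dec_def fun_eq_iff)
    have sw: "supp w = S" by (auto simp: w_def supp_def)
    \<comment> \<open>Threshold 0 counts the support, which is that of \<open>u\<close>; the higher
      thresholds are those of \<open>z\<close> shifted by one.\<close>
    have wo: "w \<in> orbit n lam"
    proof (rule orbitI_rk)
      fix t
      show "rk w n t = rk lam n t"
      proof (cases t)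
        case 0
        have "0 < w j \<longleftrightarrow> 0 < u j" for j using sw u(2) unfolding supp_def by blast
        then have "rk w n 0 = rk u n 0" by (simp add: rk_def)
        then show ?thesis using 0 rk_orbit[OF uo] by simp
      next
        case (Suc t')
        then show ?thesis
          using rk_orbit[of z n "dec lam" t'] z(1) dw by (simp add: compatible_def rk_dec[symmetric])
      qed
    next
      fix j assume "n \<le> j"
      moreover have "j \<notin> S" using Sn \<open>n \<le> j\<close> by auto
      ultimately show "w j = lam j" using lam by (simp add: w_def)
    qed
    have "bruhat_le w u" "bruhat_le w v"
      using z(3)[OF inP[OF uo u(2)] u(3)] z(3)[OF inP[OF vo v(2)] v(3)] dw sw u(2) v(2)
      by (auto intro!: bruhat_of_dec)
    then have "w \<in> I \<inter> I'"
      using I I' u(1) v(1) wo by (auto simp: ideal_def)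
    then show "y \<in> J n lam (I \<inter> I') S"
      unfolding J_def down_def fib_def using y z(2) dw sw by blast
  qed
qed

text \<open>The candidate character, shaped after the leading-term bound. Without columns the value
  is 1 for a nonempty ideal because the empty tensor product is a line.\<close>

primrec N :: "nat \<Rightarrow> nat \<Rightarrow> (nat \<Rightarrow> nat) \<Rightarrow> (nat \<Rightarrow> nat) set \<Rightarrow> (nat \<Rightarrow> int) \<Rightarrow> int" where
  "N n 0 lam I \<mu> = (if I \<noteq> {} \<and> \<mu> = (\<lambda>j. 0) then 1 else 0)"
| "N n (Suc r) lam I \<mu> =
     (\<Sum>S\<in>Pow {..<n}. N n r (dec lam) (J n lam I S) (\<lambda>j. \<mu> j - of_bool (j \<in> S)))"

definition sub :: "nat set \<Rightarrow> (nat \<Rightarrow> int) \<Rightarrow> nat \<Rightarrow> int" where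
  "sub S \<mu> = (\<lambda>j. \<mu> j - of_bool (j \<in> S))"

lemma N_Suc: "N n (Suc r) lam I \<mu> = (\<Sum>S\<in>Pow {..<n}. N n r (dec lam) (J n lam I S) (sub S \<mu>))"
  by (simp add: sub_def)

text \<open>\<open>g\<close> is the image of \<open>f\<close> under the Demazure operator for the simple root \<open>\<alpha>\<close> number \<open>i\<close>: multiply
  \<open>g = (f - e\<^bsup>-\<alpha>\<^esup> s f) / (1 - e\<^bsup>-\<alpha>\<^esup>)\<close> by the denominator and compare coefficients.\<close>

definition demazure_op :: "nat \<Rightarrow> ((nat \<Rightarrow> int) \<Rightarrow> int) \<Rightarrow> ((nat \<Rightarrow> int) \<Rightarrow> int) \<Rightarrow> bool" where
  "demazure_op i f g \<longleftrightarrow> (\<forall>\<mu>. g \<mu> - g (al i 1 \<mu>) = f \<mu> - f (al i (- 1) (swp i \<mu>)))"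

lemma dec_le: "(\<And>j. lam j \<le> Suc r) \<Longrightarrow> dec lam j \<le> r"
  by (metis dec_def diff_Suc_1 diff_le_mono One_nat_def)

lemma orbit_zero:
  assumes "\<And>j. lam j \<le> 0"
  shows "orbit n lam = {lam}"
proof -
  have "u = lam" if "u \<in> orbit n lam" for u
    using orbit_le[OF that assms] assms by (intro ext) (simp add: le_antisym)
  then show ?thesis using orbit_self[of lam n] by blast
qed

text \<open>Summand by summand: \<open>J\<close> respects unions and, for ideals,
  intersections.\<close>

lemma N_modular:
  assumes "ideal n lam I" "ideal n lam I'" "\<And>j. lam j \<le> r" "\<And>j. n \<le> j \<Longrightarrow> lam j = 0"
  shows "N n r lam (I \<union> I') \<mu> + N n r lam (I \<inter> I') \<mu> = N n r lam I \<mu> + N n r lam I' \<mu>"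
  using assms
proof (induction r arbitrary: lam I I' \<mu>)
  case 0
  have "I \<subseteq> {lam}" "I' \<subseteq> {lam}"
    using 0(1,2) orbit_zero[OF 0(3)] by (auto simp: ideal_def)
  then have "I = {} \<or> I = {lam}" "I' = {} \<or> I' = {lam}" by auto
  then show ?case by auto
next
  case (Suc r)
  have "N n r (dec lam) (J n lam (I \<union> I') S) (sub S \<mu>) + N n r (dec lam) (J n lam (I \<inter> I') S) (sub S \<mu>)
      = N n r (dec lam) (J n lam I S) (sub S \<mu>) + N n r (dec lam) (J n lam I' S) (sub S \<mu>)" for S
  proof -
    have "J n lam (I \<inter> I') S = J n lam I S \<inter> J n lam I' S"
      by (rule J_Int) (use Suc.prems in auto)
    moreover have "dec lam j \<le> r" "n \<le> j \<Longrightarrow> dec lam j = 0" for j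
      using dec_le[of lam, OF Suc.prems(3)] Suc.prems(4) by (auto simp: dec_def)
    ultimately show ?thesis
      unfolding J_Un using Suc.IH[OF ideal_J[of n lam I S] ideal_J[of n lam I' S]] by simp
  qed
  then show ?case
    unfolding N_Suc sum.distrib[symmetric] by simp
qed

lemma fib_Un_swp_image:
  assumes "i \<in> S \<longleftrightarrow> Suc i \<in> S"
  shows "fib (I \<union> swp i ` I) S = fib I S \<union> swp i ` fib I S"
proof -
  have "sw i S = S" using assms by (intro Set.set_eqI) (simp add: in_sw)
  moreover have "sw i U = S \<longleftrightarrow> U = sw i S" for U by (metis sw_sw)
  ultimately have sw: "sw i U = S \<longleftrightarrow> U = S" for U by simp
  have "fib (swp i ` I) S = swp i ` fib I S"
  proof (intro equalityI subsetI)
    fix y assume "y \<in> fib (swp i ` I) S"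
    then obtain u where u: "u \<in> I" "y = dec (swp i u)" "supp (swp i u) = S" by (auto simp: fib_def)
    then have "dec u \<in> fib I S" using sw unfolding fib_def supp_swp by blast
    then show "y \<in> swp i ` fib I S" using u(2) by (simp add: dec_swp)
  next
    fix y assume "y \<in> swp i ` fib I S"
    then obtain u where u: "u \<in> I" "y = swp i (dec u)" "supp u = S" by (auto simp: fib_def)
    then have "y = dec (swp i u)" "supp (swp i u) = S" using sw by (simp_all add: dec_swp supp_swp)
    then show "y \<in> fib (swp i ` I) S" using u(1) unfolding fib_def by blast
  qed
  moreover have "fib (I \<union> swp i ` I) S = fib I S \<union> fib (swp i ` I) S" by (auto simp: fib_def)
  ultimately show ?thesis by simp
qed

lemma J_neutral:
  assumes "i \<in> S \<longleftrightarrow> Suc i \<in> S" "Suc i < n"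
  shows "J n lam (I \<union> swp i ` I) S = J n lam I S \<union> swp i ` J n lam I S"
  unfolding J_def fib_Un_swp_image[OF assms(1)] by (rule down_swp[OF assms(2)])

lemma ideal_swp:
  assumes "ideal n lam I" "Suc i < n" "u \<in> I" "u i \<le> u (Suc i)"
  shows "swp i u \<in> I"
proof -
  have "swp i u \<in> orbit n lam" using assms(1-3) swp_in_orbit by (auto simp: ideal_def)
  then show ?thesis using assms(1,3) swp_bruhat_le[OF assms(4)] unfolding ideal_def by blast
qed

lemma supp_zero: "supp u = S \<Longrightarrow> j \<notin> S \<Longrightarrow> u j = 0"
  unfolding supp_def by (metis gr0I mem_Collect_eq)

lemma fib_zero: "x \<in> fib I S \<Longrightarrow> j \<notin> S \<Longrightarrow> x j = 0"
proof -
  assume "x \<in> fib I S" "j \<notin> S"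
  then obtain u where "x = dec u" "supp u = S" unfolding fib_def by blast
  then show "x j = 0" using supp_zero[of u S j] \<open>j \<notin> S\<close> by (simp add: dec_def)
qed

lemma down_Un_absorb:
  assumes "\<And>x. x \<in> X \<Longrightarrow> \<exists>y\<in>Y. bruhat_le x y"
  shows "down n lam (X \<union> Y) = down n lam Y"
  unfolding down_def using assms bruhat_trans by blast

text \<open>Lower sets absorb reflections in one direction, and a first column with \<open>i\<close>
  but not \<open>Suc i\<close> decides which one. These are the ingredients for a pair of columns
  exchanged by the reflection.\<close>

lemma J_upper:
  assumes "i \<in> S" "Suc i \<notin> S" "Suc i < n" "ideal n lam I"
  shows "J n lam (I \<union> swp i ` I) S = J n lam I S"
    and "J n lam (I \<union> swp i ` I) (sw i S) = J n lam I S \<union> swp i ` J n lam I S"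
    and "J n lam I (sw i S) \<union> swp i ` J n lam I (sw i S) = J n lam I (sw i S)"
proof -
  have up: "u \<in> I" if u: "swp i u \<in> I" "supp u = S" for u
  proof -
    have "u (Suc i) = 0" using u(2) assms(2) by (rule supp_zero)
    then have "swp i (swp i u) \<in> I"
      by (intro ideal_swp[OF assms(4,3) u(1)]) (simp add: swp_apply)
    then show ?thesis by simp
  qed
  have "fib (I \<union> swp i ` I) S = fib I S"
  proof -
    have "u \<in> I \<union> swp i ` I \<and> supp u = S \<longleftrightarrow> u \<in> I \<and> supp u = S" for u
      using up[of u] unfolding Un_iff in_swp_image by blast
    then show ?thesis unfolding fib_def by simp
  qed
  then show "J n lam (I \<union> swp i ` I) S = J n lam I S"
    by (simp add: J_def)
  have "fib (I \<union> swp i ` I) (sw i S) = swp i ` fib I S"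
  proof (intro equalityI subsetI)
    fix y assume "y \<in> fib (I \<union> swp i ` I) (sw i S)"
    then obtain u where u: "y = dec u" "u \<in> I \<or> swp i u \<in> I" "supp u = sw i S"
      unfolding fib_def Un_iff in_swp_image by blast
    have S: "supp (swp i u) = S" using u(3) by (simp add: supp_swp)
    have "swp i u \<in> I"
    proof (cases "swp i u \<in> I")
      case False
      then have "u \<in> I" using u(2) by blast
      have "u i = 0" using supp_zero[OF S assms(2)] by (simp add: swp_apply)
      then show ?thesis using \<open>u \<in> I\<close> by (intro ideal_swp[OF assms(4,3)]) simp_all
    qed
    then have "dec (swp i u) \<in> fib I S" using S unfolding fib_def by blast
    then show "y \<in> swp i ` fib I S" using u(1) by (simp add: in_swp_image dec_swp)
  next
    fix y assume "y \<in> swp i ` fib I S"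
    then obtain u where u: "u \<in> I" "supp u = S" "y = swp i (dec u)" unfolding fib_def by blast
    then have "y = dec (swp i u)" "swp i u \<in> I \<union> swp i ` I" "supp (swp i u) = sw i S"
      by (simp_all add: dec_swp supp_swp)
    then show "y \<in> fib (I \<union> swp i ` I) (sw i S)" unfolding fib_def by blast
  qed
  \<comment> \<open>Remainders in \<open>fib I S\<close> vanish at \<open>Suc i\<close>, so each
    lies below its reflection and can be added without changing the lower closure.\<close>
  moreover have "down n (dec lam) (fib I S \<union> swp i ` fib I S) = down n (dec lam) (swp i ` fib I S)"
  proof (rule down_Un_absorb)
    fix x assume x: "x \<in> fib I S"
    have "bruhat_le x (swp i x)" using fib_zero[OF x assms(2)] by (intro bruhat_le_swp) simp
    then show "\<exists>y\<in>swp i ` fib I S. bruhat_le x y" using x by blast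
  qed
  ultimately show "J n lam (I \<union> swp i ` I) (sw i S) = J n lam I S \<union> swp i ` J n lam I S"
    unfolding J_def down_swp[OF assms(3), symmetric] by simp
  have "down n (dec lam) (swp i ` fib I (sw i S) \<union> fib I (sw i S)) = down n (dec lam) (fib I (sw i S))"
  proof (rule down_Un_absorb)
    fix y assume "y \<in> swp i ` fib I (sw i S)"
    then obtain x where x: "y = swp i x" "x \<in> fib I (sw i S)" by blast
    have "i \<notin> sw i S" using assms(2) by (simp add: in_sw)
    from fib_zero[OF x(2) this] have "bruhat_le y x"
      unfolding x(1) by (intro swp_bruhat_le) simp
    then show "\<exists>x\<in>fib I (sw i S). bruhat_le y x" using x(2) by blast
  qed
  then have "down n (dec lam) (fib I (sw i S) \<union> swp i ` fib I (sw i S)) = down n (dec lam) (fib I (sw i S))"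
    by (simp only: Un_commute)
  then show "J n lam I (sw i S) \<union> swp i ` J n lam I (sw i S) = J n lam I (sw i S)"
    unfolding J_def down_swp[OF assms(3), symmetric] .
qed

lemma sum_Pow_split:
  fixes h :: "nat set \<Rightarrow> int"
  assumes i: "Suc i < n"
  shows "(\<Sum>S\<in>Pow {..<n}. h S) = (\<Sum>S\<in>{S \<in> Pow {..<n}. i \<in> S \<longleftrightarrow> Suc i \<in> S}. h S)
     + (\<Sum>S\<in>{S \<in> Pow {..<n}. i \<in> S \<and> Suc i \<notin> S}. h S + h (sw i S))"
proof -
  let ?C = "{S \<in> Pow {..<n}. i \<in> S \<longleftrightarrow> Suc i \<in> S}" and ?A = "{S \<in> Pow {..<n}. i \<in> S \<and> Suc i \<notin> S}"
  let ?B = "{S \<in> Pow {..<n}. i \<notin> S \<and> Suc i \<in> S}"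
  have Pn: "sw i S \<subseteq> {..<n}" if "S \<subseteq> {..<n}" for S
  proof
    fix j assume "j \<in> sw i S"
    then show "j \<in> {..<n}" using that i by (auto simp: in_sw split: if_splits)
  qed
  have "sw i ` ?A = ?B"
  proof (intro equalityI subsetI)
    fix S assume "S \<in> ?B"
    then have "sw i S \<in> ?A" using Pn by (simp add: in_sw)
    then have "sw i (sw i S) \<in> sw i ` ?A" by (rule imageI)
    then show "S \<in> sw i ` ?A" by simp
  next
    fix S assume "S \<in> sw i ` ?A"
    then obtain U where "S = sw i U" "U \<subseteq> {..<n}" "i \<in> U" "Suc i \<notin> U" by blast
    then show "S \<in> ?B" using Pn[of U] by (simp add: in_sw)
  qed
  then have "(\<Sum>S\<in>?B. h S) = (\<Sum>S\<in>sw i ` ?A. h S)" by simp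
  also have "\<dots> = (\<Sum>S\<in>?A. h (sw i S))"
  proof (rule sum.reindex_cong[OF _ refl refl])
    show "inj_on (sw i) ?A"
    proof (rule inj_onI)
      fix S U assume "sw i S = sw i U"
      then have "sw i (sw i S) = sw i (sw i U)" by (rule arg_cong)
      then show "S = U" by simp
    qed
  qed
  finally have B: "(\<Sum>S\<in>?B. h S) = (\<Sum>S\<in>?A. h (sw i S))" .
  have "Pow {..<n} = ?C \<union> (?A \<union> ?B)" by auto
  then have "(\<Sum>S\<in>Pow {..<n}. h S) = (\<Sum>S\<in>?C \<union> (?A \<union> ?B). h S)" by (rule arg_cong)
  also have "\<dots> = (\<Sum>S\<in>?C. h S) + (\<Sum>S\<in>?A \<union> ?B. h S)"
    by (rule sum.union_disjoint) auto
  also have "(\<Sum>S\<in>?A \<union> ?B. h S) = (\<Sum>S\<in>?A. h S) + (\<Sum>S\<in>?B. h S)"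
    by (rule sum.union_disjoint) auto
  finally show ?thesis unfolding sum.distrib using B by linarith
qed

lemma sub_al: "sub S (al i k \<mu>) = al i k (sub S \<mu>)"
  by (auto simp: sub_def al_def)

lemma sub_swp: "sub (sw i S) (swp i \<mu>) = swp i (sub S \<mu>)"
  by (auto simp: sub_def swp_apply in_sw fun_eq_iff)

lemma sub_sw: "i \<in> S \<Longrightarrow> Suc i \<notin> S \<Longrightarrow> sub (sw i S) \<mu> = al i 1 (sub S \<mu>)"
  by (auto simp: sub_def al_def in_sw fun_eq_iff)

lemma swp_al_comm: "swp i (al i k \<mu>) = al i (- k) (swp i \<mu>)"
  by (auto simp: al_def swp_apply fun_eq_iff)

text \<open>At \<open>\<mu>\<close> minus the root, the defining relation compares exactly
  \<open>g \<mu>\<close> with the value at the reflected weight.\<close>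

lemma demazure_op_self: "demazure_op i g g \<Longrightarrow> g (swp i \<mu>) = g \<mu>"
  unfolding demazure_op_def
proof (drule spec[of _ "al i (- 1) \<mu>"])
  assume "g (al i (- 1) \<mu>) - g (al i 1 (al i (- 1) \<mu>))
    = g (al i (- 1) \<mu>) - g (al i (- 1) (swp i (al i (- 1) \<mu>)))"
  then show "g (swp i \<mu>) = g \<mu>" by (simp add: swp_al_comm)
qed

lemma swp_zero: "swp i (\<lambda>j. 0) = (\<lambda>j. 0)"
  by (simp add: swp_def comp_def)

text \<open>A twisted Leibniz rule over the first columns. A reflection-stable column carries an
  invariant monomial, so the induction hypothesis applies directly. In a pair \<open>S\<close>,
  \<open>sw i S\<close> the old summand at \<open>sw i S\<close> is an invariant function times a
  monomial of coroot value -1 and is killed; the old summand at \<open>S\<close> survives there and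
  contributes its Demazure image at \<open>sw i S\<close>.\<close>

lemma N_demazure_op:
  assumes "ideal n lam I" "Suc i < n" "\<And>j. lam j \<le> r"
  shows "demazure_op i (N n r lam I) (N n r lam (I \<union> swp i ` I))"
  using assms
proof (induction r arbitrary: lam I)
  case 0
  have "(al i 1 \<mu> = (\<lambda>j. 0)) \<longleftrightarrow> (al i (- 1) (swp i \<mu>) = (\<lambda>j. 0))" for \<mu>
  proof -
    have "al i (- 1) (swp i \<mu>) = swp i (al i 1 \<mu>)" by (simp add: swp_al_comm)
    moreover have "swp i \<nu> = (\<lambda>j. 0) \<longleftrightarrow> \<nu> = (\<lambda>j. 0)" for \<nu> :: "nat \<Rightarrow> int"
      using swp_swp[of i \<nu>] by (metis swp_zero)
    ultimately show ?thesis by simp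
  qed
  then show ?case by (auto simp: demazure_op_def)
next
  case (Suc r)
  have op: "demazure_op i (N n r (dec lam) (J n lam I S)) (N n r (dec lam) (J n lam I S \<union> swp i ` J n lam I S))"
    for S
    by (rule Suc.IH[OF ideal_J Suc.prems(2) dec_le[OF Suc.prems(3)]])
  note IH = op[unfolded demazure_op_def, rule_format]
  let ?I = "I \<union> swp i ` I"
  show ?case
    unfolding demazure_op_def
  proof
    fix \<mu>
    let ?\<alpha> = "al i 1 \<mu>" and ?\<beta> = "al i (- 1) (swp i \<mu>)"
    let ?F = "\<lambda>S \<mu>. N n r (dec lam) (J n lam I S) (sub S \<mu>)"
    let ?G = "\<lambda>S \<mu>. N n r (dec lam) (J n lam ?I S) (sub S \<mu>)"
    have C: "?G S \<mu> - ?G S ?\<alpha> = ?F S \<mu> - ?F S ?\<beta>" if S: "i \<in> S \<longleftrightarrow> Suc i \<in> S" for S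
    proof -
      have "sw i S = S" using S by (intro Set.set_eqI) (simp add: in_sw)
      then have "sub S (swp i \<mu>) = swp i (sub S \<mu>)" using sub_swp[of i S \<mu>] by simp
      then show ?thesis
        unfolding J_neutral[OF S Suc.prems(2)] sub_al using IH[of S "sub S \<mu>"] by simp
    qed
    have A: "(?G S \<mu> + ?G (sw i S) \<mu>) - (?G S ?\<alpha> + ?G (sw i S) ?\<alpha>)
           = (?F S \<mu> + ?F (sw i S) \<mu>) - (?F S ?\<beta> + ?F (sw i S) ?\<beta>)"
      if S: "i \<in> S" "Suc i \<notin> S" for S
    proof -
      note JU = J_upper[OF S Suc.prems(2,1)]
      have "demazure_op i (N n r (dec lam) (J n lam I (sw i S))) (N n r (dec lam) (J n lam I (sw i S)))"
        using op[of "sw i S"] unfolding JU(3) .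
      from demazure_op_self[OF this, of "sub (sw i S) \<mu>"]
      \<comment> \<open>The operator kills the summand at the reflected column: its values at
        \<open>\<mu>\<close> and \<open>?\<beta>\<close> cancel.\<close>
      have g: "?F (sw i S) \<mu> = ?F (sw i S) ?\<beta>"
        using sub_swp[of i "sw i S" \<mu>] sub_sw[OF S, of ?\<beta>] by (simp add: sub_al)
      have "swp i (sub (sw i S) \<mu>) = sub S (swp i \<mu>)" using sub_swp[of i "sw i S" \<mu>] by simp
      then have f: "?G (sw i S) \<mu> - ?G (sw i S) ?\<alpha> = ?F S ?\<alpha> - ?F S ?\<beta>"
        unfolding JU(2) sub_al using IH[of S "sub (sw i S) \<mu>"] sub_sw[OF S, of \<mu>] by simp
      have "?G S \<mu> = ?F S \<mu>" "?G S ?\<alpha> = ?F S ?\<alpha>" unfolding JU(1) by simp_all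
      with g f show ?thesis by linarith
    qed
    show "N n (Suc r) lam ?I \<mu> - N n (Suc r) lam ?I ?\<alpha> = N n (Suc r) lam I \<mu> - N n (Suc r) lam I ?\<beta>"
    proof -
      let ?C = "{S \<in> Pow {..<n}. i \<in> S \<longleftrightarrow> Suc i \<in> S}" and ?A = "{S \<in> Pow {..<n}. i \<in> S \<and> Suc i \<notin> S}"
      have "(\<Sum>S\<in>?C. ?G S \<mu> - ?G S ?\<alpha>) = (\<Sum>S\<in>?C. ?F S \<mu> - ?F S ?\<beta>)"
        by (rule sum.cong[OF refl]) (use C in blast)
      moreover have "(\<Sum>S\<in>?A. (?G S \<mu> + ?G (sw i S) \<mu>) - (?G S ?\<alpha> + ?G (sw i S) ?\<alpha>))
        = (\<Sum>S\<in>?A. (?F S \<mu> + ?F (sw i S) \<mu>) - (?F S ?\<beta> + ?F (sw i S) ?\<beta>))"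
        by (rule sum.cong[OF refl]) (use A in blast)
      ultimately show ?thesis
        unfolding N_Suc sum_Pow_split[OF Suc.prems(2)] sum_subtractf by linarith
    qed
  qed
qed

section \<open>Sums of Demazure modules\<close>

lemma sum_swp_less:
  assumes "u i < u (Suc i)" "Suc i < n"
  shows "(\<Sum>j<n. j * swp i u j) < (\<Sum>j<n. j * (u j :: nat))"
  unfolding swp_def transpose_commute[of i]
  by (rule sum_transpose_less) (use assms in simp_all)

lemma not_dominantE:
  assumes "\<not> dominant n u"
  obtains i where "Suc i < n" "u i < u (Suc i)"
  using assms by (auto simp: dominant_def not_le)

text \<open>Says that \<open>r\<close> tensor factors over an \<open>n\<close>-dimensional space
  have room for the key of the weight.\<close>

definition bdd :: "nat \<Rightarrow> nat \<Rightarrow> (nat \<Rightarrow> nat) \<Rightarrow> bool" where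
  "bdd n r u \<longleftrightarrow> (\<forall>j. u j \<le> r) \<and> (\<forall>j\<ge>n. u j = 0)"

lemma bddD: "bdd n r u \<Longrightarrow> u j \<le> r" "bdd n r u \<Longrightarrow> n \<le> j \<Longrightarrow> u j = 0"
  by (auto simp: bdd_def)

lemma bdd_dec: "bdd n (Suc r) u \<Longrightarrow> bdd n r (dec u)"
  by (simp add: bdd_def dec_def le_diff_conv)

lemma orbit_bounds:
  assumes "bdd n r lam" "u \<in> orbit n lam"
  shows "u j \<le> r" "n \<le> j \<Longrightarrow> u j = 0"
  using orbit_le[of u n lam r j] orbit_beyond[of u n lam j] bddD[OF assms(1), of j] assms bddD(1)[OF assms(1)]
  by auto

text \<open>Induction along reflections that lower \<open>v\<close>. If \<open>u\<close> does not
  increase at \<open>i\<close>, it is already below \<open>swp i v\<close>. Otherwise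
  \<open>swp i u\<close> is, and the extremal vector of \<open>u\<close> is obtained from that of
  \<open>swp i u\<close> by a power of \<open>ff i\<close>, under which the module of
  \<open>v\<close> is stable.\<close>

lemma Dem_mono:
  assumes lam: "bdd n r lam"
    and uv: "u \<in> orbit n lam" "v \<in> orbit n lam" "bruhat_le u v"
  shows "Dem n r u \<subseteq> (Dem n r v :: (_ \<Rightarrow> 'k::field_char_0) set)"
  using uv
proof (induction "\<Sum>j<n. j * v j" arbitrary: u v rule: less_induct)
  case less
  note bound = orbit_bounds[OF lam]
  show ?case
  proof (cases "dominant n v")
    case True
    then have "u = v"
      using dominant_least[OF less.prems(2,1) True bddD(2)[OF lam]] less.prems(3) bruhat_antisym by blast
    then show ?thesis by simp
  next
    case False
    then obtain i where i: "Suc i < n" "v i < v (Suc i)" by (rule not_dominantE)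
    let ?v = "swp i v"
    have v': "?v \<in> orbit n lam" using less.prems(2) i(1) by (rule orbit_swp)
    have le': "?v (Suc i) \<le> ?v i" using i(2) by (simp add: swp_apply)
    have sub: "Dem n r ?v \<subseteq> (Dem n r v :: (_ \<Rightarrow> 'k) set)"
      using Dem_subset_swp[OF le' bound(1)[OF v'] bound(2)[OF v'] i(1)] by simp
    note IH = less.hyps[OF sum_swp_less[of v, OF i(2,1)] _ v']
    show ?thesis
    proof (cases "u (Suc i) \<le> u i")
      case True
      have "bruhat_le u ?v" by (rule bruhat_swp_right[OF less.prems(3) True])
      then show ?thesis using IH[OF less.prems(1)] sub by blast
    next
      case False
      let ?u = "swp i u"
      have u': "?u \<in> orbit n lam" using less.prems(1) i(1) by (rule orbit_swp)
      have leu: "?u (Suc i) \<le> ?u i" using False by (simp add: swp_apply)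
      have "u i \<le> u (Suc i)" using False by simp
      then have "bruhat_le ?u v" by (rule bruhat_trans[OF swp_bruhat_le less.prems(3)])
      then have "bruhat_le ?u ?v" using leu by (rule bruhat_swp_right)
      then have D: "Dem n r ?u \<subseteq> (Dem n r v :: (_ \<Rightarrow> 'k) set)" using IH[OF u'] sub by blast
      show ?thesis
      proof (rule Dem_minimal)
        obtain c where c: "c \<noteq> 0"
          "(ff i ^^ (?u i - ?u (Suc i))) (evec r ?u) = scl c (evec r (swp i ?u) :: _ \<Rightarrow> 'k)"
          using extremal_reflection(1)[OF leu bound(1)[OF u'] bound(2)[OF u'] i(1)] by blast
        have "(evec r ?u :: _ \<Rightarrow> 'k) \<in> Dem n r v" using D evec_Dem by blast
        then have "scl c (evec r (swp i ?u) :: _ \<Rightarrow> 'k) \<in> Dem n r v"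
          unfolding c(2)[symmetric] using ff_Dem[OF less_imp_le[OF i(2)] bound(1)[OF less.prems(2)]]
          by (intro pow_stable[of "Dem n r v"])
        then have "scl (inverse c) (scl c (evec r (swp i ?u) :: _ \<Rightarrow> 'k)) \<in> Dem n r v"
          by (rule T.subspace_scale[OF subspace_Dem])
        then show "(evec r u :: _ \<Rightarrow> 'k) \<in> Dem n r v" using c(1) by simp
      qed (auto intro: ee_Dem)
    qed
  qed
qed

definition DI :: "nat \<Rightarrow> nat \<Rightarrow> (nat \<Rightarrow> nat) set \<Rightarrow> (nat set list \<Rightarrow> 'k::field) set" where
  "DI n r I = T.span (\<Union>u\<in>I. Dem n r u)"

lemma subspace_DI [simp]: "T.subspace (DI n r I)"
  by (simp add: DI_def)

lemma Dem_DI: "u \<in> I \<Longrightarrow> Dem n r u \<subseteq> DI n r I"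
  unfolding DI_def using T.span_superset by blast

lemma DI_minimal: "T.subspace Z \<Longrightarrow> (\<And>u. u \<in> I \<Longrightarrow> Dem n r u \<subseteq> Z) \<Longrightarrow> DI n r I \<subseteq> Z"
  unfolding DI_def by (rule T.span_minimal) auto

lemma DI_mono: "I \<subseteq> I' \<Longrightarrow> DI n r I \<subseteq> DI n r I'"
  unfolding DI_def by (rule T.span_mono) auto

lemma DI_Un: "DI n r (I \<union> I') = T.span (DI n r I \<union> DI n r I')"
proof
  show "DI n r (I \<union> I') \<subseteq> T.span (DI n r I \<union> DI n r I')"
  proof (rule DI_minimal)
    fix u assume "u \<in> I \<union> I'"
    then have "Dem n r u \<subseteq> DI n r I \<union> DI n r I'" using Dem_DI by blast
    then show "Dem n r u \<subseteq> T.span (DI n r I \<union> DI n r I')" using T.span_superset by blast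
  qed simp
  show "T.span (DI n r I \<union> DI n r I') \<subseteq> DI n r (I \<union> I')"
    using DI_mono[of I "I \<union> I'" n r] DI_mono[of I' "I \<union> I'" n r]
    by (intro T.span_minimal Un_least subspace_DI) simp_all
qed

lemma ee_DI: "Suc i < n \<Longrightarrow> x \<in> DI n r I \<Longrightarrow> ee i x \<in> DI n r I"
  unfolding DI_def
proof (rule ee_span_stable)
  fix g assume "Suc i < n" "g \<in> (\<Union>u\<in>I. Dem n r u)"
  then show "ee i g \<in> T.span (\<Union>u\<in>I. Dem n r u)"
    using ee_Dem by (intro T.span_base) blast
qed

lemma graded_Un:
  assumes "\<And>U. U \<in> \<U> \<Longrightarrow> graded U"
  shows "graded (T.span (\<Union>\<U>))"
  unfolding graded_def
proof (intro ballI allI)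
  fix x \<mu> assume "x \<in> T.span (\<Union>\<U>)"
  then show "rs \<mu> x \<in> T.span (\<Union>\<U>)"
  proof (induction rule: T.span_induct)
    case base
    then show ?case
      by (rule T.subspaceI) (auto simp: rs.zero rs.add rs.scale T.span_zero T.span_add T.span_scale)
  next
    case (step g)
    then show ?case using assms unfolding graded_def by (intro T.span_base) blast
  qed
qed

context
  fixes n r :: nat and lam :: "nat \<Rightarrow> nat"
  assumes lam: "bdd n r lam"
begin

lemma DI_Supp: "I \<subseteq> orbit n lam \<Longrightarrow> DI n r I \<subseteq> Supp n r"
proof (rule DI_minimal[OF subspace_Supp])
  fix u assume "I \<subseteq> orbit n lam" "u \<in> I"
  then have "u \<in> orbit n lam" by blast
  then show "Dem n r u \<subseteq> Supp n r" by (intro Dem_Supp orbit_bounds(2)[OF lam])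
qed

lemma graded_DI: "I \<subseteq> orbit n lam \<Longrightarrow> graded (DI n r I :: (_ \<Rightarrow> 'a::field) set)"
proof -
  assume I: "I \<subseteq> orbit n lam"
  have "graded (Dem n r u :: (_ \<Rightarrow> 'a) set)" if "u \<in> I" for u
    by (rule graded_Dem, rule orbit_bounds(1)[OF lam], rule subsetD[OF I that])
  then have "graded U" if "U \<in> Dem n r ` I" for U :: "(_ \<Rightarrow> 'a) set"
    using that by fast
  then show ?thesis
    unfolding DI_def by (rule graded_Un)
qed

lemma DI_down_single: "v \<in> orbit n lam \<Longrightarrow> DI n r (down n lam {v}) = (Dem n r v :: (_ \<Rightarrow> 'k::field_char_0) set)"
proof
  assume v: "v \<in> orbit n lam"
  show "DI n r (down n lam {v}) \<subseteq> (Dem n r v :: (_ \<Rightarrow> 'k) set)"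
  proof (rule DI_minimal[OF subspace_Dem])
    fix u assume "u \<in> down n lam {v}"
    then have "u \<in> orbit n lam" "bruhat_le u v" by (simp_all add: down_def)
    then show "Dem n r u \<subseteq> (Dem n r v :: (_ \<Rightarrow> 'k) set)" by (intro Dem_mono[OF lam _ v])
  qed
  show "(Dem n r v :: (_ \<Rightarrow> 'k) set) \<subseteq> DI n r (down n lam {v})"
    by (rule Dem_DI) (simp add: v down_def)
qed

end

lemma ch_nonneg [simp]: "0 \<le> ch U \<mu>"
  by (simp add: ch_def)

lemma ch_mono:
  assumes "U \<subseteq> P" "P \<subseteq> Supp n r"
  shows "ch U \<mu> \<le> ch P \<mu>"
proof -
  have "P \<inter> Wt \<mu> \<subseteq> T.span (delta ` idx n r)" using assms(2) Supp_span by blast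
  then show ?thesis
    unfolding ch_def using assms(1)
    by (intro of_nat_mono T.dim_mono_fd[OF _ finite_Supp_basis]) auto
qed

lemma ch_modular:
  assumes A: "T.subspace A" "A \<subseteq> Supp n r" "graded A" and B: "T.subspace B" "B \<subseteq> Supp n r" "graded B"
  shows "ch (T.span (A \<union> B)) \<mu> + ch (A \<inter> B) \<mu> = ch A \<mu> + ch B \<mu>"
proof -
  let ?A = "A \<inter> Wt \<mu>" and ?B = "B \<inter> Wt \<mu>"
  have sub: "T.subspace ?A" "T.subspace ?B"
    using A(1) B(1) subspace_Wt by (auto intro: T.subspace_inter)
  have fd: "?A \<subseteq> T.span (delta ` idx n r)" "?B \<subseteq> T.span (delta ` idx n r)"
    using A(2) B(2) Supp_span by blast+
  have "T.span (A \<union> B) \<inter> Wt \<mu> = T.span (?A \<union> ?B)"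
  proof
    show "T.span (?A \<union> ?B) \<subseteq> T.span (A \<union> B) \<inter> Wt \<mu>"
      by (intro Int_greatest T.span_mono T.span_minimal subspace_Wt) auto
    show "T.span (A \<union> B) \<inter> Wt \<mu> \<subseteq> T.span (?A \<union> ?B)"
    proof
      fix x assume x: "x \<in> T.span (A \<union> B) \<inter> Wt \<mu>"
      then obtain a b where "x = a + b" "a \<in> T.span A" "b \<in> T.span B"
        unfolding T.span_Un by blast
      moreover have "T.span A = A" "T.span B = B"
        using A(1) B(1) by (simp_all only: T.span_eq_iff)
      ultimately have ab: "x = a + b" "a \<in> A" "b \<in> B" by auto
      have "x = rs \<mu> a + rs \<mu> b"
        using rs_id[of x \<mu>] x ab(1) by (simp add: rs.add)
      moreover have "rs \<mu> a \<in> ?A" "rs \<mu> b \<in> ?B"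
        using A(3) B(3) ab(2,3) by (auto simp: graded_def)
      ultimately show "x \<in> T.span (?A \<union> ?B)"
        by (simp only:) (intro T.span_add T.span_base UnI1 UnI2)
    qed
  qed
  moreover have "?A \<inter> ?B = A \<inter> B \<inter> Wt \<mu>" by blast
  ultimately show ?thesis
    using T.dim_modular_fd[OF sub(1) fd(1) sub(2) fd(2) finite_Supp_basis] by (simp add: ch_def)
qed

lemma graded_Int: "graded A \<Longrightarrow> graded B \<Longrightarrow> graded (A \<inter> B)"
  by (auto simp: graded_def)

text \<open>A vector of \<open>Supp n r\<close> is the finite sum of its weight components, so
  equality of nested graded spaces can be tested on the dimensions of weight spaces.\<close>

lemma graded_eqI:
  assumes AB: "A \<subseteq> B" and A: "T.subspace A" and B: "B \<subseteq> Supp n r" "graded B"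
    and le: "\<And>\<mu>. ch B \<mu> \<le> ch A \<mu>"
  shows "A = B"
proof
  show "B \<subseteq> A"
  proof
    fix x assume x: "x \<in> B"
    have "A \<inter> Wt \<mu> = B \<inter> Wt \<mu>" for \<mu>
    proof (rule T.dim_eq_fd[OF _ finite_Supp_basis])
      show "B \<inter> Wt \<mu> \<subseteq> T.span (delta ` idx n r)" using B(1) Supp_span by blast
      show "T.subspace (A \<inter> Wt \<mu>)" using A subspace_Wt by (rule T.subspace_inter)
      show "T.dim (B \<inter> Wt \<mu>) \<le> T.dim (A \<inter> Wt \<mu>)" using le[of \<mu>] by (simp add: ch_def)
    qed (use AB in blast)
    moreover have "rs \<mu> x \<in> B \<inter> Wt \<mu>" for \<mu> using x B(2) by (simp add: graded_def)
    ultimately have rsA: "rs \<mu> x \<in> A" for \<mu> by blast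
    have "x = (\<Sum>\<mu>\<in>wt ` idx n r. rs \<mu> x)"
    proof
      fix t
      have "(\<Sum>\<mu>\<in>wt ` idx n r. rs \<mu> x) t = (\<Sum>\<mu>\<in>wt ` idx n r. if wt t = \<mu> then x t else 0)"
        by (simp add: sum_fun_apply rs_def)
      also have "\<dots> = (if wt t \<in> wt ` idx n r then x t else 0)"
        using finite_idx[of n r] by (simp add: sum.delta)
      also have "\<dots> = x t" using x B(1) by (auto simp: Supp_def)
      finally show "x t = (\<Sum>\<mu>\<in>wt ` idx n r. rs \<mu> x) t" by simp
    qed
    also have "\<dots> \<in> A" by (rule T.subspace_sum[OF A rsA])
    finally show "x \<in> A" .
  qed
qed (rule AB)

section \<open>Leading terms in the first tensor factor\<close>

text \<open>Ranks first tensor factors; a raising operator replaces \<open>Suc i\<close> by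
  \<open>i\<close> and strictly lowers the rank of the factor it changes.\<close>

definition ht :: "nat \<Rightarrow> nat set \<Rightarrow> nat" where
  "ht n S = (\<Sum>j<n. j * of_bool (j \<in> S))"

lemma ht_sw:
  assumes "i \<in> S" "Suc i \<notin> S" "Suc i < n"
  shows "ht n S < ht n (sw i S)"
proof -
  have "swp i (\<lambda>j. of_bool (j \<in> sw i S)) = (\<lambda>j. of_bool (j \<in> S) :: nat)"
    by (rule ext) (simp add: swp_apply in_sw)
  then show ?thesis
    using sum_swp_less[of "\<lambda>j. of_bool (j \<in> sw i S)" i n] assms by (simp add: ht_def in_sw)
qed

text \<open>The slice at \<open>S\<close> itself may vanish; this makes the vectors with the
  property a subspace.\<close>

definition leading :: "nat \<Rightarrow> nat set \<Rightarrow> (nat set list \<Rightarrow> 'k::field) \<Rightarrow> bool" where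
  "leading n S x \<longleftrightarrow> (\<forall>S'. S' \<noteq> S \<longrightarrow> slice S' x \<noteq> 0 \<longrightarrow> ht n S' < ht n S)"

lemma linear_slice: "Vector_Spaces.linear scl scl (slice S)"
  by (intro Vector_Spaces.linear.intro module_hom.intro T.vector_space_axioms T.module_axioms
      module_hom_axioms.intro) (auto simp: fun_eq_iff slice_def scl_apply)

interpretation slice: Vector_Spaces.linear scl scl "slice S" for S by (rule linear_slice)

lemma slice_Supp: "x \<in> Supp n (Suc r) \<Longrightarrow> slice S x \<in> Supp n r"
proof -
  assume x: "x \<in> Supp n (Suc r)"
  have "t \<in> idx n r" if "x (S # t) \<noteq> 0" for t
  proof -
    have "S # t \<in> idx n (Suc r)" using x that unfolding Supp_def by blast
    then show ?thesis by (simp add: idx_def)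
  qed
  then show ?thesis by (simp add: Supp_def slice_def)
qed

text \<open>Rank and nullity for the slice at a set of greatest height: lifts for the other sets
  have zero slice there, as their own set is leading, and so lie in the kernel. The ranking makes
  the induction insert such a set last.\<close>

lemma sum_dim_le:
  assumes "finite \<S>" and "T.subspace U" "U \<subseteq> Supp n (Suc r)"
    and "\<And>S y. S \<in> \<S> \<Longrightarrow> y \<in> L S \<Longrightarrow> \<exists>x\<in>U. slice S x = y \<and> leading n S x"
  shows "(\<Sum>S\<in>\<S>. T.dim (L S)) \<le> T.dim U"
  using assms
proof (induction \<S> arbitrary: U rule: finite_ranking_induct[where f = "ht n"])
  case (insert S0 \<S>)
  show ?case
  proof (cases "S0 \<in> \<S>")
    case True
    then have eq: "insert S0 \<S> = \<S>" by (rule insert_absorb)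
    show ?thesis
      unfolding eq
    proof (rule insert.IH[OF insert.prems(1,2)])
      show "\<exists>x\<in>U. slice S x = y \<and> leading n S x" if "S \<in> \<S>" "y \<in> L S" for S y
        using insert.prems(3)[OF insertI2[OF that(1)] that(2)] .
    qed
  next
    case False
    let ?U = "{x \<in> U. slice S0 x = 0}"
    have fd: "U \<subseteq> T.span (delta ` idx n (Suc r))" by (rule order_trans[OF insert.prems(2) Supp_span])
    have subU: "T.subspace ?U"
      using T.subspace_inter[OF insert.prems(1) slice.subspace_kernel[of S0]]
      unfolding Collect_conj_eq Collect_mem_eq .
    have lift: "\<exists>x\<in>?U. slice S x = y \<and> leading n S x" if "S \<in> \<S>" "y \<in> L S" for S y
    proof -
      from insert.prems(3)[OF insertI2[OF that(1)] that(2)]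
      obtain x where x: "x \<in> U" "slice S x = y" "leading n S x" by (elim bexE conjE)
      have "slice S0 x = 0"
      proof (rule ccontr)
        assume "slice S0 x \<noteq> 0"
        moreover have "S0 \<noteq> S" using False that(1) by blast
        ultimately have "ht n S0 < ht n S" using x(3) unfolding leading_def by blast
        then show False using insert.hyps(2)[OF that(1)] by simp
      qed
      then show ?thesis using x by (intro bexI[of _ x] conjI CollectI)
    qed
    have "(\<Sum>S\<in>\<S>. T.dim (L S)) \<le> T.dim ?U"
    proof (rule insert.IH[OF subU])
      show "?U \<subseteq> Supp n (Suc r)" using insert.prems(2) by fast
    qed (rule lift)
    moreover have "T.dim (L S0) \<le> T.dim (slice S0 ` U)"
    proof (rule T.dim_mono_fd[OF _ finite_Supp_basis])
      show "L S0 \<subseteq> slice S0 ` U"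
      proof
        fix y assume "y \<in> L S0"
        from insert.prems(3)[OF insertI1 this] obtain x where "x \<in> U" "slice S0 x = y"
          by (elim bexE conjE)
        then show "y \<in> slice S0 ` U" by (intro image_eqI[of _ _ x]) simp_all
      qed
      show "slice S0 ` U \<subseteq> T.span (delta ` idx n r)"
      proof (rule order_trans[OF _ Supp_span], rule image_subsetI)
        fix x assume "x \<in> U"
        then show "slice S0 x \<in> Supp n r" using insert.prems(2) by (intro slice_Supp) blast
      qed
    qed
    ultimately show ?thesis
      using T.rank_nullity_fd[OF linear_slice insert.prems(1) fd finite_Supp_basis, of S0]
        insert.hyps(1) False by simp
  qed
qed simp

lemma evec_Suc_slice:
  "slice S (evec (Suc r) u) = (if S = supp u then evec r (dec u) else (0 :: nat set list \<Rightarrow> 'k::field))"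
  by (auto simp: slice_def evec_def delta_def supp_def dec_def fun_eq_iff)

text \<open>A contribution of the first factor to the slice at \<open>S\<close> would come from
  \<open>sw i S\<close>, which is higher and therefore absent.\<close>

lemma ee_leading:
  assumes x: "leading n S x" and i: "Suc i < n"
  shows "slice S (ee i x) = ee i (slice S x)" "leading n S (ee i x)"
proof -
  have zero: "slice (sw i S) x = 0" if "i \<in> S" "Suc i \<notin> S"
  proof -
    have "sw i S \<noteq> S" using that by (metis in_sw)
    then show ?thesis
      using x ht_sw[OF that i] unfolding leading_def by (metis less_asym)
  qed
  show "slice S (ee i x) = ee i (slice S x)"
    unfolding ee_def slice_mv using zero by auto
  show "leading n S (ee i x)"
    unfolding leading_def
  proof (intro allI impI)
    fix S' assume S': "S' \<noteq> S" "slice S' (ee i x) \<noteq> 0"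
    then have "(i \<in> S' \<and> Suc i \<notin> S' \<and> slice (sw i S') x \<noteq> 0) \<or> ee i (slice S' x) \<noteq> 0"
      unfolding ee_def slice_mv by (auto split: if_splits)
    then show "ht n S' < ht n S"
    proof (elim disjE conjE)
      assume a: "i \<in> S'" "Suc i \<notin> S'" "slice (sw i S') x \<noteq> 0"
      have "sw i S' = S \<or> ht n (sw i S') < ht n S" using x a(3) unfolding leading_def by blast
      then show ?thesis using ht_sw[OF a(1,2) i] by auto
    next
      assume "ee i (slice S' x) \<noteq> 0"
      then have "slice S' x \<noteq> 0" using ee.zero by metis
      then show ?thesis using x S'(1) unfolding leading_def by blast
    qed
  qed
qed

lemma leading_zero: "leading n S 0"
  by (simp add: leading_def slice.zero)

lemma leading_add: "leading n S x \<Longrightarrow> leading n S y \<Longrightarrow> leading n S (x + y)"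
  unfolding leading_def slice.add by (metis add.right_neutral)

lemma leading_scl: "leading n S x \<Longrightarrow> leading n S (scl c x)"
  unfolding leading_def slice.scale by (metis T.scale_zero_right)

text \<open>The extremal vector of \<open>u\<close> has the single first factor
  \<open>supp u\<close>, and raising operators act on a leading slice alone. Hence the slices at
  \<open>S\<close> of vectors with leading set \<open>S\<close> form a stable subspace that contains
  the extremal vectors of the remainders.\<close>

lemma leading_lift:
  assumes lam: "bdd n (Suc r) lam" and I: "I \<subseteq> orbit n lam"
    and y: "(y :: nat set list \<Rightarrow> 'k::field_char_0) \<in> DI n r (J n lam I S)"
  shows "\<exists>x\<in>DI n (Suc r) I. slice S x = y \<and> leading n S x"
proof -
  let ?P = "{x :: nat set list \<Rightarrow> 'k. x \<in> DI n (Suc r) I \<and> leading n S x}"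
  let ?Q = "slice S ` ?P"
  have "T.subspace ?P"
    by (intro T.subspaceI)
      (simp_all add: T.subspace_0 T.subspace_add T.subspace_scale leading_zero leading_add leading_scl)
  then have Q: "T.subspace ?Q" by (rule slice.subspace_image)
  note lam' = bdd_dec[OF lam]
  have "DI n r (J n lam I S) \<subseteq> ?Q"
  proof (rule DI_minimal[OF Q])
    fix v assume "v \<in> J n lam I S"
    then obtain u where v: "v \<in> orbit n (dec lam)" and u: "u \<in> I" "supp u = S" "bruhat_le v (dec u)"
      unfolding J_def down_def fib_def by blast
    have uo: "u \<in> orbit n lam" using u(1) I by blast
    have "Dem n r v \<subseteq> (Dem n r (dec u) :: (_ \<Rightarrow> 'k) set)"
      by (rule Dem_mono[OF lam' v dec_orbit[OF uo] u(3)])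
    also have "\<dots> \<subseteq> ?Q"
    proof (rule Dem_minimal[OF Q])
      have "evec (Suc r) u \<in> (DI n (Suc r) I :: (_ \<Rightarrow> 'k) set)"
        using Dem_DI[OF u(1)] evec_Dem by blast
      moreover have "leading n S (evec (Suc r) u :: _ \<Rightarrow> 'k)"
        unfolding leading_def evec_Suc_slice using u(2) by auto
      moreover have "slice S (evec (Suc r) u) = (evec r (dec u) :: _ \<Rightarrow> 'k)"
        unfolding evec_Suc_slice using u(2) by simp
      ultimately show "evec r (dec u) \<in> ?Q" by (metis (mono_tags, lifting) image_eqI mem_Collect_eq)
      show "ee i y \<in> ?Q" if i: "Suc i < n" and "y \<in> ?Q" for i y
      proof -
        obtain a where a: "a \<in> ?P" "y = slice S a" using \<open>y \<in> ?Q\<close> by blast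
        then have "ee i a \<in> ?P" "ee i y = slice S (ee i a)"
          by (simp_all add: ee_DI[OF i] ee_leading[OF _ i])
        then show ?thesis by blast
      qed
    qed
    finally show "Dem n r v \<subseteq> ?Q" .
  qed
  then show ?thesis using y by blast
qed

lemma slice_rs: "slice S (rs \<mu> x) = rs (sub S \<mu>) (slice S x)"
proof
  fix t
  have "wt (S # t) = \<mu> \<longleftrightarrow> wt t = sub S \<mu>"
    by (auto simp: sub_def fun_eq_iff)
  then show "slice S (rs \<mu> x) t = rs (sub S \<mu>) (slice S x) t"
    by (simp add: slice_def rs_def)
qed

lemma ch_lower_bound:
  assumes lam: "bdd n (Suc r) lam" and I: "I \<subseteq> orbit n lam"
  shows "(\<Sum>S\<in>Pow {..<n}. ch (DI n r (J n lam I S) :: (_ \<Rightarrow> 'k::field_char_0) set) (sub S \<mu>))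
       \<le> ch (DI n (Suc r) I :: (_ \<Rightarrow> 'k) set) \<mu>"
proof -
  let ?U = "DI n (Suc r) I \<inter> Wt \<mu> :: (_ \<Rightarrow> 'k) set"
  let ?L = "\<lambda>S. DI n r (J n lam I S) \<inter> Wt (sub S \<mu>) :: (_ \<Rightarrow> 'k) set"
  have "(\<Sum>S\<in>Pow {..<n}. T.dim (?L S)) \<le> T.dim ?U"
  proof (rule sum_dim_le)
    show "T.subspace ?U" using subspace_DI subspace_Wt by (rule T.subspace_inter)
    show "?U \<subseteq> Supp n (Suc r)" by (rule order_trans[OF Int_lower1 DI_Supp[OF lam I]])
    fix S y assume "y \<in> ?L S"
    then have y: "y \<in> DI n r (J n lam I S)" "y \<in> Wt (sub S \<mu>)" by auto
    from leading_lift[OF lam I y(1)]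
    obtain x where x: "x \<in> DI n (Suc r) I" "slice S x = y" "leading n S x" by (elim bexE conjE)
    have "graded (DI n (Suc r) I :: (_ \<Rightarrow> 'k) set)" by (rule graded_DI[OF lam I])
    then have "rs \<mu> x \<in> ?U" using x(1) by (simp add: graded_def)
    moreover have "slice S (rs \<mu> x) = y" using x(2) rs_id[OF y(2)] by (simp add: slice_rs)
    moreover have "leading n S (rs \<mu> x)"
      using x(3) unfolding leading_def slice_rs by (metis rs.zero)
    ultimately show "\<exists>x\<in>?U. slice S x = y \<and> leading n S x"
      by (intro bexI[of _ "rs \<mu> x"] conjI)
  qed simp
  then have "int (\<Sum>S\<in>Pow {..<n}. T.dim (?L S)) \<le> int (T.dim ?U)" by (rule of_nat_mono)
  then show ?thesis unfolding ch_def of_nat_sum .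
qed

section \<open>Exactness of the lower bound\<close>

lemma N_nonneg: "0 \<le> N n r lam I \<mu>"
  by (induction r arbitrary: lam I \<mu>) (auto intro: sum_nonneg)

lemma ch_line:
  fixes v :: "nat set list \<Rightarrow> 'k::field"
  assumes "v \<in> Wt \<nu>" "v \<noteq> 0"
  shows "ch (T.span {v}) \<mu> = of_bool (\<mu> = \<nu>)"
proof (cases "\<mu> = \<nu>")
  case True
  have "T.span {v} \<subseteq> Wt \<mu>"
    by (rule T.span_minimal) (use assms(1) True subspace_Wt in auto)
  then have "T.span {v} \<inter> Wt \<mu> = T.span {v}" by (rule Int_absorb2)
  moreover have "T.dim (T.span {v}) = 1"
    using T.dim_span_eq_card_independent[of "{v}"] assms(2) by simp
  ultimately show ?thesis using True by (simp add: ch_def)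
next
  case False
  have "T.span {v} \<subseteq> Wt \<nu>"
    by (rule T.span_minimal) (use assms(1) subspace_Wt in auto)
  moreover have "Wt \<mu> \<inter> Wt \<nu> = {0 :: nat set list \<Rightarrow> 'k}"
  proof -
    have "x = 0" if "x \<in> Wt \<mu>" "x \<in> Wt \<nu>" for x :: "nat set list \<Rightarrow> 'k"
      using rs_id[OF that(1)] rs_other[OF that(2) False] by simp
    then show ?thesis using T.subspace_0[OF subspace_Wt] by fast
  qed
  ultimately have "T.span {v} \<inter> Wt \<mu> = {0}"
    using T.span_zero by fast
  moreover have "T.dim {0 :: nat set list \<Rightarrow> 'k} = 0"
    using T.dim_unique[of "{}" "{0}" 0, OF _ _ T.independent_empty] by simp
  ultimately show ?thesis using False by (simp add: ch_def)
qed

lemma evec_not_zero: "evec r u \<noteq> (0 :: nat set list \<Rightarrow> 'k::field)"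
  unfolding evec_def by (rule delta_nonzero)

lemma Dem_dominant:
  assumes "dominant n u"
  shows "Dem n r u = T.span {evec r u :: nat set list \<Rightarrow> 'k::field}"
proof
  show "T.span {evec r u :: nat set list \<Rightarrow> 'k} \<subseteq> Dem n r u"
    by (rule T.span_minimal) (simp_all add: evec_Dem)
  show "Dem n r u \<subseteq> T.span {evec r u :: nat set list \<Rightarrow> 'k}"
  proof (rule Dem_minimal)
    fix i and x :: "nat set list \<Rightarrow> 'k" assume i: "Suc i < n" and "x \<in> T.span {evec r u}"
    from this(2) show "ee i x \<in> T.span {evec r u}"
    proof (rule ee_span_stable[rotated])
      fix g :: "nat set list \<Rightarrow> 'k" assume "g \<in> {evec r u}"
      then have "ee i g = 0" using ee_evec[of u i r] assms i by (simp add: dominant_def)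
      then show "ee i g \<in> T.span {evec r u}" using T.span_zero by metis
    qed
  qed (simp_all add: T.span_base)
qed

text \<open>The one-step inequality is summed along strings. The character vanishes once the entry
  at \<open>i\<close> exceeds the number \<open>r\<close> of factors, which starts a descending
  induction where the coroot value is nonnegative; reflection invariance of both sides covers the
  rest.\<close>

lemma character_le_of_demazure_op:
  fixes P :: "(nat set list \<Rightarrow> 'k::field_char_0) set"
  assumes P: "T.subspace P" "P \<subseteq> Supp n r" "\<And>x. x \<in> P \<Longrightarrow> ee i x \<in> P" "\<And>x. x \<in> P \<Longrightarrow> ff i x \<in> P"
      "graded P"
    and U: "T.subspace U" "U \<subseteq> P" "\<And>x. x \<in> U \<Longrightarrow> ee i x \<in> U" "graded U"
    and gen: "P \<subseteq> T.span {(ff i ^^ k) u | k u. u \<in> U}"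
    and g: "demazure_op i (ch U) g" "\<And>\<mu>. g (swp i \<mu>) = g \<mu>" "\<And>\<mu>. 0 \<le> g \<mu>"
  shows "ch P \<mu> \<le> g \<mu>"
proof -
  have big: "ch P \<mu> = 0" if "int r < \<mu> i" for \<mu>
  proof -
    have "x = 0" if "x \<in> P" "x \<in> Wt \<mu>" for x
    proof (rule ext, rule ccontr)
      fix t assume "x t \<noteq> 0 t"
      then have "t \<in> idx n r" "wt t = \<mu>"
        using that P(2) by (auto simp: Supp_def Wt_def)
      then show False using wt_le[of t i] \<open>int r < \<mu> i\<close> by (auto simp: idx_def)
    qed
    then have "P \<inter> Wt \<mu> = {0}"
      using T.subspace_0[OF P(1)] T.subspace_0[OF subspace_Wt] by fast
    moreover have "T.dim {0 :: nat set list \<Rightarrow> 'k} = 0"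
      using T.dim_unique[of "{}" "{0}" 0, OF _ _ T.independent_empty] by simp
    ultimately show ?thesis by (simp add: ch_def)
  qed
  have pos: "ch P \<mu> \<le> g \<mu>" if "\<mu> (Suc i) \<le> \<mu> i" for \<mu>
    using that
  proof (induction "nat (int r + 1 - \<mu> i)" arbitrary: \<mu> rule: less_induct)
    case less
    show ?case
    proof (cases "int r < \<mu> i")
      case True
      then show ?thesis using big g(3) by simp
    next
      case False
      have "ch P (al i 1 \<mu>) \<le> g (al i 1 \<mu>)"
        by (rule less.hyps) (use False less.prems in \<open>simp_all add: al_same\<close>)
      then show ?thesis
        using ch_difference_le[OF P U gen less.prems] g(1)[unfolded demazure_op_def, rule_format, of \<mu>]
        by linarith
    qed
  qed
  show ?thesis
  proof (cases "\<mu> (Suc i) \<le> \<mu> i")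
    case False
    then have "ch P (swp i \<mu>) \<le> g (swp i \<mu>)" by (intro pos) (simp add: swp_apply)
    then show ?thesis using ch_swp[OF P(1-4), of \<mu>] g(2) by simp
  qed (rule pos)
qed

lemma sum_ge_term: "finite A \<Longrightarrow> a \<in> A \<Longrightarrow> (\<And>x. x \<in> A \<Longrightarrow> 0 \<le> f x) \<Longrightarrow> f a \<le> (\<Sum>x\<in>A. f x :: int)"
  using member_le_sum[of a A f] by auto

lemma N_modular':
  "bdd n r lam \<Longrightarrow> ideal n lam I \<Longrightarrow> ideal n lam I' \<Longrightarrow>
    N n r lam (I \<union> I') \<mu> + N n r lam (I \<inter> I') \<mu> = N n r lam I \<mu> + N n r lam I' \<mu>"
  by (rule N_modular) (auto simp: bdd_def)

text \<open>Following the columns of \<open>u\<close> itself gives a positive summand at each stage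
  of the recursion.\<close>

lemma N_extremal:
  assumes "u \<in> I" "I \<subseteq> orbit n lam" "bdd n r lam"
  shows "1 \<le> N n r lam I (\<lambda>j. int (u j))"
  using assms
proof (induction r arbitrary: lam I u)
  case 0
  then have "u \<in> orbit n lam" by blast
  then have "u j = 0" for j using orbit_bounds(1)[OF 0(3), of u j] by simp
  then show ?case using 0 by auto
next
  case (Suc r)
  have uo: "u \<in> orbit n lam" using Suc.prems(1,2) by blast
  have "supp u \<in> Pow {..<n}"
  proof -
    have "j < n" if "j \<in> supp u" for j
      using that orbit_bounds(2)[OF Suc.prems(3) uo, of j] by (cases "n \<le> j") (auto simp: supp_def)
    then show ?thesis by auto
  qed
  then have "N n r (dec lam) (J n lam I (supp u)) (sub (supp u) (\<lambda>j. int (u j))) \<le> N n (Suc r) lam I (\<lambda>j. int (u j))"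
    unfolding N_Suc by (intro sum_ge_term) (simp_all add: N_nonneg)
  moreover have "sub (supp u) (\<lambda>j. int (u j)) = (\<lambda>j. int (dec u j))"
    by (auto simp: sub_def supp_def dec_def fun_eq_iff)
  moreover have "1 \<le> N n r (dec lam) (J n lam I (supp u)) (\<lambda>j. int (dec u j))"
  proof (rule Suc.IH)
    show "dec u \<in> J n lam I (supp u)"
      using dec_orbit[OF uo] Suc.prems(1) unfolding J_def down_def fib_def
      by (intro CollectI conjI bexI[of _ "dec u"] bruhat_refl) blast+
    show "J n lam I (supp u) \<subseteq> orbit n (dec lam)" by (auto simp: J_def down_def)
  qed (rule bdd_dec[OF Suc.prems(3)])
  ultimately show ?case by simp
qed

text \<open>By induction the upper bound holds for \<open>swp i v\<close>, and with
  \<open>lower\<close> its character is known exactly. Only such an equality can be fed into the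
  Demazure operator, which involves differences.\<close>

lemma ch_Dem_le:
  assumes lam: "bdd n r lam"
    and lower: "\<And>I \<mu>. ideal n lam I \<Longrightarrow> N n r lam I \<mu> \<le> ch (DI n r I :: (_ \<Rightarrow> 'k::field_char_0) set) \<mu>"
    and v: "v \<in> orbit n lam"
  shows "ch (Dem n r v :: (_ \<Rightarrow> 'k) set) \<mu> \<le> N n r lam (down n lam {v}) \<mu>"
  using v
proof (induction "\<Sum>j<n. j * v j" arbitrary: v \<mu> rule: less_induct)
  case less
  note bounds = orbit_bounds[OF lam]
  have v_down: "v \<in> down n lam {v}" using less.prems by (simp add: down_def)
  show ?case
  proof (cases "dominant n v")
    case True
    have "ch (Dem n r v :: (_ \<Rightarrow> 'k) set) \<mu> = of_bool (\<mu> = (\<lambda>j. int (v j)))"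
      unfolding Dem_dominant[OF True] by (rule ch_line[OF evec_Wt[OF bounds(1)[OF less.prems]] evec_not_zero])
    moreover have "1 \<le> N n r lam (down n lam {v}) (\<lambda>j. int (v j))"
      by (rule N_extremal[OF v_down _ lam]) (auto simp: down_def)
    ultimately show ?thesis using N_nonneg by auto
  next
    case False
    then obtain i where i: "Suc i < n" "v i < v (Suc i)" by (rule not_dominantE)
    let ?u = "swp i v" and ?D = "\<lambda>v. Dem n r v :: (_ \<Rightarrow> 'k) set"
    have u: "?u \<in> orbit n lam" using less.prems i(1) by (rule orbit_swp)
    have le': "?u (Suc i) \<le> ?u i" using i(2) by (simp add: swp_apply)
    note Dem_facts = ff_Dem_swp[OF le' bounds(1)[OF u] bounds(2)[OF u] i(1)]
      Dem_subset_swp[OF le' bounds(1)[OF u] bounds(2)[OF u] i(1)]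
      Dem_swp_generated[OF le' bounds(1)[OF u] bounds(2)[OF u] i(1)]
    have "bruhat_le ?u v" using i(2) by (intro swp_bruhat_le) simp
    then have "down n lam ({?u} \<union> {v}) = down n lam {v}" by (intro down_Un_absorb) simp
    then have down_v: "down n lam {?u} \<union> swp i ` down n lam {?u} = down n lam {v}"
      using down_swp[OF i(1), of lam "{?u}"] by simp
    have eq: "ch (?D ?u) = N n r lam (down n lam {?u})"
    proof
      fix \<mu>
      have "N n r lam (down n lam {?u}) \<mu> \<le> ch (?D ?u) \<mu>"
        using lower[OF ideal_down, of "{?u}" \<mu>] unfolding DI_down_single[OF lam u] .
      then show "ch (?D ?u) \<mu> = N n r lam (down n lam {?u}) \<mu>"
        using less.hyps[OF sum_swp_less[OF i(2,1)] u, of \<mu>] by simp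
    qed
    have op: "demazure_op i (N n r lam (down n lam {?u})) (N n r lam (down n lam {v}))"
      using N_demazure_op[OF ideal_down[of n lam "{?u}"] i(1) bddD(1)[OF lam]] unfolding down_v .
    have "down n lam {v} \<union> swp i ` down n lam {v} = down n lam {v}"
      unfolding down_v[symmetric] image_Un image_image swp_swp by auto
    then have op': "demazure_op i (N n r lam (down n lam {v})) (N n r lam (down n lam {v}))"
      using N_demazure_op[OF ideal_down[of n lam "{v}"] i(1) bddD(1)[OF lam]] by simp
    show ?thesis
    proof (rule character_le_of_demazure_op[where U = "?D ?u" and n = n and r = r])
      show "T.subspace (?D v)" "T.subspace (?D ?u)" by simp_all
      show "?D v \<subseteq> Supp n r" by (rule Dem_Supp[OF bounds(2)[OF less.prems]])
      show "graded (?D v)" by (rule graded_Dem[OF bounds(1)[OF less.prems]])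
      show "graded (?D ?u)" by (rule graded_Dem[OF bounds(1)[OF u]])
      show "ee i x \<in> ?D v" if "x \<in> ?D v" for x using i(1) that by (rule ee_Dem)
      show "ee i x \<in> ?D ?u" if "x \<in> ?D ?u" for x using i(1) that by (rule ee_Dem)
      show "ff i x \<in> ?D v" if "x \<in> ?D v" for x using Dem_facts(1)[of x] that by simp
      show "?D ?u \<subseteq> ?D v" using Dem_facts(2) by simp
      show "?D v \<subseteq> T.span {(ff i ^^ k) u | k u. u \<in> ?D ?u}" using Dem_facts(3) by simp
      show "demazure_op i (ch (?D ?u)) (N n r lam (down n lam {v}))" using op unfolding eq .
      show "N n r lam (down n lam {v}) (swp i \<mu>) = N n r lam (down n lam {v}) \<mu>" for \<mu>
        by (rule demazure_op_self[OF op'])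
      show "0 \<le> N n r lam (down n lam {v}) \<mu>" for \<mu> by (rule N_nonneg)
    qed
  qed
qed

text \<open>Inclusion and exclusion over the generators: the intersection of two modules contains
  the module of the intersection, whose character is bounded below, and this bounds the character of
  the sum from above.\<close>

lemma ch_DI_down_le:
  assumes lam: "bdd n r lam"
    and lower: "\<And>I \<mu>. ideal n lam I \<Longrightarrow> N n r lam I \<mu> \<le> ch (DI n r I :: (_ \<Rightarrow> 'k::field_char_0) set) \<mu>"
    and X: "finite X" "X \<subseteq> orbit n lam"
  shows "ch (DI n r (down n lam X) :: (_ \<Rightarrow> 'k) set) \<mu> \<le> N n r lam (down n lam X) \<mu>"
  using X
proof (induction X rule: finite_induct)
  case empty
  have "DI n r (down n lam {}) = {0 :: nat set list \<Rightarrow> 'k}" by (simp add: DI_def down_def)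
  moreover have "T.dim {0 :: nat set list \<Rightarrow> 'k} = 0"
    using T.dim_unique[of "{}" "{0}" 0, OF _ _ T.independent_empty] by simp
  moreover have "{0 :: nat set list \<Rightarrow> 'k} \<inter> Wt \<mu> = {0}" using T.subspace_0[OF subspace_Wt] by fast
  ultimately show ?case by (simp add: ch_def N_nonneg)
next
  case (insert v X)
  let ?D = "\<lambda>I. DI n r I :: (_ \<Rightarrow> 'k) set"
  let ?A = "down n lam {v}" and ?B = "down n lam X"
  have v: "v \<in> orbit n lam" using insert.prems by simp
  have sub: "?A \<subseteq> orbit n lam" "?B \<subseteq> orbit n lam" by (auto simp: down_def)
  have id: "ideal n lam ?A" "ideal n lam ?B" by (rule ideal_down)+
  have un: "down n lam (insert v X) = ?A \<union> ?B"
    using down_Un[of n lam "{v}" X] by simp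
  have "ch (?D ?A) \<mu> \<le> N n r lam ?A \<mu>"
    unfolding DI_down_single[OF lam v] by (rule ch_Dem_le[OF lam lower v])
  moreover have "ch (?D ?B) \<mu> \<le> N n r lam ?B \<mu>"
    by (rule insert.IH) (use insert.prems in simp)
  moreover have "N n r lam (?A \<inter> ?B) \<mu> \<le> ch (?D ?A \<inter> ?D ?B) \<mu>"
  proof (rule order_trans[OF lower[OF ideal_Int[OF id]]])
    show "ch (?D (?A \<inter> ?B)) \<mu> \<le> ch (?D ?A \<inter> ?D ?B) \<mu>"
    proof (rule ch_mono)
      show "?D (?A \<inter> ?B) \<subseteq> ?D ?A \<inter> ?D ?B" by (intro Int_greatest DI_mono) simp_all
      show "?D ?A \<inter> ?D ?B \<subseteq> Supp n r" by (rule order_trans[OF Int_lower1 DI_Supp[OF lam sub(1)]])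
    qed
  qed
  moreover have "ch (?D (?A \<union> ?B)) \<mu> + ch (?D ?A \<inter> ?D ?B) \<mu> = ch (?D ?A) \<mu> + ch (?D ?B) \<mu>"
    unfolding DI_Un
    by (rule ch_modular[OF subspace_DI DI_Supp[OF lam sub(1)] graded_DI[OF lam sub(1)]
          subspace_DI DI_Supp[OF lam sub(2)] graded_DI[OF lam sub(2)]])
  moreover have "N n r lam (?A \<union> ?B) \<mu> + N n r lam (?A \<inter> ?B) \<mu> = N n r lam ?A \<mu> + N n r lam ?B \<mu>"
    by (rule N_modular'[OF lam id])
  ultimately show ?case unfolding un by linarith
qed

text \<open>Exactness for the remaining columns turns the leading-term estimate into the bound by
  \<open>N\<close>; exactness with one more column then follows from the opposite estimate.\<close>

theorem ch_DI:
  assumes "bdd n r lam" "ideal n lam I"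
  shows "ch (DI n r I :: (_ \<Rightarrow> 'k::field_char_0) set) \<mu> = N n r lam I \<mu>"
  using assms
proof (induction r arbitrary: lam I \<mu>)
  case 0
  have I: "I = {} \<or> I = {lam}" using 0(2) orbit_zero[of lam n, OF bddD(1)[OF 0(1)]] by (auto simp: ideal_def)
  have lam0: "lam = (\<lambda>j. 0)" using 0(1) by (auto simp: bdd_def)
  show ?case
  proof (cases "I = {}")
    case True
    have "DI n 0 I = {0 :: nat set list \<Rightarrow> 'k}" by (simp add: DI_def True)
    moreover have "T.dim {0 :: nat set list \<Rightarrow> 'k} = 0"
      using T.dim_unique[of "{}" "{0}" 0, OF _ _ T.independent_empty] by simp
    moreover have "{0 :: nat set list \<Rightarrow> 'k} \<inter> Wt \<mu> = {0}" using T.subspace_0[OF subspace_Wt] by fast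
    ultimately show ?thesis using True by (simp add: ch_def)
  next
    case False
    then have "I = {lam}" using I by simp
    moreover have "dominant n lam" by (simp add: dominant_def lam0)
    ultimately have "DI n 0 I = T.span {evec 0 lam :: nat set list \<Rightarrow> 'k}"
      by (simp add: DI_def Dem_dominant T.span_span)
    moreover have "ch (T.span {evec 0 lam :: nat set list \<Rightarrow> 'k}) \<mu> = of_bool (\<mu> = (\<lambda>j. int (lam j)))"
      by (rule ch_line[OF evec_Wt evec_not_zero]) (simp add: lam0)
    ultimately show ?thesis using False by (simp add: lam0)
  qed
next
  case (Suc r)
  note lam' = bdd_dec[OF Suc.prems(1)]
  have lower: "N n (Suc r) lam I \<mu> \<le> ch (DI n (Suc r) I :: (_ \<Rightarrow> 'k) set) \<mu>" if "ideal n lam I" for I \<mu>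
  proof -
    have "I \<subseteq> orbit n lam" using that by (simp add: ideal_def)
    from ch_lower_bound[OF Suc.prems(1) this, where 'k = 'k]
    show ?thesis unfolding N_Suc Suc.IH[OF lam' ideal_J] .
  qed
  have "finite I" "I \<subseteq> orbit n lam"
    using Suc.prems(2) finite_orbit[of n lam] by (auto simp: ideal_def intro: finite_subset)
  from ch_DI_down_le[OF Suc.prems(1) lower this]
  have "ch (DI n (Suc r) I :: (_ \<Rightarrow> 'k) set) \<mu> \<le> N n (Suc r) lam I \<mu>"
    unfolding down_ideal[OF Suc.prems(2)] .
  then show ?case using lower[OF Suc.prems(2), of \<mu>] by simp
qed

theorem DI_Int:
  assumes lam: "bdd n r lam" and I: "ideal n lam I" "ideal n lam I'"
  shows "DI n r I \<inter> DI n r I' = (DI n r (I \<inter> I') :: (_ \<Rightarrow> 'k::field_char_0) set)"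
proof -
  let ?D = "\<lambda>I. DI n r I :: (_ \<Rightarrow> 'k) set"
  have sub: "I \<subseteq> orbit n lam" "I' \<subseteq> orbit n lam" using I by (simp_all add: ideal_def)
  have "?D (I \<inter> I') = ?D I \<inter> ?D I'"
  proof (rule graded_eqI)
    show "?D (I \<inter> I') \<subseteq> ?D I \<inter> ?D I'" by (intro Int_greatest DI_mono) simp_all
    show "?D I \<inter> ?D I' \<subseteq> Supp n r" by (rule order_trans[OF Int_lower1 DI_Supp[OF lam sub(1)]])
    show "graded (?D I \<inter> ?D I')" by (intro graded_Int graded_DI[OF lam] sub)
    fix \<mu>
    have "ch (?D (I \<union> I')) \<mu> + ch (?D I \<inter> ?D I') \<mu> = ch (?D I) \<mu> + ch (?D I') \<mu>"
      unfolding DI_Un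
      by (rule ch_modular[OF subspace_DI DI_Supp[OF lam sub(1)] graded_DI[OF lam sub(1)]
          subspace_DI DI_Supp[OF lam sub(2)] graded_DI[OF lam sub(2)]])
    then show "ch (?D I \<inter> ?D I') \<mu> \<le> ch (?D (I \<inter> I')) \<mu>"
      unfolding ch_DI[OF lam I(1)] ch_DI[OF lam I(2)] ch_DI[OF lam ideal_Un[OF I]] ch_DI[OF lam ideal_Int[OF I]]
      using N_modular'[OF lam I, of \<mu>] by linarith
  qed simp
  then show ?thesis by simp
qed

section \<open>A basis adapted to all Demazure modules\<close>

lemma subspace_coord: "T.subspace {x :: nat set list \<Rightarrow> 'k::field. x t = 0}"
  by (rule T.subspaceI) (simp_all add: scl_apply)

text \<open>Confines the monomials of the Demazure module of \<open>v\<close>: raising operators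
  move elements of a factor to smaller positions, so every prefix keeps at least the count it has in
  the key of \<open>v\<close>.\<close>

definition above :: "nat \<Rightarrow> (nat \<Rightarrow> nat) \<Rightarrow> (nat set list \<Rightarrow> 'k::field) set" where
  "above r v = {x. \<forall>t. x t \<noteq> 0 \<longrightarrow> length t = r \<and> (\<forall>p<r. \<forall>k. rk v k p \<le> rk (\<lambda>j. of_bool (j \<in> t ! p)) k 0)}"

lemma rk_sw_le:
  assumes "i \<in> S" "Suc i \<notin> S"
  shows "rk (\<lambda>j. of_bool (j \<in> sw i S)) k 0 \<le> rk (\<lambda>j. of_bool (j \<in> S)) k 0"
proof -
  have "swp i (\<lambda>j. of_bool (j \<in> S) :: nat) = (\<lambda>j. of_bool (j \<in> sw i S))"
    by (rule ext) (simp add: swp_apply in_sw)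
  moreover have "bruhat_le (\<lambda>j. of_bool (j \<in> S)) (swp i (\<lambda>j. of_bool (j \<in> S)))"
    by (rule bruhat_le_swp) (use assms in simp)
  ultimately show ?thesis by (simp add: bruhat_le_def)
qed

lemma Dem_above: "Dem n r v \<subseteq> (above r v :: (_ \<Rightarrow> 'k::field) set)"
proof (rule Dem_minimal)
  show "T.subspace (above r v :: (_ \<Rightarrow> 'k) set)"
  proof (rule T.subspaceI)
    fix x y :: "nat set list \<Rightarrow> 'k" and c assume x: "x \<in> above r v" and y: "y \<in> above r v"
    show "x + y \<in> above r v"
      unfolding above_def
    proof (intro CollectI allI impI)
      fix t assume "(x + y) t \<noteq> 0"
      then have "x t \<noteq> 0 \<or> y t \<noteq> 0" by auto
      then show "length t = r \<and> (\<forall>p<r. \<forall>k. rk v k p \<le> rk (\<lambda>j. of_bool (j \<in> t ! p)) k 0)"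
        using x y unfolding above_def by blast
    qed
    show "scl c x \<in> above r v"
      using x by (simp add: above_def scl_apply)
  qed (simp add: above_def)
  show "(evec r v :: _ \<Rightarrow> 'k) \<in> above r v"
    by (auto simp: above_def evec_nonzero nth_cols rk_def)
  fix i and x :: "nat set list \<Rightarrow> 'k" assume x: "x \<in> above r v"
  show "ee i x \<in> above r v"
    unfolding above_def
  proof (intro CollectI allI impI)
    fix t assume "ee i x t \<noteq> 0"
    then obtain q where q: "q < length t" "i \<in> t ! q" "Suc i \<notin> t ! q" "x (t[q := sw i (t ! q)]) \<noteq> 0"
      unfolding ee_def using mv_nonzero[of i i "Suc i" x t] by blast
    let ?t = "t[q := sw i (t ! q)]"
    have t: "length ?t = r" "\<And>p k. p < r \<Longrightarrow> rk v k p \<le> rk (\<lambda>j. of_bool (j \<in> ?t ! p)) k 0"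
      using x q(4) unfolding above_def by blast+
    have "rk v k p \<le> rk (\<lambda>j. of_bool (j \<in> t ! p)) k 0" if "p < r" for p k
    proof (cases "p = q")
      case True
      then show ?thesis
        using t(2)[OF that, of k] rk_sw_le[OF q(2,3), of k] q(1) by simp
    next
      case False
      then show ?thesis using t(2)[OF that, of k] by simp
    qed
    then show "length t = r \<and> (\<forall>p<r. \<forall>k. rk v k p \<le> rk (\<lambda>j. of_bool (j \<in> t ! p)) k 0)"
      using t(1) by simp
  qed
qed

text \<open>Read at the key of \<open>u\<close>, the bound on monomials is the Bruhat relation. It
  serves as a converse of \<open>Dem_mono\<close> and shows that each module is larger than the sum
  of those strictly below it.\<close>

lemma Dem_coord:
  assumes u: "\<And>j. u j \<le> r" and v: "\<And>j. v j \<le> r"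
    and x: "(x :: nat set list \<Rightarrow> 'k::field) \<in> Dem n r v" "x (cols r u) \<noteq> 0"
  shows "bruhat_le u v"
  unfolding bruhat_le_def
proof (intro allI)
  fix k p
  show "rk v k p \<le> rk u k p"
  proof (cases "p < r")
    case True
    have "x \<in> above r v" using x(1) Dem_above by blast
    then have "rk v k p \<le> rk (\<lambda>j. of_bool (j \<in> cols r u ! p)) k 0"
      using x(2) True unfolding above_def by blast
    also have "\<dots> = rk u k p" using True by (simp add: nth_cols rk_def)
    finally show ?thesis .
  next
    case False
    have "{j. j < k \<and> p < v j} = {}" using v False by (auto simp: not_less intro: order_trans)
    then have "rk v k p = 0" by (simp only: rk_def card.empty)
    then show ?thesis by simp
  qed
qed

lemma evec_DI_iff:
  assumes "bdd n r lam" "ideal n lam I" "u \<in> orbit n lam" "(evec r u :: nat set list \<Rightarrow> 'k::field) \<in> DI n r I"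
  shows "u \<in> I"
proof (rule ccontr)
  assume "u \<notin> I"
  have "DI n r I \<subseteq> {x :: nat set list \<Rightarrow> 'k. x (cols r u) = 0}"
  proof (rule DI_minimal[OF subspace_coord], rule subsetI, rule CollectI, rule ccontr)
    fix v and x :: "nat set list \<Rightarrow> 'k"
    assume v: "v \<in> I" and "x \<in> Dem n r v" "x (cols r u) \<noteq> 0"
    have vO: "v \<in> orbit n lam" using v assms(2) unfolding ideal_def by blast
    have "bruhat_le u v"
      by (rule Dem_coord[OF orbit_bounds(1)[OF assms(1,3)] orbit_bounds(1)[OF assms(1) vO]]) fact+
    then show False using \<open>u \<notin> I\<close> v assms(2,3) unfolding ideal_def by blast
  qed
  then have "(evec r u :: nat set list \<Rightarrow> 'k) (cols r u) = 0" using assms(4) by blast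
  then show False by (simp add: evec_def delta_def)
qed

context vector_space
begin

lemma independent_Un_trivial:
  assumes A: "independent A" and B: "finite B" "independent B" and AB: "span A \<inter> span B \<subseteq> {0}"
  shows "independent (A \<union> B)"
  using B AB
proof (induction B rule: finite_induct)
  case (insert b B)
  have iB: "independent B" using insert.prems(1) by (rule independent_mono) blast
  have "span A \<inter> span B \<subseteq> span A \<inter> span (insert b B)"
    using span_mono[of B "insert b B"] by blast
  then have IH: "independent (A \<union> B)" using insert.IH[OF iB] insert.prems(2) by blast
  have "b \<notin> span (A \<union> B)"
  proof
    assume "b \<in> span (A \<union> B)"
    then obtain a c where ac: "b = a + c" "a \<in> span A" "c \<in> span B" unfolding span_Un by blast
    then have "a = b - c" by simp
    moreover have "b - c \<in> span (insert b B)"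
      using ac(3) span_mono[of B "insert b B"] by (intro span_diff[OF span_base[OF insertI1]]) blast
    ultimately have "a = 0" using ac(2) insert.prems(2) by blast
    then have "b \<in> span B" using ac by simp
    then show False using insert.prems(1) insert.hyps(2) by (simp add: independent_insert)
  qed
  then show ?case using IH independent_insertI[of b "A \<union> B"] by simp
qed (use A in simp)

lemma complement_basis:
  assumes "subspace A" "A \<subseteq> D" "subspace D" "D \<subseteq> span F" "finite F"
  obtains B where "finite B" "independent B" "B \<subseteq> D" "span A \<inter> span B \<subseteq> {0}" "D = span (A \<union> B)"
proof -
  obtain C where C: "C \<subseteq> A" "independent C" "A \<subseteq> span C"
    by (rule maximal_independent_subset)
  obtain E where E: "C \<subseteq> E" "E \<subseteq> D" "independent E" "D \<subseteq> span E"
    using maximal_independent_subset_extend[of C D] C(1,2) assms(2) by blast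
  have "finite E" using independent_span_bound[OF assms(5) E(3)] E(2) assms(4) by blast
  have "span A = span C" using C(1,3) span_mono span_minimal[OF C(3)] by (meson subset_antisym subspace_span)
  then have "span A \<inter> span (E - C) \<subseteq> {0}"
    using span_Int_independent[OF E(3), of C "E - C"] E(1) by (simp add: Diff_disjoint)
  moreover have "span (A \<union> (E - C)) = D"
  proof
    show "span (A \<union> (E - C)) \<subseteq> D" using assms(2,3) E(2) by (intro span_minimal) auto
    have "E \<subseteq> A \<union> (E - C)" using C(1) by blast
    then show "D \<subseteq> span (A \<union> (E - C))" using E(4) span_mono by blast
  qed
  ultimately show ?thesis
    using that[of "E - C"] \<open>finite E\<close> independent_mono[OF E(3)] E(2) by blast
qed

end

lemma down_strict:
  assumes "u \<in> orbit n lam" "v \<in> orbit n lam" "bruhat_le u v" "u \<noteq> v"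
  shows "card (down n lam {u}) < card (down n lam {v})"
proof (rule psubset_card_mono)
  show "finite (down n lam {v})" using finite_orbit[of n lam] by (auto simp: down_def intro: finite_subset)
  have "v \<in> down n lam {v}" "v \<notin> down n lam {u}"
    using assms bruhat_antisym by (auto simp: down_def)
  moreover have "down n lam {u} \<subseteq> down n lam {v}"
    using assms(3) bruhat_trans by (auto simp: down_def)
  ultimately show "down n lam {u} \<subset> down n lam {v}" by blast
qed

lemma ideal_Diff_maximal:
  assumes I: "ideal n lam I" "v \<in> I" and max: "\<And>u. u \<in> I \<Longrightarrow> bruhat_le v u \<Longrightarrow> u = v"
  shows "ideal n lam (I - {v})"
  using assms unfolding ideal_def by blast

text \<open>Remove a maximal \<open>v\<close>. By \<open>DI_Int\<close> the module of the rest meets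
  that of \<open>v\<close> exactly in the module of the weights strictly below \<open>v\<close>, and
  \<open>B v\<close> was chosen complementary to that; so adding \<open>B v\<close> keeps
  independence.\<close>

lemma adapted_family:
  assumes lam: "bdd n r lam"
    and B: "\<And>v. v \<in> orbit n lam \<Longrightarrow> finite (B v) \<and> T.independent (B v) \<and> B v \<subseteq> Dem n r v \<and>
        DI n r (down n lam {v} - {v}) \<inter> T.span (B v) \<subseteq> {0 :: nat set list \<Rightarrow> 'k::field_char_0} \<and>
        Dem n r v = T.span (DI n r (down n lam {v} - {v}) \<union> B v)"
    and I: "ideal n lam I"
  shows "T.independent (\<Union>v\<in>I. B v) \<and> T.span (\<Union>v\<in>I. B v) = DI n r I \<and> disjoint_family_on B I"
  using I
proof (induction "card I" arbitrary: I)
  case 0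
  have "finite I" using 0(2) finite_orbit[of n lam] by (auto simp: ideal_def intro: finite_subset)
  then have "I = {}" using 0(1) by simp
  then show ?case by (simp add: DI_def disjoint_family_on_def T.independent_empty)
next
  case (Suc k)
  have finI: "finite I" using Suc.prems finite_orbit[of n lam] by (auto simp: ideal_def intro: finite_subset)
  have IO: "I \<subseteq> orbit n lam" using Suc.prems by (simp add: ideal_def)
  have "I \<noteq> {}" using Suc.hyps(2) by auto
  \<comment> \<open>The size of the lower set is strictly monotone, so a largest value belongs to a
    Bruhat-maximal weight.\<close>
  then have "Max ((\<lambda>u. card (down n lam {u})) ` I) \<in> (\<lambda>u. card (down n lam {u})) ` I"
    using finI by (intro Max_in) simp_all
  then obtain v where v: "v \<in> I" and "Max ((\<lambda>u. card (down n lam {u})) ` I) = card (down n lam {v})"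
    by (elim imageE) simp
  then have vmax: "\<And>u. u \<in> I \<Longrightarrow> card (down n lam {u}) \<le> card (down n lam {v})"
    using finI Max_ge[of "(\<lambda>u. card (down n lam {u})) ` I"] by (metis finite_imageI imageI)
  have vO: "v \<in> orbit n lam" using v IO by blast
  have max: "u = v" if "u \<in> I" "bruhat_le v u" for u
  proof (rule ccontr)
    assume "u \<noteq> v"
    then have "card (down n lam {v}) < card (down n lam {u})"
      using that IO by (intro down_strict[OF vO _ that(2)]) auto
    then show False using vmax[OF that(1)] by simp
  qed
  let ?I = "I - {v}" and ?L = "down n lam {v} - {v}"
  have idI: "ideal n lam ?I" by (rule ideal_Diff_maximal[OF Suc.prems v max])
  have idL: "ideal n lam ?L"
  proof (rule ideal_Diff_maximal[OF ideal_down])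
    show "v \<in> down n lam {v}" using vO by (simp add: down_def)
    show "u = v" if "u \<in> down n lam {v}" "bruhat_le v u" for u
      using that bruhat_antisym[of u v] by (simp add: down_def)
  qed
  have "card ?I = k" using Suc.hyps(2) v finI by simp
  from Suc.hyps(1)[OF this[symmetric] idI]
  have IH: "T.independent (\<Union>u\<in>?I. B u)" "T.span (\<Union>u\<in>?I. B u) = DI n r ?I" "disjoint_family_on B ?I"
    by auto
  note Bv = B[OF vO]
  have downI: "down n lam {v} \<subseteq> I" using Suc.prems v by (auto simp: down_def ideal_def)
  have eqL: "down n lam {v} \<inter> ?I = ?L" using downI by blast
  have int: "DI n r ?I \<inter> Dem n r v = (DI n r ?L :: (_ \<Rightarrow> 'k) set)"
  proof -
    have "DI n r (down n lam {v}) \<inter> DI n r ?I = (DI n r (down n lam {v} \<inter> ?I) :: (_ \<Rightarrow> 'k) set)"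
      by (rule DI_Int[OF lam ideal_down idI])
    then show ?thesis unfolding DI_down_single[OF lam vO] eqL by (simp only: Int_commute)
  qed
  have "T.span (B v) \<subseteq> Dem n r v" using Bv by (intro T.span_minimal) auto
  then have triv: "DI n r ?I \<inter> T.span (B v) \<subseteq> {0}"
    using int Bv by blast
  have un: "(\<Union>u\<in>I. B u) = (\<Union>u\<in>?I. B u) \<union> B v" using v by blast
  have "T.independent (\<Union>u\<in>I. B u)"
    unfolding un using IH(1,2) Bv triv by (intro T.independent_Un_trivial) auto
  moreover have "T.span (\<Union>u\<in>I. B u) = DI n r I"
  proof
    show "T.span (\<Union>u\<in>I. B u) \<subseteq> DI n r I"
    proof (rule T.span_minimal[OF _ subspace_DI], rule UN_least)
      fix u assume u: "u \<in> I"
      then have "B u \<subseteq> Dem n r u" using B IO by blast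
      also have "\<dots> \<subseteq> DI n r I" by (rule Dem_DI[OF u])
      finally show "B u \<subseteq> DI n r I" .
    qed
    have eqI: "I = ?I \<union> down n lam {v}"
    proof
      have "v \<in> down n lam {v}" using vO by (simp add: down_def)
      then show "I \<subseteq> ?I \<union> down n lam {v}" by blast
    qed (use downI in blast)
    have "DI n r (?I \<union> down n lam {v}) = T.span (DI n r ?I \<union> (DI n r (down n lam {v}) :: (_ \<Rightarrow> 'k) set))"
      by (rule DI_Un)
    then have "DI n r I = T.span (DI n r ?I \<union> (Dem n r v :: (_ \<Rightarrow> 'k) set))"
      unfolding eqI[symmetric] DI_down_single[OF lam vO] .
    also have "\<dots> \<subseteq> T.span (\<Union>u\<in>I. B u)"
    proof (rule T.span_minimal[OF Un_least T.subspace_span])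
      show *: "DI n r ?I \<subseteq> T.span (\<Union>u\<in>I. B u)"
        unfolding IH(2)[symmetric] by (rule T.span_mono) blast
      have "DI n r ?L \<subseteq> (DI n r ?I :: (_ \<Rightarrow> 'k) set)" using downI by (intro DI_mono) blast
      then have "DI n r ?L \<union> B v \<subseteq> T.span (\<Union>u\<in>I. B u)"
        using * T.span_superset[of "\<Union>u\<in>I. B u"] v by blast
      moreover have "Dem n r v = T.span (DI n r ?L \<union> B v)" using Bv by blast
      ultimately show "Dem n r v \<subseteq> T.span (\<Union>u\<in>I. B u)"
        by (simp only:) (rule T.span_minimal[OF _ T.subspace_span])
    qed
    finally show "DI n r I \<subseteq> T.span (\<Union>u\<in>I. B u)" .
  qed
  moreover have disj: "B u \<inter> B v = {}" if "u \<in> ?I" for u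
  proof -
    have "x = 0" if "x \<in> B u" "x \<in> B v" for x
    proof -
      have "x \<in> T.span (\<Union>u\<in>?I. B u)" by (rule T.span_base, rule UN_I) fact+
      then have "x \<in> DI n r ?I" unfolding IH(2) .
      moreover have "x \<in> T.span (B v)" using that(2) by (rule T.span_base)
      ultimately show ?thesis using triv by blast
    qed
    moreover have "0 \<notin> B v" using T.dependent_zero[of "B v"] Bv by fast
    ultimately show ?thesis by fast
  qed
  moreover have "disjoint_family_on B I"
  proof -
    note * = disj
    show ?thesis
      unfolding disjoint_family_on_def
    proof (intro ballI impI)
      fix a b assume ab: "a \<in> I" "b \<in> I" "a \<noteq> b"
      consider "a = v" | "b = v" | "a \<noteq> v" "b \<noteq> v" by blast
      then show "B a \<inter> B b = {}"
      proof cases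
        case 1
        then show ?thesis using *[of b] ab by (simp add: Int_commute)
      next
        case 2
        then show ?thesis using *[of a] ab by simp
      next
        case 3
        then show ?thesis using IH(3) ab by (auto simp: disjoint_family_on_def)
      qed
    qed
  qed
  ultimately show ?case by blast
qed

theorem tensor_adapted_basis:
  assumes lam: "bdd n r lam"
  obtains B :: "(nat set list \<Rightarrow> 'k::field_char_0) set" and \<kappa>
  where "T.independent B" "\<And>b. b \<in> B \<Longrightarrow> \<kappa> b \<in> orbit n lam"
    "\<And>v. v \<in> orbit n lam \<Longrightarrow> Dem n r v = T.span {b \<in> B. bruhat_le (\<kappa> b) v}"
    "\<And>v. v \<in> orbit n lam \<Longrightarrow> \<exists>b\<in>B. \<kappa> b = v"
proof -
  let ?O = "orbit n lam"
  let ?L = "\<lambda>v. down n lam {v} - {v}"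
  have ex: "\<exists>B. finite B \<and> T.independent B \<and> B \<subseteq> Dem n r v \<and>
        DI n r (?L v) \<inter> T.span B \<subseteq> {0 :: nat set list \<Rightarrow> 'k} \<and> Dem n r v = T.span (DI n r (?L v) \<union> B)"
    if v: "v \<in> ?O" for v
  proof -
    have "DI n r (?L v) \<subseteq> (DI n r (down n lam {v}) :: (_ \<Rightarrow> 'k) set)" by (rule DI_mono) blast
    then have sub: "DI n r (?L v) \<subseteq> (Dem n r v :: (_ \<Rightarrow> 'k) set)" unfolding DI_down_single[OF lam v] .
    have fd: "(Dem n r v :: (_ \<Rightarrow> 'k) set) \<subseteq> T.span (delta ` idx n r)"
      by (rule order_trans[OF Dem_Supp[OF orbit_bounds(2)[OF lam v]] Supp_span])
    obtain B :: "(nat set list \<Rightarrow> 'k) set" where "finite B" "T.independent B" "B \<subseteq> Dem n r v"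
      "T.span (DI n r (?L v)) \<inter> T.span B \<subseteq> {0}" "Dem n r v = T.span (DI n r (?L v) \<union> B)"
      by (rule T.complement_basis[OF subspace_DI sub subspace_Dem fd finite_Supp_basis])
    moreover have "T.span (DI n r (?L v)) = (DI n r (?L v) :: (_ \<Rightarrow> 'k) set)"
      by (simp only: T.span_eq_iff subspace_DI)
    ultimately show ?thesis by auto
  qed
  obtain B :: "(nat \<Rightarrow> nat) \<Rightarrow> (nat set list \<Rightarrow> 'k) set" where B: "\<And>v. v \<in> ?O \<Longrightarrow> finite (B v) \<and> T.independent (B v) \<and> B v \<subseteq> Dem n r v \<and>
        DI n r (?L v) \<inter> T.span (B v) \<subseteq> {0} \<and> Dem n r v = T.span (DI n r (?L v) \<union> B v)"
    using ex by metis
  have idO: "ideal n lam ?O" by (simp add: ideal_def)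
  have fam: "T.independent (\<Union>v\<in>I. B v) \<and> T.span (\<Union>v\<in>I. B v) = DI n r I \<and> disjoint_family_on B I"
    if "ideal n lam I" for I
    by (rule adapted_family[OF lam _ that]) (rule B)
  have disj: "disjoint_family_on B ?O" using fam[OF idO] by blast
  define \<kappa> where "\<kappa> b = (THE v. v \<in> ?O \<and> b \<in> B v)" for b
  have \<kappa>: "\<kappa> b = v" if "v \<in> ?O" "b \<in> B v" for b v
    unfolding \<kappa>_def using that disj unfolding disjoint_family_on_def by (intro the_equality) blast+
  show ?thesis
  proof
    show "T.independent (\<Union>v\<in>?O. B v)" using fam[OF idO] by blast
    show "\<kappa> b \<in> ?O" if "b \<in> (\<Union>v\<in>?O. B v)" for b using that \<kappa> by auto
    show "Dem n r v = T.span {b \<in> \<Union>v\<in>?O. B v. bruhat_le (\<kappa> b) v}" if v: "v \<in> ?O" for v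
    proof -
      have "{b \<in> \<Union>v\<in>?O. B v. bruhat_le (\<kappa> b) v} = (\<Union>u\<in>down n lam {v}. B u)"
        using \<kappa> by (auto simp: down_def)
      moreover have "T.span (\<Union>u\<in>down n lam {v}. B u) = DI n r (down n lam {v})"
        using fam[OF ideal_down] by blast
      moreover have "DI n r (down n lam {v}) = (Dem n r v :: (_ \<Rightarrow> 'k) set)"
        by (rule DI_down_single[OF lam v])
      ultimately show ?thesis by simp
    qed
    show "\<exists>b\<in>\<Union>v\<in>?O. B v. \<kappa> b = v" if v: "v \<in> ?O" for v
    proof -
      \<comment> \<open>An empty complement would put the extremal vector of \<open>v\<close> into
        the sum of strictly smaller modules.\<close>
      have "B v \<noteq> {}"
      proof
        assume "B v = {}"
        then have "Dem n r v = (DI n r (?L v) :: (_ \<Rightarrow> 'k) set)"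
          using B[OF v] by (metis T.span_eq_iff subspace_DI sup_bot_right)
        then have "(evec r v :: _ \<Rightarrow> 'k) \<in> DI n r (?L v)" using evec_Dem by blast
        moreover have "ideal n lam (?L v)"
        proof (rule ideal_Diff_maximal[OF ideal_down])
          show "v \<in> down n lam {v}" using v by (simp add: down_def)
          show "u = v" if "u \<in> down n lam {v}" "bruhat_le v u" for u
            using that bruhat_antisym[of u v] by (simp add: down_def)
        qed
        ultimately have "v \<in> ?L v" using evec_DI_iff[OF lam _ v] by blast
        then show False by blast
      qed
      then show ?thesis using v \<kappa> by blast
    qed
  qed
qed

section \<open>The submodule generated by the highest weight vector\<close>

lemma mv_sum:
  "mv i a b x t = (\<Sum>p<length t. of_bool (a \<in> t ! p \<and> b \<notin> t ! p) * x (t[p := sw i (t ! p)]))"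
proof (induction t arbitrary: x)
  case (Cons S t)
  show ?case
    unfolding mv.simps Cons length_Cons sum.lessThan_Suc_shift by simp
qed simp

text \<open>The form for which the monomials are orthonormal; it is contravariant by
  \<open>ff_adjoint\<close>.\<close>

definition pr :: "nat \<Rightarrow> nat \<Rightarrow> (nat set list \<Rightarrow> 'k::field) \<Rightarrow> (nat set list \<Rightarrow> 'k) \<Rightarrow> 'k" where
  "pr n r x z = (\<Sum>t\<in>idx n r. x t * z t)"

lemma pr_add: "pr n r (x + y) z = pr n r x z + pr n r y z"
  and pr_scl: "pr n r (scl c x) z = c * pr n r x z"
  and pr_diff: "pr n r (x - y) z = pr n r x z - pr n r y z"
  by (simp_all add: pr_def scl_apply algebra_simps sum.distrib sum_distrib_left sum_subtractf)

lemma pr_commute: "pr n r x z = pr n r z x"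
  by (simp add: pr_def mult.commute)

lemma pr_zero: "pr n r 0 z = 0"
  by (simp add: pr_def)

lemma subspace_orth: "T.subspace {z. pr n r x z = 0}"
  unfolding pr_commute[of n r x] by (rule T.subspaceI) (simp_all add: pr_add pr_scl pr_zero)

lemma ff_adjoint:
  assumes i: "Suc i < n"
  shows "pr n r (ff i x) z = pr n r x (ee i z)"
proof -
  let ?u = "\<lambda>p (t :: nat set list). t[p := sw i (t ! p)]"
  have "pr n r (ff i x) z
      = (\<Sum>t\<in>idx n r. \<Sum>p<r. of_bool (Suc i \<in> t ! p \<and> i \<notin> t ! p) * x (?u p t) * z t)"
    unfolding pr_def ff_def mv_sum
  proof (rule sum.cong[OF refl])
    fix t assume "t \<in> idx n r"
    then have len: "length t = r" by (simp add: idx_def)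
    show "(\<Sum>p<length t. of_bool (Suc i \<in> t ! p \<and> i \<notin> t ! p) * x (?u p t)) * z t
        = (\<Sum>p<r. of_bool (Suc i \<in> t ! p \<and> i \<notin> t ! p) * x (?u p t) * z t)"
      unfolding len by (rule sum_distrib_right)
  qed
  also have "\<dots> = (\<Sum>p<r. \<Sum>t\<in>idx n r. of_bool (Suc i \<in> t ! p \<and> i \<notin> t ! p) * x (?u p t) * z t)"
    by (rule sum.swap)
  also have "\<dots> = (\<Sum>p<r. \<Sum>t\<in>idx n r. of_bool (i \<in> t ! p \<and> Suc i \<notin> t ! p) * x t * z (?u p t))"
  proof (rule sum.cong[OF refl])
    fix p assume "p \<in> {..<r}"
    then have p: "p < length t" if "t \<in> idx n r" for t using that by (simp add: idx_def)
    show "(\<Sum>t\<in>idx n r. of_bool (Suc i \<in> t ! p \<and> i \<notin> t ! p) * x (?u p t) * z t)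
        = (\<Sum>t\<in>idx n r. of_bool (i \<in> t ! p \<and> Suc i \<notin> t ! p) * x t * z (?u p t))"
    proof (rule sum.reindex_bij_witness[where i = "?u p" and j = "?u p"])
      fix t assume t: "t \<in> idx n r"
      show "?u p (?u p t) = t" using p[OF t] by simp
      show "?u p t \<in> idx n r" using idx_sw[OF i p[OF t]] t by simp
      then show "of_bool (i \<in> ?u p t ! p \<and> Suc i \<notin> ?u p t ! p) * x (?u p t) * z (?u p (?u p t))
          = of_bool (Suc i \<in> t ! p \<and> i \<notin> t ! p) * x (?u p t) * z t"
        using p[OF t] by (simp add: in_sw)
    qed (use p idx_sw[OF i] in simp_all)
  qed
  also have "\<dots> = (\<Sum>t\<in>idx n r. \<Sum>p<r. of_bool (i \<in> t ! p \<and> Suc i \<notin> t ! p) * x t * z (?u p t))"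
    by (rule sum.swap)
  also have "\<dots> = pr n r x (ee i z)"
    unfolding pr_def ee_def mv_sum
  proof (rule sum.cong[OF refl])
    fix t assume "t \<in> idx n r"
    then have len: "length t = r" by (simp add: idx_def)
    show "(\<Sum>p<r. of_bool (i \<in> t ! p \<and> Suc i \<notin> t ! p) * x t * z (?u p t))
        = x t * (\<Sum>p<length t. of_bool (i \<in> t ! p \<and> Suc i \<notin> t ! p) * z (?u p t))"
      unfolding len sum_distrib_left by (intro sum.cong refl) (simp only: ac_simps)
  qed
  finally show ?thesis .
qed

definition fwords :: "nat \<Rightarrow> nat \<Rightarrow> (nat \<Rightarrow> nat) \<Rightarrow> (nat set list \<Rightarrow> 'k::field) set" where
  "fwords n r lam = {foldr ff is (evec r lam) | is. set is \<subseteq> {i. Suc i < n}}"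

definition M0 :: "nat \<Rightarrow> nat \<Rightarrow> (nat \<Rightarrow> nat) \<Rightarrow> (nat set list \<Rightarrow> 'k::field) set" where
  "M0 n r lam = T.span (fwords n r lam)"

lemma subspace_M0 [simp]: "T.subspace (M0 n r lam)"
  by (simp add: M0_def)

lemma evec_M0: "evec r lam \<in> M0 n r lam"
  unfolding M0_def fwords_def by (rule T.span_base, rule CollectI, rule exI[of _ "[]"]) simp

lemma ff_M0:
  assumes "Suc i < n" "x \<in> M0 n r lam"
  shows "ff i x \<in> M0 n r lam"
  using assms(2) unfolding M0_def
proof (rule ff_span_stable[rotated])
  fix g :: "nat set list \<Rightarrow> 'a" assume "g \<in> fwords n r lam"
  then obtain "is" where "g = foldr ff is (evec r lam)" "set is \<subseteq> {i. Suc i < n}"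
    unfolding fwords_def by blast
  then have "ff i g = foldr ff (i # is) (evec r lam)" "set (i # is) \<subseteq> {i. Suc i < n}"
    using assms(1) by auto
  then show "ff i g \<in> T.span (fwords n r lam)"
    unfolding fwords_def by (intro T.span_base CollectI exI[of _ "i # is"] conjI)
qed

lemma M0_minimal:
  assumes Z: "T.subspace Z" "evec r lam \<in> Z" "\<And>i x. Suc i < n \<Longrightarrow> x \<in> Z \<Longrightarrow> ff i x \<in> Z"
  shows "M0 n r lam \<subseteq> Z"
  unfolding M0_def
proof (rule T.span_minimal[OF _ Z(1)])
  have "foldr ff is (evec r lam) \<in> Z" if "set is \<subseteq> {i. Suc i < n}" for "is"
    using that by (induction "is") (auto simp: Z)
  then show "fwords n r lam \<subseteq> Z" unfolding fwords_def by auto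
qed

lemma M0_Supp: "bdd n r lam \<Longrightarrow> M0 n r lam \<subseteq> Supp n r"
  by (rule M0_minimal) (simp_all add: subspace_Supp evec_Supp ff_Supp bddD)

lemma mv_of_rat: "mv i a b (\<lambda>t. of_rat (x t) :: 'k::field_char_0) t = of_rat (mv i a b x t)"
  by (induction t arbitrary: x) (simp_all add: of_rat_add)

text \<open>The operators have integral matrix entries on monomials, so the words that span the
  submodule are images of rational vectors.\<close>

lemma foldr_of_rat:
  "(foldr ff is (evec r lam) :: _ \<Rightarrow> 'k::field_char_0) = (\<lambda>t. of_rat (foldr ff is (evec r lam) t))"
proof (induction "is")
  case Nil
  show ?case by (auto simp: evec_def delta_def)
next
  case (Cons i "is")
  show ?case
    unfolding foldr.simps comp_apply Cons by (rule ext) (simp add: ff_def mv_of_rat)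
qed

text \<open>Gram-Schmidt for possibly dependent vectors: if the part of \<open>f\<close> orthogonal
  to \<open>F\<close> is isotropic, it vanishes by positivity over the rationals, and
  \<open>f\<close> adds nothing.\<close>

lemma orthogonal_projection:
  fixes F :: "(nat set list \<Rightarrow> rat) set"
  assumes "finite F" "F \<subseteq> Supp n r"
  shows "\<exists>p\<in>T.span F. \<forall>y\<in>F. pr n r (x - p) y = 0"
  using assms
proof (induction F arbitrary: x rule: finite_induct)
  case empty
  then show ?case by (auto intro: T.span_zero)
next
  case (insert f F)
  have spanF: "pr n r u y = 0" if "\<forall>y\<in>F. pr n r u y = 0" "y \<in> T.span F" for u y
    using T.span_minimal[of F "{z. pr n r u z = 0}", OF _ subspace_orth] that by blast
  obtain g where g: "g \<in> T.span F" "\<forall>y\<in>F. pr n r (f - g) y = 0" using insert.IH[of f] insert.prems by blast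
  obtain p where p: "p \<in> T.span F" "\<forall>y\<in>F. pr n r (x - p) y = 0" using insert.IH[of x] insert.prems by blast
  let ?f = "f - g"
  have mono: "T.span F \<subseteq> T.span (insert f F)" by (rule T.span_mono) blast
  show ?case
  proof (cases "pr n r ?f ?f = 0")
    case True
    have "T.span F \<subseteq> Supp n r" by (rule T.span_minimal) (use insert.prems subspace_Supp in auto)
    then have fS: "?f \<in> Supp n r"
      using insert.prems g(1) by (intro T.subspace_diff[OF subspace_Supp]) auto
    have "?f t = 0" if "t \<in> idx n r" for t
      using True that sum_nonneg_eq_0_iff[of "idx n r" "\<lambda>t. ?f t * ?f t"] finite_idx[of n r]
      unfolding pr_def by simp
    then have "?f = 0" using fS unfolding Supp_def by (intro ext) auto
    then have "f \<in> T.span F" using g(1) by simp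
    then have "pr n r (x - p) f = 0" by (rule spanF[OF p(2)])
    then have "\<forall>y\<in>insert f F. pr n r (x - p) y = 0" using p(2) by blast
    then show ?thesis using p(1) mono by blast
  next
    case False
    define c where "c = pr n r (x - p) ?f / pr n r ?f ?f"
    let ?p = "p + scl c ?f"
    have eq: "x - ?p = (x - p) - scl c ?f" by simp
    have orth: "pr n r (x - ?p) y = 0" if "y \<in> F" for y
    proof -
      have "pr n r (x - p) y = 0" "pr n r (f - g) y = 0" using p(2) g(2) that by blast+
      then show ?thesis unfolding eq pr_diff[of n r "x - p"] pr_scl by simp
    qed
    have "pr n r (x - ?p) ?f = 0"
    proof -
      have "pr n r (x - ?p) ?f = pr n r (x - p) ?f - c * pr n r ?f ?f"
        unfolding eq pr_diff[of n r "x - p"] pr_scl ..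
      then show ?thesis using False by (simp add: c_def)
    qed
    moreover have "pr n r (x - ?p) g = 0"
      by (rule spanF[OF _ g(1)]) (use orth in blast)
    ultimately have "pr n r (x - ?p) f = 0"
      using pr_add[of n r ?f g "x - ?p"] unfolding pr_commute[of n r "x - ?p"] by simp
    moreover have "?p \<in> T.span (insert f F)"
      using p(1) g(1) mono by (intro T.span_add T.span_scale T.span_diff) (auto intro: T.span_base)
    ultimately show ?thesis using orth by blast
  qed
qed

lemma pr_of_rat: "pr n r (\<lambda>t. of_rat (x t)) (\<lambda>t. of_rat (y t)) = (of_rat (pr n r x y) :: 'k::field_char_0)"
  by (simp add: pr_def of_rat_sum of_rat_mult)

text \<open>The contravariant form is positive definite over the rationals, and the submodule is spanned by
  integral vectors; hence its radical vanishes over any field of characteristic 0.\<close>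

lemma M0_nondegenerate:
  fixes x :: "nat set list \<Rightarrow> 'k::field_char_0"
  assumes lam: "bdd n r lam" and x: "x \<in> M0 n r lam" and orth: "\<And>z. z \<in> M0 n r lam \<Longrightarrow> pr n r x z = 0"
  shows "x = 0"
proof -
  let ?W = "fwords n r lam :: (_ \<Rightarrow> rat) set"
  let ?L = "\<lambda>(u :: nat set list \<Rightarrow> rat) t. of_rat (u t) :: 'k"
  have W_Supp: "?W \<subseteq> Supp n r"
  proof -
    have "?W \<subseteq> M0 n r lam" unfolding M0_def by (rule T.span_superset)
    also have "\<dots> \<subseteq> Supp n r" by (rule M0_Supp[OF lam])
    finally show ?thesis .
  qed
  obtain F where F: "F \<subseteq> ?W" "T.independent F" "?W \<subseteq> T.span F"
    by (rule T.maximal_independent_subset)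
  have "F \<subseteq> T.span (delta ` idx n r)" by (rule order_trans[OF F(1) order_trans[OF W_Supp Supp_span]])
  then have finF: "finite F" using T.independent_span_bound[OF finite_Supp_basis F(2)] by simp
  have LW: "?L y \<in> M0 n r lam" if "y \<in> ?W" for y
  proof -
    obtain "is" where y: "y = foldr ff is (evec r lam)" "set is \<subseteq> {i. Suc i < n}"
      using \<open>y \<in> ?W\<close> unfolding fwords_def by blast
    have eq: "(foldr ff is (evec r lam) :: _ \<Rightarrow> 'k) = (\<lambda>t. of_rat (foldr ff is (evec r lam) t))"
      by (rule foldr_of_rat)
    have "?L y \<in> (fwords n r lam :: (_ \<Rightarrow> 'k) set)"
      unfolding y(1) eq[symmetric] fwords_def using y(2) by blast
    then show ?thesis unfolding M0_def by (rule T.span_base)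
  qed
  \<comment> \<open>The coordinate is the pairing with a monomial. Over the rationals that monomial
    splits into \<open>p\<close>, spanned by words, and \<open>?q\<close>, orthogonal to all words.
    The vector \<open>x\<close> is orthogonal to the first by assumption and to the second because
    it is itself spanned by words.\<close>
  have "x t = 0" if t: "t \<in> idx n r" for t
  proof -
    let ?d = "delta t :: _ \<Rightarrow> rat"
    obtain p where p: "p \<in> T.span F" "\<forall>y\<in>F. pr n r (?d - p) y = 0"
      using orthogonal_projection[OF finF, of n r ?d] F(1) W_Supp by auto
    let ?q = "?d - p"
    have "T.span F \<subseteq> {z. pr n r ?q z = 0}" using p(2) by (intro T.span_minimal subspace_orth) auto
    then have q: "pr n r ?q y = 0" if "y \<in> ?W" for y using that F(3) by blast
    have "T.subspace {u. ?L u \<in> M0 n r lam}"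
    proof (rule T.subspaceI; (elim CollectE)?; rule CollectI)
      have "?L 0 = 0" by (simp add: fun_eq_iff)
      moreover have "(0 :: nat set list \<Rightarrow> 'k) \<in> M0 n r lam" by (rule T.subspace_0[OF subspace_M0])
      ultimately show "?L 0 \<in> M0 n r lam" by (simp only:)
    next
      fix u v assume "?L u \<in> M0 n r lam" "?L v \<in> M0 n r lam"
      then have "?L u + ?L v \<in> M0 n r lam" by (rule T.subspace_add[OF subspace_M0])
      moreover have "?L (u + v) = ?L u + ?L v" by (auto simp: of_rat_add)
      ultimately show "?L (u + v) \<in> M0 n r lam" by (simp only:)
    next
      fix c u assume "?L u \<in> M0 n r lam"
      then have "scl (of_rat c) (?L u) \<in> M0 n r lam" by (rule T.subspace_scale[OF subspace_M0])
      moreover have "?L (scl c u) = scl (of_rat c) (?L u)" by (auto simp: of_rat_mult scl_apply)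
      ultimately show "?L (scl c u) \<in> M0 n r lam" by (simp only:)
    qed
    then have "T.span F \<subseteq> {u. ?L u \<in> M0 n r lam}" using F(1) LW by (intro T.span_minimal) auto
    then have "?L p \<in> M0 n r lam" using p(1) by blast
    then have "pr n r x (?L p) = 0" by (rule orth)
    moreover have "pr n r x (?L ?q) = 0"
    proof -
      have "M0 n r lam \<subseteq> {z. pr n r (?L ?q) z = 0}"
        unfolding M0_def
      proof (rule T.span_minimal[OF _ subspace_orth], rule subsetI, rule CollectI)
        fix z :: "nat set list \<Rightarrow> 'k" assume "z \<in> fwords n r lam"
        then obtain "is" where z: "z = foldr ff is (evec r lam)" "set is \<subseteq> {i. Suc i < n}"
          unfolding fwords_def by blast
        have "foldr ff is (evec r lam) \<in> ?W" using z(2) unfolding fwords_def by blast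
        then have "pr n r ?q (foldr ff is (evec r lam)) = 0" by (rule q)
        moreover have eq: "(foldr ff is (evec r lam) :: _ \<Rightarrow> 'k) = (\<lambda>t. of_rat (foldr ff is (evec r lam) t))"
          by (rule foldr_of_rat)
        ultimately show "pr n r (?L ?q) z = 0"
          unfolding z(1) eq pr_of_rat by (simp only: of_rat_0)
      qed
      then have "pr n r (?L ?q) x = 0" using x by blast
      then show ?thesis by (rule trans[OF pr_commute])
    qed
    moreover have "pr n r x (?L p) + pr n r x (?L ?q) = x t"
    proof -
      have "?L p + ?L ?q = (\<lambda>s. if s = t then 1 else 0)"
        by (auto simp: fun_eq_iff delta_def of_rat_diff)
      then have "pr n r (?L p) x + pr n r (?L ?q) x = pr n r (\<lambda>s. if s = t then 1 else 0) x"
        using pr_add[of n r "?L p" "?L ?q" x] by simp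
      also have "\<dots> = (\<Sum>s\<in>idx n r. if s = t then x s else 0)"
        unfolding pr_def by (intro sum.cong) auto
      also have "\<dots> = x t" using t finite_idx[of n r] by simp
      finally show ?thesis
        unfolding pr_commute[of n r "?L p" x] pr_commute[of n r "?L ?q" x] .
    qed
    ultimately show ?thesis by simp
  qed
  moreover have "x t = 0" if "t \<notin> idx n r" for t
  proof -
    have "x \<in> Supp n r" by (rule subsetD[OF M0_Supp[OF lam] x])
    then show ?thesis using that unfolding Supp_def by blast
  qed
  ultimately have "x t = 0" for t by blast
  then show ?thesis by (intro ext) simp
qed

text \<open>The coefficients drop by one per position, so every simple lowering operator decreases
  this height by exactly one.\<close>

definition htw :: "nat \<Rightarrow> nat set list \<Rightarrow> int" where
  "htw n t = (\<Sum>j<n. int (n - j) * wt t j)"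

lemma htw_al:
  assumes "wt t = al i (- 1) (wt t')" "Suc i < n"
  shows "htw n t = htw n t' - 1"
proof -
  have "htw n t = (\<Sum>j<n. int (n - j) * wt t' j - (int (n - j) * of_bool (j = i) - int (n - j) * of_bool (j = Suc i)))"
    unfolding htw_def assms(1) al_def by (intro sum.cong) (auto simp: algebra_simps)
  also have "\<dots> = htw n t' - ((\<Sum>j<n. int (n - j) * of_bool (j = i)) - (\<Sum>j<n. int (n - j) * of_bool (j = Suc i)))"
    unfolding htw_def sum_subtractf ..
  also have "(\<Sum>j<n. int (n - j) * of_bool (j = k)) = int (n - k)" if "k < n" for k
  proof -
    have "(\<Sum>j<n. int (n - j) * of_bool (j = k)) = (\<Sum>j<n. if j = k then int (n - j) else 0)"
      by (intro sum.cong) auto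
    then show ?thesis using that by simp
  qed
  from this[of i] this[of "Suc i"] assms(2) have "(\<Sum>j<n. int (n - j) * of_bool (j = i)) - (\<Sum>j<n. int (n - j) * of_bool (j = Suc i)) = 1"
    by simp
  finally show ?thesis .
qed

lemma M0_coord:
  assumes x: "(x :: nat set list \<Rightarrow> 'k::field) \<in> M0 n r lam" "x t \<noteq> 0"
  shows "t = cols r lam \<or> htw n t < htw n (cols r lam)"
proof -
  let ?Z = "{x :: nat set list \<Rightarrow> 'k. \<forall>t. x t \<noteq> 0 \<longrightarrow> t = cols r lam \<or> htw n t < htw n (cols r lam)}"
  have "M0 n r lam \<subseteq> ?Z"
  proof (rule M0_minimal)
    show "T.subspace ?Z"
    proof (rule T.subspaceI)
      fix x y :: "nat set list \<Rightarrow> 'k" assume xy: "x \<in> ?Z" "y \<in> ?Z"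
      have "x t \<noteq> 0 \<or> y t \<noteq> 0" if "(x + y) t \<noteq> 0" for t using that by auto
      then show "x + y \<in> ?Z" using xy by blast
    qed (simp_all add: scl_apply)
    show "evec r lam \<in> ?Z" by (simp add: evec_nonzero)
    fix i and x :: "nat set list \<Rightarrow> 'k" assume i: "Suc i < n" and x: "x \<in> ?Z"
    show "ff i x \<in> ?Z"
    proof (intro CollectI allI impI)
      fix t assume "ff i x t \<noteq> 0"
      then obtain q where q: "q < length t" "Suc i \<in> t ! q" "i \<notin> t ! q" "x (t[q := sw i (t ! q)]) \<noteq> 0"
        unfolding ff_def using mv_nonzero[of i "Suc i" i x t] by blast
      have "htw n t = htw n (t[q := sw i (t ! q)]) - 1"
        by (rule htw_al[OF wt_sw_f[OF q(1-3)] i])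
      moreover have "htw n (t[q := sw i (t ! q)]) \<le> htw n (cols r lam)"
        using x q(4) by fastforce
      ultimately show "t = cols r lam \<or> htw n t < htw n (cols r lam)" by simp
    qed
  qed
  then show ?thesis using x by blast
qed

lemma M0_highest:
  assumes lam: "bdd n r lam" and x: "x \<in> M0 n r lam" "x \<in> Wt (\<lambda>j. int (lam j))"
  shows "\<exists>c. x = scl c (evec r lam)"
proof -
  have "t = cols r lam" if "x t \<noteq> 0" for t
  proof -
    have "wt t = (\<lambda>j. int (lam j))" using x(2) that by (auto simp: Wt_def)
    moreover have "wt (cols r lam) = (\<lambda>j. int (lam j))" using wt_cols bddD(1)[OF lam] by blast
    ultimately have "htw n t = htw n (cols r lam)" by (simp add: htw_def)
    then show ?thesis using M0_coord[OF x(1) that] by simp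
  qed
  then have "x = scl (x (cols r lam)) (delta (cols r lam))" by (rule eq_scl_delta)
  then show ?thesis unfolding evec_def by blast
qed

text \<open>A monomial in the image of \<open>ff i\<close> has a factor with \<open>Suc i\<close>
  but without \<open>i\<close>, and no column of a dominant weight is of this kind.\<close>

lemma ff_coord_dominant:
  assumes "dominant n lam" "Suc i < n"
  shows "ff i (x :: _ \<Rightarrow> 'k::field) (cols r lam) = 0"
proof (rule ccontr)
  assume "ff i x (cols r lam) \<noteq> 0"
  then obtain q where q: "q < r" "Suc i \<in> cols r lam ! q" "i \<notin> cols r lam ! q"
    unfolding ff_def using mv_nonzero[of i "Suc i" i x "cols r lam"] by auto
  then have "q < lam (Suc i)" "\<not> q < lam i" by (simp_all add: nth_cols)
  then show False using assms by (force simp: dominant_def)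
qed

section \<open>Irreducible highest weight modules\<close>

definition hT :: "nat \<Rightarrow> (nat set list \<Rightarrow> 'k::field) \<Rightarrow> nat set list \<Rightarrow> 'k" where
  "hT j x = (\<lambda>t. of_int (wt t j) * x t)"

lemma hT_add: "hT j (x + y) = hT j x + hT j y"
  and hT_scl: "hT j (scl c x) = scl c (hT j x)"
  by (simp_all add: hT_def fun_eq_iff scl_apply algebra_simps)

lemma hT_Wt: "x \<in> Wt \<mu> \<Longrightarrow> hT j x = scl (of_int (\<mu> j)) x"
  unfolding hT_def Wt_def scl_def by (rule ext) auto

lemma ee_ff_hT: "ee i (ff i x) = ff i (ee i x) + (hT i x + scl (- 1) (hT (Suc i) x))"
  by (simp add: fun_eq_iff ee_ff_same hT_def scl_apply algebra_simps)

lemma hT_ff: "hT j (ff i x) = ff i (hT j x) + scl (- of_int (of_bool (j = i) - of_bool (j = Suc i))) (ff i x)"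
proof
  fix t
  let ?c = "of_bool (j = i) - of_bool (j = Suc i) :: int"
  have "ff i (hT j x) t = ff i (scl (of_int (wt t j + ?c)) x) t"
    unfolding ff_def
  proof (rule mv_cong)
    fix p assume p: "p < length t" "Suc i \<in> t ! p" "i \<notin> t ! p"
    have "wt t j = wt (t[p := sw i (t ! p)]) j - ?c"
      unfolding wt_sw_f[OF p] by (simp add: al_def)
    then have "wt (t[p := sw i (t ! p)]) j = wt t j + ?c" by simp
    then show "hT j x (t[p := sw i (t ! p)]) = scl (of_int (wt t j + ?c)) x (t[p := sw i (t ! p)])"
      unfolding hT_def scl_apply by (simp only:)
  qed
  also have "\<dots> = of_int (wt t j + ?c) * ff i x t"
    unfolding ff_def by (rule mv_scl)
  finally show "hT j (ff i x) t = (ff i (hT j x) + scl (- of_int ?c) (ff i x)) t"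
    unfolding plus_fun_apply scl_apply by (simp add: hT_def algebra_simps)
qed

text \<open>An irreducible module seen only through Chevalley generators. Which matrices play these
  roles is left open, so that both triangular Borel subalgebras are treated at once.\<close>

locale chevalley_module = vector_space scale
  for scale :: "'k::field_char_0 \<Rightarrow> 'v::ab_group_add \<Rightarrow> 'v" +
  fixes n :: nat and e f h :: "nat \<Rightarrow> 'v \<Rightarrow> 'v"
  assumes linear_e: "Suc i < n \<Longrightarrow> Vector_Spaces.linear scale scale (e i)"
    and linear_f: "Suc i < n \<Longrightarrow> Vector_Spaces.linear scale scale (f i)"
    and linear_h: "j < n \<Longrightarrow> Vector_Spaces.linear scale scale (h j)"
    and ef_other: "Suc i < n \<Longrightarrow> Suc j < n \<Longrightarrow> i \<noteq> j \<Longrightarrow> e i (f j x) = f j (e i x)"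
    and ef_same: "Suc i < n \<Longrightarrow> e i (f i x) = f i (e i x) + (h i x + scale (- 1) (h (Suc i) x))"
    and hf: "j < n \<Longrightarrow> Suc i < n \<Longrightarrow>
        h j (f i x) = f i (h j x) + scale (- of_int (of_bool (j = i) - of_bool (j = Suc i))) (f i x)"
    and irreducible: "subspace U \<Longrightarrow> (\<And>i x. Suc i < n \<Longrightarrow> x \<in> U \<Longrightarrow> e i x \<in> U) \<Longrightarrow>
        (\<And>i x. Suc i < n \<Longrightarrow> x \<in> U \<Longrightarrow> f i x \<in> U) \<Longrightarrow> (\<And>j x. j < n \<Longrightarrow> x \<in> U \<Longrightarrow> h j x \<in> U) \<Longrightarrow>
        U = {0} \<or> U = UNIV"
begin

lemma e_linear: "Suc i < n \<Longrightarrow> e i (x + y) = e i x + e i y" "Suc i < n \<Longrightarrow> e i (scale c x) = scale c (e i x)"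
    "Suc i < n \<Longrightarrow> e i 0 = 0"
  and f_linear: "Suc i < n \<Longrightarrow> f i (x + y) = f i x + f i y" "Suc i < n \<Longrightarrow> f i (scale c x) = scale c (f i x)"
    "Suc i < n \<Longrightarrow> f i 0 = 0"
  and h_linear: "j < n \<Longrightarrow> h j (x + y) = h j x + h j y" "j < n \<Longrightarrow> h j (scale c x) = scale c (h j x)"
    "j < n \<Longrightarrow> h j 0 = 0"
proof -
  show "e i (x + y) = e i x + e i y" "e i (scale c x) = scale c (e i x)" "e i 0 = 0" if "Suc i < n" for i x y c
  proof -
    interpret l: Vector_Spaces.linear scale scale "e i" by (rule linear_e[OF that])
    show "e i (x + y) = e i x + e i y" "e i (scale c x) = scale c (e i x)" "e i 0 = 0"
      by (rule l.add l.scale l.zero)+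
  qed
  show "f i (x + y) = f i x + f i y" "f i (scale c x) = scale c (f i x)" "f i 0 = 0" if "Suc i < n" for i x y c
  proof -
    interpret l: Vector_Spaces.linear scale scale "f i" by (rule linear_f[OF that])
    show "f i (x + y) = f i x + f i y" "f i (scale c x) = scale c (f i x)" "f i 0 = 0"
      by (rule l.add l.scale l.zero)+
  qed
  show "h j (x + y) = h j x + h j y" "h j (scale c x) = scale c (h j x)" "h j 0 = 0" if "j < n" for j x y c
  proof -
    interpret l: Vector_Spaces.linear scale scale "h j" by (rule linear_h[OF that])
    show "h j (x + y) = h j x + h j y" "h j (scale c x) = scale c (h j x)" "h j 0 = 0"
      by (rule l.add l.scale l.zero)+
  qed
qed

end

locale highest_weight_module = chevalley_module scale n e f h
  for scale :: "'k::field_char_0 \<Rightarrow> 'v::ab_group_add \<Rightarrow> 'v" and n e f h +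
  fixes r :: nat and lam :: "nat \<Rightarrow> nat" and v0 :: 'v
  assumes lam: "bdd n r lam" and dom: "dominant n lam"
    and v0: "v0 \<noteq> 0" and h_v0: "j < n \<Longrightarrow> h j v0 = scale (of_nat (lam j)) v0"
    and e_v0: "Suc i < n \<Longrightarrow> e i v0 = 0"
begin

text \<open>The submodule of the direct sum of the tensor product and the given module generated by the
  pair of highest weight vectors; it turns out to be the graph of an isomorphism.\<close>

inductive graph :: "(nat set list \<Rightarrow> 'k) \<Rightarrow> 'v \<Rightarrow> bool" where
  base: "graph (evec r lam) v0"
| add: "graph x y \<Longrightarrow> graph x' y' \<Longrightarrow> graph (x + x') (y + y')"
| smult: "graph x y \<Longrightarrow> graph (scl c x) (scale c y)"
| lower: "Suc i < n \<Longrightarrow> graph x y \<Longrightarrow> graph (ff i x) (f i y)"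

lemma graph_0: "graph 0 0"
  using smult[OF base, of 0] by simp

text \<open>The relation is generated by lowering operators alone; the others are commuted down to
  the pair of highest weight vectors, where both sides behave alike.\<close>

lemma graph_e_h: "graph x y \<Longrightarrow>
  (\<forall>i. Suc i < n \<longrightarrow> graph (ee i x) (e i y)) \<and> (\<forall>j<n. graph (hT j x) (h j y))"
proof (induction rule: graph.induct)
  case base
  have "ee i (evec r lam) = (0 :: _ \<Rightarrow> 'k)" if "Suc i < n" for i
    using dom that by (intro ee_evec) (simp add: dominant_def)
  moreover have "hT j (evec r lam) = (scl (of_nat (lam j)) (evec r lam) :: _ \<Rightarrow> 'k)" for j
    using hT_Wt[OF evec_Wt[of lam r, OF bddD(1)[OF lam]], of j] by simp
  ultimately show ?case
    by (auto simp only: e_v0 h_v0 graph_0 intro!: smult[OF graph.base])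
next
  case (add x y x' y')
  show ?case
  proof (intro conjI allI impI)
    show "graph (ee i (x + x')) (e i (y + y'))" if "Suc i < n" for i
      unfolding ee.add e_linear(1)[OF that] using add.IH that by (intro graph.add) blast+
    show "graph (hT j (x + x')) (h j (y + y'))" if "j < n" for j
      unfolding hT_add h_linear(1)[OF that] using add.IH that by (intro graph.add) blast+
  qed
next
  case (smult x y c)
  show ?case
  proof (intro conjI allI impI)
    show "graph (ee i (scl c x)) (e i (scale c y))" if "Suc i < n" for i
      unfolding ee.scale e_linear(2)[OF that] using smult.IH that by (intro graph.smult) blast
    show "graph (hT j (scl c x)) (h j (scale c y))" if "j < n" for j
      unfolding hT_scl h_linear(2)[OF that] using smult.IH that by (intro graph.smult) blast
  qed
next
  case (lower i x y)
  then have e: "\<And>i. Suc i < n \<Longrightarrow> graph (ee i x) (e i y)" and h: "\<And>j. j < n \<Longrightarrow> graph (hT j x) (h j y)"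
    by auto
  have "graph (ee k (ff i x)) (e k (f i y))" if k: "Suc k < n" for k
  proof (cases "k = i")
    case True
    show ?thesis
      unfolding True ee_ff_hT ef_same[OF lower.hyps(1)]
      by (intro graph.add graph.smult graph.lower lower.hyps(1) e h) (use lower.hyps(1) in auto)
  next
    case False
    show ?thesis
      unfolding ee_ff_commute[OF False] ef_other[OF k lower.hyps(1) False]
      by (intro graph.lower lower.hyps(1) e k)
  qed
  moreover have "graph (hT j (ff i x)) (h j (f i y))" if "j < n" for j
    unfolding hT_ff hf[OF that lower.hyps(1)]
    by (intro graph.add graph.smult graph.lower lower.hyps h that)
  ultimately show ?case by blast
qed

section \<open>Separating the highest weight vector from lower weights\<close>

definition hh :: "'v \<Rightarrow> 'v" where
  "hh y = (\<Sum>j<n. scale (of_nat (n - j)) (h j y))"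

definition top :: 'k where
  "top = (\<Sum>j<n. of_nat (n - j) * of_nat (lam j))"

lemma hh_linear: "hh (x + y) = hh x + hh y" "hh (scale c x) = scale c (hh x)"
  by (simp_all add: hh_def h_linear scale_right_distrib sum.distrib scale_sum_right mult.commute)

lemma hh_v0: "hh v0 = scale top v0"
  by (simp add: hh_def top_def h_v0 scale_sum_left)

lemma hh_f:
  assumes i: "Suc i < n"
  shows "hh (f i y) = f i (hh y) + scale (- 1) (f i y)"
proof -
  interpret f: Vector_Spaces.linear scale scale "f i" by (rule linear_f[OF i])
  have "hh (f i y) = (\<Sum>j<n. scale (of_nat (n - j)) (f i (h j y))
      + scale (of_nat (n - j) * - of_int (of_bool (j = i) - of_bool (j = Suc i))) (f i y))"
    unfolding hh_def by (intro sum.cong refl) (simp add: hf[OF _ i] scale_right_distrib)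
  also have "\<dots> = f i (hh y)
      + scale (\<Sum>j<n. of_nat (n - j) * - of_int (of_bool (j = i) - of_bool (j = Suc i))) (f i y)"
    unfolding sum.distrib hh_def f.sum f.scale scale_sum_left ..
  also have "(\<Sum>j<n. of_nat (n - j) * - of_int (of_bool (j = i) - of_bool (j = Suc i))) = (- 1 :: 'k)"
  proof -
    have "(\<Sum>j<n. of_nat (n - j) * - of_int (of_bool (j = i) - of_bool (j = Suc i)))
        = (\<Sum>j<n. (if j = Suc i then of_nat (n - j) else 0) - (if j = i then of_nat (n - j) else (0 :: 'k)))"
      by (intro sum.cong) auto
    also have "\<dots> = of_nat (n - Suc i) - of_nat (n - i)"
      unfolding sum_subtractf using i by simp
    also have "n - i = Suc (n - Suc i)" using i by simp
    finally show ?thesis by simp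
  qed
  finally show ?thesis .
qed

text \<open>Eigenspaces of the height operator \<open>hh\<close> at least one step below the
  eigenvalue of \<open>v0\<close>. They stand in for the sum of the lower weight spaces, as no
  weight decomposition of the module is given.\<close>

definition lowers :: "'v set" where
  "lowers = span {y. \<exists>p. 1 \<le> p \<and> hh y = scale (top - of_nat p) y}"

lemma f_lowers:
  assumes i: "Suc i < n" and y: "y \<in> lowers"
  shows "f i y \<in> lowers"
proof -
  interpret f: Vector_Spaces.linear scale scale "f i" by (rule linear_f[OF i])
  have "lowers \<subseteq> {y. f i y \<in> lowers}"
    unfolding lowers_def
  proof (rule span_minimal)
    show "subspace {y. f i y \<in> span {y. \<exists>p. 1 \<le> p \<and> hh y = scale (top - of_nat p) y}}"
      by (rule f.subspace_linear_preimage) simp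
    show "{y. \<exists>p. 1 \<le> p \<and> hh y = scale (top - of_nat p) y}
        \<subseteq> {y. f i y \<in> span {y. \<exists>p. 1 \<le> p \<and> hh y = scale (top - of_nat p) y}}"
    proof (rule subsetI, elim CollectE exE conjE, rule CollectI, rule span_base, rule CollectI)
      fix y p assume "1 \<le> p" and "hh y = scale (top - of_nat p) y"
      have "hh (f i y) = scale (top - of_nat (Suc p)) (f i y)"
        unfolding hh_f[OF i] \<open>hh y = scale (top - of_nat p) y\<close> f.scale scale_left_distrib[symmetric]
        by (simp add: algebra_simps)
      then show "\<exists>p. 1 \<le> p \<and> hh (f i y) = scale (top - of_nat p) (f i y)"
        by (intro exI[of _ "Suc p"] conjI) simp_all
    qed
  qed
  then show ?thesis using y by blast
qed

lemma f_v0_lowers: "Suc i < n \<Longrightarrow> f i v0 \<in> lowers"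
  unfolding lowers_def
proof (rule span_base, rule CollectI, rule exI[of _ 1])
  assume i: "Suc i < n"
  show "1 \<le> (1::nat) \<and> hh (f i v0) = scale (top - of_nat 1) (f i v0)"
    unfolding hh_f[OF i] hh_v0 by (simp add: f_linear[OF i] scale_left_diff_distrib)
qed

text \<open>The product of the operators \<open>hh - top + p\<close> for
  \<open>p = 1, ..., m\<close>. It kills the eigenspaces up to \<open>m\<close> steps below the top
  and multiplies \<open>v0\<close> by the factorial of \<open>m\<close>, which is nonzero in
  characteristic 0.\<close>

primrec annihilate :: "nat \<Rightarrow> 'v \<Rightarrow> 'v" where
  "annihilate 0 y = y"
| "annihilate (Suc m) y = annihilate m (hh y + scale (of_nat (Suc m) - top) y)"

lemma annihilate_linear:
  "annihilate m (x + y) = annihilate m x + annihilate m y"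
  "annihilate m (scale c x) = scale c (annihilate m x)"
proof -
  show "annihilate m (x + y) = annihilate m x + annihilate m y"
  proof (induction m arbitrary: x y)
    case (Suc m)
    have "hh (x + y) + scale (of_nat (Suc m) - top) (x + y)
        = (hh x + scale (of_nat (Suc m) - top) x) + (hh y + scale (of_nat (Suc m) - top) y)"
      by (simp add: hh_linear scale_right_distrib add_ac)
    then show ?case by (simp only: annihilate.simps Suc)
  qed simp
  show "annihilate m (scale c x) = scale c (annihilate m x)"
  proof (induction m arbitrary: x)
    case (Suc m)
    have "hh (scale c x) + scale (of_nat (Suc m) - top) (scale c x)
        = scale c (hh x + scale (of_nat (Suc m) - top) x)"
      by (simp add: hh_linear scale_right_distrib mult.commute)
    then show ?case by (simp only: annihilate.simps Suc)
  qed simp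
qed

lemma annihilate_eigen:
  assumes "hh y = scale (top - c) y"
  shows "annihilate m y = scale (\<Prod>p = 1..m. of_nat p - c) y"
proof (induction m)
  case (Suc m)
  have "hh y + scale (of_nat (Suc m) - top) y = scale (of_nat (Suc m) - c) y"
    unfolding assms scale_left_distrib[symmetric] by simp
  then have "annihilate (Suc m) y = scale (of_nat (Suc m) - c) (annihilate m y)"
    by (simp only: annihilate.simps annihilate_linear(2))
  then show ?case
    using Suc by (simp add: prod.nat_ivl_Suc' mult.commute)
qed simp

lemma annihilate_lowers:
  assumes "y \<in> lowers"
  shows "\<exists>m. \<forall>m'\<ge>m. annihilate m' y = 0"
  using assms unfolding lowers_def
proof (induction rule: span_induct)
  case base
  show ?case
  proof (rule subspaceI; (elim CollectE)?; rule CollectI)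
    have "annihilate m 0 = 0" for m using annihilate_linear(2)[of m 0 0] by simp
    then show "\<exists>m. \<forall>m'\<ge>m. annihilate m' 0 = 0" by blast
  next
    fix x y assume "\<exists>m. \<forall>m'\<ge>m. annihilate m' x = 0" "\<exists>m. \<forall>m'\<ge>m. annihilate m' y = 0"
    then obtain a b where ab: "\<forall>m'\<ge>a. annihilate m' x = 0" "\<forall>m'\<ge>b. annihilate m' y = 0" by blast
    then show "\<exists>m. \<forall>m'\<ge>m. annihilate m' (x + y) = 0"
      by (intro exI[of _ "max a b"]) (simp add: annihilate_linear)
  next
    fix c x assume "\<exists>m. \<forall>m'\<ge>m. annihilate m' x = 0"
    then obtain a where "\<forall>m'\<ge>a. annihilate m' x = 0" by blast
    then show "\<exists>m. \<forall>m'\<ge>m. annihilate m' (scale c x) = 0"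
      by (intro exI[of _ a]) (simp add: annihilate_linear)
  qed
next
  case (step y)
  then obtain p where p: "1 \<le> p" "hh y = scale (top - of_nat p) y" by blast
  have "annihilate m y = 0" if "p \<le> m" for m
  proof -
    have "(\<Prod>q = 1..m. of_nat q - of_nat p) = (0 :: 'k)"
      using p(1) that by (intro prod_zero) (auto intro!: bexI[of _ p])
    then show ?thesis unfolding annihilate_eigen[OF p(2)] by simp
  qed
  then show ?case by blast
qed

lemma v0_not_lowers: "v0 \<notin> lowers"
proof
  assume "v0 \<in> lowers"
  then obtain m where "annihilate m v0 = 0" using annihilate_lowers by blast
  moreover have "annihilate m v0 = scale (\<Prod>p = 1..m. of_nat p - 0) v0"
    by (rule annihilate_eigen) (simp add: hh_v0)
  ultimately have "(\<Prod>p = 1..m. of_nat p - 0) = (0 :: 'k)"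
    using v0 by simp
  then show False by (simp add: prod_zero_iff)
qed

lemma subspace_lowers: "subspace lowers"
  by (simp add: lowers_def)

text \<open>Related vectors have the same highest weight coefficient modulo \<open>lowers\<close>; a
  lowering operator destroys that coefficient on both sides.\<close>

lemma graph_coord: "graph x y \<Longrightarrow> y - scale (x (cols r lam)) v0 \<in> lowers"
proof (induction rule: graph.induct)
  case base
  have "(evec r lam :: _ \<Rightarrow> 'k) (cols r lam) = 1" by (simp add: evec_def delta_def)
  then show ?case using subspace_0[OF subspace_lowers] by (simp only:) simp
next
  case (add x y x' y')
  have "y + y' - scale ((x + x') (cols r lam)) v0
      = (y - scale (x (cols r lam)) v0) + (y' - scale (x' (cols r lam)) v0)"
    by (simp add: scale_left_distrib)
  then show ?case using subspace_add[OF subspace_lowers add.IH] by (simp only:)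
next
  case (smult x y c)
  have "scale c y - scale (scl c x (cols r lam)) v0 = scale c (y - scale (x (cols r lam)) v0)"
    by (simp add: scl_apply scale_right_diff_distrib)
  then show ?case using subspace_scale[OF subspace_lowers smult.IH] by (simp only:)
next
  case (lower i x y)
  let ?c = "x (cols r lam)"
  have "f i y = f i (y - scale ?c v0) + scale ?c (f i v0)"
    using f_linear(1)[OF lower.hyps(1), of "y - scale ?c v0" "scale ?c v0"] f_linear(2)[OF lower.hyps(1)] by simp
  also have "\<dots> \<in> lowers"
    by (intro subspace_add[OF subspace_lowers] subspace_scale[OF subspace_lowers]
        f_lowers f_v0_lowers lower.hyps(1) lower.IH)
  finally show ?case by (simp add: ff_coord_dominant[OF dom lower.hyps(1)])
qed

lemma graph_M0: "graph x y \<Longrightarrow> x \<in> M0 n r lam"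
proof (induction rule: graph.induct)
  case base
  show ?case by (rule evec_M0)
next
  case (add x y x' y')
  show ?case by (rule T.subspace_add[OF subspace_M0 add.IH])
next
  case (smult x y c)
  show ?case by (rule T.subspace_scale[OF subspace_M0 smult.IH])
next
  case (lower i x y)
  show ?case by (rule ff_M0[OF lower.hyps(1) lower.IH])
qed

text \<open>The partners of 0 form a submodule, and by \<open>graph_coord\<close> it does not
  contain \<open>v0\<close>.\<close>

lemma graph_functional:
  assumes "graph 0 y"
  shows "y = 0"
proof -
  let ?K = "{y. graph 0 y}"
  have "subspace ?K"
    using graph_0 add[of 0 _ 0] smult[of 0] by (intro subspaceI) force+
  moreover have "e i y \<in> ?K" if "Suc i < n" "y \<in> ?K" for i y
  proof -
    have "graph (ee i 0) (e i y)" using graph_e_h[of 0 y] that by blast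
    then show ?thesis unfolding ee.zero by blast
  qed
  moreover have "f i y \<in> ?K" if "Suc i < n" "y \<in> ?K" for i y
  proof -
    have "graph (ff i 0) (f i y)" using lower[of i 0 y] that by blast
    then show ?thesis unfolding ff.zero by blast
  qed
  moreover have "h j y \<in> ?K" if "j < n" "y \<in> ?K" for j y
  proof -
    have "graph (hT j 0) (h j y)" using graph_e_h[of 0 y] that by blast
    moreover have "hT j 0 = (0 :: nat set list \<Rightarrow> 'k)" by (simp add: hT_def fun_eq_iff)
    ultimately show ?thesis by (simp only: mem_Collect_eq)
  qed
  ultimately have "?K = {0} \<or> ?K = UNIV" by (rule irreducible)
  moreover have "?K \<noteq> UNIV"
  proof
    assume "?K = UNIV"
    then have "graph 0 v0" by blast
    from graph_coord[OF this] show False using v0_not_lowers by simp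
  qed
  ultimately show ?thesis using assms by blast
qed

lemma graph_surj: "\<exists>x. graph x y"
proof -
  let ?K = "{y. \<exists>x. graph x y}"
  have "subspace ?K"
  proof (rule subspaceI)
    show "0 \<in> ?K" using graph_0 by blast
  qed (use add smult in blast)+
  moreover have "e i y \<in> ?K" if "Suc i < n" "y \<in> ?K" for i y using graph_e_h that by blast
  moreover have "f i y \<in> ?K" if "Suc i < n" "y \<in> ?K" for i y using lower that by blast
  moreover have "h j y \<in> ?K" if "j < n" "y \<in> ?K" for j y using graph_e_h that by blast
  ultimately have "?K = {0} \<or> ?K = UNIV" by (rule irreducible)
  moreover have "v0 \<in> ?K" using base by blast
  ultimately show ?thesis using v0 by blast
qed

text \<open>\<open>x\<close> lies in the radical of the form: adjointness moves each lowering
  operator of a word onto \<open>x\<close> as a raising operator, the partner stays 0, and in the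
  end the pairing reads off the highest weight coefficient, which is 0.\<close>

lemma graph_inj:
  assumes "graph x 0"
  shows "x = 0"
proof (rule M0_nondegenerate[OF lam graph_M0[OF assms]])
  have word: "pr n r x (foldr ff is (evec r lam)) = 0"
    if "graph x 0" "set is \<subseteq> {i. Suc i < n}" for x "is"
    using that
  proof (induction "is" arbitrary: x)
    case Nil
    have "x (cols r lam) = 0"
    proof (rule ccontr)
      let ?c = "x (cols r lam)"
      assume c: "?c \<noteq> 0"
      have "0 - scale ?c v0 \<in> lowers" by (rule graph_coord[OF Nil(1)])
      then have "scale (- inverse ?c) (0 - scale ?c v0) \<in> lowers" by (rule subspace_scale[OF subspace_lowers])
      then show False using v0_not_lowers c by simp
    qed
    then show ?case
      by (simp add: pr_def evec_def delta_def if_distrib if_distribR cong: if_cong) 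
  next
    case (Cons i "is")
    have i: "Suc i < n" using Cons.prems(2) by simp
    have "graph (ee i x) 0" using graph_e_h[OF Cons.prems(1)] i e_linear(3)[OF i] by auto
    then have "pr n r (ee i x) (foldr ff is (evec r lam)) = 0" using Cons by simp
    then have "pr n r (foldr ff is (evec r lam)) (ee i x) = 0" by (rule trans[OF pr_commute])
    then have "pr n r (ff i (foldr ff is (evec r lam))) x = 0" unfolding ff_adjoint[OF i] .
    then show ?case unfolding foldr.simps comp_apply by (rule trans[OF pr_commute])
  qed
  show "pr n r x z = 0" if "z \<in> M0 n r lam" for z
  proof -
    have "M0 n r lam \<subseteq> {z. pr n r x z = 0}"
      unfolding M0_def
    proof (rule T.span_minimal[OF _ subspace_orth], rule subsetI, rule CollectI)
      fix z :: "nat set list \<Rightarrow> 'k" assume "z \<in> fwords n r lam"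
      then obtain "is" where "z = foldr ff is (evec r lam)" "set is \<subseteq> {i. Suc i < n}"
        unfolding fwords_def by blast
      then show "pr n r x z = 0" using word[OF assms] by blast
    qed
    then show ?thesis using that by blast
  qed
qed

lemma M0_graph: "x \<in> M0 n r lam \<Longrightarrow> \<exists>y. graph x y"
proof -
  assume x: "x \<in> M0 n r lam"
  have "M0 n r lam \<subseteq> {x. \<exists>y. graph x y}"
  proof (rule M0_minimal)
    show "T.subspace {x. \<exists>y. graph x y}"
    proof (rule T.subspaceI)
      show "0 \<in> {x. \<exists>y. graph x y}" using graph_0 by blast
    qed (use add smult in blast)+
  qed (use base lower in blast)+
  then show ?thesis using x by blast
qed

lemma graph_unique:
  assumes "graph x y" "graph x y'"
  shows "y = y'"
proof -
  have "graph (x + scl (- 1) x) (y + scale (- 1) y')" by (intro add smult assms)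
  moreover have "x + scl (- 1) x = (0 :: nat set list \<Rightarrow> 'k)" by (simp add: fun_eq_iff scl_apply)
  ultimately have "graph 0 (y + scale (- 1) y')" by (simp only:)
  from graph_functional[OF this] show ?thesis by simp
qed

text \<open>Partners exist only on the submodule; they are chosen on a basis of it and extended
  linearly to the whole function space.\<close>

lemma ex_iso: "\<exists>\<phi>. Vector_Spaces.linear scl scale \<phi> \<and> (\<forall>x\<in>M0 n r lam. graph x (\<phi> x))"
proof -
  interpret pair: vector_space_pair "scl :: 'k \<Rightarrow> _" scale
    by (rule vector_space_pair.intro[OF T.vector_space_axioms vector_space_axioms])
  obtain C :: "(nat set list \<Rightarrow> 'k) set" where
    C: "C \<subseteq> M0 n r lam" "T.independent C" "M0 n r lam \<subseteq> T.span C"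
    by (rule T.maximal_independent_subset)
  obtain \<phi> where \<phi>: "Vector_Spaces.linear scl scale \<phi>" "\<forall>x\<in>C. \<phi> x = (SOME y. graph x y)"
    using pair.linear_independent_extend[OF C(2), of "\<lambda>x. SOME y. graph x y"] by blast
  interpret \<phi>: Vector_Spaces.linear scl scale \<phi> by (rule \<phi>(1))
  have "T.span C \<subseteq> {x. graph x (\<phi> x)}"
  proof (rule T.span_minimal)
    show "C \<subseteq> {x. graph x (\<phi> x)}"
    proof
      fix x assume x: "x \<in> C"
      then have "\<exists>y. graph x y" using C(1) M0_graph by blast
      then have "graph x (SOME y. graph x y)" by (rule someI_ex)
      then show "x \<in> {x. graph x (\<phi> x)}" using \<phi>(2) x by simp
    qed
    show "T.subspace {x. graph x (\<phi> x)}"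
    proof (rule T.subspaceI; (elim CollectE)?; rule CollectI)
      show "graph 0 (\<phi> 0)" unfolding \<phi>.zero by (rule graph_0)
      show "graph (x + y) (\<phi> (x + y))" if "graph x (\<phi> x)" "graph y (\<phi> y)" for x y
        unfolding \<phi>.add using that by (rule add)
      show "graph (scl c x) (\<phi> (scl c x))" if "graph x (\<phi> x)" for c x
        unfolding \<phi>.scale using that by (rule smult)
    qed
  qed
  then show ?thesis using \<phi>(1) C(3) by blast
qed

definition iso :: "(nat set list \<Rightarrow> 'k) \<Rightarrow> 'v" where
  "iso = (SOME \<phi>. Vector_Spaces.linear scl scale \<phi> \<and> (\<forall>x\<in>M0 n r lam. graph x (\<phi> x)))"

lemma linear_iso: "Vector_Spaces.linear scl scale iso"
  and graph_iso: "x \<in> M0 n r lam \<Longrightarrow> graph x (iso x)"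
  using someI_ex[OF ex_iso] unfolding iso_def[symmetric] by blast+

lemma iso_eq: "graph x y \<Longrightarrow> iso x = y"
  using graph_unique graph_iso graph_M0 by blast

lemma ee_M0: "Suc i < n \<Longrightarrow> x \<in> M0 n r lam \<Longrightarrow> ee i x \<in> M0 n r lam"
  and iso_ee: "Suc i < n \<Longrightarrow> x \<in> M0 n r lam \<Longrightarrow> iso (ee i x) = e i (iso x)"
  and hT_M0: "j < n \<Longrightarrow> x \<in> M0 n r lam \<Longrightarrow> hT j x \<in> M0 n r lam"
  and iso_hT: "j < n \<Longrightarrow> x \<in> M0 n r lam \<Longrightarrow> iso (hT j x) = h j (iso x)"
  using graph_e_h graph_iso iso_eq graph_M0 by blast+

lemma iso_ff: "Suc i < n \<Longrightarrow> x \<in> M0 n r lam \<Longrightarrow> iso (ff i x) = f i (iso x)"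
  using lower graph_iso iso_eq by blast

lemma iso_inj_on: "inj_on iso (M0 n r lam)"
proof (rule inj_onI)
  interpret iso: Vector_Spaces.linear scl scale iso by (rule linear_iso)
  fix x y assume xy: "x \<in> M0 n r lam" "y \<in> M0 n r lam" "iso x = iso y"
  have "x - y \<in> M0 n r lam" by (rule T.subspace_diff[OF subspace_M0 xy(1,2)])
  then have "graph (x - y) (iso (x - y))" by (rule graph_iso)
  also have "iso (x - y) = 0" unfolding iso.diff xy(3) by simp
  finally have "x - y = 0" by (rule graph_inj)
  then show "x = y" by (simp only: right_minus_eq)
qed

section \<open>Extremal weight lines and the transported basis\<close>

lemma dominant_orbit_unique:
  assumes u: "u \<in> orbit n lam" "dominant n u"
  shows "u = lam"
proof (rule bruhat_antisym)
  show "bruhat_le u lam" by (rule dominant_least[OF u(1) orbit_self u(2) bddD(2)[OF lam]])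
  show "bruhat_le lam u" by (rule dominant_least[OF orbit_self u(1) dom bddD(2)[OF lam]])
qed

text \<open>Reflections that lower a weight end at a dominant one, and \<open>lam\<close> is the
  only dominant weight of its orbit.\<close>

lemma orbit_descent [consumes 1, case_names highest reflect]:
  assumes "u \<in> orbit n lam" and "P lam"
    and "\<And>i u. u \<in> orbit n lam \<Longrightarrow> Suc i < n \<Longrightarrow> u i < u (Suc i) \<Longrightarrow> swp i u \<in> orbit n lam \<Longrightarrow> P (swp i u) \<Longrightarrow> P u"
  shows "P u"
  using assms(1)
proof (induction "\<Sum>j<n. j * u j" arbitrary: u rule: less_induct)
  case less
  show ?case
  proof (cases "dominant n u")
    case True
    then show ?thesis using dominant_orbit_unique[OF less.prems] assms(2) by simp
  next
    case False
    then obtain i where i: "Suc i < n" "u i < u (Suc i)" by (rule not_dominantE)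
    have s: "swp i u \<in> orbit n lam" by (rule orbit_swp[OF less.prems i(1)])
    show ?thesis
      by (rule assms(3)[OF less.prems i s]) (rule less.hyps[OF sum_swp_less[OF i(2,1)] s])
  qed
qed

lemma evec_orbit_M0:
  assumes "u \<in> orbit n lam"
  shows "evec r u \<in> (M0 n r lam :: (nat set list \<Rightarrow> 'k) set)"
  using assms
proof (induction rule: orbit_descent)
  case highest
  show ?case by (rule evec_M0)
next
  case (reflect i u)
  have le: "swp i u (Suc i) \<le> swp i u i" using reflect(3) by (simp add: swp_apply)
  obtain c :: 'k where c: "c \<noteq> 0" "(ff i ^^ (swp i u i - swp i u (Suc i))) (evec r (swp i u)) = scl c (evec r (swp i (swp i u)))"
    using extremal_reflection(1)[OF le orbit_bounds[OF lam reflect(4)] reflect(2)] by blast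
  have "(ff i ^^ (swp i u i - swp i u (Suc i))) (evec r (swp i u)) \<in> (M0 n r lam :: (nat set list \<Rightarrow> 'k) set)"
    by (rule pow_stable[of "M0 n r lam", OF ff_M0[OF reflect(2)] reflect(5)])
  then have "scl (inverse c) (scl c (evec r u)) \<in> M0 n r lam"
    unfolding c(2) swp_swp by (rule T.subspace_scale[OF subspace_M0])
  also have "scl (inverse c) (scl c (evec r u)) = evec r u" using c(1) by simp
  finally show ?case .
qed

text \<open>The character of a module stable under raising and lowering is reflection invariant, so
  multiplicity one passes from the highest weight to its orbit.\<close>

lemma ch_M0:
  assumes "u \<in> orbit n lam"
  shows "ch (M0 n r lam :: (nat set list \<Rightarrow> 'k) set) (\<lambda>j. int (u j)) = 1"
  using assms
proof (induction rule: orbit_descent)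
  case highest
  let ?v = "evec r lam :: nat set list \<Rightarrow> 'k" and ?W = "Wt (\<lambda>j. int (lam j)) :: (nat set list \<Rightarrow> 'k) set"
  have v: "?v \<in> ?W" by (rule evec_Wt[OF bddD(1)[OF lam]])
  have "M0 n r lam \<inter> ?W = T.span {?v} \<inter> ?W"
  proof
    show "M0 n r lam \<inter> ?W \<subseteq> T.span {?v} \<inter> ?W"
    proof
      fix x assume x: "x \<in> M0 n r lam \<inter> ?W"
      then obtain c where "x = scl c ?v" using M0_highest[OF lam] by blast
      then have "x \<in> T.span {?v}" using T.span_scale[OF T.span_base[of ?v "{?v}"]] by blast
      then show "x \<in> T.span {?v} \<inter> ?W" using x by blast
    qed
    have "T.span {?v} \<subseteq> M0 n r lam" by (rule T.span_minimal) (auto simp: evec_M0)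
    then show "T.span {?v} \<inter> ?W \<subseteq> M0 n r lam \<inter> ?W" by blast
  qed
  then have "ch (M0 n r lam :: (nat set list \<Rightarrow> 'k) set) (\<lambda>j. int (lam j)) = ch (T.span {?v}) (\<lambda>j. int (lam j))"
    by (simp only: ch_def)
  also have "\<dots> = 1" using ch_line[OF v evec_not_zero, of "\<lambda>j. int (lam j)"] by simp
  finally show ?case .
next
  case (reflect i u)
  have "ch (M0 n r lam :: (nat set list \<Rightarrow> 'k) set) (swp i (\<lambda>j. int (u j))) = ch (M0 n r lam :: (nat set list \<Rightarrow> 'k) set) (\<lambda>j. int (u j))"
    by (rule ch_swp[OF subspace_M0 M0_Supp[OF lam] ee_M0[OF reflect(2)] ff_M0[OF reflect(2)]])
  moreover have "swp i (\<lambda>j. int (u j)) = (\<lambda>j. int (swp i u j))" by (rule ext) (simp add: swp_apply)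
  ultimately show ?case using reflect(5) by simp
qed

lemma M0_weight_line:
  fixes x :: "nat set list \<Rightarrow> 'k"
  assumes u: "u \<in> orbit n lam" and x: "x \<in> M0 n r lam" "x \<in> Wt (\<lambda>j. int (u j))"
  shows "\<exists>c. x = scl c (evec r u)"
proof -
  let ?v = "evec r u :: nat set list \<Rightarrow> 'k" and ?W = "Wt (\<lambda>j. int (u j)) :: (nat set list \<Rightarrow> 'k) set"
  have v: "?v \<in> ?W" by (rule evec_Wt[OF orbit_bounds(1)[OF lam u]])
  have "T.span {?v} \<inter> ?W = M0 n r lam \<inter> ?W"
  proof (rule T.dim_eq_fd)
    show "T.span {?v} \<inter> ?W \<subseteq> M0 n r lam \<inter> ?W"
      using T.span_minimal[of "{?v}" "M0 n r lam"] evec_orbit_M0[OF u] subspace_M0 by blast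
    show "finite (delta ` idx n r :: (nat set list \<Rightarrow> 'k) set)" by (rule finite_Supp_basis)
    show "M0 n r lam \<inter> ?W \<subseteq> T.span (delta ` idx n r)"
      using M0_Supp[OF lam] Supp_span by blast
    show "T.subspace (T.span {?v} \<inter> ?W)" by (rule T.subspace_inter[OF T.subspace_span subspace_Wt])
    have "int (T.dim (M0 n r lam \<inter> ?W)) = 1" using ch_M0[OF u] by (simp add: ch_def)
    moreover have "int (T.dim (T.span {?v} \<inter> ?W)) = 1"
      using ch_line[OF v evec_not_zero, of "\<lambda>j. int (u j)"] by (simp add: ch_def)
    ultimately show "T.dim (M0 n r lam \<inter> ?W) \<le> T.dim (T.span {?v} \<inter> ?W)" by linarith
  qed
  then have "x \<in> T.span {?v}" using x by blast
  then show ?thesis by (simp add: T.span_singleton) blast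
qed

text \<open>Makes the choice of extremal vectors immaterial up to scalars. The diagonal eigenvalues
  determine the weights of all monomials that occur, since the integers embed in characteristic
  0.\<close>

lemma weight_vector_unique:
  assumes u: "u \<in> orbit n lam" and y: "\<And>j. j < n \<Longrightarrow> h j y = scale (of_nat (u j)) y"
  shows "\<exists>c. y = scale c (iso (evec r u))"
proof -
  interpret iso: Vector_Spaces.linear scl scale iso by (rule linear_iso)
  obtain x where gx: "graph x y" using graph_surj by blast
  have x: "x \<in> M0 n r lam" "iso x = y" by (rule graph_M0[OF gx]) (rule iso_eq[OF gx])
  have hx: "hT j x = scl (of_nat (u j)) x" if j: "j < n" for j
  proof (rule inj_onD[OF iso_inj_on _ hT_M0[OF j x(1)] T.subspace_scale[OF subspace_M0 x(1)]])
    show "iso (hT j x) = iso (scl (of_nat (u j)) x)"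
      unfolding iso_hT[OF j x(1)] iso.scale x(2) by (rule y[OF j])
  qed
  have "x \<in> Wt (\<lambda>j. int (u j))"
    unfolding Wt_def
  proof (intro CollectI allI impI ext)
    fix t j assume t: "x t \<noteq> 0"
    show "wt t j = int (u j)"
    proof (cases "j < n")
      case True
      have "of_int (wt t j) * x t = of_nat (u j) * x t"
        using fun_cong[OF hx[OF True], of t] by (simp add: hT_def scl_apply)
      then have "(of_int (wt t j) :: 'k) = of_int (int (u j))" using t by simp
      then show ?thesis by (simp only: of_int_eq_iff)
    next
      case False
      have "x \<in> Supp n r" using M0_Supp[OF lam] x(1) by blast
      then have "set t \<subseteq> Pow {..<n}" using t by (auto simp: Supp_def idx_def)
      then have "wt t j = 0" unfolding wt_def using False
        by (induction t) auto
      then show ?thesis using orbit_bounds(2)[OF lam u] False by simp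
    qed
  qed
  then obtain c where "x = scl c (evec r u)" using M0_weight_line[OF u x(1)] by blast
  then have "y = scale c (iso (evec r u))" using x(2) iso.scale by blast
  then show ?thesis ..
qed

definition ewords :: "'v \<Rightarrow> 'v set" where
  "ewords y = {foldr e is y | is. set is \<subseteq> {i. Suc i < n}}"

lemma foldr_e_scale: "set is \<subseteq> {i. Suc i < n} \<Longrightarrow> foldr e is (scale c y) = scale c (foldr e is y)"
  by (induction "is") (simp_all add: e_linear(2))

lemma span_ewords_scale_le: "span (ewords (scale c y)) \<subseteq> span (ewords y)"
proof (rule span_minimal[OF _ subspace_span])
  show "ewords (scale c y) \<subseteq> span (ewords y)"
  proof
    fix z assume "z \<in> ewords (scale c y)"
    then obtain "is" where w: "z = foldr e is (scale c y)" "set is \<subseteq> {i. Suc i < n}"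
      unfolding ewords_def by blast
    have "foldr e is y \<in> ewords y" unfolding ewords_def using w(2) by blast
    then show "z \<in> span (ewords y)"
      unfolding w(1) foldr_e_scale[OF w(2)] by (intro span_scale span_base)
  qed
qed

lemma span_ewords_scale: "c \<noteq> 0 \<Longrightarrow> span (ewords (scale c y)) = span (ewords y)"
  using span_ewords_scale_le[of c y] span_ewords_scale_le[of "inverse c" "scale c y"] by simp

lemma iso_Dem:
  assumes u: "u \<in> orbit n lam"
  shows "Dem n r u \<subseteq> (M0 n r lam :: (nat set list \<Rightarrow> 'k) set)" "iso ` Dem n r u = span (ewords (iso (evec r u)))"
proof -
  interpret pair: vector_space_pair "scl :: 'k \<Rightarrow> _" scale
    by (rule vector_space_pair.intro[OF T.vector_space_axioms vector_space_axioms])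
  show "Dem n r u \<subseteq> (M0 n r lam :: (nat set list \<Rightarrow> 'k) set)"
    by (rule Dem_minimal[OF subspace_M0 evec_orbit_M0[OF u] ee_M0])
  have word: "foldr ee is (evec r u) \<in> (M0 n r lam :: (nat set list \<Rightarrow> 'k) set) \<and> iso (foldr ee is (evec r u)) = foldr e is (iso (evec r u))"
    if "set is \<subseteq> {i. Suc i < n}" for "is"
    using that
  proof (induction "is")
    case Nil
    show ?case using evec_orbit_M0[OF u] by simp
  next
    case (Cons i "is")
    then have i: "Suc i < n" and IH: "foldr ee is (evec r u) \<in> (M0 n r lam :: (nat set list \<Rightarrow> 'k) set)"
      "iso (foldr ee is (evec r u)) = foldr e is (iso (evec r u))" by auto
    show ?case unfolding foldr.simps comp_apply
      using ee_M0[OF i IH(1)] iso_ee[OF i IH(1)] IH(2) by simp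
  qed
  have "ewords (iso (evec r u)) = (\<lambda>is. foldr e is (iso (evec r u))) ` {is. set is \<subseteq> {i. Suc i < n}}"
    unfolding ewords_def by blast
  also have "\<dots> = (\<lambda>is. iso (foldr ee is (evec r u))) ` {is. set is \<subseteq> {i. Suc i < n}}"
    by (rule image_cong[OF refl]) (simp only: mem_Collect_eq word)
  also have "\<dots> = iso ` {foldr ee is (evec r u) | is. set is \<subseteq> {i. Suc i < n}}"
    by blast
  finally show "iso ` Dem n r u = span (ewords (iso (evec r u)))"
    unfolding Dem_def by (simp only: pair.linear_span_image[OF linear_iso])
qed

theorem adapted_basis:
  assumes ev: "\<And>u j. u \<in> orbit n lam \<Longrightarrow> j < n \<Longrightarrow> h j (ev u) = scale (of_nat (u j)) (ev u)"
    "\<And>u. u \<in> orbit n lam \<Longrightarrow> ev u \<noteq> 0"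
  obtains B \<kappa>
  where "independent B" "\<And>b. b \<in> B \<Longrightarrow> \<kappa> b \<in> orbit n lam"
    "\<And>u. u \<in> orbit n lam \<Longrightarrow> span (ewords (ev u)) = span {b \<in> B. bruhat_le (\<kappa> b) u}"
    "\<And>u. u \<in> orbit n lam \<Longrightarrow> \<exists>b\<in>B. \<kappa> b = u"
proof -
  interpret pair: vector_space_pair "scl :: 'k \<Rightarrow> _" scale
    by (rule vector_space_pair.intro[OF T.vector_space_axioms vector_space_axioms])
  obtain B :: "(nat set list \<Rightarrow> 'k) set" and \<kappa> where
    B: "T.independent B" "\<And>b. b \<in> B \<Longrightarrow> \<kappa> b \<in> orbit n lam"
      "\<And>v. v \<in> orbit n lam \<Longrightarrow> Dem n r v = T.span {b \<in> B. bruhat_le (\<kappa> b) v}"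
      "\<And>v. v \<in> orbit n lam \<Longrightarrow> \<exists>b\<in>B. \<kappa> b = v"
    by (rule tensor_adapted_basis[OF lam]) (rule that)
  have BM: "B \<subseteq> M0 n r lam"
  proof
    fix b assume b: "b \<in> B"
    have "b \<in> T.span {x \<in> B. bruhat_le (\<kappa> x) (\<kappa> b)}" using b by (intro T.span_base) simp
    then have "b \<in> Dem n r (\<kappa> b)" unfolding B(3)[OF B(2)[OF b]] .
    then show "b \<in> M0 n r lam" using iso_Dem(1)[OF B(2)[OF b]] by blast
  qed
  have sM: "T.span B \<subseteq> M0 n r lam" by (rule T.span_minimal[OF BM subspace_M0])
  have inj: "inj_on iso B" by (rule inj_on_subset[OF iso_inj_on BM])
  let ?\<kappa> = "\<kappa> \<circ> the_inv_into B iso"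
  have \<kappa>: "?\<kappa> (iso b) = \<kappa> b" if "b \<in> B" for b
    using the_inv_into_f_f[OF inj that] by simp
  show ?thesis
  proof
    show "independent (iso ` B)"
      by (rule pair.linear_independent_injective_image[OF linear_iso B(1) inj_on_subset[OF iso_inj_on sM]])
    show "?\<kappa> b \<in> orbit n lam" if b: "b \<in> iso ` B" for b
    proof -
      obtain b' where b': "b' \<in> B" "b = iso b'" using b by blast
      show ?thesis unfolding b'(2) \<kappa>[OF b'(1)] by (rule B(2)[OF b'(1)])
    qed
    show "\<exists>b\<in>iso ` B. ?\<kappa> b = u" if u: "u \<in> orbit n lam" for u
    proof -
      obtain b where "b \<in> B" "\<kappa> b = u" using B(4)[OF u] by blast
      then show ?thesis using \<kappa> by blast
    qed
    show "span (ewords (ev u)) = span {b \<in> iso ` B. bruhat_le (?\<kappa> b) u}" if u: "u \<in> orbit n lam" for u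
    proof -
      obtain c where c: "ev u = scale c (iso (evec r u))" using weight_vector_unique[OF u ev(1)[OF u]] by blast
      then have "c \<noteq> 0" using ev(2)[OF u] by auto
      then have "span (ewords (ev u)) = span (ewords (iso (evec r u)))" unfolding c by (rule span_ewords_scale)
      also have "\<dots> = iso ` T.span {b \<in> B. bruhat_le (\<kappa> b) u}" unfolding iso_Dem(2)[OF u, symmetric] B(3)[OF u] ..
      also have "\<dots> = span (iso ` {b \<in> B. bruhat_le (\<kappa> b) u})"
        by (rule pair.linear_span_image[OF linear_iso, symmetric])
      also have "iso ` {b \<in> B. bruhat_le (\<kappa> b) u} = {b \<in> iso ` B. bruhat_le (?\<kappa> b) u}"
        using \<kappa> by (auto simp del: comp_apply)
      finally show ?thesis .
    qed
  qed
qed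

text \<open>Serves the right modules: applied to the lowest weight, it shows that its vector is a
  highest weight vector for the reversed order of the basis.\<close>

lemma f_weight_vector:
  assumes u: "u \<in> orbit n lam" and y: "\<And>j. j < n \<Longrightarrow> h j y = scale (of_nat (u j)) y"
    and i: "Suc i < n" "u i \<le> u (Suc i)"
  shows "f i y = 0"
proof -
  interpret iso: Vector_Spaces.linear scl scale iso by (rule linear_iso)
  obtain c where c: "y = scale c (iso (evec r u))" using weight_vector_unique[OF u y] by blast
  have "f i (iso (evec r u)) = iso (ff i (evec r u))"
    by (rule iso_ff[OF i(1) evec_orbit_M0[OF u], symmetric])
  also have "\<dots> = 0" unfolding ff_evec[OF i(2)] by (rule iso.zero)
  finally show ?thesis unfolding c f_linear(2)[OF i(1)] by simp
qed

end

section \<open>Modules over the general linear Lie algebra\<close>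

definition matrix_unit :: "nat \<Rightarrow> nat \<Rightarrow> nat \<Rightarrow> 'k::{zero_neq_one} mat" where
  "matrix_unit n a b = mat n n (\<lambda>(i, j). of_bool (i = a \<and> j = b))"

lemma matrix_unit_carrier [simp]: "matrix_unit n a b \<in> carrier_mat n n"
  by (simp add: matrix_unit_def)

lemma matrix_unit_mult:
  assumes "a < n" "b < n" "c < n" "d < n"
  shows "matrix_unit n a b * matrix_unit n c d = (of_bool (b = c) \<cdot>\<^sub>m matrix_unit n a d :: 'k::comm_ring_1 mat)"
proof (rule eq_matI)
  fix i j assume "i < dim_row (of_bool (b = c) \<cdot>\<^sub>m matrix_unit n a d :: 'k mat)"
    "j < dim_col (of_bool (b = c) \<cdot>\<^sub>m matrix_unit n a d :: 'k mat)"
  then have ij: "i < n" "j < n" by (simp_all add: matrix_unit_def)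
  have "(matrix_unit n a b * matrix_unit n c d :: 'k mat) $$ (i, j)
      = (\<Sum>k\<in>{0..<n}. of_bool (i = a \<and> k = b) * of_bool (k = c \<and> j = d))"
    using ij by (simp add: matrix_unit_def scalar_prod_def)
  also have "\<dots> = (\<Sum>k\<in>{0..<n}. if k = b then of_bool (b = c) * of_bool (i = a \<and> j = d) else 0)"
    by (intro sum.cong) auto
  also have "\<dots> = of_bool (b = c) * of_bool (i = a \<and> j = d)" using assms by simp
  finally show "(matrix_unit n a b * matrix_unit n c d) $$ (i, j)
      = (of_bool (b = c) \<cdot>\<^sub>m matrix_unit n a d :: 'k mat) $$ (i, j)"
    using ij by (simp add: matrix_unit_def)
qed (simp_all add: matrix_unit_def)

context gl_module
begin

lemma linear_act: "X \<in> carrier_mat n n \<Longrightarrow> Vector_Spaces.linear scale scale (act X)"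
  unfolding Vector_Spaces.linear_iff
  by (intro conjI allI vector_space_axioms) (simp_all only: act_add_right act_scale_right)

lemma act_diff:
  assumes "X \<in> carrier_mat n n" "Y \<in> carrier_mat n n"
  shows "act (X - Y) v = act X v - act Y v"
proof -
  have "X - Y = X + (- 1) \<cdot>\<^sub>m Y" by (rule eq_matI) (use assms in auto)
  then show ?thesis using act_add_left[OF assms(1), of "(- 1) \<cdot>\<^sub>m Y" v] act_scale_left[OF assms(2), of "- 1" v] assms
    by simp
qed

lemma act_matrix_unit:
  assumes "a < n" "b < n" "c < n" "d < n"
  shows "act (matrix_unit n a b) (act (matrix_unit n c d) v) = act (matrix_unit n c d) (act (matrix_unit n a b) v)
    + (scale (of_bool (b = c)) (act (matrix_unit n a d) v) - scale (of_bool (d = a)) (act (matrix_unit n c b) v))"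
  using act_bracket[OF matrix_unit_carrier matrix_unit_carrier, of a b c d v]
  by (simp add: matrix_unit_mult assms act_diff act_scale_left algebra_simps)

lemma act_expand:
  assumes X: "X \<in> carrier_mat n n"
  shows "act X v = (\<Sum>p\<in>{..<n} \<times> {..<n}. scale (X $$ p) (act (matrix_unit n (fst p) (snd p)) v))"
proof -
  define R where "R S = mat n n (\<lambda>p. if p \<in> S then X $$ p else 0)" for S
  have R: "R S \<in> carrier_mat n n" for S by (simp add: R_def)
  have "act (R S) v = (\<Sum>p\<in>S. scale (X $$ p) (act (matrix_unit n (fst p) (snd p)) v))"
    if "finite S" for S
    using that
  proof (induction S rule: finite_induct)
    case empty
    have "R {} = 0 \<cdot>\<^sub>m R {}" by (rule eq_matI) (simp_all add: R_def)
    then show ?case using act_scale_left[OF R, of 0 "{}" v] by simp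
  next
    case (insert p S)
    have "R (insert p S) = R S + X $$ p \<cdot>\<^sub>m matrix_unit n (fst p) (snd p)"
      using insert.hyps(2) by (intro eq_matI) (auto simp: R_def matrix_unit_def)
    then have "act (R (insert p S)) v = act (R S) v + scale (X $$ p) (act (matrix_unit n (fst p) (snd p)) v)"
      using act_add_left[OF R, of "X $$ p \<cdot>\<^sub>m matrix_unit n (fst p) (snd p)" S v]
      by (simp add: act_scale_left)
    then show ?case using insert by (simp add: add.commute)
  qed
  from this[of "{..<n} \<times> {..<n}"] have "act (R ({..<n} \<times> {..<n})) v
      = (\<Sum>p\<in>{..<n} \<times> {..<n}. scale (X $$ p) (act (matrix_unit n (fst p) (snd p)) v))" by simp
  also have "R ({..<n} \<times> {..<n}) = X" using X by (intro eq_matI) (auto simp: R_def)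
  finally show ?thesis .
qed

lemma weight_vector_unit:
  assumes "weight_vector scale n act \<nu> v" "j < n"
  shows "act (matrix_unit n j j) v = scale (of_nat (\<nu> ! j)) v"
proof -
  have "diagonal_mat (matrix_unit n j j :: 'k mat)"
    by (auto simp: diagonal_mat_def matrix_unit_def)
  then have "act (matrix_unit n j j) v
      = scale (\<Sum>i<n. of_nat (\<nu> ! i) * (matrix_unit n j j :: 'k mat) $$ (i, i)) v"
    using assms(1) unfolding weight_vector_def by simp
  also have "(\<Sum>i<n. of_nat (\<nu> ! i) * (matrix_unit n j j :: 'k mat) $$ (i, i))
      = (\<Sum>i<n. if i = j then of_nat (\<nu> ! j) else 0)"
    by (intro sum.cong) (auto simp: matrix_unit_def)
  also have "\<dots> = of_nat (\<nu> ! j)" using assms(2) by simp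
  finally show ?thesis .
qed

end

text \<open>The involution \<open>\<pi>\<close> re-indexes the basis: the reversal turns lower triangular into upper
  triangular matrices, so that the right modules are covered by the same argument.\<close>

locale reindexed_gl_module = gl_module scale n act
  for scale :: "'k::field \<Rightarrow> 'v::ab_group_add \<Rightarrow> 'v" and n act +
  fixes \<pi> :: "nat \<Rightarrow> nat"
  assumes \<pi>_less: "j < n \<Longrightarrow> \<pi> j < n" and \<pi>_\<pi>: "\<pi> (\<pi> j) = j"
begin

definition u where "u a b = act (matrix_unit n (\<pi> a) (\<pi> b))"
definition e where "e i = u i (Suc i)"
definition f where "f i = u (Suc i) i"
definition h where "h j = u j j"

lemma \<pi>_eq [simp]: "\<pi> a = \<pi> b \<longleftrightarrow> a = b"
  using \<pi>_\<pi> by metis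

lemma linear_u: "Vector_Spaces.linear scale scale (u a b)"
  unfolding u_def by (rule linear_act) simp

lemma u_bracket:
  assumes "a < n" "b < n" "c < n" "d < n"
  shows "u a b (u c d v) = u c d (u a b v)
    + (scale (of_bool (b = c)) (u a d v) - scale (of_bool (d = a)) (u c b v))"
  unfolding u_def act_matrix_unit[OF \<pi>_less[OF assms(1)] \<pi>_less[OF assms(2)] \<pi>_less[OF assms(3)] \<pi>_less[OF assms(4)]]
    \<pi>_eq ..

lemma h_e:
  assumes "j < n" "Suc i < n"
  shows "h j (e i v) = e i (h j v) + scale (of_int (of_bool (j = i) - of_bool (j = Suc i))) (e i v)"
  using u_bracket[of j j i "Suc i" v] assms unfolding h_def e_def by auto

lemma h_f:
  assumes "j < n" "Suc i < n"
  shows "h j (f i v) = f i (h j v) + scale (- of_int (of_bool (j = i) - of_bool (j = Suc i))) (f i v)"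
  using u_bracket[of j j "Suc i" i v] assms unfolding h_def f_def by auto

lemma e_f_other:
  assumes "Suc i < n" "Suc j < n" "i \<noteq> j"
  shows "e i (f j v) = f j (e i v)"
  using u_bracket[of i "Suc i" "Suc j" j v] assms unfolding e_def f_def by simp

lemma e_f_same:
  assumes "Suc i < n"
  shows "e i (f i v) = f i (e i v) + (h i v + scale (- 1) (h (Suc i) v))"
  using u_bracket[of i "Suc i" "Suc i" i v] assms unfolding e_def f_def h_def by simp

text \<open>Induction on the distance from the diagonal: a root vector that is not simple is the
  commutator of a simple one with one a step closer to the diagonal.\<close>

lemma stable_upper:
  assumes U: "subspace U" and e: "\<And>i x. Suc i < n \<Longrightarrow> x \<in> U \<Longrightarrow> e i x \<in> U"
  shows "Suc (k + a) < n \<Longrightarrow> x \<in> U \<Longrightarrow> u a (Suc (k + a)) x \<in> U"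
proof (induction k arbitrary: a x)
  case 0
  then show ?case using e[of a x] by (simp add: e_def)
next
  case (Suc k)
  have lt: "a < n" "Suc a < n" "Suc (Suc k + a) < n" using Suc.prems by auto
  let ?b = "Suc (Suc k + a)"
  have "u a (Suc a) (u (Suc a) ?b x) = u (Suc a) ?b (u a (Suc a) x) + u a ?b x"
    using u_bracket[OF lt(1,2,2,3), of x] by simp
  then have "u a ?b x = e a (u (Suc a) ?b x) - u (Suc a) ?b (e a x)" by (simp add: e_def)
  moreover have "u (Suc a) ?b y \<in> U" if "y \<in> U" for y using Suc.IH[of "Suc a" y] that lt(3) by simp
  ultimately show ?case using e[OF lt(2)] Suc.prems(2) subspace_diff[OF U] by simp
qed

lemma stable_lower:
  assumes U: "subspace U" and f: "\<And>i x. Suc i < n \<Longrightarrow> x \<in> U \<Longrightarrow> f i x \<in> U"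
  shows "Suc (k + a) < n \<Longrightarrow> x \<in> U \<Longrightarrow> u (Suc (k + a)) a x \<in> U"
proof (induction k arbitrary: a x)
  case 0
  then show ?case using f[of a x] by (simp add: f_def)
next
  case (Suc k)
  have lt: "a < n" "Suc a < n" "Suc (Suc k + a) < n" using Suc.prems by auto
  let ?b = "Suc (Suc k + a)"
  have "u ?b (Suc a) (u (Suc a) a x) = u (Suc a) a (u ?b (Suc a) x) + u ?b a x"
    using u_bracket[OF lt(3,2,2,1), of x] by simp
  then have "u ?b a x = u ?b (Suc a) (f a x) - f a (u ?b (Suc a) x)" by (simp add: f_def)
  moreover have "u ?b (Suc a) y \<in> U" if "y \<in> U" for y using Suc.IH[of "Suc a" y] that lt(3) by simp
  ultimately show ?case using f[OF lt(2)] Suc.prems(2) subspace_diff[OF U] by simp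
qed

text \<open>The Borel subalgebra for the order \<open>\<pi> 0\<close>, \<open>\<pi> 1\<close>, ...
  of the basis.\<close>

definition flag :: "'k mat set" where
  "flag = {X \<in> carrier_mat n n. \<forall>i<n. \<forall>j<i. X $$ (\<pi> i, \<pi> j) = 0}"

lemma act_stable:
  assumes U: "subspace U" and X: "X \<in> carrier_mat n n" and x: "x \<in> U"
    and u: "\<And>a b. a < n \<Longrightarrow> b < n \<Longrightarrow> X $$ (\<pi> a, \<pi> b) \<noteq> 0 \<Longrightarrow> u a b x \<in> U"
  shows "act X x \<in> U"
  unfolding act_expand[OF X]
proof (rule subspace_sum[OF U])
  fix p assume "p \<in> {..<n} \<times> {..<n}"
  then obtain a b where p: "p = (a, b)" "a < n" "b < n" by blast
  have "u (\<pi> a) (\<pi> b) x \<in> U" if "X $$ p \<noteq> 0"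
    using u[OF \<pi>_less[OF p(2)] \<pi>_less[OF p(3)]] that unfolding p(1) \<pi>_\<pi> by simp
  then show "scale (X $$ p) (act (matrix_unit n (fst p) (snd p)) x) \<in> U"
    unfolding p(1) u_def \<pi>_\<pi> fst_conv snd_conv
    by (cases "X $$ (a, b) = 0") (simp_all add: subspace_0[OF U] subspace_scale[OF U])
qed

lemma flag_stable:
  assumes U: "subspace U" and e: "\<And>i x. Suc i < n \<Longrightarrow> x \<in> U \<Longrightarrow> e i x \<in> U"
    and h: "\<And>j x. j < n \<Longrightarrow> x \<in> U \<Longrightarrow> h j x \<in> U" and X: "X \<in> flag" and x: "x \<in> U"
  shows "act X x \<in> U"
proof (rule act_stable[OF U _ x])
  show "X \<in> carrier_mat n n" using X by (simp add: flag_def)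
  fix a b assume ab: "a < n" "b < n" "X $$ (\<pi> a, \<pi> b) \<noteq> 0"
  then have "\<not> b < a" using X by (auto simp: flag_def)
  then consider "a = b" | k where "b = Suc (k + a)"
    using less_imp_Suc_add[of a b] by (metis add.commute linorder_neqE_nat)
  then show "u a b x \<in> U"
  proof cases
    case 1
    then show ?thesis using h[OF ab(1) x] by (simp add: h_def)
  next
    case 2
    show ?thesis unfolding 2 by (rule stable_upper[OF U e _ x]) (use ab 2 in auto)
  qed
qed

lemma all_stable:
  assumes U: "subspace U" and e: "\<And>i x. Suc i < n \<Longrightarrow> x \<in> U \<Longrightarrow> e i x \<in> U"
    and f: "\<And>i x. Suc i < n \<Longrightarrow> x \<in> U \<Longrightarrow> f i x \<in> U"
    and h: "\<And>j x. j < n \<Longrightarrow> x \<in> U \<Longrightarrow> h j x \<in> U" and X: "X \<in> carrier_mat n n" and x: "x \<in> U"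
  shows "act X x \<in> U"
proof (rule act_stable[OF U X x])
  fix a b assume ab: "a < n" "b < n"
  consider "a = b" | k where "b = Suc (k + a)" | k where "a = Suc (k + b)"
    using less_imp_Suc_add[of a b] less_imp_Suc_add[of b a] by (metis add.commute linorder_neqE_nat)
  then show "u a b x \<in> U"
  proof cases
    case 1
    then show ?thesis using h[OF ab(1) x] by (simp add: h_def)
  next
    case 2
    show ?thesis unfolding 2 by (rule stable_upper[OF U e _ x]) (use ab 2 in auto)
  next
    case 3
    show ?thesis unfolding 3 by (rule stable_lower[OF U f _ x]) (use ab 3 in auto)
  qed
qed

lemma e_flag: "Suc i < n \<Longrightarrow> matrix_unit n (\<pi> i) (\<pi> (Suc i)) \<in> flag"
  using \<pi>_less by (auto simp: flag_def) (auto simp: matrix_unit_def)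

text \<open>Words of simple raising operators on a weight vector are eigenvectors of the diagonal,
  so their span is stable under the diagonal and, through commutators, under the whole Borel
  subalgebra.\<close>

lemma span_flag_words:
  assumes v: "\<And>j. j < n \<Longrightarrow> \<exists>c. h j v = scale c v"
  shows "span {foldr act Xs v | Xs. set Xs \<subseteq> flag} = span {foldr e is v | is. set is \<subseteq> {i. Suc i < n}}"
    (is "span ?F = span ?E")
proof
  have eword: "e i x \<in> span ?E" if i: "Suc i < n" and x: "x \<in> span ?E" for i x
  proof -
    interpret l: Vector_Spaces.linear scale scale "e i" unfolding e_def by (rule linear_u)
    have "span ?E \<subseteq> {x. e i x \<in> span ?E}"
    proof (rule span_minimal)
      show "subspace {x. e i x \<in> span ?E}" by (rule l.subspace_linear_preimage) simp
      show "?E \<subseteq> {x. e i x \<in> span ?E}"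
      proof (rule subsetI, elim CollectE exE conjE, rule CollectI, rule span_base, rule CollectI)
        fix x "is" assume "x = foldr e is v" "set is \<subseteq> {i. Suc i < n}"
        then show "\<exists>is. e i x = foldr e is v \<and> set is \<subseteq> {i. Suc i < n}"
          using i by (intro exI[of _ "i # is"]) simp
      qed
    qed
    then show ?thesis using x by blast
  qed
  have eigen: "\<exists>c. h j (foldr e is v) = scale c (foldr e is v)" if "j < n" "set is \<subseteq> {i. Suc i < n}" for j "is"
    using that(2)
  proof (induction "is")
    case Nil
    then show ?case using v[OF that(1)] by simp
  next
    case (Cons i "is")
    then obtain c where c: "h j (foldr e is v) = scale c (foldr e is v)" by auto
    have i: "Suc i < n" using Cons.prems by simp
    interpret l: Vector_Spaces.linear scale scale "e i" unfolding e_def by (rule linear_u)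
    show ?case
      unfolding foldr.simps comp_apply h_e[OF that(1) i] c l.scale scale_left_distrib[symmetric] by blast
  qed
  have hword: "h j x \<in> span ?E" if j: "j < n" and x: "x \<in> span ?E" for j x
  proof -
    interpret l: Vector_Spaces.linear scale scale "h j" unfolding h_def by (rule linear_u)
    have "span ?E \<subseteq> {x. h j x \<in> span ?E}"
    proof (rule span_minimal)
      show "subspace {x. h j x \<in> span ?E}" by (rule l.subspace_linear_preimage) simp
      show "?E \<subseteq> {x. h j x \<in> span ?E}"
      proof (rule subsetI, elim CollectE exE conjE, rule CollectI)
        fix x "is" assume w: "x = foldr e is v" "set is \<subseteq> {i. Suc i < n}"
        obtain c where "h j x = scale c x" using eigen[OF j w(2)] w(1) by blast
        moreover have "x \<in> span ?E" by (rule span_base) (use w in blast)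
        ultimately show "h j x \<in> span ?E" by (simp add: span_scale)
      qed
    qed
    then show ?thesis using x by blast
  qed
  have "foldr act Xs v \<in> span ?E" if "set Xs \<subseteq> flag" for Xs
    using that
  proof (induction Xs)
    case Nil
    have "v \<in> ?E" by (rule CollectI, rule exI[of _ "[]"]) simp
    then show ?case by (simp add: span_base)
  next
    case (Cons X Xs)
    have "act X (foldr act Xs v) \<in> span ?E"
      by (rule flag_stable[OF subspace_span eword hword]) (use Cons in auto)
    then show ?case by simp
  qed
  then show "span ?F \<subseteq> span ?E" by (intro span_minimal subspace_span) blast
  have "foldr e is v = foldr act (map (\<lambda>i. matrix_unit n (\<pi> i) (\<pi> (Suc i))) is) v" for "is"
    by (induction "is") (simp_all add: e_def u_def)
  then have "?E \<subseteq> ?F" using e_flag by fastforce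
  then show "span ?E \<subseteq> span ?F" by (rule span_mono)
qed

end

section \<open>Weights as lists and as functions of the position\<close>

definition list_weight :: "nat \<Rightarrow> nat list \<Rightarrow> nat \<Rightarrow> nat" where
  "list_weight n \<nu> j = (if j < n then \<nu> ! j else 0)"

lemma length_pad: "length lam \<le> n \<Longrightarrow> length (pad n lam) = n"
  by (simp add: pad_def)

lemma sym_orbit_eq:
  assumes "length lam \<le> n"
  shows "sym_orbit n lam = (\<lambda>w. map w [0..<n]) ` orbit n (list_weight n (pad n lam))"
proof -
  have "permute_list \<sigma> (pad n lam) = map (list_weight n (pad n lam) \<circ> \<sigma>) [0..<n]" if "\<sigma> permutes {..<n}" for \<sigma>
    using permutes_in_image[OF that] length_pad[OF assms]
    by (simp add: permute_list_def list_weight_def)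
  then have "(\<lambda>\<sigma>. permute_list \<sigma> (pad n lam)) ` {\<sigma>. \<sigma> permutes {..<n}}
      = (\<lambda>w. map w [0..<n]) ` (\<lambda>\<sigma>. list_weight n (pad n lam) \<circ> \<sigma>) ` {\<sigma>. \<sigma> permutes {..<n}}"
    unfolding image_image by (intro image_cong refl) simp
  moreover have "sym_orbit n lam = (\<lambda>\<sigma>. permute_list \<sigma> (pad n lam)) ` {\<sigma>. \<sigma> permutes {..<n}}"
    unfolding sym_orbit_def by blast
  moreover have "orbit n w = (\<lambda>\<sigma>. w \<circ> \<sigma>) ` {\<sigma>. \<sigma> permutes {..<n}}" for w
    unfolding orbit_def by blast
  ultimately show ?thesis by simp
qed

lemma dominant_pad:
  assumes "is_partition lam"
  shows "dominant n (list_weight n (pad n lam))"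
proof -
  have "sorted_wrt (\<ge>) (replicate k (0 :: nat))" for k by (induction k) auto
  then have "sorted_wrt (\<ge>) (pad n lam)" using assms by (auto simp: is_partition_def pad_def sorted_wrt_append)
  moreover have "n \<le> length (pad n lam)" by (simp add: pad_def)
  ultimately show ?thesis
    by (auto simp: dominant_def list_weight_def sorted_wrt_iff_nth_less)
qed

text \<open>Any bound on the parts can serve as the number of tensor factors; their sum avoids a
  case distinction for the empty partition, and surplus factors are empty columns.\<close>

lemma bdd_pad:
  assumes "length lam \<le> n"
  shows "bdd n (sum_list (pad n lam)) (list_weight n (pad n lam))"
  using elem_le_sum_list[of _ "pad n lam"] length_pad[OF assms] by (auto simp: bdd_def list_weight_def)

locale reindexed_irreducible = irreducible_gl_module scale n act lam + reindexed_gl_module scale n act \<pi>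
  for scale :: "'k::field_char_0 \<Rightarrow> 'v::ab_group_add \<Rightarrow> 'v" and n act lam \<pi> +
  fixes ev
  assumes partition: "is_partition lam" and len: "length lam \<le> n"
    and ev: "extremal_vectors scale n act lam ev"
begin

abbreviation lamf where "lamf \<equiv> list_weight n (pad n lam)"

text \<open>The weight \<open>w\<close> is read in the re-indexed order, whereas \<open>ev\<close>
  takes weights in the original one; the involution converts between them.\<close>

definition evf :: "(nat \<Rightarrow> nat) \<Rightarrow> 'v" where
  "evf w = ev (map (w \<circ> \<pi>) [0..<n])"

lemma chevalley: "chevalley_module scale n e f h"
proof (rule chevalley_module.intro[OF vector_space_axioms], rule chevalley_module_axioms.intro)
  show "Vector_Spaces.linear scale scale (e i)" "Vector_Spaces.linear scale scale (f i)"
    "Vector_Spaces.linear scale scale (h i)" for i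
    unfolding e_def f_def h_def by (rule linear_u)+
  fix U :: "'v set"
  assume U: "subspace U" "\<And>i x. Suc i < n \<Longrightarrow> x \<in> U \<Longrightarrow> e i x \<in> U"
    "\<And>i x. Suc i < n \<Longrightarrow> x \<in> U \<Longrightarrow> f i x \<in> U" "\<And>j x. j < n \<Longrightarrow> x \<in> U \<Longrightarrow> h j x \<in> U"
  show "U = {0} \<or> U = UNIV" by (rule irreducible[OF U(1)]) (rule all_stable[OF U])
qed (rule e_f_other e_f_same h_f; assumption)+

lemma orbit_reindex: "w \<in> orbit n lamf \<Longrightarrow> w \<circ> \<pi> \<in> orbit n lamf"
proof -
  assume "w \<in> orbit n lamf"
  then obtain \<sigma> where \<sigma>: "\<sigma> permutes {..<n}" "w = lamf \<circ> \<sigma>" unfolding orbit_def by blast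
  let ?\<pi> = "\<lambda>j. if j < n then \<pi> j else j"
  have "bij_betw ?\<pi> {..<n} {..<n}"
    by (rule bij_betwI[of _ _ _ ?\<pi>]) (auto simp: \<pi>_less \<pi>_\<pi>)
  then have p: "?\<pi> permutes {..<n}" by (rule bij_imp_permutes) simp
  have "w \<circ> \<pi> = lamf \<circ> (\<sigma> \<circ> ?\<pi>)"
  proof
    fix j
    have "\<not> \<pi> j < n" if "\<not> j < n" using that \<pi>_less[of "\<pi> j"] \<pi>_\<pi>[of j] by auto
    then show "(w \<circ> \<pi>) j = (lamf \<circ> (\<sigma> \<circ> ?\<pi>)) j"
      using permutes_not_in[OF \<sigma>(1), of j] permutes_not_in[OF \<sigma>(1), of "\<pi> j"]
      by (auto simp: \<sigma>(2) list_weight_def)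
  qed
  moreover have "\<sigma> \<circ> ?\<pi> permutes {..<n}" by (rule permutes_compose[OF p \<sigma>(1)])
  ultimately show ?thesis unfolding orbit_def by blast
qed

lemma evf_weight:
  assumes "w \<in> orbit n lamf"
  shows "evf w \<noteq> 0" "j < n \<Longrightarrow> h j (evf w) = scale (of_nat (w j)) (evf w)"
proof -
  have "map (w \<circ> \<pi>) [0..<n] \<in> sym_orbit n lam"
    unfolding sym_orbit_eq[OF len] using orbit_reindex[OF assms] by blast
  then have wv: "weight_vector scale n act (map (w \<circ> \<pi>) [0..<n]) (evf w)"
    using ev unfolding extremal_vectors_def evf_def by blast
  then show "evf w \<noteq> 0" by (simp add: weight_vector_def)
  show "h j (evf w) = scale (of_nat (w j)) (evf w)" if "j < n"
    unfolding h_def u_def weight_vector_unit[OF wv \<pi>_less[OF that]] using \<pi>_less[OF that] by (simp add: \<pi>_\<pi>)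
qed

lemma adapted_basis_from_highest:
  assumes v0: "v0 \<noteq> 0" "\<And>j. j < n \<Longrightarrow> h j v0 = scale (of_nat (lamf j)) v0" "\<And>i. Suc i < n \<Longrightarrow> e i v0 = 0"
  obtains B \<kappa>
  where "independent B" "\<And>b. b \<in> B \<Longrightarrow> \<kappa> b \<in> orbit n lamf"
    "\<And>w. w \<in> orbit n lamf \<Longrightarrow> span {foldr act Xs (evf w) | Xs. set Xs \<subseteq> flag} = span {b \<in> B. bruhat_le (\<kappa> b) w}"
    "\<And>w. w \<in> orbit n lamf \<Longrightarrow> \<exists>b\<in>B. \<kappa> b = w"
proof -
  interpret C: highest_weight_module scale n e f h "sum_list (pad n lam)" lamf v0
    by (rule highest_weight_module.intro[OF chevalley], unfold_locales)
      (rule bdd_pad[OF len] dominant_pad[OF partition] v0; assumption?)+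
  obtain B \<kappa> where B: "independent B" "\<And>b. b \<in> B \<Longrightarrow> \<kappa> b \<in> orbit n lamf"
    "\<And>w. w \<in> orbit n lamf \<Longrightarrow> span (C.ewords (evf w)) = span {b \<in> B. bruhat_le (\<kappa> b) w}"
    "\<And>w. w \<in> orbit n lamf \<Longrightarrow> \<exists>b\<in>B. \<kappa> b = w"
    by (rule C.adapted_basis[of evf, OF evf_weight(2,1)]) (assumption | rule that)+
  show ?thesis
  proof (rule that[OF B(1,2)])
    show "span {foldr act Xs (evf w) | Xs. set Xs \<subseteq> flag} = span {b \<in> B. bruhat_le (\<kappa> b) w}"
      if w: "w \<in> orbit n lamf" for w
      unfolding B(3)[OF w, symmetric] C.ewords_def
      by (rule span_flag_words) (use evf_weight(2)[OF w] in blast)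
  qed (use B(4) in blast)+
qed

lemma f_evf:
  assumes v0: "v0 \<noteq> 0" "\<And>j. j < n \<Longrightarrow> h j v0 = scale (of_nat (lamf j)) v0" "\<And>i. Suc i < n \<Longrightarrow> e i v0 = 0"
    and w: "w \<in> orbit n lamf" and i: "Suc i < n" "w i \<le> w (Suc i)"
  shows "f i (evf w) = 0"
proof -
  interpret C: highest_weight_module scale n e f h "sum_list (pad n lam)" lamf v0
    by (rule highest_weight_module.intro[OF chevalley], unfold_locales)
      (rule bdd_pad[OF len] dominant_pad[OF partition] v0; assumption?)+
  show ?thesis by (rule C.f_weight_vector[OF w evf_weight(2)[OF w] i])
qed

end

definition rev_index :: "nat \<Rightarrow> nat \<Rightarrow> nat" where
  "rev_index n j = (if j < n then n - 1 - j else j)"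

context
  fixes scale :: "'k::field_char_0 \<Rightarrow> 'v::ab_group_add \<Rightarrow> 'v" and n act lam ev
  assumes M: "irreducible_gl_module scale n act lam" "is_partition lam" "length lam \<le> n"
    "extremal_vectors scale n act lam ev"
begin

interpretation irreducible_gl_module scale n act lam by (rule M(1))

abbreviation "lamf \<equiv> list_weight n (pad n lam)"

lemma reindexed_id: "reindexed_irreducible scale n act lam id ev"
  by unfold_locales (use M in auto)

abbreviation "rv \<equiv> rev_index n"

lemma reindexed_rv: "reindexed_irreducible scale n act lam rv ev"
  by unfold_locales (use M in \<open>auto simp: rev_index_def\<close>)

lemma highest_exists:
  obtains v0 where "v0 \<noteq> 0" "\<And>j. j < n \<Longrightarrow> act (matrix_unit n j j) v0 = scale (of_nat (lamf j)) v0"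
    "\<And>i. Suc i < n \<Longrightarrow> act (matrix_unit n i (Suc i)) v0 = 0"
proof -
  obtain v0 where v0: "weight_vector scale n act (pad n lam) v0" "\<forall>X\<in>strictly_upper n. act X v0 = 0"
    using highest_weight by blast
  show ?thesis
  proof (rule that)
    show "v0 \<noteq> 0" using v0(1) by (simp add: weight_vector_def)
    show "act (matrix_unit n j j) v0 = scale (of_nat (lamf j)) v0" if "j < n" for j
      using weight_vector_unit[OF v0(1) that] that by (simp add: list_weight_def)
    show "act (matrix_unit n i (Suc i)) v0 = 0" if "Suc i < n" for i
    proof -
      have "(matrix_unit n i (Suc i) :: 'k mat) \<in> strictly_upper n"
        by (auto simp: strictly_upper_def) (auto simp: matrix_unit_def)
      then show ?thesis using v0(2) by blast
    qed
  qed
qed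

theorem demazure_adapted_basis:
  obtains B \<kappa>
  where "independent B" "\<And>b. b \<in> B \<Longrightarrow> \<kappa> b \<in> orbit n lamf"
    "\<And>w. w \<in> orbit n lamf \<Longrightarrow> demazure scale n act (ev (map w [0..<n])) = span {b \<in> B. bruhat_le (\<kappa> b) w}"
    "\<And>w. w \<in> orbit n lamf \<Longrightarrow> \<exists>b\<in>B. \<kappa> b = w"
proof -
  interpret R: reindexed_irreducible scale n act lam id ev by (rule reindexed_id)
  obtain v0 where v0: "v0 \<noteq> 0" "\<And>j. j < n \<Longrightarrow> act (matrix_unit n j j) v0 = scale (of_nat (lamf j)) v0"
    "\<And>i. Suc i < n \<Longrightarrow> act (matrix_unit n i (Suc i)) v0 = 0"
    by (rule highest_exists) (rule that)
  have flag: "R.flag = borel n" by (auto simp: R.flag_def borel_def upper_triangular_def)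
  obtain B \<kappa> where B: "independent B" "\<And>b. b \<in> B \<Longrightarrow> \<kappa> b \<in> orbit n lamf"
    "\<And>w. w \<in> orbit n lamf \<Longrightarrow> span {foldr act Xs (R.evf w) | Xs. set Xs \<subseteq> R.flag} = span {b \<in> B. bruhat_le (\<kappa> b) w}"
    "\<And>w. w \<in> orbit n lamf \<Longrightarrow> \<exists>b\<in>B. \<kappa> b = w"
  proof (rule R.adapted_basis_from_highest[OF v0(1)])
    show "j < n \<Longrightarrow> R.h j v0 = scale (of_nat (lamf j)) v0" for j unfolding R.h_def R.u_def id_apply by (rule v0(2))
    show "Suc i < n \<Longrightarrow> R.e i v0 = 0" for i unfolding R.e_def R.u_def id_apply by (rule v0(3))
  qed (rule that)
  show ?thesis
    by (rule that[OF B(1,2) _ B(4)]) (use B(3) in \<open>simp_all add: demazure_def flag R.evf_def\<close>)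
qed

text \<open>Transposes of upper triangular matrices are upper triangular for the reversed basis, and
  in that order the extremal vector of lowest weight is a highest weight vector.\<close>

theorem op_demazure_adapted_basis:
  obtains B \<kappa>
  where "independent B" "\<And>b. b \<in> B \<Longrightarrow> \<kappa> b \<in> orbit n lamf"
    "\<And>w. w \<in> orbit n lamf \<Longrightarrow> op_demazure scale n act (ev (map (w \<circ> rv) [0..<n])) = span {b \<in> B. bruhat_le (\<kappa> b) w}"
    "\<And>w. w \<in> orbit n lamf \<Longrightarrow> \<exists>b\<in>B. \<kappa> b = w"
proof -
  interpret I: reindexed_irreducible scale n act lam id ev by (rule reindexed_id)
  interpret R: reindexed_irreducible scale n act lam rv ev by (rule reindexed_rv)
  obtain v1 where v1: "v1 \<noteq> 0" "\<And>j. j < n \<Longrightarrow> act (matrix_unit n j j) v1 = scale (of_nat (lamf j)) v1"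
    "\<And>i. Suc i < n \<Longrightarrow> act (matrix_unit n i (Suc i)) v1 = 0"
    by (rule highest_exists) (rule that)
  have v1h: "j < n \<Longrightarrow> I.h j v1 = scale (of_nat (lamf j)) v1" for j unfolding I.h_def I.u_def id_apply by (rule v1(2))
  have v1e: "Suc i < n \<Longrightarrow> I.e i v1 = 0" for i unfolding I.e_def I.u_def id_apply by (rule v1(3))
  \<comment> \<open>In the original order this vector has the reversed weight. The raising operator
    \<open>R.e i\<close> is the original lowering operator number \<open>n - Suc (Suc i)\<close>, so
    \<open>f_evf\<close> applies.\<close>
  let ?v = "R.evf lamf"
  have orb: "lamf \<circ> rv \<in> orbit n lamf" by (rule R.orbit_reindex[OF orbit_self])
  have low: "R.e i ?v = 0" if i: "Suc i < n" for i
  proof -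
    let ?k = "n - Suc (Suc i)"
    have "I.f ?k (I.evf (lamf \<circ> rv)) = 0"
    proof (rule I.f_evf[OF v1(1) v1h v1e orb])
      show "Suc ?k < n" using i by simp
      have "Suc i < n \<Longrightarrow> lamf (Suc i) \<le> lamf i" using dominant_pad[OF M(2), of n] unfolding dominant_def by blast
      moreover have "rv ?k = Suc i" "rv (Suc ?k) = i" using i by (auto simp: rev_index_def)
      ultimately show "(lamf \<circ> rv) ?k \<le> (lamf \<circ> rv) (Suc ?k)" using i by simp
    qed
    moreover have "I.f ?k = R.e i"
    proof -
      have "rv i = Suc ?k" "rv (Suc i) = ?k" using i by (auto simp: rev_index_def)
      then show ?thesis by (simp add: I.f_def R.e_def I.u_def R.u_def)
    qed
    moreover have "I.evf (lamf \<circ> rv) = ?v" by (simp add: I.evf_def R.evf_def)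
    ultimately show ?thesis by simp
  qed
  have flag: "R.flag = transpose_mat ` borel n"
  proof -
    have "X \<in> R.flag \<longleftrightarrow> transpose_mat X \<in> borel n" for X
    proof -
      have "(\<forall>i<n. \<forall>j<i. X $$ (rv i, rv j) = 0) \<longleftrightarrow> (\<forall>i<n. \<forall>j<i. X $$ (j, i) = 0)"
      proof (intro iffI allI impI)
        fix i j assume *: "\<forall>i<n. \<forall>j<i. X $$ (rv i, rv j) = 0" "i < n" "j < i"
        have "X $$ (rv (rv j), rv (rv i)) = 0"
          by (rule *(1)[rule_format]) (use *(2,3) in \<open>auto simp: rev_index_def\<close>)
        then show "X $$ (j, i) = 0" by (simp add: R.\<pi>_\<pi>)
      next
        fix i j assume *: "\<forall>i<n. \<forall>j<i. X $$ (j, i) = 0" "i < n" "j < i"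
        show "X $$ (rv i, rv j) = 0"
          by (rule *(1)[rule_format]) (use *(2,3) in \<open>auto simp: rev_index_def\<close>)
      qed
      then show ?thesis by (auto simp: R.flag_def borel_def upper_triangular_def)
    qed
    then have "X \<in> R.flag \<longleftrightarrow> X \<in> transpose_mat ` borel n" for X
      by (metis image_iff transpose_transpose)
    then show ?thesis by blast
  qed
  \<comment> \<open>A right action composes in the opposite order: folding from the left over a list
    is folding from the right over the reversed list of transposes.\<close>
  have words: "{foldl (op_act act) y Xs | Xs. set Xs \<subseteq> borel n} = {foldr act Xs y | Xs. set Xs \<subseteq> R.flag}" for y
  proof -
    have fl: "foldl (op_act act) y Xs = foldr act (rev (map transpose_mat Xs)) y" for Xs
      unfolding foldr_conv_foldl rev_rev_ident by (induction Xs rule: rev_induct) (simp_all add: op_act_def)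
    have "\<exists>Ys. foldl (op_act act) y Xs = foldr act Ys y \<and> set Ys \<subseteq> R.flag" if "set Xs \<subseteq> borel n" for Xs
      unfolding fl flag using that by (intro exI[of _ "rev (map transpose_mat Xs)"]) auto
    moreover have "\<exists>Xs. foldr act Ys y = foldl (op_act act) y Xs \<and> set Xs \<subseteq> borel n" if "set Ys \<subseteq> R.flag" for Ys
      unfolding fl using that
      by (intro exI[of _ "rev (map transpose_mat Ys)"]) (auto simp: flag rev_map comp_def)
    ultimately show ?thesis by blast
  qed
  obtain B \<kappa> where B: "independent B" "\<And>b. b \<in> B \<Longrightarrow> \<kappa> b \<in> orbit n lamf"
    "\<And>w. w \<in> orbit n lamf \<Longrightarrow> span {foldr act Xs (R.evf w) | Xs. set Xs \<subseteq> R.flag} = span {b \<in> B. bruhat_le (\<kappa> b) w}"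
    "\<And>w. w \<in> orbit n lamf \<Longrightarrow> \<exists>b\<in>B. \<kappa> b = w"
    by (rule R.adapted_basis_from_highest[OF R.evf_weight(1)[OF orbit_self] R.evf_weight(2)[OF orbit_self] low])
      (assumption | rule that)+
  show ?thesis
    by (rule that[OF B(1,2) _ B(4)]) (use B(3) in \<open>simp_all add: op_demazure_def words R.evf_def\<close>)
qed

end

section \<open>Lattices of subspaces with an adapted basis\<close>

text \<open>What the lattice argument needs of index sets. The element \<open>b\<close> makes each
  member prime among unions of members. \<open>Q\<close> has to be nonempty because the generated
  lattice need not contain the zero space.\<close>

definition meet_family :: "'p set \<Rightarrow> ('p \<Rightarrow> 'b set) \<Rightarrow> bool" where
  "meet_family P K \<longleftrightarrow> finite P \<and>
     (\<forall>p\<in>P. \<forall>q\<in>P. \<exists>Q\<subseteq>P. Q \<noteq> {} \<and> K p \<inter> K q = \<Union>(K ` Q)) \<and>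
     (\<forall>p\<in>P. \<exists>b\<in>K p. \<forall>q\<in>P. b \<in> K q \<longrightarrow> K p \<subseteq> K q)"

lemmas meet_family_finite = meet_family_def[THEN iffD1, THEN conjunct1]
  and meet_family_meet = meet_family_def[THEN iffD1, THEN conjunct2, THEN conjunct1, THEN bspec, THEN bspec]
  and meet_family_prime = meet_family_def[THEN iffD1, THEN conjunct2, THEN conjunct2, THEN bspec]

lemma meet_family_Times:
  assumes "meet_family P K" "meet_family P' K'"
  shows "meet_family (P \<times> P') (\<lambda>(p, q). K p \<times> K' q)"
  unfolding meet_family_def
proof (intro conjI ballI)
  show "finite (P \<times> P')" using assms by (simp add: meet_family_def)
next
  fix x y assume "x \<in> P \<times> P'" "y \<in> P \<times> P'"
  then obtain p p' q q' where x: "x = (p, p')" "p \<in> P" "p' \<in> P'" and y: "y = (q, q')" "q \<in> P" "q' \<in> P'"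
    by (elim SigmaE) 
  obtain Q where Q: "Q \<subseteq> P" "Q \<noteq> {}" "K p \<inter> K q = \<Union>(K ` Q)"
    using meet_family_meet[OF assms(1) x(2) y(2)] by blast
  obtain Q' where Q': "Q' \<subseteq> P'" "Q' \<noteq> {}" "K' p' \<inter> K' q' = \<Union>(K' ` Q')"
    using meet_family_meet[OF assms(2) x(3) y(3)] by blast
  have "(case x of (p, q) \<Rightarrow> K p \<times> K' q) \<inter> (case y of (p, q) \<Rightarrow> K p \<times> K' q)
      = \<Union>(K ` Q) \<times> \<Union>(K' ` Q')"
    unfolding x(1) y(1) split Times_Int_Times Q(3) Q'(3) ..
  also have "\<dots> = \<Union>((\<lambda>(p, q). K p \<times> K' q) ` (Q \<times> Q'))" by auto
  finally show "\<exists>R\<subseteq>P \<times> P'. R \<noteq> {} \<and> (case x of (p, q) \<Rightarrow> K p \<times> K' q) \<inter> (case y of (p, q) \<Rightarrow> K p \<times> K' q)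
      = \<Union>((\<lambda>(p, q). K p \<times> K' q) ` R)"
    by (intro exI[of _ "Q \<times> Q'"] conjI Sigma_mono Q(1) Q'(1)) (simp add: Q(2) Q'(2))
next
  fix x assume "x \<in> P \<times> P'"
  then obtain p p' where x: "x = (p, p')" "p \<in> P" "p' \<in> P'" by blast
  obtain b where b: "b \<in> K p" "\<forall>q\<in>P. b \<in> K q \<longrightarrow> K p \<subseteq> K q"
    using meet_family_prime[OF assms(1) x(2)] by blast
  obtain b' where b': "b' \<in> K' p'" "\<forall>q\<in>P'. b' \<in> K' q \<longrightarrow> K' p' \<subseteq> K' q"
    using meet_family_prime[OF assms(2) x(3)] by blast
  show "\<exists>b\<in>case x of (p, q) \<Rightarrow> K p \<times> K' q. \<forall>q\<in>P \<times> P'. b \<in> (case q of (p, q) \<Rightarrow> K p \<times> K' q) \<longrightarrow>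
      (case x of (p, q) \<Rightarrow> K p \<times> K' q) \<subseteq> (case q of (p, q) \<Rightarrow> K p \<times> K' q)"
    unfolding x(1) split
  proof (rule bexI[of _ "(b, b')"], intro ballI impI)
    show "(b, b') \<in> K p \<times> K' p'" using b(1) b'(1) by simp
    fix y assume "y \<in> P \<times> P'" "(b, b') \<in> (case y of (p, q) \<Rightarrow> K p \<times> K' q)"
    moreover obtain q q' where "y = (q, q')" by force
    ultimately show "K p \<times> K' p' \<subseteq> (case y of (p, q) \<Rightarrow> K p \<times> K' q)"
      using b(2) b'(2) by simp blast
  qed
qed

lemma meet_family_image:
  assumes "meet_family P K" and inj: "inj_on f (\<Union>(K ` P))"
  shows "meet_family P (\<lambda>p. f ` K p)"
  unfolding meet_family_def
proof (intro conjI ballI)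
  show "finite P" using assms by (simp add: meet_family_def)
next
  fix p q assume pq: "p \<in> P" "q \<in> P"
  obtain Q where "Q \<subseteq> P" "Q \<noteq> {}" "K p \<inter> K q = \<Union>(K ` Q)"
    using meet_family_meet[OF assms(1) pq] by blast
  moreover have "f ` K p \<inter> f ` K q = f ` (K p \<inter> K q)"
    by (rule inj_on_image_Int[OF inj, symmetric]) (use pq in auto)
  ultimately show "\<exists>Q\<subseteq>P. Q \<noteq> {} \<and> f ` K p \<inter> f ` K q = (\<Union>p\<in>Q. f ` K p)"
    by (intro exI[of _ Q]) (simp add: image_Union image_image)
next
  fix p assume p: "p \<in> P"
  obtain b where b: "b \<in> K p" "\<And>q. q \<in> P \<Longrightarrow> b \<in> K q \<Longrightarrow> K p \<subseteq> K q"
    using meet_family_prime[OF assms(1) p] by blast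
  have "f ` K p \<subseteq> f ` K q" if q: "q \<in> P" "f b \<in> f ` K q" for q
  proof -
    obtain b' where b': "b' \<in> K q" "f b = f b'" using q(2) by blast
    have "b = b'" by (rule inj_onD[OF inj b'(2)]) (use p b(1) q(1) b'(1) in auto)
    then show ?thesis using b(2)[OF q(1)] b'(1) by blast
  qed
  then show "\<exists>b\<in>f ` K p. \<forall>q\<in>P. b \<in> f ` K q \<longrightarrow> f ` K p \<subseteq> f ` K q" using b(1) by blast
qed

lemma lattice_gen_mono: "G \<subseteq> G' \<Longrightarrow> lattice_gen G \<subseteq> lattice_gen G'"
proof
  fix U assume "G \<subseteq> G'" "U \<in> lattice_gen G"
  from this(2,1) show "U \<in> lattice_gen G'"
  proof (induction rule: lattice_gen.induct)
    case (generator U)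
    then show ?case by (intro lattice_gen.generator) blast
  qed (rule lattice_gen.meet lattice_gen.join; assumption)+
qed

context vector_space
begin

lemma span_plus: "span A + span B = span (A \<union> B)"
  unfolding span_Un set_plus_def by blast

lemma independent_span_inject:
  assumes "independent B" "X \<subseteq> B" "Y \<subseteq> B" "span X \<subseteq> span Y"
  shows "X \<subseteq> Y"
proof
  fix b assume b: "b \<in> X"
  show "b \<in> Y"
  proof (rule ccontr)
    assume "b \<notin> Y"
    then have "span Y \<subseteq> span (B - {b})" using assms(3) by (intro span_mono) blast
    moreover have "b \<in> span Y" using span_base[OF b] assms(4) by blast
    ultimately show False using assms(1,2) b unfolding dependent_def by blast
  qed
qed

lemma lattice_gen_adapted:
  assumes B: "independent B" and K: "\<And>p. p \<in> P \<Longrightarrow> K p \<subseteq> B" and fam: "meet_family P K"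
    and U: "U \<in> lattice_gen {span (K p) | p. p \<in> P}"
  shows "\<exists>Q\<subseteq>P. Q \<noteq> {} \<and> U = span (\<Union>(K ` Q))"
  using U
proof (induction rule: lattice_gen.induct)
  case (generator U)
  then obtain p where "p \<in> P" "U = span (K p)" by blast
  then show ?case by (intro exI[of _ "{p}"]) simp
next
  case (meet U W)
  then obtain Q Q' where Q: "Q \<subseteq> P" "Q \<noteq> {}" "U = span (\<Union>(K ` Q))"
    and Q': "Q' \<subseteq> P" "Q' \<noteq> {}" "W = span (\<Union>(K ` Q'))" by blast
  define S where "S p q = (SOME S. S \<subseteq> P \<and> S \<noteq> {} \<and> K p \<inter> K q = \<Union>(K ` S))" for p q
  have S: "S p q \<subseteq> P \<and> S p q \<noteq> {} \<and> K p \<inter> K q = \<Union>(K ` S p q)" if "p \<in> P" "q \<in> P" for p q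
    unfolding S_def by (rule someI_ex[OF meet_family_meet[OF fam that]])
  let ?R = "\<Union>p\<in>Q. \<Union>q\<in>Q'. S p q"
  have "\<Union>(K ` Q) \<inter> \<Union>(K ` Q') = (\<Union>p\<in>Q. \<Union>q\<in>Q'. K p \<inter> K q)" by blast
  also have "\<dots> = (\<Union>p\<in>Q. \<Union>q\<in>Q'. \<Union>(K ` S p q))"
  proof (intro SUP_cong refl)
    fix p q assume "p \<in> Q" "q \<in> Q'"
    then show "K p \<inter> K q = \<Union>(K ` S p q)" using S[of p q] Q(1) Q'(1) by blast
  qed
  also have "\<dots> = \<Union>(K ` ?R)" by blast
  finally have "\<Union>(K ` Q) \<inter> \<Union>(K ` Q') = \<Union>(K ` ?R)" .
  moreover have "U \<inter> W = span (\<Union>(K ` Q) \<inter> \<Union>(K ` Q'))"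
    unfolding Q(3) Q'(3) by (rule span_Int_independent[OF B]) (use K Q(1) Q'(1) in blast)+
  ultimately have "U \<inter> W = span (\<Union>(K ` ?R))" by (simp only:)
  moreover have "?R \<subseteq> P"
  proof (intro UN_least)
    show "S p q \<subseteq> P" if "p \<in> Q" "q \<in> Q'" for p q using S[of p q] Q(1) Q'(1) that by blast
  qed
  moreover have "?R \<noteq> {}"
  proof -
    obtain p q where pq: "p \<in> Q" "q \<in> Q'" using Q(2) Q'(2) by blast
    then have "S p q \<noteq> {}" using S[of p q] Q(1) Q'(1) by blast
    then show ?thesis using pq by blast
  qed
  ultimately show ?case by (intro exI[of _ ?R] conjI)
next
  case (join U W)
  then obtain Q Q' where Q: "Q \<subseteq> P" "Q \<noteq> {}" "U = span (\<Union>(K ` Q))"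
    and Q': "Q' \<subseteq> P" "Q' \<noteq> {}" "W = span (\<Union>(K ` Q'))" by blast
  have "U + W = span (\<Union>(K ` (Q \<union> Q')))" unfolding Q(3) Q'(3) span_plus image_Un Union_Un_distrib ..
  then show ?case using Q(1,2) Q'(1) by (intro exI[of _ "Q \<union> Q'"] conjI) blast+
qed

lemma span_Union_lattice_gen:
  assumes "finite Q" "Q \<noteq> {}" "Q \<subseteq> P"
  shows "span (\<Union>(K ` Q)) \<in> lattice_gen {span (K p) | p. p \<in> P}"
  using assms
proof (induction rule: finite_ne_induct)
  case (singleton p)
  then have "span (K p) \<in> {span (K p) | p. p \<in> P}" by blast
  then show ?case by (simp add: lattice_gen.generator)
next
  case (insert p Q)
  have "span (K p) + span (\<Union>(K ` Q)) \<in> lattice_gen {span (K p) | p. p \<in> P}"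
  proof (rule lattice_gen.join)
    show "span (K p) \<in> lattice_gen {span (K p) | p. p \<in> P}"
      by (rule lattice_gen.generator) (use insert.prems in blast)
    show "span (\<Union>(K ` Q)) \<in> lattice_gen {span (K p) | p. p \<in> P}"
      by (rule insert.IH) (use insert.prems in blast)
  qed
  then show ?case unfolding image_insert Union_insert span_plus .
qed

text \<open>Spans of subsets of one independent set behave like the subsets, whence distributivity.
  If a generator is a sum of two elements, its distinguished basis vector lies in one of them, which
  then is everything. Conversely, an irreducible element is a finite sum of generators, split off
  one at a time.\<close>

theorem adapted_lattice:
  assumes B: "independent B" and K: "\<And>p. p \<in> P \<Longrightarrow> K p \<subseteq> B" and fam: "meet_family P K"
  defines "G \<equiv> {span (K p) | p. p \<in> P}"
  shows "distributive (lattice_gen G)" "G = {V. join_irreducible (lattice_gen G) V}"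
proof -
  have spans: "\<exists>X\<subseteq>B. U = span X" if U: "U \<in> lattice_gen G" for U
  proof -
    obtain Q where "Q \<subseteq> P" "U = span (\<Union>(K ` Q))"
      using lattice_gen_adapted[OF B K fam U[unfolded G_def]] by blast
    then show ?thesis using K by (intro exI[of _ "\<Union>(K ` Q)"]) blast
  qed
  show "distributive (lattice_gen G)"
    unfolding distributive_def
  proof (intro ballI)
    fix U V W assume UVW: "U \<in> lattice_gen G" "V \<in> lattice_gen G" "W \<in> lattice_gen G"
    obtain X where X: "X \<subseteq> B" "U = span X" using spans[OF UVW(1)] by blast
    obtain Y where Y: "Y \<subseteq> B" "V = span Y" using spans[OF UVW(2)] by blast
    obtain Z where Z: "Z \<subseteq> B" "W = span Z" using spans[OF UVW(3)] by blast
    have "U \<inter> (V + W) = span (X \<inter> (Y \<union> Z))"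
      unfolding X(2) Y(2) Z(2) span_plus by (rule span_Int_independent[OF B X(1) Un_least[OF Y(1) Z(1)]])
    also have "\<dots> = span (X \<inter> Y) + span (X \<inter> Z)" unfolding Int_Un_distrib span_plus ..
    also have "span (X \<inter> Y) = U \<inter> V"
      unfolding X(2) Y(2) by (rule span_Int_independent[OF B X(1) Y(1), symmetric])
    also have "span (X \<inter> Z) = U \<inter> W"
      unfolding X(2) Z(2) by (rule span_Int_independent[OF B X(1) Z(1), symmetric])
    finally show "U \<inter> (V + W) = U \<inter> V + U \<inter> W" .
  qed
  show "G = {V. join_irreducible (lattice_gen G) V}"
  proof (intro Set.set_eqI iffI CollectI)
    fix V assume "V \<in> G"
    then obtain p where p: "p \<in> P" "V = span (K p)" unfolding G_def by blast
    obtain b where b: "b \<in> K p" "\<And>q. q \<in> P \<Longrightarrow> b \<in> K q \<Longrightarrow> K p \<subseteq> K q"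
      using meet_family_prime[OF fam p(1)] by blast
    show "join_irreducible (lattice_gen G) V"
      unfolding join_irreducible_def
    proof (intro conjI ballI impI)
      show "V \<in> lattice_gen G" using \<open>V \<in> G\<close> by (rule lattice_gen.generator)
      fix V1 V2 assume V12: "V1 \<in> lattice_gen G" "V2 \<in> lattice_gen G" and V: "V = V1 + V2"
      obtain Q1 where Q1: "Q1 \<subseteq> P" "V1 = span (\<Union>(K ` Q1))"
        using lattice_gen_adapted[OF B K fam V12(1)[unfolded G_def]] by blast
      obtain Q2 where Q2: "Q2 \<subseteq> P" "V2 = span (\<Union>(K ` Q2))"
        using lattice_gen_adapted[OF B K fam V12(2)[unfolded G_def]] by blast
      note Q = Q1 Q2
      have U: "\<Union>(K ` Q1) \<subseteq> B" "\<Union>(K ` Q2) \<subseteq> B" using K Q by blast+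
      have eq: "span (K p) = span (\<Union>(K ` Q1) \<union> \<Union>(K ` Q2))" using V unfolding p(2) Q span_plus .
      have "K p \<subseteq> \<Union>(K ` Q1) \<union> \<Union>(K ` Q2)"
        by (rule independent_span_inject[OF B K[OF p(1)]]) (use U eq in auto)
      moreover have "\<Union>(K ` Q1) \<union> \<Union>(K ` Q2) \<subseteq> K p"
        by (rule independent_span_inject[OF B _ K[OF p(1)]]) (use U eq in auto)
      ultimately have Kp: "\<Union>(K ` Q1) \<union> \<Union>(K ` Q2) = K p" by blast
      have cover: "V = span (\<Union>(K ` Q))" if Q: "Q \<subseteq> P" "b \<in> \<Union>(K ` Q)" "\<Union>(K ` Q) \<subseteq> K p" for Q
      proof -
        obtain q where q: "q \<in> Q" "b \<in> K q" using Q(2) by blast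
        then have "K p \<subseteq> K q" using b(2) Q(1) by blast
        then have "\<Union>(K ` Q) = K p" using q(1) Q(3) by blast
        then show ?thesis using p(2) by (simp only:)
      qed
      have "b \<in> \<Union>(K ` Q1) \<union> \<Union>(K ` Q2)" unfolding Kp by (rule b(1))
      then show "V = V1 \<or> V = V2"
      proof
        assume "b \<in> \<Union>(K ` Q1)"
        then have "V = V1" unfolding Q(2) by (rule cover[OF Q(1)]) (use Kp in blast)
        then show ?thesis ..
      next
        assume "b \<in> \<Union>(K ` Q2)"
        then have "V = V2" unfolding Q(4) by (rule cover[OF Q(3)]) (use Kp in blast)
        then show ?thesis ..
      qed
    qed
  next
    fix V assume "V \<in> {V. join_irreducible (lattice_gen G) V}"
    then have V: "V \<in> lattice_gen G" "\<And>V1 V2. V1 \<in> lattice_gen G \<Longrightarrow> V2 \<in> lattice_gen G \<Longrightarrow> V = V1 + V2 \<Longrightarrow> V = V1 \<or> V = V2"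
      unfolding join_irreducible_def by blast+
    obtain Q where Q: "Q \<subseteq> P" "Q \<noteq> {}" "V = span (\<Union>(K ` Q))"
      using lattice_gen_adapted[OF B K fam V(1)[unfolded G_def]] by blast
    have "finite Q" by (rule finite_subset[OF Q(1) meet_family_finite[OF fam]])
    then show "V \<in> G" using Q(2,1,3)
    proof (induction rule: finite_ne_induct)
      case (singleton p)
      then have "V = span (K p)" "p \<in> P" by simp_all
      then show ?case unfolding G_def by blast
    next
      case (insert p Q)
      have V': "V = span (K p) + span (\<Union>(K ` Q))"
        using insert.prems(2) unfolding image_insert Union_insert span_plus .
      have p: "span (K p) \<in> G" using insert.prems(1) unfolding G_def by blast
      have Q': "span (\<Union>(K ` Q)) \<in> lattice_gen G"
        unfolding G_def by (rule span_Union_lattice_gen[OF insert.hyps(1,2)]) (use insert.prems(1) in blast)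
      from V(2)[OF lattice_gen.generator[OF p] Q' V'] show ?case
      proof
        assume "V = span (K p)"
        then show ?thesis using p by (simp only:)
      next
        assume "V = span (\<Union>(K ` Q))"
        then show ?thesis by (intro insert.IH) (use insert.prems(1) in blast)
      qed
    qed
  qed
qed

end

context tensor_product
begin

lemma tensor_linear:
  "Vector_Spaces.linear sV sT (\<lambda>v. tensor v w)" "Vector_Spaces.linear sW sT (tensor v)"
  using bilinear_tensor by (auto simp: bilinear_map_def)

text \<open>A product of two coordinate functionals is bilinear, and the universal property turns it
  into a functional that detects one pure tensor of basis vectors.\<close>

lemma tensor_functional:
  assumes "V.independent B" "W.independent B'" "b \<in> B" "b' \<in> B'"
  shows "\<exists>F. Vector_Spaces.linear sT (*) F \<and> (\<forall>x\<in>B. \<forall>y\<in>B'. F (tensor x y) = of_bool (x = b \<and> y = b'))"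
proof -
  have K: "vector_space ((*) :: 'k \<Rightarrow> 'k \<Rightarrow> 'k)" by unfold_locales (simp_all add: algebra_simps)
  interpret VK: vector_space_pair sV "(*) :: 'k \<Rightarrow> 'k \<Rightarrow> 'k"
    by (rule vector_space_pair.intro[OF V.vector_space_axioms K])
  interpret WK: vector_space_pair sW "(*) :: 'k \<Rightarrow> 'k \<Rightarrow> 'k"
    by (rule vector_space_pair.intro[OF W.vector_space_axioms K])
  obtain f where f: "Vector_Spaces.linear sV (*) f" "\<forall>x\<in>B. f x = of_bool (x = b)"
    using VK.linear_independent_extend[OF assms(1), of "\<lambda>x. of_bool (x = b)"] by (elim exE conjE)
  obtain g where g: "Vector_Spaces.linear sW (*) g" "\<forall>x\<in>B'. g x = of_bool (x = b')"
    using WK.linear_independent_extend[OF assms(2), of "\<lambda>x. of_bool (x = b')"] by (elim exE conjE)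
  interpret f: Vector_Spaces.linear sV "(*)" f by (rule f(1))
  interpret g: Vector_Spaces.linear sW "(*)" g by (rule g(1))
  have "Vector_Spaces.linear sV (*) (\<lambda>v. f v * c)" for c
    unfolding Vector_Spaces.linear_iff
    by (intro conjI allI V.vector_space_axioms K) (simp_all only: f.add f.scale distrib_right mult.assoc)
  moreover have "Vector_Spaces.linear sW (*) (\<lambda>w. c * g w)" for c
    unfolding Vector_Spaces.linear_iff
    by (intro conjI allI W.vector_space_axioms K) (simp_all only: g.add g.scale distrib_left mult.left_commute)
  ultimately have "bilinear_map sV sW (*) (\<lambda>v w. f v * g w)"
    unfolding bilinear_map_def by blast
  from ex1_implies_ex[OF universal[OF this]]
  obtain F where F: "Vector_Spaces.linear sT (*) F" "\<forall>v w. F (tensor v w) = f v * g w"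
    by (elim exE conjE)
  have "F (tensor x y) = of_bool (x = b \<and> y = b')" if "x \<in> B" "y \<in> B'" for x y
    unfolding F(2)[rule_format] f(2)[rule_format, OF that(1)] g(2)[rule_format, OF that(2)] of_bool_conj ..
  then show ?thesis using F(1) by (intro exI[of _ F] conjI ballI)
qed

lemma tensor_independent:
  assumes "V.independent B" "W.independent B'"
  shows "inj_on (\<lambda>(x, y). tensor x y) (B \<times> B')" "T.independent ((\<lambda>(x, y). tensor x y) ` (B \<times> B'))"
proof -
  show inj: "inj_on (\<lambda>(x, y). tensor x y) (B \<times> B')"
  proof (rule inj_onI)
    fix p q assume pq: "p \<in> B \<times> B'" "q \<in> B \<times> B'" "(case p of (x, y) \<Rightarrow> tensor x y) = (case q of (x, y) \<Rightarrow> tensor x y)"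
    obtain x y where p: "p = (x, y)" "x \<in> B" "y \<in> B'" using pq(1) by (rule SigmaE)
    obtain x' y' where q: "q = (x', y')" "x' \<in> B" "y' \<in> B'" using pq(2) by (rule SigmaE)
    have *: "x \<in> B" "y \<in> B'" "x' \<in> B" "y' \<in> B'" "tensor x y = tensor x' y'"
      using p q pq(3) by simp_all
    obtain F :: "'t \<Rightarrow> 'k" where "Vector_Spaces.linear sT (*) F"
      and F: "\<forall>u\<in>B. \<forall>w\<in>B'. F (tensor u w) = of_bool (u = x \<and> w = y)"
      using tensor_functional[OF assms *(1,2)] by (elim exE conjE)
    have "F (tensor x y) = of_bool (x = x \<and> y = y)" "F (tensor x' y') = of_bool (x' = x \<and> y' = y)"
      by (rule F[rule_format, OF *(1,2)], rule F[rule_format, OF *(3,4)])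
    then have "(1 :: 'k) = of_bool (x' = x \<and> y' = y)" unfolding *(5) by simp
    then show "p = q" unfolding p(1) q(1) by (cases "x' = x \<and> y' = y") simp_all
  qed
  show "T.independent ((\<lambda>(x, y). tensor x y) ` (B \<times> B'))"
    unfolding T.dependent_def
  proof (rule notI, erule bexE)
    let ?S = "(\<lambda>(x, y). tensor x y) ` (B \<times> B')"
    fix a assume a: "a \<in> ?S" "a \<in> T.span (?S - {a})"
    obtain p where "a = (case p of (x, y) \<Rightarrow> tensor x y)" "p \<in> B \<times> B'" using a(1) by (rule imageE)
    then obtain x y where p: "a = tensor x y" "x \<in> B" "y \<in> B'" by auto
    obtain F where F: "Vector_Spaces.linear sT (*) F"
      "\<forall>u\<in>B. \<forall>w\<in>B'. F (tensor u w) = of_bool (u = x \<and> w = y)"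
      using tensor_functional[OF assms p(2,3)] by (elim exE conjE)
    interpret F: Vector_Spaces.linear sT "(*)" F by (rule F(1))
    have "T.span (?S - {a}) \<subseteq> {z. F z = 0}"
    proof (rule T.span_minimal)
      show "?S - {a} \<subseteq> {z. F z = 0}"
      proof
        fix z assume z: "z \<in> ?S - {a}"
        then obtain q where "z = (case q of (x, y) \<Rightarrow> tensor x y)" "q \<in> B \<times> B'" by (elim DiffE imageE)
        then obtain x' y' where z': "z = tensor x' y'" "x' \<in> B" "y' \<in> B'" by auto
        have "\<not> (x' = x \<and> y' = y)" using z unfolding z'(1) p(1) by auto
        then show "z \<in> {z. F z = 0}" unfolding z'(1) mem_Collect_eq F(2)[rule_format, OF z'(2,3)] by simp
      qed
      show "T.subspace {z. F z = 0}"
        by (rule T.subspaceI; (elim CollectE)?; rule CollectI) (simp_all only: F.add F.scale F.zero add_0_left mult_zero_right)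
    qed
    then have "F a = 0" using a(2) by blast
    moreover have "F a = 1" unfolding p(1) F(2)[rule_format, OF p(2,3)] by simp
    ultimately show False by simp
  qed
qed

lemma tensor_subspace_span:
  "tensor_subspace sT tensor (V.span X) (W.span Y) = T.span ((\<lambda>(x, y). tensor x y) ` (X \<times> Y))"
  (is "_ = T.span ?S")
proof
  have one: "tensor u y \<in> T.span ?S" if "u \<in> V.span X" "y \<in> Y" for u y
  proof -
    interpret l: Vector_Spaces.linear sV sT "\<lambda>v. tensor v y" by (rule tensor_linear)
    have "V.span X \<subseteq> {u. tensor u y \<in> T.span ?S}"
    proof (rule V.span_minimal)
      show "X \<subseteq> {u. tensor u y \<in> T.span ?S}" using that(2) by (intro subsetI CollectI T.span_base image_eqI[of _ _ "(_, y)"]) simp_all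
      show "V.subspace {u. tensor u y \<in> T.span ?S}" by (rule l.subspace_linear_preimage) simp
    qed
    then show ?thesis using that by blast
  qed
  have "tensor u u' \<in> T.span ?S" if "u \<in> V.span X" "u' \<in> W.span Y" for u u'
  proof -
    interpret l: Vector_Spaces.linear sW sT "tensor u" by (rule tensor_linear)
    have "W.span Y \<subseteq> {w. tensor u w \<in> T.span ?S}"
    proof (rule W.span_minimal)
      show "Y \<subseteq> {w. tensor u w \<in> T.span ?S}" using one that(1) by blast
      show "W.subspace {w. tensor u w \<in> T.span ?S}" by (rule l.subspace_linear_preimage) simp
    qed
    then show ?thesis using that by blast
  qed
  then show "tensor_subspace sT tensor (V.span X) (W.span Y) \<subseteq> T.span ?S"
    unfolding tensor_subspace_def by (intro T.span_minimal T.subspace_span) blast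
  show "T.span ?S \<subseteq> tensor_subspace sT tensor (V.span X) (W.span Y)"
    unfolding tensor_subspace_def
  proof (rule T.span_mono, rule subsetI, elim imageE SigmaE)
    fix t p x y assume "t = (case p of (x, y) \<Rightarrow> tensor x y)" "p = (x, y)" "x \<in> X" "y \<in> Y"
    then have "t = tensor x y" "x \<in> V.span X" "y \<in> W.span Y" by (simp_all add: V.span_base W.span_base)
    then show "t \<in> {tensor u u' | u u'. u \<in> V.span X \<and> u' \<in> W.span Y}" by blast
  qed
qed

end

section \<open>DL-dense arrays\<close>

lemma finite_diagram: "finite (diagram h m)"
proof (rule finite_subset)
  show "diagram h m \<subseteq> (\<Union>j\<in>{1..m}. {1..h j} \<times> {j})" by (auto simp: diagram_def)
qed simp

lemma staircase_diagram: "staircase h m \<subseteq> diagram h m"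
proof (induction m)
  case (Suc j)
  let ?F = "{i \<in> {1..h (Suc j)}. i \<notin> fst ` staircase h j}"
  have "Max ?F \<in> ?F" if "?F \<noteq> {}" using that by (intro Max_in) auto
  moreover have "diagram h j \<subseteq> diagram h (Suc j)" by (auto simp: diagram_def)
  ultimately show ?case using Suc by (auto simp: Let_def diagram_def)
qed simp

lemma staircase_inj: "inj_on fst (staircase h m)" "inj_on snd (staircase h m)"
proof -
  have "inj_on fst (staircase h m) \<and> inj_on snd (staircase h m)"
  proof (induction m)
    case (Suc j)
    let ?F = "{i \<in> {1..h (Suc j)}. i \<notin> fst ` staircase h j}"
    show ?case
    proof (cases "?F = {}")
      case True
      then have "staircase h (Suc j) = staircase h j"
        unfolding staircase.simps(2) Let_def by (rule if_P)
      then show ?thesis using Suc by (simp only:)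
    next
      case False
      then have "Max ?F \<in> ?F" by (intro Max_in) auto
      then have "Max ?F \<notin> fst ` staircase h j" by blast
      moreover have "Suc j \<notin> snd ` staircase h j"
        using staircase_diagram[of h j] by (auto simp: diagram_def)
      moreover have "staircase h (Suc j) = insert (Max ?F, Suc j) (staircase h j)"
        unfolding staircase.simps(2) Let_def by (rule if_not_P[OF False])
      ultimately show ?thesis using Suc by (simp only: inj_on_insert) auto
    qed
  qed simp
  then show "inj_on fst (staircase h m)" "inj_on snd (staircase h m)" by blast+
qed

lemma size_filter_count:
  "size (filter_mset (\<lambda>x. t < x) M) = count M (Suc t) + size (filter_mset (\<lambda>x. Suc t < x) M)"
  by (induction M) auto

text \<open>Tail counts are what ranks provide; their differences recover the multiplicities of
  positive values, and 0 is excluded separately.\<close>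

lemma mset_eqI_tails:
  fixes M M' :: "nat multiset"
  assumes "\<And>t. size (filter_mset (\<lambda>x. t < x) M) = size (filter_mset (\<lambda>x. t < x) M')" "0 \<notin># M" "0 \<notin># M'"
  shows "M = M'"
proof (rule multiset_eqI)
  fix x :: nat
  show "count M x = count M' x"
  proof (cases x)
    case 0
    then show ?thesis using assms(2,3) by (simp add: not_in_iff)
  next
    case (Suc t)
    then show ?thesis
      using size_filter_count[of t M] size_filter_count[of t M'] assms(1)[of t] assms(1)[of "Suc t"] by simp
  qed
qed

lemma rk_partition:
  assumes "length lam \<le> k"
  shows "rk (list_weight k (pad k lam)) k t = size (filter_mset (\<lambda>x. t < x) (mset lam))"
proof -
  have "{j. j < k \<and> t < list_weight k (pad k lam) j} = {j. j < length lam \<and> t < lam ! j}"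
    using assms by (auto simp: list_weight_def pad_def nth_append split: if_splits)
  then have "rk (list_weight k (pad k lam)) k t = card {j. j < length lam \<and> t < lam ! j}"
    by (simp add: rk_def)
  also have "\<dots> = length (filter (\<lambda>x. t < x) lam)" by (simp add: length_filter_conv_card)
  finally show ?thesis by (simp flip: mset_filter)
qed

text \<open>The positions of the staircase cells (rows from above, or columns from the right) and their
  labels (columns, or rows) turn the two families of weights into one and the same combinatorial
  object.\<close>

locale staircase_positions =
  fixes h :: "nat \<Rightarrow> nat" and m :: nat and lam :: "nat list" and k :: nat
    and pos lab :: "nat \<times> nat \<Rightarrow> nat"
  assumes pos_inj: "inj_on pos (staircase h m)" and lab_inj: "inj_on lab (staircase h m)"
    and pos_less: "s \<in> staircase h m \<Longrightarrow> pos s < k"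
    and cell_less_pos: "s \<in> staircase h m \<Longrightarrow> t \<in> staircase h m \<Longrightarrow>
          cell_less s t \<longleftrightarrow> pos s < pos t \<and> lab t < lab s"
    and partition: "is_partition lam" and len: "length lam \<le> card (staircase h m)"
begin

abbreviation S where "S \<equiv> staircase h m"

definition label :: "nat \<Rightarrow> nat" where "label = lab \<circ> the_inv_into S pos"

definition rows :: "nat set" where "rows = pos ` S"

definition weight :: "(nat \<times> nat \<Rightarrow> nat) \<Rightarrow> nat \<Rightarrow> nat" where
  "weight A p = (\<Sum>s\<in>S. if pos s = p then A s else 0)"

lemma finite_S: "finite S"
  by (rule finite_subset[OF staircase_diagram finite_diagram])

lemma len_N: "length lam \<le> k"
proof -
  have "pos ` S \<subseteq> {..<k}" using pos_less by blast
  from card_inj_on_le[OF pos_inj this] have "card S \<le> card {..<k}" by simp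
  then show ?thesis using len by simp
qed

lemma label_pos [simp]: "s \<in> S \<Longrightarrow> label (pos s) = lab s"
  by (simp add: label_def the_inv_into_f_f[OF pos_inj])

lemma rows_less: "rows \<subseteq> {..<k}"
  using pos_less by (auto simp: rows_def)

lemma label_inj: "inj_on label rows"
  unfolding rows_def
proof (rule inj_onI, elim imageE)
  fix i i' s t assume *: "label i = label i'" "i = pos s" "s \<in> S" "i' = pos t" "t \<in> S"
  then have "lab s = lab t" by simp
  then have "s = t" by (rule inj_onD[OF lab_inj _ *(3,5)])
  then show "i = i'" using *(2,4) by simp
qed

lemma weight_pos [simp]: "s \<in> S \<Longrightarrow> weight A (pos s) = A s"
proof -
  assume s: "s \<in> S"
  have "weight A (pos s) = (\<Sum>t\<in>S. if t = s then A s else 0)"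
    unfolding weight_def by (rule sum.cong) (simp_all add: inj_on_eq_iff[OF pos_inj _ s])
  then show ?thesis using s finite_S by simp
qed

lemma weight_other: "p \<notin> rows \<Longrightarrow> weight A p = 0"
  unfolding weight_def rows_def by (rule sum.neutral) auto

abbreviation lamf where "lamf \<equiv> list_weight k (pad k lam)"

lemma rk_weight: "rk (weight A) k t = card {s \<in> S. t < A s}"
proof -
  have eq: "{j. j < k \<and> t < weight A j} = pos ` {s \<in> S. t < A s}"
  proof (rule Set.set_eqI, rule iffI)
    fix j assume "j \<in> {j. j < k \<and> t < weight A j}"
    then have j: "t < weight A j" by (rule CollectE) (erule conjunct2)
    have "j \<in> rows"
    proof (rule ccontr)
      assume "j \<notin> rows"
      then have "weight A j = 0" by (rule weight_other)
      then show False using j by linarith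
    qed
    then obtain s where s: "s \<in> S" "j = pos s" unfolding rows_def by (elim imageE)
    have "t < A s" using j unfolding s(2) weight_pos[OF s(1)] .
    then show "j \<in> pos ` {s \<in> S. t < A s}" unfolding s(2) using s(1) by (intro imageI CollectI conjI)
  next
    fix j assume "j \<in> pos ` {s \<in> S. t < A s}"
    then obtain s where s: "j = pos s" "s \<in> S" "t < A s" by (elim imageE CollectE conjE)
    show "j \<in> {j. j < k \<and> t < weight A j}"
      unfolding s(1) mem_Collect_eq weight_pos[OF s(2)] using pos_less[OF s(2)] s(3) by (rule conjI)
  qed
  have "inj_on pos {s \<in> S. t < A s}" by (rule inj_on_subset[OF pos_inj Collect_restrict])
  then show ?thesis unfolding rk_def eq by (rule card_image)
qed

lemma size_filter_entries:
  fixes A :: "nat \<times> nat \<Rightarrow> nat"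
  assumes A0: "\<forall>s. s \<notin> S \<longrightarrow> A s = 0"
  shows "size (filter_mset (\<lambda>x. t < x) (image_mset A (mset_set {s \<in> diagram h m. A s \<noteq> 0}))) = card {s \<in> S. t < A s}"
proof -
  let ?D = "{s \<in> diagram h m. A s \<noteq> 0}"
  have fin: "finite ?D" by (rule finite_subset[OF Collect_restrict finite_diagram])
  have eq: "{s \<in> ?D. t < A s} = {s \<in> S. t < A s}"
  proof (rule Set.set_eqI, rule iffI)
    fix s assume "s \<in> {s \<in> ?D. t < A s}"
    then have s: "t < A s" by (elim CollectE conjE)
    have "s \<in> S"
    proof (rule ccontr)
      assume "s \<notin> S"
      then have "A s = 0" by (rule A0[rule_format])
      then show False using s by linarith
    qed
    then show "s \<in> {s \<in> S. t < A s}" using s by (intro CollectI conjI)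
  next
    fix s assume "s \<in> {s \<in> S. t < A s}"
    then have s: "s \<in> S" "t < A s" by simp_all
    have "s \<in> diagram h m" by (rule subsetD[OF staircase_diagram s(1)])
    moreover have "A s \<noteq> 0" using s(2) by linarith
    ultimately show "s \<in> {s \<in> ?D. t < A s}" using s(2) by (intro CollectI conjI)
  qed
  show ?thesis
    unfolding filter_mset_image_mset size_image_mset filter_mset_mset_set[OF fin] size_mset_set eq ..
qed

text \<open>Tail counts of the entries of the array are the ranks of its weight at full length, so
  the multiset condition places the weight in the orbit of the partition.\<close>

lemma DL_weight:
  assumes A: "A \<in> DL h m lam"
  shows "weight A \<in> compatible k lamf rows label"
proof -
  have A0: "\<forall>s. s \<notin> S \<longrightarrow> A s = 0" and mono: "\<And>s t. s \<in> S \<Longrightarrow> t \<in> S \<Longrightarrow> cell_less s t \<Longrightarrow> A s \<le> A t"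
    and ms: "image_mset A (mset_set {s \<in> diagram h m. A s \<noteq> 0}) = mset lam"
    using A unfolding DL_def by blast+
  have "weight A \<in> orbit k lamf"
  proof (rule orbitI_rk)
    show "rk (weight A) k t = rk lamf k t" for t
      unfolding rk_weight rk_partition[OF len_N] ms[symmetric] size_filter_entries[OF A0] ..
    show "weight A j = lamf j" if j: "k \<le> j" for j
    proof -
      have "j \<notin> rows" using j rows_less by auto
      then show ?thesis using j by (simp add: weight_other list_weight_def)
    qed
  qed
  moreover have "j \<in> rows" if "0 < weight A j" for j
    using that weight_other[of j A] by (cases "j \<in> rows") simp_all
  moreover have "weight A i \<le> weight A i'" if i: "i \<in> rows" "i' \<in> rows" "i < i'" "label i' < label i" for i i'
  proof -
    obtain s where s: "s \<in> S" "i = pos s" using i(1) unfolding rows_def by (elim imageE)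
    obtain t where t: "t \<in> S" "i' = pos t" using i(2) unfolding rows_def by (elim imageE)
    have "cell_less s t" unfolding cell_less_pos[OF s(1) t(1)] using i(3,4) s t by simp
    then show ?thesis using mono[OF s(1) t(1)] s t by simp
  qed
  ultimately show ?thesis unfolding compatible_def by (intro CollectI conjI allI ballI impI)
qed

lemma compatible_DL:
  assumes z: "z \<in> compatible k lamf rows label"
  shows "\<exists>A\<in>DL h m lam. weight A = z"
proof -
  define A where "A s = (if s \<in> S then z (pos s) else 0)" for s
  have zo: "z \<in> orbit k lamf" and zr: "\<And>j. 0 < z j \<Longrightarrow> j \<in> rows"
    and zm: "\<And>i i'. i \<in> rows \<Longrightarrow> i' \<in> rows \<Longrightarrow> i < i' \<Longrightarrow> label i' < label i \<Longrightarrow> z i \<le> z i'"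
    using z unfolding compatible_def by simp_all
  have A0: "\<forall>s. s \<notin> S \<longrightarrow> A s = 0" by (simp add: A_def)
  have w: "weight A = z"
  proof
    fix p show "weight A p = z p"
    proof (cases "p \<in> rows")
      case True
      then obtain s where "s \<in> S" "p = pos s" unfolding rows_def by (elim imageE)
      then show ?thesis by (simp add: A_def)
    next
      case False
      then show ?thesis using weight_other[OF False, of A] zr[of p] by auto
    qed
  qed
  have "image_mset A (mset_set {s \<in> diagram h m. A s \<noteq> 0}) = mset lam"
  proof (rule mset_eqI_tails)
    show "size (filter_mset (\<lambda>x. t < x) (image_mset A (mset_set {s \<in> diagram h m. A s \<noteq> 0})))
        = size (filter_mset (\<lambda>x. t < x) (mset lam))" for t
      unfolding size_filter_entries[OF A0] rk_partition[OF len_N, symmetric] rk_weight[symmetric] w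
      by (rule rk_orbit[OF zo])
    show "0 \<notin># mset lam" using partition by (simp add: is_partition_def)
    have "finite {s \<in> diagram h m. A s \<noteq> 0}" by (rule finite_subset[OF _ finite_diagram[of h m]]) blast
    then show "0 \<notin># image_mset A (mset_set {s \<in> diagram h m. A s \<noteq> 0})"
      unfolding set_image_mset by (simp only: finite_set_mset_mset_set) (auto simp: image_iff)
  qed
  moreover have "A s \<le> A t" if "s \<in> S" "t \<in> S" "cell_less s t" for s t
    using zm[of "pos s" "pos t"] that cell_less_pos[OF that(1,2)] by (simp add: A_def rows_def)
  ultimately have "A \<in> DL h m lam" using A0 unfolding DL_def by (intro CollectI conjI ballI impI)
  then show ?thesis using w by blast
qed

lemma weight_DL: "weight ` DL h m lam = compatible k lamf rows label"
  using DL_weight compatible_DL by blast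

text \<open>If the label of a basis vector is below two members, the least compatible weight above
  it is below both; so the intersection is the union over the common lower members. A basis vector
  labelled by the member itself is the distinguished one.\<close>

lemma meet_family_weights:
  assumes \<kappa>: "\<And>b. b \<in> B \<Longrightarrow> \<kappa> b \<in> orbit k lamf" "\<And>w. w \<in> orbit k lamf \<Longrightarrow> \<exists>b\<in>B. \<kappa> b = w"
  shows "meet_family (weight ` DL h m lam) (\<lambda>w. {b \<in> B. bruhat_le (\<kappa> b) w})"
  unfolding weight_DL meet_family_def
proof (intro conjI ballI)
  let ?P = "compatible k lamf rows label"
  show "finite ?P" by (rule finite_subset[OF _ finite_orbit]) (auto simp: compatible_def)
  have closure: "\<exists>z\<in>?P. bruhat_le u z \<and> (\<forall>x\<in>?P. bruhat_le u x \<longrightarrow> bruhat_le z x)"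
    if u: "u \<in> orbit k lamf" "x \<in> ?P" "bruhat_le u x" for u x
  proof (rule compatible_closure[OF rows_less label_inj u(1)])
    show "\<exists>x\<in>?P. bruhat_le u x" by (rule bexI[of "bruhat_le u" x, OF u(3,2)])
  qed
  fix x assume x: "x \<in> ?P"
  then have xo: "x \<in> orbit k lamf" by (simp add: compatible_def)
  show "\<exists>b\<in>{b \<in> B. bruhat_le (\<kappa> b) x}. \<forall>q\<in>?P. b \<in> {b \<in> B. bruhat_le (\<kappa> b) q} \<longrightarrow>
      {b \<in> B. bruhat_le (\<kappa> b) x} \<subseteq> {b \<in> B. bruhat_le (\<kappa> b) q}"
  proof -
    obtain b where "b \<in> B" "\<kappa> b = x" using \<kappa>(2)[OF xo] by blast
    moreover have "{b \<in> B. bruhat_le (\<kappa> b) x} \<subseteq> {b \<in> B. bruhat_le (\<kappa> b) q}" if "bruhat_le x q" for q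
      using bruhat_trans[OF _ that] by blast
    ultimately show ?thesis by (intro bexI[of _ b] ballI impI) (elim CollectE conjE, simp only:, simp)
  qed
  fix y assume y: "y \<in> ?P"
  then have yo: "y \<in> orbit k lamf" by (simp add: compatible_def)
  let ?Q = "{z \<in> ?P. bruhat_le z x \<and> bruhat_le z y}"
  have below: "\<exists>z\<in>?Q. bruhat_le u z" if u: "u \<in> orbit k lamf" "bruhat_le u x" "bruhat_le u y" for u
  proof -
    obtain z where z: "z \<in> ?P" "bruhat_le u z" "\<forall>x\<in>?P. bruhat_le u x \<longrightarrow> bruhat_le z x"
      using closure[OF u(1) x u(2)] by (elim bexE conjE)
    have "bruhat_le z x" "bruhat_le z y"
      by (rule z(3)[rule_format, OF x u(2)], rule z(3)[rule_format, OF y u(3)])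
    then show ?thesis using z(1,2) by (intro bexI[of _ z]) simp_all
  qed
  show "\<exists>Q\<subseteq>?P. Q \<noteq> {} \<and> {b \<in> B. bruhat_le (\<kappa> b) x} \<inter> {b \<in> B. bruhat_le (\<kappa> b) y}
      = (\<Union>w\<in>Q. {b \<in> B. bruhat_le (\<kappa> b) w})"
  proof (intro exI[of _ ?Q] conjI)
    have zero: "lamf j = 0" if "k \<le> j" for j using that by (simp add: list_weight_def)
    \<comment> \<open>The dominant weight lies below both, and the least compatible weight above it
      is a common lower member.\<close>
    have "bruhat_le lamf x"
      by (rule dominant_least[OF orbit_self xo dominant_pad[OF partition]]) (rule zero)
    moreover have "bruhat_le lamf y"
      by (rule dominant_least[OF orbit_self yo dominant_pad[OF partition]]) (rule zero)
    ultimately show "?Q \<noteq> {}" using below[OF orbit_self] by (metis (no_types, lifting) empty_iff)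
    show "{b \<in> B. bruhat_le (\<kappa> b) x} \<inter> {b \<in> B. bruhat_le (\<kappa> b) y} = (\<Union>w\<in>?Q. {b \<in> B. bruhat_le (\<kappa> b) w})"
    proof (intro equalityI subsetI)
      fix b assume "b \<in> {b \<in> B. bruhat_le (\<kappa> b) x} \<inter> {b \<in> B. bruhat_le (\<kappa> b) y}"
      then have b: "b \<in> B" "bruhat_le (\<kappa> b) x" "bruhat_le (\<kappa> b) y" by simp_all
      obtain z where "z \<in> ?Q" "bruhat_le (\<kappa> b) z" using below[OF \<kappa>(1)[OF b(1)] b(2,3)] by (elim bexE)
      then show "b \<in> (\<Union>w\<in>?Q. {b \<in> B. bruhat_le (\<kappa> b) w})" using b(1) by (intro UN_I[of z]) simp_all
    next
      fix b assume "b \<in> (\<Union>w\<in>?Q. {b \<in> B. bruhat_le (\<kappa> b) w})"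
      then obtain w where "b \<in> B" "bruhat_le (\<kappa> b) w" "bruhat_le w x" "bruhat_le w y" by blast
      then show "b \<in> {b \<in> B. bruhat_le (\<kappa> b) x} \<inter> {b \<in> B. bruhat_le (\<kappa> b) y}"
        by (simp add: bruhat_trans[of "\<kappa> b" w])
    qed
    show "?Q \<subseteq> ?P" by (rule Collect_restrict)
  qed
qed

end

context
  fixes h :: "nat \<Rightarrow> nat" and m n :: nat and lam :: "nat list"
  assumes h: "1 \<le> m" "mono_on {1..m} h" "n = h m"
    and lam: "is_partition lam" "length lam \<le> card (staircase h m)"
begin

lemma staircase_bounds:
  assumes "s \<in> staircase h m"
  shows "1 \<le> fst s" "fst s \<le> n" "1 \<le> snd s" "snd s \<le> m"
proof -
  have s: "1 \<le> snd s" "snd s \<le> m" "1 \<le> fst s" "fst s \<le> h (snd s)"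
    using staircase_diagram[of h m] assms by (auto simp: diagram_def)
  moreover have "h (snd s) \<le> h m" using monotone_onD[OF h(2)] s(1,2) h(1) by simp
  ultimately show "1 \<le> fst s" "fst s \<le> n" "1 \<le> snd s" "snd s \<le> m" using h(3) by auto
qed

lemma staircase_eq:
  assumes "s \<in> staircase h m" "t \<in> staircase h m"
  shows "fst s = fst t \<longleftrightarrow> s = t" "snd s = snd t \<longleftrightarrow> s = t"
  using inj_on_eq_iff[OF staircase_inj(1) assms] inj_on_eq_iff[OF staircase_inj(2) assms] by auto

text \<open>No two staircase cells share a row or a column, so the weak inequalities become
  strict.\<close>

lemma cell_less_staircase:
  assumes "s \<in> staircase h m" "t \<in> staircase h m"
  shows "cell_less s t \<longleftrightarrow> fst s < fst t \<and> snd t < snd s"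
  using staircase_eq[OF assms] by (auto simp: cell_less_def)

lemma hor_positions: "staircase_positions h m lam n (\<lambda>s. fst s - 1) snd"
proof
  show "inj_on (\<lambda>s. fst s - 1) (staircase h m)"
  proof (rule inj_onI)
    fix s t assume st: "s \<in> staircase h m" "t \<in> staircase h m" "fst s - 1 = fst t - 1"
    then have "fst s = fst t" using staircase_bounds(1)[OF st(1)] staircase_bounds(1)[OF st(2)] by simp
    then show "s = t" using staircase_eq(1)[OF st(1,2)] by simp
  qed
  show "fst s - 1 < n" if "s \<in> staircase h m" for s using staircase_bounds[OF that] by simp
  show "cell_less s t \<longleftrightarrow> fst s - 1 < fst t - 1 \<and> snd t < snd s"
    if "s \<in> staircase h m" "t \<in> staircase h m" for s t
    unfolding cell_less_staircase[OF that] using staircase_bounds[OF that(1)] staircase_bounds[OF that(2)] by auto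
qed (rule staircase_inj lam)+

text \<open>Columns are counted from the right to match the reversed order of the basis for the
  right modules; rows become labels, and reversing them as well preserves the order of
  cells.\<close>

lemma vrt_positions: "staircase_positions h m lam m (\<lambda>s. m - snd s) (\<lambda>s. n - fst s)"
proof
  show "inj_on (\<lambda>s. m - snd s) (staircase h m)"
  proof (rule inj_onI)
    fix s t assume st: "s \<in> staircase h m" "t \<in> staircase h m" "m - snd s = m - snd t"
    then have "snd s = snd t" using staircase_bounds(4)[OF st(1)] staircase_bounds(4)[OF st(2)] by simp
    then show "s = t" using staircase_eq(2)[OF st(1,2)] by simp
  qed
  show "inj_on (\<lambda>s. n - fst s) (staircase h m)"
  proof (rule inj_onI)
    fix s t assume st: "s \<in> staircase h m" "t \<in> staircase h m" "n - fst s = n - fst t"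
    then have "fst s = fst t" using staircase_bounds(2)[OF st(1)] staircase_bounds(2)[OF st(2)] by simp
    then show "s = t" using staircase_eq(1)[OF st(1,2)] by simp
  qed
  show "m - snd s < m" if "s \<in> staircase h m" for s using staircase_bounds[OF that] by simp
  show "cell_less s t \<longleftrightarrow> m - snd s < m - snd t \<and> n - fst t < n - fst s"
    if "s \<in> staircase h m" "t \<in> staircase h m" for s t
    unfolding cell_less_staircase[OF that] using staircase_bounds[OF that(1)] staircase_bounds[OF that(2)] by auto
qed (rule lam)+

lemma hor_weight:
  assumes "A \<in> DL h m lam"
  shows "hor n m A = map (staircase_positions.weight h m (\<lambda>s. fst s - 1) A) [0..<n]"
proof -
  interpret staircase_positions h m lam n "\<lambda>s. fst s - 1" snd by (rule hor_positions)
  have A0: "A s = 0" if "s \<notin> S" for s using assms that unfolding DL_def by blast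
  have "(\<Sum>j\<in>{1..m}. A (Suc k, j)) = weight A k" for k
  proof -
    have "(\<Sum>j\<in>{1..m}. A (Suc k, j)) = sum A (Pair (Suc k) ` {1..m})"
      by (subst sum.reindex) (auto simp: inj_on_def)
    also have "\<dots> = sum A {s \<in> S. fst s - 1 = k}"
    proof (rule sum.mono_neutral_right)
      show "{s \<in> S. fst s - 1 = k} \<subseteq> Pair (Suc k) ` {1..m}"
      proof
        fix s assume s: "s \<in> {s \<in> S. fst s - 1 = k}"
        then have "s = (Suc k, snd s)" "snd s \<in> {1..m}"
          using staircase_bounds[of s] by (auto simp: prod_eq_iff)
        then show "s \<in> Pair (Suc k) ` {1..m}" by blast
      qed
      show "\<forall>s\<in>Pair (Suc k) ` {1..m} - {s \<in> S. fst s - 1 = k}. A s = 0"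
      proof
        fix s assume s: "s \<in> Pair (Suc k) ` {1..m} - {s \<in> S. fst s - 1 = k}"
        then have "fst s - 1 = k" by auto
        then show "A s = 0" using s by (intro A0) blast
      qed
    qed simp
    also have "\<dots> = weight A k" unfolding weight_def by (rule sum.inter_filter[OF finite_S])
    finally show ?thesis .
  qed
  then show ?thesis by (intro nth_equalityI) (simp_all add: hor_def del: upt_Suc)
qed

text \<open>Column sums are listed from the left but positions count from the right, hence the
  reversal.\<close>

lemma vrt_weight:
  assumes "A \<in> DL h m lam"
  shows "vrt n m A = map (staircase_positions.weight h m (\<lambda>s. m - snd s) A \<circ> rev_index m) [0..<m]"
proof -
  interpret staircase_positions h m lam m "\<lambda>s. m - snd s" "\<lambda>s. n - fst s" by (rule vrt_positions)
  have A0: "A s = 0" if "s \<notin> S" for s using assms that unfolding DL_def by blast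
  have "(\<Sum>i\<in>{1..n}. A (i, Suc k)) = weight A (rev_index m k)" if k: "k < m" for k
  proof -
    have "(\<Sum>i\<in>{1..n}. A (i, Suc k)) = sum A ((\<lambda>i. (i, Suc k)) ` {1..n})"
      by (subst sum.reindex) (auto simp: inj_on_def)
    also have "\<dots> = sum A {s \<in> S. m - snd s = rev_index m k}"
    proof (rule sum.mono_neutral_right)
      show "{s \<in> S. m - snd s = rev_index m k} \<subseteq> (\<lambda>i. (i, Suc k)) ` {1..n}"
      proof
        fix s assume s: "s \<in> {s \<in> S. m - snd s = rev_index m k}"
        then have "s = (fst s, Suc k)" "fst s \<in> {1..n}"
          using staircase_bounds[of s] k by (auto simp: prod_eq_iff rev_index_def)
        then show "s \<in> (\<lambda>i. (i, Suc k)) ` {1..n}" by blast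
      qed
      show "\<forall>s\<in>(\<lambda>i. (i, Suc k)) ` {1..n} - {s \<in> S. m - snd s = rev_index m k}. A s = 0"
      proof
        fix s assume s: "s \<in> (\<lambda>i. (i, Suc k)) ` {1..n} - {s \<in> S. m - snd s = rev_index m k}"
        then have "m - snd s = rev_index m k" using k by (auto simp: rev_index_def)
        then show "A s = 0" using s by (intro A0) blast
      qed
    qed simp
    also have "\<dots> = weight A (rev_index m k)" unfolding weight_def by (rule sum.inter_filter[OF finite_S])
    finally show ?thesis .
  qed
  then show ?thesis by (intro nth_equalityI) (simp_all add: vrt_def del: upt_Suc)
qed

end

theorem corollaryM:
  fixes h :: "nat \<Rightarrow> nat" and m n :: nat and lam :: "nat list"
    and sV :: "'k::{alg_closed_field, field_char_0} \<Rightarrow> 'v::ab_group_add \<Rightarrow> 'v"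
    and sW :: "'k \<Rightarrow> 'w::ab_group_add \<Rightarrow> 'w"
    and sT :: "'k \<Rightarrow> 't::ab_group_add \<Rightarrow> 't"
    and actV :: "'k mat \<Rightarrow> 'v \<Rightarrow> 'v" and actW :: "'k mat \<Rightarrow> 'w \<Rightarrow> 'w"
    and tensor :: "'v \<Rightarrow> 'w \<Rightarrow> 't"
    and eV :: "nat list \<Rightarrow> 'v" and eW :: "nat list \<Rightarrow> 'w"
  assumes "1 \<le> m" and "0 < h 1" and "mono_on {1..m} h" and "n = h m"
    and "is_partition lam" and "length lam \<le> card (staircase h m)"
    and "irreducible_gl_module sV n actV lam" and "extremal_vectors sV n actV lam eV"
    and "irreducible_gl_module sW m actW lam" and "extremal_vectors sW m actW lam eW"
    and "tensor_product sV sW sT tensor"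
  shows
    "let D = (\<lambda>\<nu>. demazure sV n actV (eV \<nu>));
         D_op = (\<lambda>\<nu>. op_demazure sW m actW (eW \<nu>));
         G1 = {D (hor n m A) | A. A \<in> DL h m lam};
         G2 = {D_op (vrt n m A) | A. A \<in> DL h m lam};
         G3 = {tensor_subspace sT tensor (D (hor n m A)) (D_op (vrt n m B)) | A B.
                 A \<in> DL h m lam \<and> B \<in> DL h m lam};
         L_D = lattice_gen {D \<nu> | \<nu>. \<nu> \<in> sym_orbit n lam};
         L_D_op = lattice_gen {D_op \<nu> | \<nu>. \<nu> \<in> sym_orbit m lam};
         L_D_D_op = lattice_gen {tensor_subspace sT tensor (D \<nu>) (D_op \<nu>') | \<nu> \<nu>'.
                 \<nu> \<in> sym_orbit n lam \<and> \<nu>' \<in> sym_orbit m lam}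
     in (distributive (lattice_gen G1) \<and> G1 = {V. join_irreducible (lattice_gen G1) V} \<and>
           lattice_gen G1 \<subseteq> L_D) \<and>
        (distributive (lattice_gen G2) \<and> G2 = {V. join_irreducible (lattice_gen G2) V} \<and>
           lattice_gen G2 \<subseteq> L_D_op) \<and>
        (distributive (lattice_gen G3) \<and> G3 = {V. join_irreducible (lattice_gen G3) V} \<and>
           lattice_gen G3 \<subseteq> L_D_D_op)"
proof -
  interpret TP: tensor_product sV sW sT tensor by (rule assms(11))
  interpret H: staircase_positions h m lam n "\<lambda>s. fst s - 1" snd
    by (rule hor_positions[OF assms(1,3,4,5,6)])
  interpret V: staircase_positions h m lam m "\<lambda>s. m - snd s" "\<lambda>s. n - fst s"
    by (rule vrt_positions[OF assms(1,3,4,5,6)])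
  let ?D = "\<lambda>\<nu>. demazure sV n actV (eV \<nu>)" and ?D' = "\<lambda>\<nu>. op_demazure sW m actW (eW \<nu>)"
  let ?O = "orbit n (list_weight n (pad n lam))" and ?O' = "orbit m (list_weight m (pad m lam))"
  let ?P = "H.weight ` DL h m lam" and ?P' = "V.weight ` DL h m lam"
  obtain B \<kappa> where B: "TP.V.independent B" "\<And>b. b \<in> B \<Longrightarrow> \<kappa> b \<in> ?O"
      "\<And>w. w \<in> ?O \<Longrightarrow> ?D (map w [0..<n]) = TP.V.span {b \<in> B. bruhat_le (\<kappa> b) w}"
      "\<And>w. w \<in> ?O \<Longrightarrow> \<exists>b\<in>B. \<kappa> b = w"
    by (rule demazure_adapted_basis[OF assms(7,5) H.len_N assms(8)]) (rule that)
  obtain B' \<kappa>' where B': "TP.W.independent B'" "\<And>b. b \<in> B' \<Longrightarrow> \<kappa>' b \<in> ?O'"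
      "\<And>w. w \<in> ?O' \<Longrightarrow> ?D' (map (w \<circ> rev_index m) [0..<m]) = TP.W.span {b \<in> B'. bruhat_le (\<kappa>' b) w}"
      "\<And>w. w \<in> ?O' \<Longrightarrow> \<exists>b\<in>B'. \<kappa>' b = w"
    by (rule op_demazure_adapted_basis[OF assms(9,5) V.len_N assms(10)]) (rule that)
  define K where "K w = {b \<in> B. bruhat_le (\<kappa> b) w}" for w
  define K' where "K' w = {b \<in> B'. bruhat_le (\<kappa>' b) w}" for w
  have KB: "K w \<subseteq> B" "K' w \<subseteq> B'" for w by (auto simp: K_def K'_def)
  have fam: "meet_family ?P K" unfolding K_def by (rule H.meet_family_weights[OF B(2,4)])
  have fam': "meet_family ?P' K'" unfolding K'_def by (rule V.meet_family_weights[OF B'(2,4)])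
  have O: "H.weight A \<in> ?O" "V.weight A \<in> ?O'" if "A \<in> DL h m lam" for A
    using H.DL_weight[OF that] V.DL_weight[OF that] by (simp_all add: compatible_def)
  have hor: "?D (hor n m A) = TP.V.span (K (H.weight A))" if A: "A \<in> DL h m lam" for A
    unfolding hor_weight[OF assms(1,3,4,5,6) A] K_def by (rule B(3)[OF O(1)[OF A]])
  have vrt: "?D' (vrt n m A) = TP.W.span (K' (V.weight A))" if A: "A \<in> DL h m lam" for A
    unfolding vrt_weight[OF assms(1,3,4,5,6) A] K'_def by (rule B'(3)[OF O(2)[OF A]])
  have hor_orbit: "hor n m A \<in> sym_orbit n lam" if A: "A \<in> DL h m lam" for A
    unfolding hor_weight[OF assms(1,3,4,5,6) A] sym_orbit_eq[OF H.len_N] using O(1)[OF A] by (rule imageI)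
  have vrt_orbit: "vrt n m A \<in> sym_orbit m lam" if A: "A \<in> DL h m lam" for A
    unfolding vrt_weight[OF assms(1,3,4,5,6) A] sym_orbit_eq[OF V.len_N]
    by (rule imageI, rule reindexed_irreducible.orbit_reindex[OF reindexed_rv[OF assms(9,5) V.len_N assms(10)]])
      (rule O(2)[OF A])
  let ?G1 = "{?D (hor n m A) | A. A \<in> DL h m lam}"
  let ?G2 = "{?D' (vrt n m A) | A. A \<in> DL h m lam}"
  let ?G3 = "{tensor_subspace sT tensor (?D (hor n m A)) (?D' (vrt n m B)) | A B. A \<in> DL h m lam \<and> B \<in> DL h m lam}"
  \<comment> \<open>The tensor modules are indexed by products of index sets, carried into the
    tensor space by the map on pairs of basis vectors, which is injective there.\<close>
  let ?K3 = "\<lambda>p. (\<lambda>(x, y). tensor x y) ` (case p of (w, w') \<Rightarrow> K w \<times> K' w')"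
  have G1: "?G1 = {TP.V.span (K w) | w. w \<in> ?P}"
    using hor by (intro Set.set_eqI iffI; elim CollectE exE conjE imageE) (simp, blast, simp, metis)
  have G2: "?G2 = {TP.W.span (K' w) | w. w \<in> ?P'}"
    using vrt by (intro Set.set_eqI iffI; elim CollectE exE conjE imageE) (simp, blast, simp, metis)
  have t3: "tensor_subspace sT tensor (?D (hor n m A)) (?D' (vrt n m A')) = TP.T.span (?K3 (H.weight A, V.weight A'))"
    if "A \<in> DL h m lam" "A' \<in> DL h m lam" for A A'
    unfolding hor[OF that(1)] vrt[OF that(2)] TP.tensor_subspace_span split ..
  have G3: "?G3 = {TP.T.span (?K3 p) | p. p \<in> ?P \<times> ?P'}" (is "_ = ?R3")
  proof (rule Set.set_eqI, rule iffI)
    fix U assume "U \<in> ?G3"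
    then obtain A A' where "A \<in> DL h m lam" "A' \<in> DL h m lam"
      "U = tensor_subspace sT tensor (?D (hor n m A)) (?D' (vrt n m A'))" by (elim CollectE exE conjE)
    then have "U = TP.T.span (?K3 (H.weight A, V.weight A'))" "(H.weight A, V.weight A') \<in> ?P \<times> ?P'"
      by (simp_all only: t3) blast
    then show "U \<in> ?R3" by (intro CollectI exI conjI)
  next
    fix U assume "U \<in> ?R3"
    then obtain p where p: "U = TP.T.span (?K3 p)" "p \<in> ?P \<times> ?P'" by (elim CollectE exE conjE)
    obtain A A' where A: "p = (H.weight A, V.weight A')" "A \<in> DL h m lam" "A' \<in> DL h m lam"
      using p(2) by (elim SigmaE imageE) (simp only:)
    show "U \<in> ?G3" unfolding p(1) A(1) t3[OF A(2,3), symmetric] using A(2,3)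
      by (intro CollectI exI[of _ A] exI[of _ A'] conjI refl)
  qed
  have "distributive (lattice_gen ?G1)" "?G1 = {V. join_irreducible (lattice_gen ?G1) V}"
    unfolding G1 by (rule TP.V.adapted_lattice[OF B(1) KB(1) fam])+
  moreover have "lattice_gen ?G1 \<subseteq> lattice_gen {?D \<nu> | \<nu>. \<nu> \<in> sym_orbit n lam}"
    by (rule lattice_gen_mono) (use hor_orbit in blast)
  moreover have "distributive (lattice_gen ?G2)" "?G2 = {V. join_irreducible (lattice_gen ?G2) V}"
    unfolding G2 by (rule TP.W.adapted_lattice[OF B'(1) KB(2) fam'])+
  moreover have "lattice_gen ?G2 \<subseteq> lattice_gen {?D' \<nu> | \<nu>. \<nu> \<in> sym_orbit m lam}"
    by (rule lattice_gen_mono) (use vrt_orbit in blast)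
  moreover have "distributive (lattice_gen ?G3)" "?G3 = {V. join_irreducible (lattice_gen ?G3) V}"
  proof -
    have sub: "(case p of (w, w') \<Rightarrow> K w \<times> K' w') \<subseteq> B \<times> B'" for p
      by (cases p) (simp add: Sigma_mono KB)
    have "inj_on (\<lambda>(x, y). tensor x y) (\<Union>p\<in>?P \<times> ?P'. case p of (w, w') \<Rightarrow> K w \<times> K' w')"
      by (rule inj_on_subset[OF TP.tensor_independent(1)[OF B(1) B'(1)] UN_least[OF sub]])
    then have fam3: "meet_family (?P \<times> ?P') ?K3"
      by (rule meet_family_image[OF meet_family_Times[OF fam fam']])
    have sub3: "?K3 p \<subseteq> (\<lambda>(x, y). tensor x y) ` (B \<times> B')" for p by (rule image_mono[OF sub])
    show "distributive (lattice_gen ?G3)" "?G3 = {V. join_irreducible (lattice_gen ?G3) V}"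
      unfolding G3
      by (rule TP.T.adapted_lattice[OF TP.tensor_independent(2)[OF B(1) B'(1)] sub3 fam3])+
  qed
  moreover have "lattice_gen ?G3 \<subseteq> lattice_gen {tensor_subspace sT tensor (?D \<nu>) (?D' \<nu>') | \<nu> \<nu>'.
      \<nu> \<in> sym_orbit n lam \<and> \<nu>' \<in> sym_orbit m lam}"
    by (rule lattice_gen_mono) (use hor_orbit vrt_orbit in blast)
  ultimately show ?thesis unfolding Let_def by (intro conjI)
qed

end
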